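(* Let $\mathbf k:=\mathbb Z[\frac1{|\Gamma|},e^{2\pi i/|\Gamma|}]$ and $A=\mathbf k\langle x,y,r'\rangle/(xy-yx+r')$, and let $\Gamma\subset SL_2(\mathbf k)$ be a finite subgroup, which acts on $x$ and $y$ by the tautological action on $\mathbf k\cdot\{x,y\}\cong\mathbf k^2$ (the free $\mathbf k$-module generated by $x$ and $y$), and fixes $r'$. Then the $\mathbf k$-module $(A\rtimes\Gamma)_{\mathrm{cyc}}$ has a canonical decomposition along the conjugacy classes $C$ of $\Gamma$, $$(A\rtimes\Gamma)_{\mathrm{cyc}}=\bigoplus_C(A\rtimes\Gamma)_{\mathrm{cyc},C},$$ presented as follows: (i) For $C\ne\{1\}$ and any choice $\gamma_C\in C$, $(A\rtimes\Gamma)_{\mathrm{cyc},C}$ is torsion-free (and in fact $\mathbf k$-projective). (ii) For $C=\{1\}$, there is an isomorphism $V_1/W_1\to(A\rtimes\Gamma)_{\mathrm{cyc},\{1\}}$, where $V_1$ is the direct sum of $\mathbf k[x,y]^\Gamma$ and the $\mathbf k$-module of $\Gamma$-invariant classes of elements of the form $$\sum_{a_\cdot,b_\cdot}\alpha_{a_\cdot,b_\cdot}\,z_{a_1,b_1}r'\cdots z_{a_m,b_m}r',$$ modulo cyclic permutations, with $\alpha_{a_\cdot,b_\cdot}\in\mathbf k$, and $W_1$ is $\mathbf k$-linearly spanned by the $\Gamma$-invariant classes in $W$. This map is induced by the obvious morphism $V_1\to(A\rtimes\Gamma)_{\mathrm{cyc},\{1\}}$. (iii) The projection $W_1\to[(r')]^\Gamma/[(r')^2]^\Gamma\cong\langle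 r'\rangle\otimes\mathbf k[x,y]^\Gamma$ is a monomorphism and becomes an isomorphism after tensoring by $\mathbb C$. The image is $$\Big(\bigoplus_{a,b}\langle\gcd(a,b)\,r'\otimes x^{a-1}y^{b-1}\rangle\Big)^\Gamma .$$ (iv) $(A\rtimes\Gamma)_{\mathrm{cyc},\{1\}}$ is torsion-free (in fact, projective over $\mathbf k$), but its quotient by the image of $\langle[(r')^\ell]\rangle_{\ell\ge1}$ has $\mathbf k/(p)$-torsion in each degree $2p^\ell$ for $p$ prime, $p\nmid|\Gamma|$ and $\ell\ge1$. The torsion then appears in $V_1/(W_1+\langle[(r')^\ell]\rangle_{\ell\ge1})$ and is $\mathbf k$-linearly spanned by the image of $r^{(p^\ell)}=\frac1p[(xy-yx+r')^{p^\ell}]$ under the map $(\mathbf k\langle x,y,r'\rangle)_{\mathrm{cyc}}\to(A\rtimes\Gamma)_{\mathrm{cyc}}/\langle[(r')^\ell]\rangle_{\ell\ge1}$.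
   Context: For an algebra $B$ over a commutative ring, $B_{\mathrm{cyc}}=B/[B,B]$ with $[B,B]$ the linear span of commutators. $A\rtimes\Gamma$ is the skew group algebra. $(A\rtimes\Gamma)_{\mathrm{cyc},C}$ is the summand coming from $\bigoplus_{\gamma\in C}A\gamma$. Angle brackets $\langle S\rangle$ denote $\mathbf k$-linear span, except in $\mathbf k\langle x,y,r'\rangle$, which is the free associative algebra. Grading: $|x|=|y|=1$, $|r'|=2$. Square brackets denote classes modulo cyclic permutation, i.e. in $V$ below or in $(\cdot)_{\mathrm{cyc}}$. $z_{a,b}:=(xy)^bx^{a-b}$ if $a\ge b$, and $z_{a,b}:=(yx)^ay^{b-a}$ if $a<b$. $V:=A/[Ar'A,A]$ (quotient by the $\mathbf k$-span of commutators); it has a $\mathbf k$-basis consisting of the $z_{a,b}$ ($a,b\ge0$) and the classes $[z_{a_1,b_1}r'\cdots z_{a_m,b_m}r']$, $m\ge1$, up to simultaneous cyclic permutation of the indices. $W\subset V$ is the $\mathbf k$-span of the following classes, for $a>b\ge1$ (and $a\ge1$ in the last case): $$W_{a,b}=\sum\frac{\gcd(a,b)}{\mathrm{rep}(a_\cdot,b_\cdot)}\Big[\prod_{l=1}^{k}(-r')z_{a_l,b_l}\Big],\quad W_{b,a}=\sum\frac{\gcd(a,b)}{\mathrm{rep}(a_\cdot,b_\cdot)}\Big[\prod_{l=1}^{k}r'z_{b_l,a_l}\Big],\quad W_{a,a}=[(xy+r')^a]-[(xy)^a].$$ The sums are over all distinct pairs $(a_\cdot,b_\cdot)$ of $k$-tuples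 of nonnegative integers (all $k\ge1$), modulo simultaneous cyclic permutation, with $a_l>b_l$ for all $l$, $\sum_l(a_l+1)=a$ and $\sum_l(b_l+1)=b$; products are in left-to-right order; $\mathrm{rep}(a_\cdot,b_\cdot)$ is the number of cyclic permutations in $\mathbb Z/k$ fixing the $k$-tuple $((a_l,b_l))_l$. In (iii), $[(r')]$ and $[(r')^2]$ denote the images of the two-sided ideal generated by $r'$ and of its square; modulo the latter, $[r'z_{a,b}]$ is identified with $r'\otimes x^ay^b$. Elsewhere $[(r')^\ell]$ is the class of the element $(r')^\ell$.
   Formalization: In (iv), [(xy-yx+r')^{p^l}] is not divisible by p in k<x,y,r'>_cyc (the coefficient of [(r')^{p^l}] is 1), so r^{(p^l)} is read as any class u with p u = [(xy-yx+r')^{p^l}] modulo the span of the [(r')^m]; existence of u is proved. *)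

theory Defs
  imports
    "HOL-Analysis.Determinants"
    "HOL-Library.Product_Plus"
    "HOL-Library.Poly_Mapping"
    "HOL-Computational_Algebra.Primes"
    "HOL-Algebra.Algebra"
begin

section \<open>Modules over a commutative ring\<close>

text \<open>
  Submodules of a module \<open>M\<close> are subsets, in the sense of \<^locale>\<open>submodule\<close>;
  \<open>M\<lparr>carrier := N\<rparr>\<close> is the submodule \<open>N\<close> regarded as a module.
\<close>

definition mod_span :: "('k, 'r) ring_scheme \<Rightarrow> ('k, 'a, 'm) module_scheme \<Rightarrow> 'a set \<Rightarrow> 'a set" where
  "mod_span K M S = \<Inter>{N. submodule N K M \<and> S \<subseteq> N}"

text \<open>
  The first five fields are those of \<^const>\<open>FactRing\<close>. The same record is used for the quotient
  algebra by a two-sided ideal and for the quotient module by a submodule; in the latter case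
  the fields \<open>mult\<close> and \<open>one\<close> are meaningless and never used.
\<close>

definition quot_mod :: "('k, 'a, 'm) module_scheme \<Rightarrow> 'a set \<Rightarrow> ('k, 'a set) module" where
  "quot_mod M N =
    \<lparr>carrier = a_rcosets\<^bsub>M\<^esub> N, mult = rcoset_mult M N, one = N +>\<^bsub>M\<^esub> \<one>\<^bsub>M\<^esub>,
     ring.zero = N, add = set_add M, smult = (\<lambda>c U. \<Union>x\<in>U. N +>\<^bsub>M\<^esub> (c \<odot>\<^bsub>M\<^esub> x))\<rparr>"

text \<open>The map induced on a quotient by a map that is constant on cosets.\<close>

definition induced :: "('a \<Rightarrow> 'b) \<Rightarrow> 'a set \<Rightarrow> 'b" where
  "induced f U = the_elem (f ` U)"

definition mod_hom ::
  "('k, 'r) ring_scheme \<Rightarrow> ('k, 'a, 'm) module_scheme \<Rightarrow> ('k, 'b, 'n) module_scheme \<Rightarrow> ('a \<Rightarrow> 'b) set" where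
  "mod_hom K M N =
    {f \<in> carrier M \<rightarrow> carrier N.
       (\<forall>x\<in>carrier M. \<forall>y\<in>carrier M. f (x \<oplus>\<^bsub>M\<^esub> y) = f x \<oplus>\<^bsub>N\<^esub> f y) \<and>
       (\<forall>c\<in>carrier K. \<forall>x\<in>carrier M. f (c \<odot>\<^bsub>M\<^esub> x) = c \<odot>\<^bsub>N\<^esub> f x)}"

definition mod_iso ::
  "('k, 'r) ring_scheme \<Rightarrow> ('k, 'a, 'm) module_scheme \<Rightarrow> ('k, 'b, 'n) module_scheme \<Rightarrow> ('a \<Rightarrow> 'b) set" where
  "mod_iso K M N = {f \<in> mod_hom K M N. bij_betw f (carrier M) (carrier N)}"

definition mod_dirsum ::
  "('k, 'a, 'm) module_scheme \<Rightarrow> ('k, 'b, 'n) module_scheme \<Rightarrow> ('k, 'a \<times> 'b) module" where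
  "mod_dirsum M N =
    \<lparr>carrier = carrier M \<times> carrier N,
     mult = (\<lambda>(x, y) (x', y'). (x \<otimes>\<^bsub>M\<^esub> x', y \<otimes>\<^bsub>N\<^esub> y')), one = (\<one>\<^bsub>M\<^esub>, \<one>\<^bsub>N\<^esub>),
     ring.zero = (\<zero>\<^bsub>M\<^esub>, \<zero>\<^bsub>N\<^esub>),
     add = (\<lambda>(x, y) (x', y'). (x \<oplus>\<^bsub>M\<^esub> x', y \<oplus>\<^bsub>N\<^esub> y')),
     smult = (\<lambda>c (x, y). (c \<odot>\<^bsub>M\<^esub> x, c \<odot>\<^bsub>N\<^esub> y))\<rparr>"

definition internal_direct_sum ::
  "('k, 'r) ring_scheme \<Rightarrow> ('k, 'a, 'm) module_scheme \<Rightarrow> 'i set \<Rightarrow> ('i \<Rightarrow> 'a set) \<Rightarrow> bool" where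
  "internal_direct_sum K M I N \<longleftrightarrow>
    finite I \<and> (\<forall>i\<in>I. submodule (N i) K M) \<and>
    (\<forall>m\<in>carrier M. \<exists>!f. f \<in> (\<Pi>\<^sub>E i\<in>I. N i) \<and> m = (\<Oplus>\<^bsub>M\<^esub>i\<in>I. f i))"

text \<open>
  The free module on a set \<open>S\<close>: finitely supported functions, extended by zero outside \<open>S\<close>
  (multiplication is pointwise and irrelevant).
\<close>

definition free_mod :: "('k, 'r) ring_scheme \<Rightarrow> 's set \<Rightarrow> ('k, 's \<Rightarrow> 'k) module" where
  "free_mod K S =
    \<lparr>carrier = {f. (\<forall>s. f s \<in> carrier K) \<and> (\<forall>s. s \<notin> S \<longrightarrow> f s = \<zero>\<^bsub>K\<^esub>) \<and> finite {s. f s \<noteq> \<zero>\<^bsub>K\<^esub>}},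
     mult = (\<lambda>f g s. f s \<otimes>\<^bsub>K\<^esub> g s), one = (\<lambda>s. \<one>\<^bsub>K\<^esub>),
     ring.zero = (\<lambda>s. \<zero>\<^bsub>K\<^esub>), add = (\<lambda>f g s. f s \<oplus>\<^bsub>K\<^esub> g s), smult = (\<lambda>c f s. c \<otimes>\<^bsub>K\<^esub> f s)\<rparr>"

definition free_basis :: "('k, 'r) ring_scheme \<Rightarrow> 's \<Rightarrow> 's \<Rightarrow> 'k" where
  "free_basis K s = (\<lambda>t. if t = s then \<one>\<^bsub>K\<^esub> else \<zero>\<^bsub>K\<^esub>)"

text \<open>
  Projective means: a direct summand (retract) of a free module. Basis sets inside the type of
  the elements of \<open>M\<close> suffice, since \<open>M\<close> is a quotient of the free module on \<open>carrier M\<close>.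
\<close>

definition projective_mod :: "('k, 'r) ring_scheme \<Rightarrow> ('k, 'a, 'm) module_scheme \<Rightarrow> bool" where
  "projective_mod K M \<longleftrightarrow>
    Module.module K M \<and>
    (\<exists>(S :: 'a set) i p. i \<in> mod_hom K M (free_mod K S) \<and> p \<in> mod_hom K (free_mod K S) M \<and>
       (\<forall>m\<in>carrier M. p (i m) = m))"

definition torsion :: "('k, 'r) ring_scheme \<Rightarrow> ('k, 'a, 'm) module_scheme \<Rightarrow> 'a set" where
  "torsion K M = {m \<in> carrier M. \<exists>c\<in>carrier K. c \<noteq> \<zero>\<^bsub>K\<^esub> \<and> c \<odot>\<^bsub>M\<^esub> m = \<zero>\<^bsub>M\<^esub>}"

definition torsion_free :: "('k, 'r) ring_scheme \<Rightarrow> ('k, 'a, 'm) module_scheme \<Rightarrow> bool" where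
  "torsion_free K M \<longleftrightarrow> torsion K M = {\<zero>\<^bsub>M\<^esub>}"

definition tensor_relations ::
  "('k, 'r) ring_scheme \<Rightarrow> ('k, 'a, 'm) module_scheme \<Rightarrow> ('k, 'b, 'n) module_scheme \<Rightarrow> ('a \<times> 'b \<Rightarrow> 'k) set" where
  "tensor_relations K M N =
    (let F = free_mod K (carrier M \<times> carrier N); e = free_basis K in
     mod_span K F
      ({e (x \<oplus>\<^bsub>M\<^esub> x', y) \<ominus>\<^bsub>F\<^esub> (e (x, y) \<oplus>\<^bsub>F\<^esub> e (x', y)) | x x' y.
          x \<in> carrier M \<and> x' \<in> carrier M \<and> y \<in> carrier N} \<union>
       {e (x, y \<oplus>\<^bsub>N\<^esub> y') \<ominus>\<^bsub>F\<^esub> (e (x, y) \<oplus>\<^bsub>F\<^esub> e (x, y')) | x y y'.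
          x \<in> carrier M \<and> y \<in> carrier N \<and> y' \<in> carrier N} \<union>
       {e (c \<odot>\<^bsub>M\<^esub> x, y) \<ominus>\<^bsub>F\<^esub> (c \<odot>\<^bsub>F\<^esub> e (x, y)) | c x y.
          c \<in> carrier K \<and> x \<in> carrier M \<and> y \<in> carrier N} \<union>
       {e (x, c \<odot>\<^bsub>N\<^esub> y) \<ominus>\<^bsub>F\<^esub> (c \<odot>\<^bsub>F\<^esub> e (x, y)) | c x y.
          c \<in> carrier K \<and> x \<in> carrier M \<and> y \<in> carrier N}))"

definition tensor_mod ::
  "('k, 'r) ring_scheme \<Rightarrow> ('k, 'a, 'm) module_scheme \<Rightarrow> ('k, 'b, 'n) module_scheme \<Rightarrow> ('k, ('a \<times> 'b \<Rightarrow> 'k) set) module" where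
  "tensor_mod K M N = quot_mod (free_mod K (carrier M \<times> carrier N)) (tensor_relations K M N)"

definition pure_tensor ::
  "('k, 'r) ring_scheme \<Rightarrow> ('k, 'a, 'm) module_scheme \<Rightarrow> ('k, 'b, 'n) module_scheme \<Rightarrow> 'a \<Rightarrow> 'b \<Rightarrow> ('a \<times> 'b \<Rightarrow> 'k) set" where
  "pure_tensor K M N x y =
    tensor_relations K M N +>\<^bsub>free_mod K (carrier M \<times> carrier N)\<^esub> free_basis K (x, y)"

text \<open>The map \<open>id\<^sub>L \<otimes> f : L \<otimes> M \<rightarrow> L \<otimes> N\<close> is an isomorphism.\<close>

definition tensor_iso ::
  "('k, 'r) ring_scheme \<Rightarrow> ('k, 'l, 'o) module_scheme \<Rightarrow> ('k, 'a, 'm) module_scheme \<Rightarrow> ('k, 'b, 'n) module_scheme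
     \<Rightarrow> ('a \<Rightarrow> 'b) \<Rightarrow> bool" where
  "tensor_iso K L M N f \<longleftrightarrow>
    (\<exists>h\<in>mod_iso K (tensor_mod K L M) (tensor_mod K L N).
       \<forall>l\<in>carrier L. \<forall>m\<in>carrier M. h (pure_tensor K L M l m) = pure_tensor K L N l (f m))"

definition invariants :: "'g set \<Rightarrow> ('g \<Rightarrow> 'a \<Rightarrow> 'a) \<Rightarrow> 'a set \<Rightarrow> 'a set" where
  "invariants G act S = {m \<in> S. \<forall>g\<in>G. act g m = m}"


section \<open>Commutator quotients and skew group algebras\<close>

definition comm_span :: "('k, 'r) ring_scheme \<Rightarrow> ('k, 'a, 'm) module_scheme \<Rightarrow> 'a set \<Rightarrow> 'a set \<Rightarrow> 'a set" where
  "comm_span K B S T = mod_span K B {s \<otimes>\<^bsub>B\<^esub> t \<ominus>\<^bsub>B\<^esub> t \<otimes>\<^bsub>B\<^esub> s | s t. s \<in> S \<and> t \<in> T}"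

definition cyc :: "('k, 'r) ring_scheme \<Rightarrow> ('k, 'a, 'm) module_scheme \<Rightarrow> ('k, 'a set) module" where
  "cyc K B = quot_mod B (comm_span K B (carrier B) (carrier B))"

definition cyc_class :: "('k, 'r) ring_scheme \<Rightarrow> ('k, 'a, 'm) module_scheme \<Rightarrow> 'a \<Rightarrow> 'a set" where
  "cyc_class K B b = comm_span K B (carrier B) (carrier B) +>\<^bsub>B\<^esub> b"

text \<open>
  \<open>B \<rtimes> G\<close>: the function \<open>f\<close> stands for \<open>\<Sum>\<gamma>. f \<gamma> \<gamma>\<close>, and \<open>(a \<delta>) (b \<epsilon>) = a (\<delta> \<cdot> b) \<delta> \<epsilon>\<close>.
\<close>

definition skew_alg ::
  "('g, 'h) monoid_scheme \<Rightarrow> ('k, 'a, 'm) module_scheme \<Rightarrow> ('g \<Rightarrow> 'a \<Rightarrow> 'a) \<Rightarrow> ('k, 'g \<Rightarrow> 'a) module" where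
  "skew_alg G B act =
    \<lparr>carrier = carrier G \<rightarrow>\<^sub>E carrier B,
     mult = (\<lambda>f h. \<lambda>\<gamma>\<in>carrier G. \<Oplus>\<^bsub>B\<^esub>\<delta>\<in>carrier G. f \<delta> \<otimes>\<^bsub>B\<^esub> act \<delta> (h (inv\<^bsub>G\<^esub> \<delta> \<otimes>\<^bsub>G\<^esub> \<gamma>))),
     one = (\<lambda>\<gamma>\<in>carrier G. if \<gamma> = \<one>\<^bsub>G\<^esub> then \<one>\<^bsub>B\<^esub> else \<zero>\<^bsub>B\<^esub>),
     ring.zero = (\<lambda>\<gamma>\<in>carrier G. \<zero>\<^bsub>B\<^esub>),
     add = (\<lambda>f h. \<lambda>\<gamma>\<in>carrier G. f \<gamma> \<oplus>\<^bsub>B\<^esub> h \<gamma>),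
     smult = (\<lambda>c f. \<lambda>\<gamma>\<in>carrier G. c \<odot>\<^bsub>B\<^esub> f \<gamma>)\<rparr>"

definition skew_single ::
  "('g, 'h) monoid_scheme \<Rightarrow> ('k, 'a, 'm) module_scheme \<Rightarrow> 'g \<Rightarrow> 'a \<Rightarrow> 'g \<Rightarrow> 'a" where
  "skew_single G B g a = (\<lambda>\<gamma>\<in>carrier G. if \<gamma> = g then a else \<zero>\<^bsub>B\<^esub>)"

definition conj_classes :: "('g, 'h) monoid_scheme \<Rightarrow> 'g set set" where
  "conj_classes G = orbits G (carrier G) (\<lambda>g. \<lambda>h\<in>carrier G. g \<otimes>\<^bsub>G\<^esub> h \<otimes>\<^bsub>G\<^esub> inv\<^bsub>G\<^esub> g)"


section \<open>The base ring and the group\<close>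

text \<open>The complex numbers, as a ring and as a module over each of its subrings.\<close>

definition complex_ring :: "(complex, complex) module" where
  "complex_ring = \<lparr>carrier = UNIV, mult = (*), one = 1, ring.zero = 0, add = (+), smult = (*)\<rparr>"

definition base_ring :: "nat \<Rightarrow> (complex, complex) module" where
  "base_ring n = complex_ring\<lparr>carrier :=
     generate_ring complex_ring {1 / of_nat n, exp (2 * of_real pi * \<i> / of_nat n)}\<rparr>"

definition SL2 :: "(complex, 'r) ring_scheme \<Rightarrow> (complex^2^2) monoid" where
  "SL2 K = \<lparr>carrier = {g. (\<forall>i j. g $ i $ j \<in> carrier K) \<and> det g = 1}, mult = (**), one = mat 1\<rparr>"


section \<open>The algebra \<open>A\<close>\<close>

datatype letter = Lx | Ly | Lr

datatype ncword = Word (letters: "letter list")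

text \<open>The free monoid on the letters, written additively as \<^typ>\<open>'a \<Rightarrow>\<^sub>0 'b\<close> requires.\<close>

instantiation ncword :: monoid_add
begin

definition zero_ncword :: ncword where "0 = Word []"

definition plus_ncword :: "ncword \<Rightarrow> ncword \<Rightarrow> ncword" where "u + v = Word (letters u @ letters v)"

instance
  by standard (simp_all add: zero_ncword_def plus_ncword_def)

end

type_synonym ncpoly = "ncword \<Rightarrow>\<^sub>0 complex"
type_synonym cpoly = "(nat \<times> nat) \<Rightarrow>\<^sub>0 complex"

text \<open>
  The monoid algebra over a subring \<open>K\<close> of the complex numbers: for words this is the free algebra
  \<open>K\<langle>x, y, r'\<rangle>\<close>, for pairs of exponents the polynomial ring \<open>K[x, y]\<close>.
\<close>

definition monoid_alg :: "(complex, 'r) ring_scheme \<Rightarrow> (complex, 'w::monoid_add \<Rightarrow>\<^sub>0 complex) module" where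
  "monoid_alg K =
    \<lparr>carrier = {f. \<forall>w. Poly_Mapping.lookup f w \<in> carrier K}, mult = (*), one = 1, ring.zero = 0, add = (+),
     smult = (\<lambda>c f. Poly_Mapping.single 0 c * f)\<rparr>"

abbreviation free_alg :: "(complex, 'r) ring_scheme \<Rightarrow> (complex, ncpoly) module" where
  "free_alg \<equiv> monoid_alg"

abbreviation poly_alg :: "(complex, 'r) ring_scheme \<Rightarrow> (complex, cpoly) module" where
  "poly_alg \<equiv> monoid_alg"

definition gen :: "letter \<Rightarrow> ncpoly" where
  "gen l = Poly_Mapping.single (Word [l]) 1"

abbreviation gx :: ncpoly where "gx \<equiv> gen Lx"
abbreviation gy :: ncpoly where "gy \<equiv> gen Ly"
abbreviation gr :: ncpoly where "gr \<equiv> gen Lr"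

definition xy_monom :: "nat \<Rightarrow> nat \<Rightarrow> cpoly" where
  "xy_monom a b = Poly_Mapping.single (a, b) 1"

text \<open>The tautological action: \<open>\<gamma> \<cdot> x\<close> and \<open>\<gamma> \<cdot> y\<close> are the columns of \<open>\<gamma>\<close>.\<close>

fun act_letter :: "complex^2^2 \<Rightarrow> letter \<Rightarrow> ncpoly" where
  "act_letter g Lx = Poly_Mapping.single 0 (g $ 1 $ 1) * gx + Poly_Mapping.single 0 (g $ 2 $ 1) * gy"
| "act_letter g Ly = Poly_Mapping.single 0 (g $ 1 $ 2) * gx + Poly_Mapping.single 0 (g $ 2 $ 2) * gy"
| "act_letter g Lr = gr"

definition act_free :: "complex^2^2 \<Rightarrow> ncpoly \<Rightarrow> ncpoly" where
  "act_free g f =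
    (\<Sum>w\<in>Poly_Mapping.keys f. Poly_Mapping.single 0 (Poly_Mapping.lookup f w) * prod_list (map (act_letter g) (letters w)))"

definition act_poly :: "complex^2^2 \<Rightarrow> cpoly \<Rightarrow> cpoly" where
  "act_poly g f =
    (\<Sum>m\<in>Poly_Mapping.keys f. Poly_Mapping.single 0 (Poly_Mapping.lookup f m) *
       (Poly_Mapping.single 0 (g $ 1 $ 1) * xy_monom 1 0 + Poly_Mapping.single 0 (g $ 2 $ 1) * xy_monom 0 1) ^ fst m *
       (Poly_Mapping.single 0 (g $ 1 $ 2) * xy_monom 1 0 + Poly_Mapping.single 0 (g $ 2 $ 2) * xy_monom 0 1) ^ snd m)"

definition rel_ideal :: "(complex, 'r) ring_scheme \<Rightarrow> ncpoly set" where
  "rel_ideal K = Idl\<^bsub>free_alg K\<^esub> {gx * gy - gy * gx + gr}"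

definition algA :: "(complex, 'r) ring_scheme \<Rightarrow> (complex, ncpoly set) module" where
  "algA K = quot_mod (free_alg K) (rel_ideal K)"

definition clsA :: "(complex, 'r) ring_scheme \<Rightarrow> ncpoly \<Rightarrow> ncpoly set" where
  "clsA K f = rel_ideal K +>\<^bsub>free_alg K\<^esub> f"

text \<open>
  An element of \<open>SL\<^sub>2(K)\<close> acts on the free algebra by an automorphism preserving the relation, so the
  image of a coset is a coset.
\<close>

definition actA :: "complex^2^2 \<Rightarrow> ncpoly set \<Rightarrow> ncpoly set" where
  "actA g U = act_free g ` U"


section \<open>The modules \<open>V\<close> and \<open>W\<close>\<close>

definition zmon :: "nat \<Rightarrow> nat \<Rightarrow> ncpoly" where
  "zmon a b = (if b \<le> a then (gx * gy) ^ b * gx ^ (a - b) else (gy * gx) ^ a * gy ^ (b - a))"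

definition ideal_r :: "(complex, 'r) ring_scheme \<Rightarrow> ncpoly set set" where
  "ideal_r K = Idl\<^bsub>algA K\<^esub> {clsA K gr}"

definition modV :: "(complex, 'r) ring_scheme \<Rightarrow> (complex, ncpoly set set) module" where
  "modV K = quot_mod (algA K) (comm_span K (algA K) (ideal_r K) (carrier (algA K)))"

definition imgV :: "(complex, 'r) ring_scheme \<Rightarrow> ncpoly set \<Rightarrow> ncpoly set set" where
  "imgV K a = comm_span K (algA K) (ideal_r K) (carrier (algA K)) +>\<^bsub>algA K\<^esub> a"

definition clsV :: "(complex, 'r) ring_scheme \<Rightarrow> ncpoly \<Rightarrow> ncpoly set set" where
  "clsV K f = imgV K (clsA K f)"

definition actV :: "complex^2^2 \<Rightarrow> ncpoly set set \<Rightarrow> ncpoly set set" where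
  "actV g v = actA g ` v"

text \<open>The pair of tuples \<open>(a\<^sub>l)\<close>, \<open>(b\<^sub>l)\<close> is encoded as the list of the pairs \<open>(a\<^sub>l, b\<^sub>l)\<close>.\<close>

definition W_tuples :: "nat \<Rightarrow> nat \<Rightarrow> (nat \<times> nat) list set" where
  "W_tuples a b =
    {t. t \<noteq> [] \<and> (\<forall>(i, j)\<in>set t. i > j) \<and>
        (\<Sum>(i, j)\<leftarrow>t. i + 1) = a \<and> (\<Sum>(i, j)\<leftarrow>t. j + 1) = b}"

definition rep :: "'a list \<Rightarrow> nat" where
  "rep t = card {n. n < length t \<and> rotate n t = t}"

text \<open>
  Sum over the cyclic orbits in \<^const>\<open>W_tuples\<close>; the summand does not depend on the chosen
  representative, because every factor \<open>u (a\<^sub>l, b\<^sub>l)\<close> below is a multiple of \<open>r'\<close>.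
\<close>

definition W_sum :: "(complex, 'r) ring_scheme \<Rightarrow> nat \<Rightarrow> nat \<Rightarrow> (nat \<times> nat \<Rightarrow> ncpoly) \<Rightarrow> ncpoly set set" where
  "W_sum K a b u =
    (\<Oplus>\<^bsub>modV K\<^esub>orb \<in> (\<lambda>t. range (\<lambda>n. rotate n t)) ` W_tuples a b.
       let t = (SOME t. t \<in> orb)
       in (of_nat (gcd a b) / of_nat (rep t)) \<odot>\<^bsub>modV K\<^esub> clsV K (prod_list (map u t)))"

definition modW :: "(complex, 'r) ring_scheme \<Rightarrow> ncpoly set set set" where
  "modW K = mod_span K (modV K)
    ({W_sum K a b (\<lambda>(i, j). - gr * zmon i j) | a b. a > b \<and> b \<ge> 1} \<union>
     {W_sum K a b (\<lambda>(i, j). gr * zmon j i) | a b. a > b \<and> b \<ge> 1} \<union>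
     {clsV K ((gx * gy + gr) ^ a) \<ominus>\<^bsub>modV K\<^esub> clsV K ((gx * gy) ^ a) | a. a \<ge> 1})"

text \<open>The classes of elements \<open>\<Sum> \<alpha> z\<^sub>a\<^sub>1\<^sub>,\<^sub>b\<^sub>1 r' \<dots> z\<^sub>a\<^sub>m\<^sub>,\<^sub>b\<^sub>m r'\<close>, \<open>m \<ge> 1\<close>.\<close>

definition zr_classes :: "(complex, 'r) ring_scheme \<Rightarrow> ncpoly set set set" where
  "zr_classes K = clsV K `
     mod_span K (free_alg K) {prod_list (map (\<lambda>(a, b). zmon a b * gr) t) | t. t \<noteq> []}"

definition modV1 ::
  "(complex, 'r) ring_scheme \<Rightarrow> (complex^2^2) set \<Rightarrow> (complex, cpoly \<times> ncpoly set set) module" where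
  "modV1 K \<Gamma> =
    mod_dirsum
      ((poly_alg K)\<lparr>carrier := invariants \<Gamma> act_poly (carrier (poly_alg K))\<rparr>)
      ((modV K)\<lparr>carrier := invariants \<Gamma> actV (zr_classes K)\<rparr>)"

definition W1 :: "(complex, 'r) ring_scheme \<Rightarrow> (complex^2^2) set \<Rightarrow> ncpoly set set set" where
  "W1 K \<Gamma> = mod_span K (modV K) (invariants \<Gamma> actV (modW K))"

definition W1_in_V1 :: "(complex, 'r) ring_scheme \<Rightarrow> (complex^2^2) set \<Rightarrow> (cpoly \<times> ncpoly set set) set" where
  "W1_in_V1 K \<Gamma> = {0} \<times> W1 K \<Gamma>"

definition r_powers_in_V1 :: "(complex, 'r) ring_scheme \<Rightarrow> (complex^2^2) set \<Rightarrow> (cpoly \<times> ncpoly set set) set" where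
  "r_powers_in_V1 K \<Gamma> = mod_span K (modV1 K \<Gamma>) {(0, clsV K (gr ^ l)) | l. l \<ge> 1}"

text \<open>The images in \<open>V\<close> of the ideal \<open>(r')\<close> and of its square.\<close>

definition V_r :: "(complex, 'r) ring_scheme \<Rightarrow> ncpoly set set set" where
  "V_r K = imgV K ` ideal_r K"

definition V_r2 :: "(complex, 'r) ring_scheme \<Rightarrow> ncpoly set set set" where
  "V_r2 K = imgV K ` (ideal_prod (algA K) (ideal_r K) (ideal_r K))"

text \<open>
  The module \<open>(\<Oplus>\<^sub>a\<^sub>,\<^sub>b \<langle>gcd(a,b) r' \<otimes> x\<^sup>a\<^sup>-\<^sup>1 y\<^sup>b\<^sup>-\<^sup>1\<rangle>)\<^sup>\<Gamma>\<close>. As \<open>\<langle>r'\<rangle>\<close> is free of rank one on the invariant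
  symbol \<open>r'\<close>, the element \<open>r' \<otimes> f\<close> of \<open>\<langle>r'\<rangle> \<otimes> K[x, y]\<close> is written as \<open>f\<close>.
\<close>

definition gcd_module :: "(complex, 'r) ring_scheme \<Rightarrow> (complex^2^2) set \<Rightarrow> cpoly set" where
  "gcd_module K \<Gamma> = invariants \<Gamma> act_poly
    (mod_span K (poly_alg K) {of_nat (gcd a b) * xy_monom (a - 1) (b - 1) | a b. a \<ge> 1 \<and> b \<ge> 1})"


section \<open>The module \<open>(A \<rtimes> \<Gamma>)\<^sub>c\<^sub>y\<^sub>c\<close>\<close>

abbreviation grp :: "(complex, 'r) ring_scheme \<Rightarrow> (complex^2^2) set \<Rightarrow> (complex^2^2) monoid" where
  "grp K \<Gamma> \<equiv> (SL2 K)\<lparr>carrier := \<Gamma>\<rparr>"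

definition skewA ::
  "(complex, 'r) ring_scheme \<Rightarrow> (complex^2^2) set \<Rightarrow> (complex, complex^2^2 \<Rightarrow> ncpoly set) module" where
  "skewA K \<Gamma> = skew_alg (grp K \<Gamma>) (algA K) actA"

definition skew_cyc ::
  "(complex, 'r) ring_scheme \<Rightarrow> (complex^2^2) set \<Rightarrow> (complex, (complex^2^2 \<Rightarrow> ncpoly set) set) module" where
  "skew_cyc K \<Gamma> = cyc K (skewA K \<Gamma>)"

definition cyc_part ::
  "(complex, 'r) ring_scheme \<Rightarrow> (complex^2^2) set \<Rightarrow> (complex^2^2) set \<Rightarrow> (complex^2^2 \<Rightarrow> ncpoly set) set set" where
  "cyc_part K \<Gamma> C = cyc_class K (skewA K \<Gamma>) `
     {f \<in> carrier (skewA K \<Gamma>). \<forall>\<gamma>\<in>\<Gamma> - C. f \<gamma> = \<zero>\<^bsub>algA K\<^esub>}"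

definition skew_cyc_at ::
  "(complex, 'r) ring_scheme \<Rightarrow> (complex^2^2) set \<Rightarrow> (complex^2^2) set \<Rightarrow> (complex, (complex^2^2 \<Rightarrow> ncpoly set) set) module" where
  "skew_cyc_at K \<Gamma> C = (skew_cyc K \<Gamma>)\<lparr>carrier := cyc_part K \<Gamma> C\<rparr>"

definition A_to_cyc ::
  "(complex, 'r) ring_scheme \<Rightarrow> (complex^2^2) set \<Rightarrow> ncpoly set \<Rightarrow> (complex^2^2 \<Rightarrow> ncpoly set) set" where
  "A_to_cyc K \<Gamma> a = cyc_class K (skewA K \<Gamma>) (skew_single (grp K \<Gamma>) (algA K) (mat 1) a)"

definition free_to_cyc ::
  "(complex, 'r) ring_scheme \<Rightarrow> (complex^2^2) set \<Rightarrow> ncpoly \<Rightarrow> (complex^2^2 \<Rightarrow> ncpoly set) set" where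
  "free_to_cyc K \<Gamma> f = A_to_cyc K \<Gamma> (clsA K f)"

text \<open>A polynomial is lifted to \<open>A\<close> by sending \<open>x\<^sup>a y\<^sup>b\<close> to the basis element \<open>z\<^sub>a\<^sub>,\<^sub>b\<close>.\<close>

definition z_lift :: "cpoly \<Rightarrow> ncpoly" where
  "z_lift f = (\<Sum>m\<in>Poly_Mapping.keys f. Poly_Mapping.single 0 (Poly_Mapping.lookup f m) * zmon (fst m) (snd m))"

definition V1_to_cyc ::
  "(complex, 'r) ring_scheme \<Rightarrow> (complex^2^2) set \<Rightarrow> cpoly \<times> ncpoly set set \<Rightarrow> (complex^2^2 \<Rightarrow> ncpoly set) set" where
  "V1_to_cyc K \<Gamma> = (\<lambda>(f, v).
     free_to_cyc K \<Gamma> (z_lift f) \<oplus>\<^bsub>skew_cyc K \<Gamma>\<^esub> induced (A_to_cyc K \<Gamma>) v)"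


section \<open>The quotient by the powers of \<open>r'\<close>\<close>

definition r_powers ::
  "(complex, 'r) ring_scheme \<Rightarrow> (complex^2^2) set \<Rightarrow> (complex^2^2 \<Rightarrow> ncpoly set) set set" where
  "r_powers K \<Gamma> = mod_span K (skew_cyc K \<Gamma>) {free_to_cyc K \<Gamma> (gr ^ l) | l. l \<ge> 1}"

definition modQ ::
  "(complex, 'r) ring_scheme \<Rightarrow> (complex^2^2) set \<Rightarrow> (complex, (complex^2^2 \<Rightarrow> ncpoly set) set set) module" where
  "modQ K \<Gamma> = quot_mod (skew_cyc_at K \<Gamma> {mat 1}) (r_powers K \<Gamma>)"

definition cls_modQ ::
  "(complex, 'r) ring_scheme \<Rightarrow> (complex^2^2) set \<Rightarrow> (complex^2^2 \<Rightarrow> ncpoly set) set \<Rightarrow> (complex^2^2 \<Rightarrow> ncpoly set) set set" where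
  "cls_modQ K \<Gamma> v = r_powers K \<Gamma> +>\<^bsub>skew_cyc K \<Gamma>\<^esub> v"

definition word_degree :: "ncword \<Rightarrow> nat" where
  "word_degree w = (\<Sum>l\<leftarrow>letters w. if l = Lr then 2 else 1)"

text \<open>The grading of the quotient is induced from the free algebra.\<close>

definition modQ_degree ::
  "(complex, 'r) ring_scheme \<Rightarrow> (complex^2^2) set \<Rightarrow> nat \<Rightarrow> (complex^2^2 \<Rightarrow> ncpoly set) set set set" where
  "modQ_degree K \<Gamma> d =
    {cls_modQ K \<Gamma> (free_to_cyc K \<Gamma> f) | f. f \<in> carrier (free_alg K) \<and> (\<forall>w\<in>Poly_Mapping.keys f. word_degree w = d)}"

text \<open>
  The class \<open>(1/p) [(xy - yx + r')\<^sup>q]\<close>, \<open>q = p\<^sup>l\<close>. In the cyclic quotient of the free algebra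
  \<open>[(xy - yx + r')\<^sup>q]\<close> is divisible by \<open>p\<close> only modulo \<open>[(r')\<^sup>q]\<close>, hence \<open>u\<close> is determined only modulo
  the span of the \<open>[(r')\<^sup>m]\<close>, which the map \<open>cyc_to_modQ\<close> kills.
\<close>

definition is_r_divided :: "(complex, 'r) ring_scheme \<Rightarrow> nat \<Rightarrow> nat \<Rightarrow> ncpoly set \<Rightarrow> bool" where
  "is_r_divided K p l u \<longleftrightarrow>
    u \<in> carrier (cyc K (free_alg K)) \<and>
    (of_nat p \<odot>\<^bsub>cyc K (free_alg K)\<^esub> u)
       \<ominus>\<^bsub>cyc K (free_alg K)\<^esub> cyc_class K (free_alg K) ((gx * gy - gy * gx + gr) ^ (p ^ l))
     \<in> mod_span K (cyc K (free_alg K)) {cyc_class K (free_alg K) (gr ^ m) | m. m \<ge> 1}"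

definition cyc_to_modQ ::
  "(complex, 'r) ring_scheme \<Rightarrow> (complex^2^2) set \<Rightarrow> ncpoly set \<Rightarrow> (complex^2^2 \<Rightarrow> ncpoly set) set set" where
  "cyc_to_modQ K \<Gamma> = induced (\<lambda>f. cls_modQ K \<Gamma> (free_to_cyc K \<Gamma> f))"

end

theory Submission
  imports
    Defs
    "HOL-Library.Function_Algebras"
    "HOL-Computational_Algebra.Formal_Power_Series"
begin

text \<open>
  Eliminating \<open>r' = yx - xy\<close> identifies \<open>A\<close> with the free algebra on \<open>x, y\<close>. An element \<open>\<gamma>\<close> of \<open>\<Gamma>\<close> is
  diagonalizable with roots of unity \<open>\<mu>\<close> as eigenvalues, and \<open>1 - \<mu>\<close> is invertible in \<open>K\<close> if \<open>\<mu> \<noteq> 1\<close>.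
  Rotating words in the eigenletters therefore yields a \<open>K\<close>-linear projection of the free algebra whose
  kernel is spanned by the twisted commutators \<open>ac - c \<gamma>(a)\<close>. Composed with the average over the
  centralizer of \<open>\<gamma>\<close>, it makes the summand of the class of \<open>\<gamma>\<close> a retract of a free module.

  For \<open>\<gamma> = 1\<close> the relations are the commutators \<open>[A, A]\<close>. Modulo \<open>[Ar'A, A]\<close> they are detected by the
  linear term in \<open>\<epsilon>\<close> of the map from \<open>A\<close> to the Weyl algebra \<open>yx - xy = \<epsilon>\<close>: its values on \<open>[A, A]\<close> are
  spanned by the \<open>gcd(a,b) x\<^sup>a\<^sup>-\<^sup>1 y\<^sup>b\<^sup>-\<^sup>1\<close>, which are the values of the \<open>W\<^sub>a\<^sub>,\<^sub>b\<close>. The \<open>W\<^sub>a\<^sub>,\<^sub>b\<close> with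
  \<open>a > b\<close> are commutators in \<open>A\<close> because they are the components of the trace of the logarithm of a
  multiplicative commutator of power series. Invariants are handled by averaging, as \<open>|\<Gamma>|\<close> is invertible.

  For \<open>n \<ge> 2\<close> the coefficients of the cyclic class of \<open>(yx - xy)\<^sup>n\<close> have greatest common divisor \<open>p\<close> if \<open>n\<close> is a
  power of the prime \<open>p\<close>, and \<open>1\<close> if \<open>n\<close> is not a prime power. This determines the torsion of the
  quotient by the powers of \<open>r'\<close>, one degree at a time.
\<close>

section \<open>Modules presented by subspaces of complex vector spaces\<close>

text \<open>The modules of the statement are iterated quotients over K, whereas the proof divides:
  by the order of \<Gamma>, by 1 - \<mu>, by gcd(a,b), by the length of a cyclic word. So every
  module is presented by a pair of K-submodules of a complex vector space; the divisions are made
  there, and only membership in a K-submodule is left to check. The gcd arises as follows. Modulo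
  \<open>[Ar'A, A]\<close> a commutator depends on each factor only through its commutative image,
  so the commutators of bidegree (a,b) are combinations of \<alpha> =
  \<open>[x^(a-1) y^b, x]\<close> and \<beta> = \<open>[x^a y^(b-1), y]\<close>. Powers of one word
  commute, which gives (a/g) \<alpha> + (b/g) \<beta> = 0 for g = gcd(a,b). The remaining module is
  cyclic, and Bezout coefficients provide a generator with linear term
  \<open>g x^(a-1) y^(b-1)\<close>. The prime in (iv) arises because \<open>(xy - yx + r')^q\<close>
  is zero in A, while for a power q of p its cyclic class in the free algebra is
  \<open>[r'^q]\<close> plus a multiple of p. If two primes divide n, then two coefficients of the
  class of \<open>(yx - xy)^n\<close> are coprime.\<close>

class complex_module = ab_group_add +
  fixes cscale :: "complex \<Rightarrow> 'a \<Rightarrow> 'a" (infixr "*\<^sub>C" 75)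
  assumes cscale_add_right: "c *\<^sub>C (x + y) = c *\<^sub>C x + c *\<^sub>C y"
    and cscale_add_left: "(c + d) *\<^sub>C x = c *\<^sub>C x + d *\<^sub>C x"
    and cscale_cscale [simp]: "c *\<^sub>C d *\<^sub>C x = (c * d) *\<^sub>C x"
    and cscale_one [simp]: "1 *\<^sub>C x = x"
begin

lemma cscale_zero_right [simp]: "c *\<^sub>C 0 = 0"
  using cscale_add_right[of c 0 0] by simp

lemma cscale_zero_left [simp]: "0 *\<^sub>C x = 0"
  using cscale_add_left[of 0 0 x] by simp

lemma cscale_minus_right [simp]: "c *\<^sub>C (- x) = - (c *\<^sub>C x)"
  using cscale_add_right[of c x "- x"] by (simp add: eq_neg_iff_add_eq_0 add.commute)

lemma cscale_minus_left [simp]: "(- c) *\<^sub>C x = - (c *\<^sub>C x)"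
  using cscale_add_left[of c "- c" x] by (simp add: eq_neg_iff_add_eq_0 add.commute)

lemma cscale_diff_right: "c *\<^sub>C (x - y) = c *\<^sub>C x - c *\<^sub>C y"
  using cscale_add_right[of c x "- y"] by simp

lemma cscale_diff_left: "(c - d) *\<^sub>C x = c *\<^sub>C x - d *\<^sub>C x"
  using cscale_add_left[of c "- d" x] by simp

lemma cscale_sum_right: "c *\<^sub>C (\<Sum>i\<in>I. f i) = (\<Sum>i\<in>I. c *\<^sub>C f i)"
  by (induct I rule: infinite_finite_induct) (simp_all add: cscale_add_right)

lemma cscale_cancel: "c \<noteq> 0 \<Longrightarrow> c *\<^sub>C x = c *\<^sub>C y \<longleftrightarrow> x = y"
  by (metis cscale_cscale cscale_one left_inverse)

lemma cscale_eq_0_iff [simp]: "c *\<^sub>C x = 0 \<longleftrightarrow> c = 0 \<or> x = 0"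
  using cscale_cancel[of c x 0] by (cases "c = 0") auto

end

instantiation complex :: complex_module
begin
definition cscale_complex :: "complex \<Rightarrow> complex \<Rightarrow> complex" where [simp]: "cscale_complex c x = c * x"
instance by standard (simp_all add: algebra_simps)
end

instantiation "fun" :: (type, complex_module) complex_module
begin
definition cscale_fun :: "complex \<Rightarrow> ('a \<Rightarrow> 'b) \<Rightarrow> 'a \<Rightarrow> 'b" where "cscale_fun c f = (\<lambda>x. c *\<^sub>C f x)"
instance by standard (simp_all add: cscale_fun_def fun_eq_iff cscale_add_right cscale_add_left)
end

lemma cscale_apply [simp]: "(c *\<^sub>C f) x = c *\<^sub>C f x"
  by (simp add: cscale_fun_def)

instantiation prod :: (complex_module, complex_module) complex_module
begin
definition cscale_prod :: "complex \<Rightarrow> 'a \<times> 'b \<Rightarrow> 'a \<times> 'b" where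
  "cscale_prod c p = (c *\<^sub>C fst p, c *\<^sub>C snd p)"
instance by standard (simp_all add: cscale_prod_def prod_eq_iff cscale_add_right cscale_add_left)
end

lemma cscale_Pair [simp]: "c *\<^sub>C (x, y) = (c *\<^sub>C x, c *\<^sub>C y)"
  and fst_cscale [simp]: "fst (c *\<^sub>C p) = c *\<^sub>C fst p"
  and snd_cscale [simp]: "snd (c *\<^sub>C p) = c *\<^sub>C snd p"
  by (simp_all add: cscale_prod_def)

instantiation poly_mapping :: (type, complex_module) complex_module
begin
lift_definition cscale_poly_mapping :: "complex \<Rightarrow> ('a \<Rightarrow>\<^sub>0 'b) \<Rightarrow> 'a \<Rightarrow>\<^sub>0 'b"
  is "\<lambda>c f w. c *\<^sub>C f w"
  by (erule finite_subset[rotated]) auto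
instance by standard (transfer, simp add: fun_eq_iff cscale_add_right cscale_add_left)+
end

lemma lookup_cscale [simp]: "Poly_Mapping.lookup (c *\<^sub>C f) w = c *\<^sub>C Poly_Mapping.lookup f w"
  by transfer simp

lemma lookup_plus [simp]:
  "Poly_Mapping.lookup (f + g) w = Poly_Mapping.lookup f w + Poly_Mapping.lookup (g :: _ \<Rightarrow>\<^sub>0 'b::monoid_add) w"
  by (simp add: lookup_add)

lemma single_0_mult:
  "Poly_Mapping.single 0 c * (f :: 'w::monoid_add \<Rightarrow>\<^sub>0 complex) = c *\<^sub>C f"
  unfolding mult_map_scale_conv_mult[symmetric]
  by (rule poly_mapping_eqI) (simp add: Poly_Mapping.map.rep_eq when_def)

text \<open>Linearity over all complex numbers and not just over K: such maps are determined by the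
  basis words (\<open>clin_wd_eqI\<close>) and commute with divisions.\<close>

definition clin :: "('a::complex_module \<Rightarrow> 'b::complex_module) \<Rightarrow> bool" where
  "clin f \<longleftrightarrow> (\<forall>x y. f (x + y) = f x + f y) \<and> (\<forall>c x. f (c *\<^sub>C x) = c *\<^sub>C f x)"

lemma clinI: "(\<And>x y. f (x + y) = f x + f y) \<Longrightarrow> (\<And>c x. f (c *\<^sub>C x) = c *\<^sub>C f x) \<Longrightarrow> clin f"
  by (simp add: clin_def)

lemma clin_add: "clin f \<Longrightarrow> f (x + y) = f x + f y"
  and clin_cscale: "clin f \<Longrightarrow> f (c *\<^sub>C x) = c *\<^sub>C f x"
  by (simp_all add: clin_def)

lemma clin_zero: "clin f \<Longrightarrow> f 0 = 0"
  using clin_cscale[of f 0 0] by simp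

lemma clin_minus: "clin f \<Longrightarrow> f (- x) = - f x"
  using clin_cscale[of f "-1" x] by simp

lemma clin_diff: "clin f \<Longrightarrow> f (x - y) = f x - f y"
  using clin_add[of f x "- y"] by (simp add: clin_minus)

lemma clin_sum: "clin f \<Longrightarrow> f (\<Sum>i\<in>I. g i) = (\<Sum>i\<in>I. f (g i))"
  by (induct I rule: infinite_finite_induct) (simp_all add: clin_zero clin_add)

lemmas clin_simps = clin_add clin_cscale clin_zero clin_minus clin_diff clin_sum

lemma clin_comp: "clin f \<Longrightarrow> clin g \<Longrightarrow> clin (\<lambda>x. f (g x))"
  by (simp add: clin_def)

lemma clin_id [simp]: "clin (\<lambda>x. x)"
  by (simp add: clin_def)

lemma clin_plus: "clin f \<Longrightarrow> clin g \<Longrightarrow> clin (\<lambda>x. f x + g x)"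
  by (simp add: clin_def cscale_add_right algebra_simps)

lemma clin_minus_fun: "clin f \<Longrightarrow> clin g \<Longrightarrow> clin (\<lambda>x. f x - g x)"
  by (simp add: clin_def cscale_diff_right algebra_simps)

lemma clin_scaled: "clin f \<Longrightarrow> clin (\<lambda>x. c *\<^sub>C f x)"
  by (simp add: clin_def cscale_add_right mult.commute)

lemma clin_sum_fun: "(\<And>i. i \<in> I \<Longrightarrow> clin (f i)) \<Longrightarrow> clin (\<lambda>x. \<Sum>i\<in>I. f i x)"
  by (induct I rule: infinite_finite_induct) (simp_all add: clin_plus, simp_all add: clin_def)

text \<open>Any subring of the complex numbers; the inverse of the group order and the roots of
  unity come with \<open>finite_sl2\<close>. The scalar multiplication is fixed as well because K is
  also used as a module over itself (\<open>pres_K\<close>).\<close>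

locale coeff_ring =
  fixes K :: "(complex, complex) module"
  assumes ring_ops [simp]: "mult K = (*)" "one K = 1" "ring.zero K = 0" "add K = (+)" "smult K = (*)"
    and K_one [simp]: "1 \<in> carrier K"
    and K_add [simp]: "a \<in> carrier K \<Longrightarrow> b \<in> carrier K \<Longrightarrow> a + b \<in> carrier K"
    and K_mult [simp]: "a \<in> carrier K \<Longrightarrow> b \<in> carrier K \<Longrightarrow> a * b \<in> carrier K"
    and K_minus [simp]: "a \<in> carrier K \<Longrightarrow> - a \<in> carrier K"
begin

abbreviation k where "k \<equiv> carrier K"

lemma K_zero [simp]: "0 \<in> k"
  using K_add[OF K_one K_minus[OF K_one]] by simp

lemma K_diff [simp]: "a \<in> k \<Longrightarrow> b \<in> k \<Longrightarrow> a - b \<in> k"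
  using K_add[of a "- b"] by simp

lemma K_of_nat [simp]: "of_nat n \<in> k"
  by (induct n) simp_all

lemma K_of_int [simp]: "of_int n \<in> k"
  by (cases n rule: int_cases2) simp_all

lemma K_sum: "(\<And>i. i \<in> I \<Longrightarrow> f i \<in> k) \<Longrightarrow> sum f I \<in> k"
  by (induct I rule: infinite_finite_induct) auto

lemma K_power [simp]: "a \<in> k \<Longrightarrow> a ^ n \<in> k"
  by (induct n) auto

lemma K_cring: "cring K"
proof (rule cringI)
  show "abelian_group K"
  proof (rule abelian_groupI)
    show "\<exists>y\<in>k. y \<oplus>\<^bsub>K\<^esub> x = \<zero>\<^bsub>K\<^esub>" if "x \<in> k" for x
      using that by (intro bexI[of _ "- x"]) auto
  qed (auto simp: algebra_simps)
  show "comm_monoid K"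
    by (rule comm_monoidI) (auto simp: algebra_simps)
qed (auto simp: algebra_simps)

section \<open>Submodules and spans over K\<close>

definition ksub :: "'a::complex_module set \<Rightarrow> bool" where
  "ksub N \<longleftrightarrow> 0 \<in> N \<and> (\<forall>x\<in>N. \<forall>y\<in>N. x + y \<in> N) \<and> (\<forall>c\<in>k. \<forall>x\<in>N. c *\<^sub>C x \<in> N)"

text \<open>Adding one scaled generator at a time gives an induction rule;
  \<open>pres_mod_span\<close> reconciles this span with the intersection
  \<open>mod_span\<close>.\<close>

inductive_set kspan :: "'a::complex_module set \<Rightarrow> 'a set" for S :: "'a set" where
  zero [simp]: "0 \<in> kspan S"
| step: "c \<in> k \<Longrightarrow> x \<in> S \<Longrightarrow> v \<in> kspan S \<Longrightarrow> c *\<^sub>C x + v \<in> kspan S"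

lemma ksubI: "0 \<in> N \<Longrightarrow> (\<And>x y. x \<in> N \<Longrightarrow> y \<in> N \<Longrightarrow> x + y \<in> N) \<Longrightarrow>
    (\<And>c x. c \<in> k \<Longrightarrow> x \<in> N \<Longrightarrow> c *\<^sub>C x \<in> N) \<Longrightarrow> ksub N"
  by (simp add: ksub_def)

lemma ksub_zero: "ksub N \<Longrightarrow> 0 \<in> N"
  and ksub_add: "ksub N \<Longrightarrow> x \<in> N \<Longrightarrow> y \<in> N \<Longrightarrow> x + y \<in> N"
  and ksub_cscale: "ksub N \<Longrightarrow> c \<in> k \<Longrightarrow> x \<in> N \<Longrightarrow> c *\<^sub>C x \<in> N"
  by (simp_all add: ksub_def)

lemma ksub_minus: "ksub N \<Longrightarrow> x \<in> N \<Longrightarrow> - x \<in> N"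
  using ksub_cscale[of N "-1" x] by simp

lemma ksub_diff: "ksub N \<Longrightarrow> x \<in> N \<Longrightarrow> y \<in> N \<Longrightarrow> x - y \<in> N"
  using ksub_add[of N x "- y"] ksub_minus[of N y] by simp

lemma ksub_diff_commute: "ksub N \<Longrightarrow> x - y \<in> N \<Longrightarrow> y - x \<in> N"
  using ksub_minus[of N "x - y"] by simp

lemma ksub_sum: "ksub N \<Longrightarrow> (\<And>i. i \<in> I \<Longrightarrow> f i \<in> N) \<Longrightarrow> sum f I \<in> N"
  by (induct I rule: infinite_finite_induct) (auto simp: ksub_zero ksub_add)

lemma ksub_trans: "ksub N \<Longrightarrow> x - y \<in> N \<Longrightarrow> y - z \<in> N \<Longrightarrow> x - z \<in> N"
  using ksub_add[of N "x - y" "y - z"] by simp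

lemma ksub_cong: "ksub N \<Longrightarrow> x - y \<in> N \<Longrightarrow> x \<in> N \<longleftrightarrow> y \<in> N"
  using ksub_diff[of N x "x - y"] ksub_add[of N "x - y" y] by auto

lemma ksub_Int: "ksub N \<Longrightarrow> ksub M \<Longrightarrow> ksub (N \<inter> M)"
  by (auto simp: ksub_def)

lemma ksub_singleton_0: "ksub {0}"
  by (simp add: ksub_def)

lemma ksub_UNIV: "ksub UNIV"
  by (simp add: ksub_def)

lemma ksub_vimage: "clin f \<Longrightarrow> ksub N \<Longrightarrow> ksub {x. f x \<in> N}"
  by (auto simp: ksub_def clin_simps)

lemma ksub_Collect_ker: "ksub U \<Longrightarrow> clin f \<Longrightarrow> ksub {x \<in> U. f x = 0}"
  by (auto simp: ksub_def clin_simps)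

lemma ksub_Collect_vimage: "ksub U \<Longrightarrow> clin f \<Longrightarrow> ksub N \<Longrightarrow> ksub {x \<in> U. f x \<in> N}"
  by (auto simp: ksub_def clin_simps)

lemma ksub_image: "clin f \<Longrightarrow> ksub N \<Longrightarrow> ksub (f ` N)"
  by (rule ksubI) (auto simp: clin_simps ksub_def simp flip: clin_add clin_cscale
      intro: image_eqI[OF clin_zero[symmetric]])

lemma ksub_set_plus:
  assumes "ksub N" "ksub M"
  shows "ksub {x + y | x y. x \<in> N \<and> y \<in> M}"
proof (rule ksubI)
  show "0 \<in> {x + y | x y. x \<in> N \<and> y \<in> M}"
    using ksub_zero[OF assms(1)] ksub_zero[OF assms(2)] by force
  fix u v assume "u \<in> {x + y | x y. x \<in> N \<and> y \<in> M}" "v \<in> {x + y | x y. x \<in> N \<and> y \<in> M}"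
  then obtain x y x' y' where "u = x + y" "v = x' + y'" "x \<in> N" "y \<in> M" "x' \<in> N" "y' \<in> M" by auto
  then have "u + v = (x + x') + (y + y')" "x + x' \<in> N" "y + y' \<in> M"
    using assms by (auto simp: ksub_add)
  then show "u + v \<in> {x + y | x y. x \<in> N \<and> y \<in> M}" by blast
next
  fix c u assume "c \<in> k" "u \<in> {x + y | x y. x \<in> N \<and> y \<in> M}"
  then show "c *\<^sub>C u \<in> {x + y | x y. x \<in> N \<and> y \<in> M}"
    using assms by (fastforce simp: cscale_add_right intro: ksub_cscale)
qed

lemma kspan_base: "x \<in> S \<Longrightarrow> x \<in> kspan S"
  using kspan.step[of 1 x S 0] by simp

lemma ksub_kspan: "ksub (kspan S)"
proof (rule ksubI)
  show "x + y \<in> kspan S" if "x \<in> kspan S" "y \<in> kspan S" for x y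
    using that by (induct x) (auto simp: add.assoc intro: kspan.step)
  show "c *\<^sub>C x \<in> kspan S" if "c \<in> k" "x \<in> kspan S" for c x
    using that(2,1) by (induct x) (auto simp: cscale_add_right intro!: kspan.step)
qed simp

lemma kspan_minimal: "S \<subseteq> N \<Longrightarrow> ksub N \<Longrightarrow> kspan S \<subseteq> N"
proof
  fix x assume "x \<in> kspan S" "S \<subseteq> N" "ksub N"
  then show "x \<in> N" by (induct x) (auto simp: ksub_zero ksub_add ksub_cscale)
qed

lemma kspan_mono: "S \<subseteq> T \<Longrightarrow> kspan S \<subseteq> kspan T"
  by (rule kspan_minimal) (auto intro: kspan_base ksub_kspan)

lemma kspan_eq: "ksub N \<Longrightarrow> kspan N = N"
  by (meson kspan_base kspan_minimal order_refl subsetI subset_antisym)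

lemma kspan_lin_in:
  assumes "clin f" "ksub N" "\<And>x. x \<in> S \<Longrightarrow> f x \<in> N" "x \<in> kspan S"
  shows "f x \<in> N"
  using kspan_minimal[of S "{x. f x \<in> N}"] ksub_vimage[OF assms(1,2)] assms(3,4) by auto

text \<open>
  The module \<open>M\<close> is identified with \<open>U / N\<close> by means of the quotient map \<open>q\<close>.
\<close>

definition pres :: "(complex, 'b) module \<Rightarrow> 'a::complex_module set \<Rightarrow> 'a set \<Rightarrow> ('a \<Rightarrow> 'b) \<Rightarrow> bool" where
  "pres M U N q \<longleftrightarrow> ksub U \<and> ksub N \<and> N \<subseteq> U \<and> q ` U = carrier M \<and>
    (\<forall>x\<in>U. \<forall>y\<in>U. q (x + y) = q x \<oplus>\<^bsub>M\<^esub> q y) \<and> (\<forall>c\<in>k. \<forall>x\<in>U. q (c *\<^sub>C x) = c \<odot>\<^bsub>M\<^esub> q x) \<and>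
    (\<forall>x\<in>U. \<forall>y\<in>U. q x = q y \<longleftrightarrow> x - y \<in> N) \<and> q 0 = \<zero>\<^bsub>M\<^esub>"

context
  fixes M :: "(complex, 'b) module" and U N :: "'a::complex_module set" and q
  assumes P: "pres M U N q"
begin

lemma presD: "ksub U" "ksub N" "N \<subseteq> U" "q ` U = carrier M"
  "x \<in> U \<Longrightarrow> y \<in> U \<Longrightarrow> q (x + y) = q x \<oplus>\<^bsub>M\<^esub> q y"
  "c \<in> k \<Longrightarrow> x \<in> U \<Longrightarrow> q (c *\<^sub>C x) = c \<odot>\<^bsub>M\<^esub> q x"
  "x \<in> U \<Longrightarrow> y \<in> U \<Longrightarrow> q x = q y \<longleftrightarrow> x - y \<in> N"
  "q 0 = \<zero>\<^bsub>M\<^esub>" "x \<in> U \<Longrightarrow> q x \<in> carrier M"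
  using P unfolding pres_def by auto

lemma pres_surj: "m \<in> carrier M \<Longrightarrow> \<exists>x\<in>U. m = q x"
  using presD(4) by auto

lemma pres_zero_iff: "x \<in> U \<Longrightarrow> q x = \<zero>\<^bsub>M\<^esub> \<longleftrightarrow> x \<in> N"
  using presD(7)[of x 0] presD(8) ksub_zero[OF presD(1)] by simp

lemma pres_module: "Module.module K M"
proof (rule moduleI[OF K_cring])
  note cl = ksub_zero[OF presD(1)] ksub_add[OF presD(1)] ksub_cscale[OF presD(1)] ksub_minus[OF presD(1)]
  show "abelian_group M"
  proof (rule abelian_groupI)
    show "\<zero>\<^bsub>M\<^esub> \<in> carrier M" using presD(8,9) cl(1) by metis
    fix m assume m: "m \<in> carrier M"
    then obtain x where x: "x \<in> U" "m = q x" using pres_surj by blast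
    show "\<zero>\<^bsub>M\<^esub> \<oplus>\<^bsub>M\<^esub> m = m"
      using presD(5)[of 0 x] x cl by (simp add: presD(8))
    show "\<exists>y\<in>carrier M. y \<oplus>\<^bsub>M\<^esub> m = \<zero>\<^bsub>M\<^esub>"
      using presD(5)[of "- x" x] x cl by (intro bexI[of _ "q (- x)"]) (auto simp: presD(8,9))
    fix m' assume "m' \<in> carrier M"
    then obtain y where y: "y \<in> U" "m' = q y" using pres_surj by blast
    show "m \<oplus>\<^bsub>M\<^esub> m' \<in> carrier M"
      using presD(5)[of x y] x y cl presD(9) by metis
    show "m \<oplus>\<^bsub>M\<^esub> m' = m' \<oplus>\<^bsub>M\<^esub> m"
      using presD(5)[of x y] presD(5)[of y x] x y by (simp add: add.commute)
    fix m'' assume "m'' \<in> carrier M"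
    then obtain z where z: "z \<in> U" "m'' = q z" using pres_surj by blast
    show "m \<oplus>\<^bsub>M\<^esub> m' \<oplus>\<^bsub>M\<^esub> m'' = m \<oplus>\<^bsub>M\<^esub> (m' \<oplus>\<^bsub>M\<^esub> m'')"
      using presD(5)[of x y] presD(5)[of "x + y" z] presD(5)[of y z] presD(5)[of x "y + z"] x y z cl
      by (simp add: add.assoc)
  qed
  show "\<one>\<^bsub>K\<^esub> \<odot>\<^bsub>M\<^esub> m = m" if "m \<in> carrier M" for m
    using presD(6)[of 1] pres_surj[OF that] by auto
  fix a m assume a: "a \<in> k" and m: "m \<in> carrier M"
  then obtain x where x: "x \<in> U" "m = q x" using pres_surj by blast
  show "a \<odot>\<^bsub>M\<^esub> m \<in> carrier M" using presD(6)[of a x] a x cl presD(9) by metis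
  { fix b assume b: "b \<in> k"
    show "(a \<oplus>\<^bsub>K\<^esub> b) \<odot>\<^bsub>M\<^esub> m = a \<odot>\<^bsub>M\<^esub> m \<oplus>\<^bsub>M\<^esub> b \<odot>\<^bsub>M\<^esub> m"
      using presD(6)[of "a + b" x] presD(6)[of a x] presD(6)[of b x] presD(5)[of "a *\<^sub>C x" "b *\<^sub>C x"] a b x cl
      by (simp add: cscale_add_left)
    show "(a \<otimes>\<^bsub>K\<^esub> b) \<odot>\<^bsub>M\<^esub> m = a \<odot>\<^bsub>M\<^esub> (b \<odot>\<^bsub>M\<^esub> m)"
      using presD(6)[of "a * b" x] presD(6)[of b x] presD(6)[of a "b *\<^sub>C x"] a b x cl by simp }
  fix m' assume "m' \<in> carrier M"
  then obtain y where y: "y \<in> U" "m' = q y" using pres_surj by blast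
  show "a \<odot>\<^bsub>M\<^esub> (m \<oplus>\<^bsub>M\<^esub> m') = a \<odot>\<^bsub>M\<^esub> m \<oplus>\<^bsub>M\<^esub> a \<odot>\<^bsub>M\<^esub> m'"
    using presD(5)[of x y] presD(6)[of a "x + y"] presD(6)[of a x] presD(6)[of a y]
      presD(5)[of "a *\<^sub>C x" "a *\<^sub>C y"] a x y cl by (simp add: cscale_add_right)
qed

lemma pres_inv: assumes "x \<in> U" shows "\<ominus>\<^bsub>M\<^esub> q x = q (- x)"
proof -
  interpret M: Module.module K M by (rule pres_module)
  have "- x \<in> U" using ksub_minus presD(1) assms by blast
  then show ?thesis
    using presD(5)[of x "- x"] assms presD(8,9)
    by (intro M.minus_equality) (auto simp: M.M.a_comm)
qed

lemma pres_diff: assumes "x \<in> U" "y \<in> U" shows "q x \<ominus>\<^bsub>M\<^esub> q y = q (x - y)"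
  using presD(5)[of x "- y"] assms ksub_minus[OF presD(1)] by (simp add: a_minus_def pres_inv)

lemma pres_finsum:
  assumes "finite I" "\<And>i. i \<in> I \<Longrightarrow> f i \<in> U" shows "(\<Oplus>\<^bsub>M\<^esub>i\<in>I. q (f i)) = q (\<Sum>i\<in>I. f i)"
proof -
  interpret M: Module.module K M by (rule pres_module)
  show ?thesis using assms
  proof (induct I)
    case empty then show ?case by (simp add: presD(8))
  next
    case (insert i I)
    then have "(\<Oplus>\<^bsub>M\<^esub>i\<in>insert i I. q (f i)) = q (f i) \<oplus>\<^bsub>M\<^esub> (\<Oplus>\<^bsub>M\<^esub>i\<in>I. q (f i))"
      by (intro M.M.finsum_insert) (auto simp: presD(9))
    also have "\<dots> = q (f i + sum f I)"
      using insert ksub_sum[OF presD(1), of I f] by (simp add: presD(5))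
    finally show ?case using insert by simp
  qed
qed

lemma pres_submodule: assumes "ksub Y" "Y \<subseteq> U" shows "submodule (q ` Y) K M"
proof -
  interpret M: Module.module K M by (rule pres_module)
  show ?thesis
  proof (rule M.submoduleI)
    show "\<zero>\<^bsub>M\<^esub> \<in> q ` Y" using imageI[OF ksub_zero[OF assms(1)], of q] presD(8) by simp
  next
    fix a b assume "a \<in> q ` Y" "b \<in> q ` Y"
    then obtain x y where "x \<in> Y" "y \<in> Y" "a = q x" "b = q y" by blast
    then have "a \<oplus>\<^bsub>M\<^esub> b = q (x + y)" "x + y \<in> Y"
      using presD(5)[of x y] ksub_add[OF assms(1)] subsetD[OF assms(2)] by auto
    then show "a \<oplus>\<^bsub>M\<^esub> b \<in> q ` Y" by blast
  next
    fix a m assume "a \<in> k" "m \<in> q ` Y"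
    then obtain x where "x \<in> Y" "m = q x" by blast
    then have "a \<odot>\<^bsub>M\<^esub> m = q (a *\<^sub>C x)" "a *\<^sub>C x \<in> Y"
      using \<open>a \<in> k\<close> subsetD[OF assms(2)] presD(6)[of a x] ksub_cscale[OF assms(1)] by auto
    then show "a \<odot>\<^bsub>M\<^esub> m \<in> q ` Y" by blast
  qed (use assms presD(9) ksub_minus[OF assms(1)] in \<open>auto simp: pres_inv subset_iff\<close>)
qed

lemma pres_submodule_vimage: assumes "submodule H K M" shows "ksub {x \<in> U. q x \<in> H}" "H = q ` {x \<in> U. q x \<in> H}"
proof -
  interpret M: Module.module K M by (rule pres_module)
  note H = M.submoduleE[OF assms]
  have z: "\<zero>\<^bsub>M\<^esub> \<in> H" using assms subgroup.one_closed[of H "add_monoid M"] by (simp add: submodule_def)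
  show "ksub {x \<in> U. q x \<in> H}"
    using H presD(1) by (intro ksubI) (auto simp: presD ksub_zero ksub_add ksub_cscale z)
  show "H = q ` {x \<in> U. q x \<in> H}"
    using H(1) unfolding presD(4)[symmetric] by auto
qed

lemma pres_mod_span: assumes "S \<subseteq> U" shows "mod_span K M (q ` S) = q ` kspan S"
proof
  have "kspan S \<subseteq> U" using kspan_minimal assms presD(1) by blast
  then have "submodule (q ` kspan S) K M" by (rule pres_submodule[OF ksub_kspan])
  then show "mod_span K M (q ` S) \<subseteq> q ` kspan S"
    unfolding mod_span_def by (auto intro: kspan_base)
  show "q ` kspan S \<subseteq> mod_span K M (q ` S)"
    unfolding mod_span_def
  proof safe
    fix x H assume x: "x \<in> kspan S" and H: "submodule H K M" "q ` S \<subseteq> H"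
    have "kspan S \<subseteq> {x \<in> U. q x \<in> H}"
      using H assms by (intro kspan_minimal pres_submodule_vimage(1)) auto
    then show "q x \<in> H" using x by auto
  qed
qed

lemma pres_torsion: "torsion K M = q ` {x \<in> U. \<exists>c\<in>k. c \<noteq> 0 \<and> c *\<^sub>C x \<in> N}"
proof -
  have "(c \<odot>\<^bsub>M\<^esub> q x = \<zero>\<^bsub>M\<^esub>) = (c *\<^sub>C x \<in> N)" if "c \<in> k" "x \<in> U" for c x
    using that presD(6)[of c x] pres_zero_iff[of "c *\<^sub>C x"] ksub_cscale[OF presD(1)] by simp
  then show ?thesis unfolding torsion_def presD(4)[symmetric] by auto
qed

lemma pres_torsion_free:
  assumes "\<And>c x. c \<in> k \<Longrightarrow> c \<noteq> 0 \<Longrightarrow> x \<in> U \<Longrightarrow> c *\<^sub>C x \<in> N \<Longrightarrow> x \<in> N"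
  shows "torsion_free K M"
proof -
  have "\<zero>\<^bsub>M\<^esub> \<in> q ` {x \<in> U. \<exists>c\<in>k. c \<noteq> 0 \<and> c *\<^sub>C x \<in> N}"
    by (intro image_eqI[of _ _ 0]) (auto simp: presD(8) ksub_zero[OF presD(1)] ksub_zero[OF presD(2)] intro!: bexI[of _ 1])
  then show ?thesis
    unfolding torsion_free_def pres_torsion
  proof (intro antisym)
    show "q ` {x \<in> U. \<exists>c\<in>k. c \<noteq> 0 \<and> c *\<^sub>C x \<in> N} \<subseteq> {\<zero>\<^bsub>M\<^esub>}"
    proof safe
      fix x c assume "x \<in> U" "c \<in> k" "c \<noteq> 0" "c *\<^sub>C x \<in> N"
      then show "q x = \<zero>\<^bsub>M\<^esub>" using assms pres_zero_iff by blast
    qed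
  qed simp
qed

lemma pres_restrict:
  assumes "ksub Y" "Y \<subseteq> U" shows "pres (M\<lparr>carrier := q ` Y\<rparr>) Y (N \<inter> Y) q"
  unfolding pres_def using assms
  by (auto simp: presD subset_iff ksub_diff intro!: ksub_Int)

lemma pres_restrict':
  assumes "ksub Y" "N \<subseteq> Y" "Y \<subseteq> U" shows "pres (M\<lparr>carrier := q ` Y\<rparr>) Y N q"
  using pres_restrict[OF assms(1,3)] assms(2) by (simp add: Int_absorb2)

lemma pres_image_eq: assumes "ksub Y" "Y \<subseteq> U" "N \<subseteq> Y" "x \<in> U" shows "q x \<in> q ` Y \<longleftrightarrow> x \<in> Y"
proof
  assume "q x \<in> q ` Y"
  then obtain y where "y \<in> Y" "q x = q y" by auto
  then have "x - y \<in> Y" using presD(7) assms by blast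
  then show "x \<in> Y" using ksub_cong[OF assms(1)] \<open>y \<in> Y\<close> by blast
qed (use assms in auto)

lemma pres_coset:
  assumes "ksub N'" "N \<subseteq> N'" "N' \<subseteq> U" "x \<in> U"
  shows "q ` N' +>\<^bsub>M\<^esub> q x = q ` {y \<in> U. y - x \<in> N'}"
proof -
  have "q ` N' +>\<^bsub>M\<^esub> q x = {q n \<oplus>\<^bsub>M\<^esub> q x | n. n \<in> N'}"
    by (auto simp: a_r_coset_def r_coset_def)
  also have "\<dots> = {q (n + x) | n. n \<in> N'}"
    using assms presD(5) by (metis (no_types, opaque_lifting) subsetD)
  also have "\<dots> = q ` {y \<in> U. y - x \<in> N'}"
  proof safe
    fix n assume "n \<in> N'" then show "q (n + x) \<in> q ` {y \<in> U. y - x \<in> N'}"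
      using assms ksub_add[OF presD(1)] by (intro imageI) auto
  next
    fix y assume "y \<in> U" "y - x \<in> N'" then show "\<exists>n. q y = q (n + x) \<and> n \<in> N'"
      by (intro exI[of _ "y - x"]) auto
  qed
  finally show ?thesis .
qed

lemma pres_set_add:
  assumes "A \<subseteq> U" "B \<subseteq> U" shows "q ` A <+>\<^bsub>M\<^esub> q ` B = q ` {a + b | a b. a \<in> A \<and> b \<in> B}"
proof -
  have "q ` A <+>\<^bsub>M\<^esub> q ` B = {q a \<oplus>\<^bsub>M\<^esub> q b | a b. a \<in> A \<and> b \<in> B}"
    by (auto simp: set_add_def set_mult_def)
  also have "\<dots> = {q (a + b) | a b. a \<in> A \<and> b \<in> B}"
  proof (intro Collect_cong iffI)
    fix m assume "\<exists>a b. m = q a \<oplus>\<^bsub>M\<^esub> q b \<and> a \<in> A \<and> b \<in> B"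
    then obtain a b where *: "m = q a \<oplus>\<^bsub>M\<^esub> q b" "a \<in> A" "b \<in> B" by blast
    then have "m = q (a + b)" using presD(5)[of a b] subsetD[OF assms(1)] subsetD[OF assms(2)] by simp
    then show "\<exists>a b. m = q (a + b) \<and> a \<in> A \<and> b \<in> B" using * by blast
  next
    fix m assume "\<exists>a b. m = q (a + b) \<and> a \<in> A \<and> b \<in> B"
    then obtain a b where *: "m = q (a + b)" "a \<in> A" "b \<in> B" by blast
    then have "m = q a \<oplus>\<^bsub>M\<^esub> q b" using presD(5)[of a b] subsetD[OF assms(1)] subsetD[OF assms(2)] by simp
    then show "\<exists>a b. m = q a \<oplus>\<^bsub>M\<^esub> q b \<and> a \<in> A \<and> b \<in> B" using * by blast
  qed
  finally show ?thesis by blast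
qed

text \<open>The third isomorphism theorem. Iterated quotients keep the same numerator
  \<open>U\<close>, so even the torsion quotient in (iv) is presented directly by the free
  algebra.\<close>

lemma pres_quot:
  assumes N': "ksub N'" "N \<subseteq> N'" "N' \<subseteq> U"
  shows "pres (quot_mod M (q ` N')) U N' (\<lambda>x. q ` N' +>\<^bsub>M\<^esub> q x)"
proof -
  let ?c = "\<lambda>x. q ` {y \<in> U. y - x \<in> N'}"
  have eq: "?c x = ?c y \<longleftrightarrow> x - y \<in> N'" if "x \<in> U" "y \<in> U" for x y
  proof
    assume "?c x = ?c y"
    moreover have "q x \<in> ?c x" using that ksub_zero[OF N'(1)] by auto
    ultimately have "q x \<in> ?c y" by simp
    then obtain z where z: "z \<in> U" "z - y \<in> N'" "q x = q z" by auto
    then have "x - z \<in> N'" using presD(7)[of x z] that N'(2) by auto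
    then show "x - y \<in> N'" using z ksub_trans[OF N'(1)] by blast
  next
    assume *: "x - y \<in> N'"
    have "z - x \<in> N' \<longleftrightarrow> z - y \<in> N'" for z
      using ksub_trans[OF N'(1) _ *] ksub_trans[OF N'(1) _ ksub_diff_commute[OF N'(1) *]] by blast
    then show "?c x = ?c y" by auto
  qed
  have carr: "carrier (quot_mod M (q ` N')) = ?c ` U"
  proof -
    have "carrier (quot_mod M (q ` N')) = (\<lambda>m. q ` N' +>\<^bsub>M\<^esub> m) ` (q ` U)"
      unfolding presD(4) by (auto simp: quot_mod_def A_RCOSETS_def RCOSETS_def a_r_coset_def)
    then show ?thesis using pres_coset[OF N'] by (simp add: image_image cong: image_cong)
  qed
  have add: "?c x \<oplus>\<^bsub>quot_mod M (q ` N')\<^esub> ?c y = ?c (x + y)" if "x \<in> U" "y \<in> U" for x y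
  proof -
    have "?c x \<oplus>\<^bsub>quot_mod M (q ` N')\<^esub> ?c y = ?c x <+>\<^bsub>M\<^esub> ?c y"
      by (simp add: quot_mod_def)
    also have "\<dots> = q ` {a + b | a b. a \<in> {y \<in> U. y - x \<in> N'} \<and> b \<in> {z \<in> U. z - y \<in> N'}}"
      by (rule pres_set_add) auto
    also have "\<dots> = {q (a + b) | a b. a \<in> U \<and> b \<in> U \<and> a - x \<in> N' \<and> b - y \<in> N'}"
      by auto
    also have "\<dots> = ?c (x + y)"
    proof safe
      fix a b assume "a \<in> U" "b \<in> U" "a - x \<in> N'" "b - y \<in> N'"
      then show "q (a + b) \<in> ?c (x + y)"
        using ksub_add[OF N'(1), of "a - x" "b - y"] ksub_add[OF presD(1)]
        by (intro imageI) (auto simp: algebra_simps)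
    next
      fix z assume z: "z \<in> U" "z - (x + y) \<in> N'"
      show "\<exists>a b. q z = q (a + b) \<and> a \<in> U \<and> b \<in> U \<and> a - x \<in> N' \<and> b - y \<in> N'"
        using z that ksub_diff[OF presD(1)] ksub_zero[OF N'(1)]
        by (intro exI[of _ "z - y"] exI[of _ y]) (auto simp: algebra_simps)
    qed
    finally show ?thesis .
  qed
  have sm: "?c (c *\<^sub>C x) = c \<odot>\<^bsub>quot_mod M (q ` N')\<^esub> ?c x" if "c \<in> k" "x \<in> U" for c x
  proof -
    have "c \<odot>\<^bsub>quot_mod M (q ` N')\<^esub> ?c x = (\<Union>y\<in>{y \<in> U. y - x \<in> N'}. q ` N' +>\<^bsub>M\<^esub> (c \<odot>\<^bsub>M\<^esub> q y))"
      by (auto simp: quot_mod_def)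
    also have "\<dots> = (\<Union>y\<in>{y \<in> U. y - x \<in> N'}. ?c (c *\<^sub>C y))"
      using that pres_coset[OF N'] ksub_cscale[OF presD(1)]
      by (intro SUP_cong) (auto simp: presD(6)[symmetric])
    also have "\<dots> = (\<Union>y\<in>{y \<in> U. y - x \<in> N'}. ?c (c *\<^sub>C x))"
    proof (intro SUP_cong refl)
      fix y assume "y \<in> {y \<in> U. y - x \<in> N'}"
      then show "?c (c *\<^sub>C y) = ?c (c *\<^sub>C x)"
        using that ksub_cscale[OF presD(1)] ksub_cscale[OF N'(1), of c "y - x"]
        by (subst eq) (auto simp: cscale_diff_right)
    qed
    also have "\<dots> = ?c (c *\<^sub>C x)"
      using that ksub_zero[OF N'(1)] by auto
    finally show ?thesis by simp
  qed
  have "{y \<in> U. y - 0 \<in> N'} = N'" using N' by auto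
  then have "{y \<in> U. y \<in> N'} = N'" by simp
  moreover have "\<zero>\<^bsub>quot_mod M (q ` N')\<^esub> = q ` N'"
    by (simp add: quot_mod_def)
  ultimately have z: "q ` {y \<in> U. y \<in> N'} = \<zero>\<^bsub>quot_mod M (q ` N')\<^esub>"
    by simp
  have coset: "q ` N' +>\<^bsub>M\<^esub> q x = ?c x" if "x \<in> U" for x
    by (rule pres_coset[OF N' that])
  note cl = ksub_zero[OF presD(1)] ksub_add[OF presD(1)] ksub_cscale[OF presD(1)]
  show ?thesis
    unfolding pres_def
    by (auto simp: presD(1) N' carr coset add sm z eq cl)
qed

text \<open>The induced maps of the theorem select the only element in the image of a coset, so they
  can be computed once the map is constant on that coset.\<close>

lemma pres_induced:
  assumes "ksub N'" "N \<subseteq> N'" "N' \<subseteq> U" "x \<in> U"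
    and "\<And>y. y \<in> U \<Longrightarrow> y - x \<in> N' \<Longrightarrow> F (q y) = F (q x)"
  shows "induced F (q ` N' +>\<^bsub>M\<^esub> q x) = F (q x)"
proof -
  have "F ` (q ` N' +>\<^bsub>M\<^esub> q x) = {F (q x)}"
    unfolding pres_coset[OF assms(1-4)]
  proof (intro antisym subsetI)
    have "x \<in> {y \<in> U. y - x \<in> N'}" using assms(4) ksub_zero[OF assms(1)] by simp
    then show "z \<in> F ` q ` {y \<in> U. y - x \<in> N'}" if "z \<in> {F (q x)}" for z
      using that by blast
  qed (use assms(5) in blast)
  then show ?thesis by (simp add: induced_def)
qed

end

section \<open>Homomorphisms between presented modules\<close>

lemma pres_hom:
  assumes P: "pres M U N q" and P': "pres M' U' N' q'"
    and L: "\<And>x. x \<in> U \<Longrightarrow> L x \<in> U'"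
      "\<And>x y. x \<in> U \<Longrightarrow> y \<in> U \<Longrightarrow> L (x + y) - (L x + L y) \<in> N'"
      "\<And>c x. c \<in> k \<Longrightarrow> x \<in> U \<Longrightarrow> L (c *\<^sub>C x) - c *\<^sub>C L x \<in> N'"
    and h: "\<And>x. x \<in> U \<Longrightarrow> h (q x) = q' (L x)"
  shows "h \<in> mod_hom K M M'"
  unfolding mod_hom_def
proof (intro CollectI conjI Pi_I ballI)
  note cl = ksub_zero[OF presD(1)[OF P]] ksub_add[OF presD(1)[OF P]] ksub_cscale[OF presD(1)[OF P]]
    ksub_add[OF presD(1)[OF P']] ksub_cscale[OF presD(1)[OF P']]
  fix m assume "m \<in> carrier M"
  then obtain x where x: "x \<in> U" "m = q x" using pres_surj[OF P] by blast
  show "h m \<in> carrier M'" using x h L(1) presD(9)[OF P'] by simp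
  { fix c assume "c \<in> k"
    then show "h (c \<odot>\<^bsub>M\<^esub> m) = c \<odot>\<^bsub>M'\<^esub> h m"
      using x h L cl presD(7)[OF P', of "L (c *\<^sub>C x)" "c *\<^sub>C L x"]
      by (simp add: presD(6)[OF P, symmetric] presD(6)[OF P', symmetric]) }
  fix m' assume "m' \<in> carrier M"
  then obtain y where y: "y \<in> U" "m' = q y" using pres_surj[OF P] by blast
  show "h (m \<oplus>\<^bsub>M\<^esub> m') = h m \<oplus>\<^bsub>M'\<^esub> h m'"
    using x y h L cl presD(7)[OF P', of "L (x + y)" "L x + L y"]
    by (simp add: presD(5)[OF P, symmetric] presD(5)[OF P', symmetric])
qed

lemma pres_hom_inj:
  assumes P: "pres M U N q" and P': "pres M' U' N' q'"
    and L: "\<And>x. x \<in> U \<Longrightarrow> L x \<in> U'"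
      "\<And>x y. x \<in> U \<Longrightarrow> y \<in> U \<Longrightarrow> L (x + y) = L x + L y"
      "\<And>c x. c \<in> k \<Longrightarrow> x \<in> U \<Longrightarrow> L (c *\<^sub>C x) = c *\<^sub>C L x"
      "\<And>x. x \<in> U \<Longrightarrow> L x \<in> N' \<Longrightarrow> x \<in> N"
    and h: "\<And>x. x \<in> U \<Longrightarrow> h (q x) = q' (L x)"
  shows "inj_on h (carrier M)"
proof (rule inj_onI)
  fix m m' assume m: "m \<in> carrier M" "m' \<in> carrier M" "h m = h m'"
  then obtain x y where xy: "x \<in> U" "m = q x" "y \<in> U" "m' = q y" using pres_surj[OF P] by metis
  have d: "x - y \<in> U" using xy ksub_diff[OF presD(1)[OF P]] by blast
  have "L (x - y) = L x - L y"
    using L(2)[OF d xy(3)] by (simp add: algebra_simps)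
  moreover have "L x - L y \<in> N'"
    using presD(7)[OF P'] m(3) xy h L(1) by metis
  ultimately have "x - y \<in> N" using L(4) d by simp
  then show "m = m'" using presD(7)[OF P] xy by blast
qed

lemma pres_iso:
  assumes P: "pres M U N q" and P': "pres M' U' N' q'"
    and L: "\<And>x. x \<in> U \<Longrightarrow> L x \<in> U'"
      "\<And>x y. x \<in> U \<Longrightarrow> y \<in> U \<Longrightarrow> L (x + y) = L x + L y"
      "\<And>c x. c \<in> k \<Longrightarrow> x \<in> U \<Longrightarrow> L (c *\<^sub>C x) = c *\<^sub>C L x"
      "\<And>x. x \<in> U \<Longrightarrow> L x \<in> N' \<Longrightarrow> x \<in> N"
      "\<And>y. y \<in> U' \<Longrightarrow> \<exists>x\<in>U. L x - y \<in> N'"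
    and h: "\<And>x. x \<in> U \<Longrightarrow> h (q x) = q' (L x)"
  shows "h \<in> mod_iso K M M'"
proof -
  have "h \<in> mod_hom K M M'"
    using ksub_zero[OF presD(2)[OF P']] L h by (intro pres_hom[OF P P', where L = L]) auto
  moreover have "inj_on h (carrier M)"
    by (rule pres_hom_inj[OF P P' L(1-4) h])
  moreover have "h ` carrier M = carrier M'"
  proof -
    have "q' y \<in> h ` carrier M" if "y \<in> U'" for y
    proof -
      obtain x where "x \<in> U" "L x - y \<in> N'" using L(5) \<open>y \<in> U'\<close> by blast
      then have "q' y = h (q x)" using presD(7)[OF P'] L(1) that h by metis
      then show ?thesis using \<open>x \<in> U\<close> presD(9)[OF P] by blast
    qed
    then have "carrier M' \<subseteq> h ` carrier M" unfolding presD(4)[OF P', symmetric] by blast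
    then show ?thesis using \<open>h \<in> mod_hom K M M'\<close> by (auto simp: mod_hom_def)
  qed
  ultimately show ?thesis by (simp add: mod_iso_def bij_betw_def)
qed

lemma pres_dirsum:
  assumes P: "pres M U N q" and P': "pres M' U' N' q'"
  shows "pres (mod_dirsum M M') (U \<times> U') (N \<times> N') (map_prod q q')"
proof -
  have "ksub (Y \<times> Y')" if "ksub Y" "ksub Y'" for Y :: "'u::complex_module set" and Y' :: "'v::complex_module set"
    using that by (auto simp: ksub_def zero_prod_def)
  then show ?thesis
    using presD[OF P] presD[OF P'] unfolding pres_def
    by (auto simp: mod_dirsum_def map_prod_surj_on zero_prod_def)
qed

end

section \<open>The free algebra and the algebra \<open>A\<close>\<close>

abbreviation bas :: "'w \<Rightarrow> 'w \<Rightarrow>\<^sub>0 complex" where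
  "bas w \<equiv> Poly_Mapping.single w 1"

abbreviation wd :: "letter list \<Rightarrow> ncpoly" where
  "wd w \<equiv> bas (Word w)"

definition ext :: "('w \<Rightarrow> 'b::complex_module) \<Rightarrow> ('w \<Rightarrow>\<^sub>0 complex) \<Rightarrow> 'b" where
  "ext g f = (\<Sum>w\<in>Poly_Mapping.keys f. Poly_Mapping.lookup f w *\<^sub>C g w)"

lemma ext_superset:
  assumes "finite A" "Poly_Mapping.keys f \<subseteq> A"
  shows "ext g f = (\<Sum>w\<in>A. Poly_Mapping.lookup f w *\<^sub>C g w)"
  unfolding ext_def using assms
  by (intro sum.mono_neutral_left) (auto simp: in_keys_iff)

lemma clin_ext: "clin (ext g)"
proof (rule clinI)
  fix f h :: "'a \<Rightarrow>\<^sub>0 complex" and c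
  let ?A = "Poly_Mapping.keys f \<union> Poly_Mapping.keys h"
  have "ext g (f + h) = (\<Sum>w\<in>?A. Poly_Mapping.lookup (f + h) w *\<^sub>C g w)"
    by (rule ext_superset) (use keys_add[of f h] in auto)
  also have "\<dots> = ext g f + ext g h"
    by (simp add: ext_superset[of ?A] cscale_add_left sum.distrib)
  finally show "ext g (f + h) = ext g f + ext g h" .
  have "ext g (c *\<^sub>C f) = (\<Sum>w\<in>Poly_Mapping.keys f. Poly_Mapping.lookup (c *\<^sub>C f) w *\<^sub>C g w)"
    by (rule ext_superset) (auto simp: in_keys_iff)
  then show "ext g (c *\<^sub>C f) = c *\<^sub>C ext g f"
    by (simp add: ext_def cscale_sum_right)
qed

lemma ext_bas [simp]: "ext g (bas w) = g w"
  by (simp add: ext_def)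

lemma ext_one: "ext g 1 = g 0"
  using ext_bas[of g 0] by simp

lemma ext_bas_id: "ext bas f = f"
proof (rule poly_mapping_eqI)
  show "Poly_Mapping.lookup (ext bas f) w = Poly_Mapping.lookup f w" for w
    unfolding ext_def lookup_sum
    by (auto simp: lookup_single when_def in_keys_iff if_distrib cong: if_cong)
qed

lemma clin_eqI:
  assumes "clin F" "clin G" "\<And>w. F (bas w) = G (bas w)"
  shows "F f = G f"
proof -
  have "F (ext bas f) = G (ext bas f)"
    unfolding ext_def using assms by (simp add: clin_simps)
  then show ?thesis by (simp add: ext_bas_id)
qed

lemma clin_lookup: "clin (\<lambda>f. Poly_Mapping.lookup f w :: complex)"
  by (rule clinI) simp_all

lemma mult_cscale_left: "(c *\<^sub>C f) * g = c *\<^sub>C (f * (g :: 'w::monoid_add \<Rightarrow>\<^sub>0 complex))"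
  by (simp add: single_0_mult[symmetric] mult.assoc)

lemma clin_mult_left: "clin (\<lambda>f. f * (g :: 'w::monoid_add \<Rightarrow>\<^sub>0 complex))"
  by (rule clinI) (simp_all add: distrib_right mult_cscale_left)

lemma mult_cscale_right: "f * (c *\<^sub>C g) = c *\<^sub>C (f * (g :: 'w::monoid_add \<Rightarrow>\<^sub>0 complex))"
proof -
  have "bas w * (c *\<^sub>C g) = c *\<^sub>C (bas w * g)" for w
  proof -
    have "bas w * (c *\<^sub>C g) = (bas w * Poly_Mapping.single 0 c) * g"
      by (simp add: single_0_mult[symmetric] mult.assoc)
    also have "\<dots> = (Poly_Mapping.single 0 c * bas w) * g"
      by (simp add: mult_single)
    finally show ?thesis by (simp only: single_0_mult mult_cscale_left)
  qed
  then show ?thesis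
    by (rule clin_eqI[OF clin_mult_left clin_scaled[OF clin_mult_left]])
qed

lemma clin_mult_right: "clin (\<lambda>g. f * (g :: 'w::monoid_add \<Rightarrow>\<^sub>0 complex))"
  by (rule clinI) (simp_all add: distrib_left mult_cscale_right)

lemma clin_multL: "clin h \<Longrightarrow> clin (\<lambda>x. h x * (g :: 'w::monoid_add \<Rightarrow>\<^sub>0 complex))"
  by (rule clin_comp[OF clin_mult_left])

lemma clin_multR: "clin h \<Longrightarrow> clin (\<lambda>x. (g :: 'w::monoid_add \<Rightarrow>\<^sub>0 complex) * h x)"
  by (rule clin_comp[OF clin_mult_right])

lemmas clin_intros = clin_id clin_plus clin_minus_fun clin_scaled clin_multL clin_multR

lemma bas_mult: "bas u * bas v = bas (u + v :: 'w::monoid_add)"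
  by (simp add: mult_single)

lemma Word_plus [simp]: "Word u + Word v = Word (u @ v)"
  by (simp add: plus_ncword_def)

lemma Word_Nil: "Word [] = 0"
  by (simp add: zero_ncword_def)

lemma wd_Nil [simp]: "wd [] = 1"
  by (simp add: Word_Nil)

lemma wd_mult: "wd u * wd v = wd (u @ v)"
  by (simp add: bas_mult)

lemma wd_Cons: "wd (l # w) = gen l * wd w"
  by (simp add: gen_def wd_mult)

lemma gen_eq: "gen l = wd [l]"
  by (simp add: gen_def)

lemma wd_inj [simp]: "wd u = wd v \<longleftrightarrow> u = v"
  by (auto dest: arg_cong[of _ _ Poly_Mapping.keys])

lemma clin_wd_eqI:
  assumes "clin F" "clin G" "\<And>w. F (wd w) = G (wd w)"
  shows "F f = G f"
proof (rule clin_eqI[OF assms(1,2)])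
  show "F (bas w) = G (bas w)" for w by (cases w) (simp add: assms(3))
qed

section \<open>Algebra homomorphisms given on letters\<close>

definition alghom :: "(letter \<Rightarrow> 'v::monoid_add \<Rightarrow>\<^sub>0 complex) \<Rightarrow> ncpoly \<Rightarrow> 'v \<Rightarrow>\<^sub>0 complex" where
  "alghom \<phi> = ext (\<lambda>w. prod_list (map \<phi> (letters w)))"

lemma clin_alghom: "clin (alghom \<phi>)"
  unfolding alghom_def by (rule clin_ext)

lemmas lin_alghom = clin_comp[OF clin_alghom]

lemmas alghom_linear = clin_simps[OF clin_alghom]

lemma alghom_wd: "alghom \<phi> (wd w) = prod_list (map \<phi> w)"
  by (simp add: alghom_def)

lemma alghom_gen [simp]: "alghom \<phi> (gen l) = \<phi> l"
  by (simp add: gen_eq alghom_wd)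

lemma alghom_one [simp]: "alghom \<phi> 1 = 1"
  using alghom_wd[of \<phi> "[]"] by simp

lemma alghom_mult: "alghom \<phi> (f * g) = alghom \<phi> f * alghom \<phi> g"
proof -
  have "alghom \<phi> (wd u * g) = alghom \<phi> (wd u) * alghom \<phi> g" for u
    by (rule clin_wd_eqI[where F = "\<lambda>g. alghom \<phi> (wd u * g)" and G = "\<lambda>g. alghom \<phi> (wd u) * alghom \<phi> g"])
      (intro lin_alghom clin_intros | simp add: wd_mult alghom_wd)+
  then show ?thesis
    by (rule clin_wd_eqI[where F = "\<lambda>f. alghom \<phi> (f * g)" and G = "\<lambda>f. alghom \<phi> f * alghom \<phi> g", rotated 2])
      (intro lin_alghom clin_intros)+
qed

lemma alghom_power: "alghom \<phi> (f ^ n) = alghom \<phi> f ^ n"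
  by (induct n) (simp_all add: alghom_mult)

lemma alghom_eqI:
  assumes "clin F" "F 1 = 1" "\<And>l f. F (gen l * f) = \<phi> l * F f"
  shows "F f = alghom \<phi> f"
proof (rule clin_wd_eqI[OF assms(1) clin_alghom])
  show "F (wd w) = alghom \<phi> (wd w)" for w
    by (induct w) (simp_all add: assms(2,3) wd_Cons alghom_mult)
qed

lemma alghom_comp: "alghom \<phi> (alghom \<psi> f) = alghom (\<lambda>l. alghom \<phi> (\<psi> l)) f"
  by (rule alghom_eqI[where F = "\<lambda>f. alghom \<phi> (alghom \<psi> f)"]) (intro lin_alghom clin_intros | simp add: alghom_mult)+

lemma act_free_eq: "act_free g = alghom (act_letter g)"
  by (simp add: fun_eq_iff act_free_def alghom_def ext_def single_0_mult)

lemma act_free_compose: "act_free g (act_free h f) = act_free (g ** h) f"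
proof -
  have "(\<lambda>l. alghom (act_letter g) (act_letter h l)) = act_letter (g ** h)"
  proof
    show "alghom (act_letter g) (act_letter h l) = act_letter (g ** h) l" for l
      by (cases l) (simp_all add: single_0_mult alghom_linear matrix_matrix_mult_def UNIV_2
          cscale_add_right cscale_add_left algebra_simps)
  qed
  then show ?thesis by (simp add: act_free_eq alghom_comp)
qed

lemma act_free_1 [simp]: "act_free (mat 1) f = f"
proof -
  have "act_letter (mat 1) = gen"
  proof
    show "act_letter (mat 1) l = gen l" for l
      by (cases l) (simp_all add: mat_def single_0_mult)
  qed
  then show ?thesis
    unfolding act_free_eq using alghom_eqI[of "\<lambda>f. f" gen f] by simp
qed

definition relA :: ncpoly where "relA = gx * gy - gy * gx + gr"

text \<open>A retraction of the free algebra onto the subalgebra generated by x and y. Its kernel is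
  the ideal of the relation (\<open>rel_ideal_eq\<close>), so equality in A becomes equality of
  normal forms.\<close>

definition expA :: "ncpoly \<Rightarrow> ncpoly" where
  "expA = alghom (\<lambda>l. if l = Lr then gy * gx - gx * gy else gen l)"

text \<open>The passage to \<open>A/(r')\<close>, which is the commutative polynomial ring because
  r' is the commutator of the generators.\<close>

definition abl :: "ncpoly \<Rightarrow> cpoly" where
  "abl = alghom (\<lambda>l. case l of Lx \<Rightarrow> xy_monom 1 0 | Ly \<Rightarrow> xy_monom 0 1 | Lr \<Rightarrow> 0)"

lemma clin_expA: "clin expA" and clin_abl: "clin abl" and clin_act: "clin (act_free g)"
  by (simp_all add: expA_def abl_def act_free_eq clin_alghom)

lemmas expA_linear = clin_simps[OF clin_expA]
lemmas abl_linear = clin_simps[OF clin_abl]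
lemmas act_linear = clin_simps[OF clin_act]

lemma expA_mult: "expA (f * g) = expA f * expA g"
  and abl_mult: "abl (f * g) = abl f * abl g"
  and act_mult: "act_free h (f * g) = act_free h f * act_free h g"
  by (simp_all add: expA_def abl_def act_free_eq alghom_mult)

lemma expA_power: "expA (f ^ n) = expA f ^ n"
  and abl_power: "abl (f ^ n) = abl f ^ n"
  and act_power: "act_free h (f ^ n) = act_free h f ^ n"
  by (simp_all add: expA_def abl_def act_free_eq alghom_power)

lemma expA_gen [simp]: "expA gx = gx" "expA gy = gy" "expA gr = gy * gx - gx * gy" "expA 1 = 1"
  and abl_gen [simp]: "abl gx = xy_monom 1 0" "abl gy = xy_monom 0 1" "abl gr = 0" "abl 1 = 1"
  and act_gr [simp]: "act_free g gr = gr" "act_free g 1 = 1"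
  by (simp_all add: expA_def abl_def act_free_eq)

lemma expA_relA [simp]: "expA relA = 0"
  by (simp add: relA_def expA_linear expA_mult)

lemma expA_idem [simp]: "expA (expA f) = expA f"
proof -
  have "(\<lambda>l. expA (if l = Lr then gy * gx - gx * gy else gen l)) = (\<lambda>l. if l = Lr then gy * gx - gx * gy else gen l)"
  proof
    show "expA (if l = Lr then gy * gx - gx * gy else gen l) = (if l = Lr then gy * gx - gx * gy else gen l)" for l
      by (cases l) (simp_all add: expA_linear expA_mult)
  qed
  then show ?thesis unfolding expA_def alghom_comp by simp
qed

lemma abl_expA [simp]: "abl (expA f) = abl f"
proof -
  have "(\<lambda>l. abl (if l = Lr then gy * gx - gx * gy else gen l)) = (\<lambda>l. abl (gen l))"
  proof
    show "abl (if l = Lr then gy * gx - gx * gy else gen l) = abl (gen l)" for l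
      by (cases l) (simp_all add: abl_linear abl_mult mult.commute)
  qed
  moreover have "(\<lambda>l. abl (gen l)) = (\<lambda>l. case l of Lx \<Rightarrow> xy_monom 1 0 | Ly \<Rightarrow> xy_monom 0 1 | Lr \<Rightarrow> 0)"
    by (simp add: abl_def)
  ultimately show ?thesis unfolding expA_def by (simp add: abl_def alghom_comp)
qed

text \<open>A linear substitution multiplies yx - xy by its determinant. Determinant 1 is what makes
  the action compatible with a fixed r'.\<close>

lemma expA_act_commute:
  assumes "det g = 1"
  shows "expA (act_free g f) = act_free g (expA f)"
proof -
  have d: "g $ 1 $ 1 * g $ 2 $ 2 = 1 + g $ 1 $ 2 * g $ 2 $ 1" using assms by (simp add: det_2 algebra_simps)
  have r: "act_free g (gy * gx - gx * gy) = gy * gx - gx * gy"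
  proof -
    have "act_free g (gy * gx - gx * gy) =
      (g $ 1 $ 1 * g $ 2 $ 2 - g $ 1 $ 2 * g $ 2 $ 1) *\<^sub>C (gy * gx - gx * gy)"
      by (simp add: act_free_eq alghom_linear alghom_mult single_0_mult distrib_left distrib_right
          mult_cscale_left mult_cscale_right cscale_diff_left cscale_diff_right cscale_add_right mult.commute)
    then show ?thesis by (simp add: d)
  qed
  have "expA (act_letter g l) = act_free g (if l = Lr then gy * gx - gx * gy else gen l)" for l
    by (cases l) (simp_all add: r[unfolded act_free_eq] single_0_mult expA_linear act_free_eq)
  then show ?thesis
    unfolding expA_def act_free_eq alghom_comp by (simp add: expA_def act_free_eq)
qed

lemma xy_monom_mult: "xy_monom a b * xy_monom c d = xy_monom (a + c) (b + d)"
  by (simp add: xy_monom_def mult_single)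

lemma xy_monom_0 [simp]: "xy_monom 0 0 = 1"
  by (simp add: xy_monom_def flip: zero_prod_def)

lemma act_poly_eq: "act_poly g = ext (\<lambda>m. (g $ 1 $ 1 *\<^sub>C xy_monom 1 0 + g $ 2 $ 1 *\<^sub>C xy_monom 0 1) ^ fst m *
       (g $ 1 $ 2 *\<^sub>C xy_monom 1 0 + g $ 2 $ 2 *\<^sub>C xy_monom 0 1) ^ snd m)"
  by (simp add: fun_eq_iff act_poly_def ext_def single_0_mult mult.assoc mult_cscale_left)

lemma clin_act_poly: "clin (act_poly g)"
  unfolding act_poly_eq by (rule clin_ext)

lemma act_poly_mult: "act_poly g (f * h) = act_poly g f * act_poly g h"
proof -
  have "act_poly g (bas u * h) = act_poly g (bas u) * act_poly g h" for u
    by (rule clin_eqI[where F = "\<lambda>h. act_poly g (bas u * h)" and G = "\<lambda>h. act_poly g (bas u) * act_poly g h"])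
      (intro clin_comp[OF clin_act_poly] clin_intros | simp add: bas_mult act_poly_eq power_add algebra_simps)+
  then show ?thesis
    by (rule clin_eqI[where F = "\<lambda>f. act_poly g (f * h)" and G = "\<lambda>f. act_poly g f * act_poly g h", rotated 2])
      (intro clin_comp[OF clin_act_poly] clin_intros)+
qed

lemma abl_act: "abl (act_free g f) = act_poly g (abl f)"
proof -
  have "abl (act_free g f) = alghom (\<lambda>l. abl (act_letter g l)) f"
    by (simp add: act_free_eq abl_def alghom_comp)
  moreover have "act_poly g (abl f) = alghom (\<lambda>l. abl (act_letter g l)) f"
  proof (rule alghom_eqI[where F = "\<lambda>f. act_poly g (abl f)"])
    have "act_poly g (abl (gen l)) = abl (act_letter g l)" for l
      by (cases l) (simp_all add: single_0_mult abl_linear clin_zero[OF clin_ext] act_poly_eq xy_monom_def)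
    then show "act_poly g (abl (gen l * h)) = abl (act_letter g l) * act_poly g (abl h)" for l h
      by (simp add: abl_mult act_poly_mult)
    show "act_poly g (abl 1) = 1"
      by (simp add: act_poly_eq ext_one)
    show "clin (\<lambda>f. act_poly g (abl f))" by (rule clin_comp[OF clin_act_poly clin_abl])
  qed
  ultimately show ?thesis by simp
qed

section \<open>Integrality over K, and the ring structure of A\<close>

context coeff_ring
begin

abbreviation F where "F \<equiv> carrier (free_alg K)"
abbreviation PK where "PK \<equiv> carrier (poly_alg K)"

lemma ksub_monoid_alg: "ksub (carrier (monoid_alg K))"
  by (auto simp: ksub_def monoid_alg_def)

lemma bas_in [simp]: "bas w \<in> carrier (monoid_alg K)"
  by (auto simp: monoid_alg_def lookup_single when_def)

lemma alg_lin_in: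
  assumes "f \<in> carrier (monoid_alg K)" "clin G" "ksub N" "\<And>w. G (bas w) \<in> N"
  shows "G f \<in> N"
proof -
  have "G (ext bas f) \<in> N"
    unfolding ext_def using assms
    by (auto simp: clin_simps monoid_alg_def intro!: ksub_sum ksub_cscale)
  then show ?thesis by (simp add: ext_bas_id)
qed

lemma F_lin_in:
  assumes "f \<in> F" "clin G" "ksub N" "\<And>w. G (wd w) \<in> N"
  shows "G f \<in> N"
proof (rule alg_lin_in[OF assms(1-3)])
  show "G (bas w) \<in> N" for w by (cases w) (simp add: assms(4))
qed

lemma monoid_alg_mult:
  assumes "f \<in> carrier (monoid_alg K)" "g \<in> carrier (monoid_alg K)"
  shows "f * g \<in> carrier (monoid_alg K)"
proof -
  have "bas u * g \<in> carrier (monoid_alg K)" for u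
    by (rule alg_lin_in[OF assms(2) clin_mult_right ksub_monoid_alg]) (simp add: bas_mult)
  then show ?thesis
    by (rule alg_lin_in[OF assms(1) clin_mult_left ksub_monoid_alg])
qed

lemma one_in [simp]: "1 \<in> carrier (monoid_alg K)"
  using bas_in[of 0] by simp

lemma single_0_in: "c \<in> k \<Longrightarrow> Poly_Mapping.single w c \<in> carrier (monoid_alg K)"
  by (auto simp: monoid_alg_def lookup_single when_def)

lemma monoid_alg_power: "f \<in> carrier (monoid_alg K) \<Longrightarrow> f ^ n \<in> carrier (monoid_alg K)"
  by (induct n) (simp_all add: monoid_alg_mult)

lemma monoid_alg_prod_list: "set xs \<subseteq> carrier (monoid_alg K) \<Longrightarrow> prod_list xs \<in> carrier (monoid_alg K)"
  by (induct xs) (simp_all add: monoid_alg_mult)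

lemmas alg_in = monoid_alg_mult ksub_add[OF ksub_monoid_alg] ksub_diff[OF ksub_monoid_alg]
  ksub_cscale[OF ksub_monoid_alg] ksub_minus[OF ksub_monoid_alg] ksub_zero[OF ksub_monoid_alg]
  ksub_sum[OF ksub_monoid_alg] monoid_alg_power

lemma gen_in [simp]: "gen l \<in> F"
  by (simp add: gen_eq)

lemma xy_monom_in [simp]: "xy_monom a b \<in> PK"
  by (simp add: xy_monom_def)

lemma alghom_in:
  assumes "\<And>l. \<phi> l \<in> carrier (monoid_alg K)" "f \<in> F"
  shows "alghom \<phi> f \<in> carrier (monoid_alg K)"
  by (rule F_lin_in[OF assms(2) clin_alghom ksub_monoid_alg])
    (auto simp: alghom_wd assms intro!: monoid_alg_prod_list)

lemma relA_in [simp]: "relA \<in> F"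
  by (simp add: relA_def alg_in)

lemma expA_in: "f \<in> F \<Longrightarrow> expA f \<in> F"
  unfolding expA_def by (rule alghom_in) (auto simp: alg_in)

lemma abl_in: "f \<in> F \<Longrightarrow> abl f \<in> PK"
  unfolding abl_def by (rule alghom_in) (auto simp: alg_in split: letter.split)

lemma act_in: "(\<And>i j. g $ i $ j \<in> k) \<Longrightarrow> f \<in> F \<Longrightarrow> act_free g f \<in> F"
  unfolding act_free_eq
proof (rule alghom_in)
  show "act_letter g l \<in> F" if "\<And>i j. g $ i $ j \<in> k" for l
    using that by (cases l) (auto simp: single_0_mult alg_in)
qed

lemma pres_alg: "pres (monoid_alg K) (carrier (monoid_alg K)) {0} (\<lambda>f. f)"
  by (auto simp: pres_def ksub_monoid_alg ksub_singleton_0 single_0_mult alg_in)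
    (simp_all add: monoid_alg_def single_0_mult)

lemma alg_ops [simp]: "mult (monoid_alg K) = (*)" "one (monoid_alg K) = 1"
  "add (monoid_alg K) = (+)" "ring.zero (monoid_alg K) = 0" "smult (monoid_alg K) = (\<lambda>c f. c *\<^sub>C f)"
  by (simp_all add: monoid_alg_def single_0_mult fun_eq_iff)

lemma ring_monoid_alg: "ring (monoid_alg K :: (complex, 'w::monoid_add \<Rightarrow>\<^sub>0 complex) module)"
proof (rule ringI)
  show "abelian_group (monoid_alg K :: (complex, 'w \<Rightarrow>\<^sub>0 complex) module)"
  proof -
    have "Module.module K (monoid_alg K :: (complex, 'w \<Rightarrow>\<^sub>0 complex) module)"
      by (rule pres_module[OF pres_alg])
    then show ?thesis by (simp add: Module.module_def)
  qed
  show "monoid (monoid_alg K :: (complex, 'w \<Rightarrow>\<^sub>0 complex) module)"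
    by (rule monoidI) (auto simp: alg_in mult.assoc)
qed (auto simp: algebra_simps)

lemma ksub_ideal:
  assumes "ideal I (monoid_alg K)" shows "ksub I"
proof (rule ksubI)
  interpret I: ideal I "monoid_alg K" by fact
  show "0 \<in> I" using additive_subgroup.zero_closed[OF ideal.axioms(1)[OF assms]] by simp
  show "x + y \<in> I" if "x \<in> I" "y \<in> I" for x y using additive_subgroup.a_closed[OF ideal.axioms(1)[OF assms] that] by simp
  show "c *\<^sub>C x \<in> I" if "c \<in> k" "x \<in> I" for c x
    using I.I_l_closed[OF that(2) single_0_in[OF that(1), of 0]] by (simp add: single_0_mult)
qed

definition relspan :: "ncpoly set" where
  "relspan = kspan {u * relA * v | u v. u \<in> F \<and> v \<in> F}"

lemma relspan_mult: "f \<in> relspan \<Longrightarrow> g \<in> F \<Longrightarrow> f * g \<in> relspan"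
  "f \<in> relspan \<Longrightarrow> g \<in> F \<Longrightarrow> g * f \<in> relspan"
  unfolding relspan_def
   apply (rule kspan_lin_in[OF clin_mult_left ksub_kspan], auto)
   apply (rule kspan_base)
   apply (metis (mono_tags, lifting) alg_in(1) mem_Collect_eq mult.assoc)
  apply (rule kspan_lin_in[OF clin_mult_right ksub_kspan], auto)
  apply (rule kspan_base)
  apply (metis (mono_tags, lifting) alg_in(1) mem_Collect_eq mult.assoc)
  done

lemma sub_expA_relspan: assumes "f \<in> F" shows "f - expA f \<in> relspan"
proof (rule F_lin_in[OF assms, of "\<lambda>f. f - expA f"])
  show "wd w - expA (wd w) \<in> relspan" for w
  proof (induct w)
    case Nil then show ?case by (simp add: relspan_def)
  next
    case (Cons l w)
    have "gen l - expA (gen l) \<in> relspan"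
    proof (cases "l = Lr")
      case True
      have "1 * relA * 1 \<in> relspan" unfolding relspan_def by (rule kspan_base) (use one_in in blast)
      then show ?thesis using True by (simp add: relA_def algebra_simps)
    next
      case False then have "expA (gen l) = gen l" by (cases l) auto
      then show ?thesis by (simp add: relspan_def)
    qed
    then have "gen l * (wd w - expA (wd w)) + (gen l - expA (gen l)) * expA (wd w) \<in> relspan"
      using Cons relspan_mult expA_in by (auto simp: relspan_def intro!: ksub_add[OF ksub_kspan])
    then show ?case by (simp add: wd_Cons expA_mult algebra_simps)
  qed
qed (auto simp: relspan_def ksub_kspan intro!: clin_intros clin_expA)

text \<open>The kernel of the substitution is an ideal containing the relation. Conversely,
  replacing the letters r' one at a time changes an element only by multiples of the
  relation.\<close>

lemma rel_ideal_eq: "rel_ideal K = {f \<in> F. expA f = 0}"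
proof
  let ?I = "{f \<in> F. expA f = 0}"
  have ks: "ksub ?I" by (rule ksub_Collect_ker[OF ksub_monoid_alg clin_expA])
  interpret M: Module.module K "free_alg K" by (rule pres_module[OF pres_alg])
  have "ideal ?I (free_alg K)"
  proof (rule idealI[OF ring_monoid_alg])
    have "submodule ((\<lambda>f. f) ` ?I) K (free_alg K)"
      by (rule pres_submodule[OF pres_alg ks]) auto
    then show "subgroup ?I (add_monoid (free_alg K))" by (simp add: submodule_def)
  qed (auto simp: alg_in expA_mult)
  then show "rel_ideal K \<subseteq> ?I"
    unfolding rel_ideal_def genideal_def by (auto simp: relA_def[symmetric])
  show "?I \<subseteq> rel_ideal K"
    unfolding rel_ideal_def genideal_def
  proof safe
    fix f I assume f: "f \<in> F" "expA f = 0" and I: "ideal I (free_alg K)" "{gx * gy - gy * gx + gr} \<subseteq> I"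
    interpret I: ideal I "free_alg K" by fact
    have "relspan \<subseteq> I"
      unfolding relspan_def
    proof (rule kspan_minimal[OF _ ksub_ideal[OF I(1)]], safe)
      fix u v assume "u \<in> F" "v \<in> F"
      then show "u * relA * v \<in> I"
        using I.I_l_closed[of relA u] I.I_r_closed[of "u * relA" v] I(2) by (simp add: relA_def)
    qed
    then show "f \<in> I" using sub_expA_relspan[OF f(1)] f(2) by auto
  qed
qed

lemma pres_algA: "pres (algA K) F {f \<in> F. expA f = 0} (clsA K)"
proof -
  have "pres (quot_mod (free_alg K) ((\<lambda>f. f) ` {f \<in> F. expA f = 0})) F {f \<in> F. expA f = 0}
     (\<lambda>x. (\<lambda>f. f) ` {f \<in> F. expA f = 0} +>\<^bsub>free_alg K\<^esub> x)"
    by (rule pres_quot[OF pres_alg ksub_Collect_ker[OF ksub_monoid_alg clin_expA]])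
      (auto simp: alg_in expA_linear)
  then show ?thesis
    by (simp add: algA_def rel_ideal_eq clsA_def[abs_def])
qed

lemma clsA_eq: "f \<in> F \<Longrightarrow> g \<in> F \<Longrightarrow> clsA K f = clsA K g \<longleftrightarrow> expA f = expA g"
  using presD(7)[OF pres_algA, of f g] by (auto simp: alg_in expA_linear)

lemma clsA_in [simp]: "f \<in> F \<Longrightarrow> clsA K f \<in> carrier (algA K)"
  by (rule presD(9)[OF pres_algA])

lemma clsA_set: assumes "f \<in> F" shows "clsA K f = {g \<in> F. expA g = expA f}"
proof -
  have "(\<lambda>f. f) ` {f \<in> F. expA f = 0} +>\<^bsub>free_alg K\<^esub> f = (\<lambda>f. f) ` {g \<in> F. g - f \<in> {f \<in> F. expA f = 0}}"
    by (rule pres_coset[OF pres_alg ksub_Collect_ker[OF ksub_monoid_alg clin_expA] _ _ assms])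
      (auto simp: expA_linear ksub_zero[OF ksub_monoid_alg])
  then have "clsA K f = {g \<in> F. g - f \<in> {f \<in> F. expA f = 0}}"
    unfolding clsA_def rel_ideal_eq image_ident .
  also have "\<dots> = {g \<in> F. expA g = expA f}"
    using ksub_diff[OF ksub_monoid_alg _ assms] by (auto simp only: mem_Collect_eq expA_linear right_minus_eq)
  finally show ?thesis .
qed

lemma clsA_mult:
  assumes "f \<in> F" "g \<in> F" shows "clsA K f \<otimes>\<^bsub>algA K\<^esub> clsA K g = clsA K (f * g)"
proof -
  have "ideal (rel_ideal K) (free_alg K)"
    unfolding rel_ideal_def by (rule ring.genideal_ideal[OF ring_monoid_alg]) (auto simp: alg_in)
  from ideal.rcoset_mult_add[OF this, of f g] assms show ?thesis
    by (simp add: algA_def clsA_def quot_mod_def)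
qed

lemma algA_one: "\<one>\<^bsub>algA K\<^esub> = clsA K 1"
  by (simp add: algA_def quot_mod_def clsA_def)

lemma algA_E: assumes "a \<in> carrier (algA K)" obtains f where "f \<in> F" "a = clsA K f"
  using pres_surj[OF pres_algA assms] by blast

lemma ring_algA: "ring (algA K)"
proof (rule ringI)
  show "abelian_group (algA K)"
    using pres_module[OF pres_algA] by (simp add: Module.module_def)
  show "monoid (algA K)"
  proof (rule monoidI)
    fix a b c assume "a \<in> carrier (algA K)" "b \<in> carrier (algA K)" "c \<in> carrier (algA K)"
    then show "a \<otimes>\<^bsub>algA K\<^esub> b \<otimes>\<^bsub>algA K\<^esub> c = a \<otimes>\<^bsub>algA K\<^esub> (b \<otimes>\<^bsub>algA K\<^esub> c)"
      by (elim algA_E) (simp add: clsA_mult alg_in mult.assoc)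
  next
    fix a b assume "a \<in> carrier (algA K)" "b \<in> carrier (algA K)"
    then show "a \<otimes>\<^bsub>algA K\<^esub> b \<in> carrier (algA K)"
      by (elim algA_E) (simp add: clsA_mult alg_in)
  next
    fix a assume "a \<in> carrier (algA K)"
    then show "\<one>\<^bsub>algA K\<^esub> \<otimes>\<^bsub>algA K\<^esub> a = a" "a \<otimes>\<^bsub>algA K\<^esub> \<one>\<^bsub>algA K\<^esub> = a"
      by (elim algA_E, simp add: clsA_mult algA_one)+
  qed (simp add: algA_one)
next
  fix a b c assume "a \<in> carrier (algA K)" "b \<in> carrier (algA K)" "c \<in> carrier (algA K)"
  then show "(a \<oplus>\<^bsub>algA K\<^esub> b) \<otimes>\<^bsub>algA K\<^esub> c = a \<otimes>\<^bsub>algA K\<^esub> c \<oplus>\<^bsub>algA K\<^esub> b \<otimes>\<^bsub>algA K\<^esub> c"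
    "c \<otimes>\<^bsub>algA K\<^esub> (a \<oplus>\<^bsub>algA K\<^esub> b) = c \<otimes>\<^bsub>algA K\<^esub> a \<oplus>\<^bsub>algA K\<^esub> c \<otimes>\<^bsub>algA K\<^esub> b"
    by (elim algA_E, simp add: clsA_mult alg_in distrib_left distrib_right flip: presD(5)[OF pres_algA])+
qed

text \<open>\<open>actA\<close> takes the image of a set, so it fills out a whole coset only because
  the inverse matrix \<open>h\<close> also acts over K and respects the relation.\<close>

lemma actA_cls:
  assumes "\<And>i j. g $ i $ j \<in> k" "\<And>i j. h $ i $ j \<in> k" "det g = 1" "det h = 1" "g ** h = mat 1" "f \<in> F"
  shows "actA g (clsA K f) = clsA K (act_free g f)"
proof -
  have gh: "act_free g (act_free h f) = f" for f by (simp add: act_free_compose assms(5))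
  have "act_free g ` {f' \<in> F. expA f' = expA f} = {f' \<in> F. expA f' = expA (act_free g f)}"
  proof safe
    fix f' assume *: "f' \<in> F" "expA f' = expA f"
    then show "act_free g f' \<in> F" using act_in assms(1) by blast
    show "expA (act_free g f') = expA (act_free g f)"
      using * by (simp add: expA_act_commute assms(3))
  next
    fix f' assume *: "f' \<in> F" "expA f' = expA (act_free g f)"
    have "h ** g = mat 1" using assms(5) matrix_left_right_inverse by blast
    then have "act_free h (act_free g f) = f" by (simp add: act_free_compose)
    then have "expA (act_free h f') = expA f"
      by (metis "*"(2) expA_act_commute assms(4))
    then show "f' \<in> act_free g ` {f' \<in> F. expA f' = expA f}"
      using act_in[of h f'] assms(2) *(1) by (intro image_eqI[of _ _ "act_free h f'"]) (simp_all add: gh)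
  qed
  then show ?thesis using assms act_in by (simp add: actA_def clsA_set)
qed

end

section \<open>The Weyl algebra to first order, and the module \<open>V\<close>\<close>

abbreviation nx :: "letter list \<Rightarrow> nat" where "nx w \<equiv> count_list w Lx"
abbreviation ny :: "letter list \<Rightarrow> nat" where "ny w \<equiv> count_list w Ly"
abbreviation nr :: "letter list \<Rightarrow> nat" where "nr w \<equiv> count_list w Lr"

text \<open>The number of inversions of a word, that is, of swaps of an adjacent yx on the way to
  the order \<open>x^a y^b\<close>. Each swap contributes one \<epsilon>.\<close>

fun yx_pairs :: "letter list \<Rightarrow> nat" where
  "yx_pairs [] = 0"
| "yx_pairs (l # w) = (if l = Ly then nx w else 0) + yx_pairs w"

lemma yx_pairs_append: "yx_pairs (u @ v) = yx_pairs u + yx_pairs v + ny u * nx v"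
  by (induct u) (auto simp: algebra_simps)

text \<open>
  The \<open>\<epsilon>\<close>-component of the homomorphism from \<open>A\<close> to the Weyl algebra \<open>yx - xy = \<epsilon>\<close> with \<open>\<epsilon>\<close> central
  and \<open>\<epsilon>\<^sup>2 = 0\<close>, in the normally ordered basis \<open>x\<^sup>ay\<^sup>b\<close>.
\<close>

definition weyl_word :: "letter list \<Rightarrow> cpoly" where
  "weyl_word w = (if nr w = 0 then of_nat (yx_pairs w) *\<^sub>C xy_monom (nx w - 1) (ny w - 1)
     else if nr w = 1 then xy_monom (nx w) (ny w) else 0)"

definition weyl :: "ncpoly \<Rightarrow> cpoly" where
  "weyl = ext (\<lambda>w. weyl_word (letters w))"

lemma clin_weyl: "clin weyl"
  unfolding weyl_def by (rule clin_ext)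

lemmas weyl_linear = clin_simps[OF clin_weyl]
lemmas lin_weyl = clin_comp[OF clin_weyl]
lemmas lin_abl = clin_comp[OF clin_abl]
lemmas lin_expA = clin_comp[OF clin_expA]
lemmas lin_act = clin_comp[OF clin_act]

lemma weyl_wd: "weyl (wd w) = weyl_word w"
  by (simp add: weyl_def)

lemma abl_wd: "abl (wd w) = (if nr w = 0 then xy_monom (nx w) (ny w) else 0)"
proof (induct w)
  case (Cons l w)
  then show ?case by (cases l) (auto simp: wd_Cons abl_mult xy_monom_mult)
qed simp

lemma clin_wd_eqI2:
  fixes G H :: "ncpoly \<Rightarrow> ncpoly \<Rightarrow> 'b::complex_module"
  assumes "\<And>g. clin (\<lambda>f. G f g)" "\<And>f. clin (G f)" "\<And>g. clin (\<lambda>f. H f g)" "\<And>f. clin (H f)"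
    and "\<And>u v. G (wd u) (wd v) = H (wd u) (wd v)"
  shows "G f g = H f g"
proof -
  have "G (wd u) g = H (wd u) g" for u
    by (rule clin_wd_eqI[OF assms(2,4)]) (rule assms(5))
  then show ?thesis by (rule clin_wd_eqI[OF assms(1,3)])
qed

text \<open>An r' already uses up the one available \<epsilon>, so the rest of the word counts only
  through its commutative image.\<close>

lemma weyl_mid_r: "weyl (u * gr * v) = abl (u * v)"
proof (rule clin_wd_eqI2[where G = "\<lambda>u v. weyl (u * gr * v)" and H = "\<lambda>u v. abl (u * v)"])
  show "weyl (wd u * gr * wd v) = abl (wd u * wd v)" for u v
    by (auto simp: gen_eq wd_mult weyl_wd abl_wd weyl_word_def)
qed (intro lin_weyl lin_abl clin_intros)+

text \<open>Well-definedness on A: turning an adjacent xy into yx adds one inversion, which the r'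
  of the relation compensates. The truncated exponents in \<open>weyl_word\<close> do no harm, since
  a word lacking x or y has no inversions.\<close>

lemma weyl_relA: "weyl (u * relA * v) = 0"
proof (rule clin_wd_eqI2[where G = "\<lambda>u v. weyl (u * relA * v)" and H = "\<lambda>u v. 0"])
  show "weyl (wd u * relA * wd v) = 0" for u v
  proof -
    have "weyl (wd u * relA * wd v) =
        weyl_word (u @ [Lx, Ly] @ v) - weyl_word (u @ [Ly, Lx] @ v) + weyl_word (u @ [Lr] @ v)"
      by (simp add: relA_def distrib_left distrib_right left_diff_distrib right_diff_distrib weyl_linear
          gen_eq wd_mult weyl_wd)
    also have "\<dots> = 0"
      by (auto simp: weyl_word_def yx_pairs_append algebra_simps cscale_add_left)
    finally show ?thesis .
  qed
qed (intro lin_weyl clin_intros | simp add: clin_def)+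

lemma weyl_r: "weyl (gr * f) = abl f"
  using weyl_mid_r[of 1 f] by simp

definition xword :: "nat \<Rightarrow> nat \<Rightarrow> letter list" where
  "xword a b = replicate a Lx @ replicate b Ly"

lemma wd_power: "wd u ^ n = wd (concat (replicate n u))"
  by (induct n) (simp_all add: wd_mult)

lemma count_concat_replicate: "count_list (concat (replicate n u)) l = n * count_list u l"
  by (induct n) simp_all

lemma count_replicate: "count_list (replicate n l) l' = (if l = l' then n else 0)"
  by (cases "l = l'"; induct n) simp_all

lemma zmon_wd: obtains w where "zmon a b = wd w" "nr w = 0" "nx w = a" "ny w = b"
proof (cases "b \<le> a")
  case True
  let ?w = "concat (replicate b [Lx, Ly]) @ concat (replicate (a - b) [Lx])"
  have "zmon a b = wd ?w" using True by (simp add: zmon_def gen_eq wd_mult wd_power)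
  then show ?thesis using True that[of ?w] by (simp add: count_concat_replicate count_replicate)
next
  case False
  let ?w = "concat (replicate a [Ly, Lx]) @ concat (replicate (b - a) [Ly])"
  have "zmon a b = wd ?w" using False by (simp add: zmon_def gen_eq wd_mult wd_power)
  then show ?thesis using False that[of ?w] by (simp add: count_concat_replicate count_replicate)
qed

lemma abl_zmon [simp]: "abl (zmon a b) = xy_monom a b"
  by (rule zmon_wd[of a b]) (simp add: abl_wd)

lemma z_lift_eq: "z_lift = ext (\<lambda>m. zmon (fst m) (snd m))"
  by (simp add: fun_eq_iff z_lift_def ext_def single_0_mult)

lemma clin_z_lift: "clin z_lift"
  unfolding z_lift_eq by (rule clin_ext)

lemma z_lift_xy_monom [simp]: "z_lift (xy_monom a b) = zmon a b"
  by (simp add: z_lift_eq xy_monom_def)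

lemma abl_z_lift [simp]: "abl (z_lift p) = p"
  by (rule clin_eqI[OF lin_abl[OF clin_z_lift] clin_id])
    (simp add: z_lift_eq, simp add: xy_monom_def)

context coeff_ring
begin

lemma kspan_Un_ksub: "ksub N \<Longrightarrow> kspan (S \<union> N) = {x + y | x y. x \<in> kspan S \<and> y \<in> N}"
proof
  assume N: "ksub N"
  show "kspan (S \<union> N) \<subseteq> {x + y | x y. x \<in> kspan S \<and> y \<in> N}"
  proof (rule kspan_minimal[OF _ ksub_set_plus[OF ksub_kspan N]])
    have "x + 0 \<in> {x + y | x y. x \<in> kspan S \<and> y \<in> N}" if "x \<in> S" for x
      using kspan_base[OF that] ksub_zero[OF N] by blast
    moreover have "0 + x \<in> {x + y | x y. x \<in> kspan S \<and> y \<in> N}" if "x \<in> N" for x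
      using kspan.zero that by blast
    ultimately show "S \<union> N \<subseteq> {x + y | x y. x \<in> kspan S \<and> y \<in> N}" by auto
  qed
  show "{x + y | x y. x \<in> kspan S \<and> y \<in> N} \<subseteq> kspan (S \<union> N)"
  proof safe
    fix x y assume "x \<in> kspan S" "y \<in> N"
    then have "x \<in> kspan (S \<union> N)" "y \<in> kspan (S \<union> N)"
      using kspan_mono[of S "S \<union> N"] kspan_base[of y "S \<union> N"] by auto
    then show "x + y \<in> kspan (S \<union> N)" by (rule ksub_add[OF ksub_kspan])
  qed
qed

lemma kspan_Un_ksubE:
  assumes "z \<in> kspan (S \<union> N)" "ksub N" obtains x where "x \<in> kspan S" "z - x \<in> N"
proof -
  obtain x y where "z = x + y" "x \<in> kspan S" "y \<in> N" using assms kspan_Un_ksub by blast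
  then show ?thesis using that[of x] by simp
qed

text \<open>Adding \<open>N\<close> to the generators makes the span the full preimage of the
  submodule, which is the form that \<open>pres_quot\<close> takes.\<close>

lemma pres_span_Un:
  assumes P: "pres M U N q" and S: "S \<subseteq> U" shows "mod_span K M (q ` S) = q ` kspan (S \<union> N)"
proof -
  have sub: "kspan S \<subseteq> U" using kspan_minimal S presD(1)[OF P] by blast
  have "q ` kspan (S \<union> N) \<subseteq> q ` kspan S"
  proof safe
    fix z assume z: "z \<in> kspan (S \<union> N)"
    then obtain x where x: "x \<in> kspan S" "z - x \<in> N" using kspan_Un_ksubE presD(2)[OF P] by blast
    have "z \<in> U" using z kspan_minimal[of "S \<union> N" U] S presD(1,3)[OF P] by auto
    then have "q z = q x" using presD(7)[OF P] x sub by blast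
    then show "q z \<in> q ` kspan S" using x by blast
  qed
  moreover have "kspan S \<subseteq> kspan (S \<union> N)" by (rule kspan_mono) auto
  ultimately show ?thesis using pres_mod_span[OF P S] by blast
qed

section \<open>Sorting words modulo r'\<close>

abbreviation kerA :: "ncpoly set" where "kerA \<equiv> {f \<in> F. expA f = 0}"
abbreviation kerAb :: "ncpoly set" where "kerAb \<equiv> {f \<in> F. abl f = 0}"

lemma ksub_F: "ksub F" by (rule ksub_monoid_alg)

lemma ksub_kerA: "ksub kerA"
  by (rule ksub_Collect_ker[OF ksub_F clin_expA])

lemma ksub_kerAb: "ksub kerAb"
  by (rule ksub_Collect_ker[OF ksub_F clin_abl])

lemma kerA_subset_kerAb: "kerA \<subseteq> kerAb"
  using abl_expA clin_zero[OF clin_abl] by (metis (mono_tags, lifting) Collect_mono)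

lemma sub_expA_kerA: "f \<in> F \<Longrightarrow> f - expA f \<in> kerA"
  by (simp add: expA_linear expA_in ksub_diff[OF ksub_F])

text \<open>The error terms of sorting. A swap trades the two letters xy for one r', so the words on
  both sides of r' together are at least two letters shorter than the word being sorted;
  \<open>word_zrprod\<close> recurses on them.\<close>

definition midr :: "nat \<Rightarrow> ncpoly set" where
  "midr n = kspan ({wd u * gr * wd v | u v. length u + length v + 2 \<le> n} \<union> kerA)"

lemma ksub_midr: "ksub (midr n)"
  by (simp add: midr_def ksub_kspan)

lemma midr_base: "length u + length v + 2 \<le> n \<Longrightarrow> wd u * gr * wd v \<in> midr n"
  unfolding midr_def by (rule kspan_base) blast

lemma kerA_midr: "kerA \<subseteq> midr n"
  unfolding midr_def by (auto intro: kspan_base)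

lemma midr_Cons: assumes "f \<in> midr n" shows "gen l * f \<in> midr (Suc n)"
  using assms unfolding midr_def[of n]
proof (rule kspan_lin_in[OF clin_mult_right ksub_midr, rotated])
  fix f assume "f \<in> {wd u * gr * wd v | u v. length u + length v + 2 \<le> n} \<union> kerA"
  then show "gen l * f \<in> midr (Suc n)"
  proof
    assume "f \<in> {wd u * gr * wd v | u v. length u + length v + 2 \<le> n}"
    then obtain u v where f: "f = wd u * gr * wd v" "length u + length v + 2 \<le> n" by blast
    have "gen l * f = wd (l # u) * gr * wd v" by (simp add: f(1) wd_Cons mult.assoc)
    then show ?thesis using midr_base[of "l # u" v "Suc n"] f(2) by simp
  next
    assume "f \<in> kerA"
    then have "gen l * f \<in> kerA" by (auto simp: expA_mult alg_in)
    then show ?thesis using kerA_midr by blast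
  qed
qed

lemma xy_swap: "wd (Ly # Lx # w) - wd (Lx # Ly # w) \<in> midr (length w + 2)"
proof -
  have "relA * wd w \<in> kerA" by (simp add: expA_mult alg_in)
  then have "gr * wd w - relA * wd w \<in> midr (length w + 2)"
    using midr_base[of "[]" w "length w + 2"] kerA_midr by (intro ksub_diff[OF ksub_midr]) auto
  then show ?thesis by (simp add: relA_def wd_Cons algebra_simps)
qed

lemma y_through_x: "wd (Ly # replicate a Lx @ w) - wd (replicate a Lx @ Ly # w) \<in> midr (a + length w + 1)"
proof (induct a)
  case 0 then show ?case by (simp add: ksub_zero[OF ksub_midr])
next
  case (Suc a)
  have "wd (Ly # Lx # replicate a Lx @ w) - wd (Lx # Ly # replicate a Lx @ w) \<in> midr (Suc a + length w + 1)"
    using xy_swap[of "replicate a Lx @ w"] by simp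
  moreover have "wd (Lx # Ly # replicate a Lx @ w) - wd (Lx # replicate a Lx @ Ly # w) \<in> midr (Suc a + length w + 1)"
    using midr_Cons[OF Suc, of Lx] by (simp add: right_diff_distrib wd_Cons)
  ultimately show ?case using ksub_trans[OF ksub_midr] by fastforce
qed

lemma word_xword: "nr w = 0 \<Longrightarrow> wd w - wd (xword (nx w) (ny w)) \<in> midr (length w)"
proof (induct w)
  case Nil then show ?case by (simp add: xword_def ksub_zero[OF ksub_midr])
next
  case (Cons l w)
  have IH: "wd w - wd (xword (nx w) (ny w)) \<in> midr (length w)" using Cons by (simp split: if_splits)
  have len: "nx w + ny w = length w"
  proof -
    have "nr w = 0" using Cons(2) by (simp split: if_splits)
    then show ?thesis
    proof (induct w)
      case (Cons l w) then show ?case by (cases l) (auto split: if_splits)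
    qed simp
  qed
  have 1: "wd (l # w) - wd (l # xword (nx w) (ny w)) \<in> midr (length (l # w))"
    using midr_Cons[OF IH, of l] by (simp add: right_diff_distrib wd_Cons)
  show ?case
  proof (cases l)
    case Lx then show ?thesis using 1 by (simp add: xword_def)
  next
    case Ly
    then show ?thesis
      using 1 y_through_x[of "nx w" "replicate (ny w) Ly"] len ksub_trans[OF ksub_midr]
      by (simp add: xword_def)
  qed (use Cons(2) in simp)
qed

text \<open>Both the word and the \<open>zmon\<close> with the same letters sort to the same
  \<open>xword\<close>.\<close>

lemma word_zmon: assumes "nr w = 0" shows "wd w - zmon (nx w) (ny w) \<in> midr (length w)"
proof -
  obtain v where v: "zmon (nx w) (ny w) = wd v" "nr v = 0" "nx v = nx w" "ny v = ny w"
    using zmon_wd by blast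
  have "length w = nx w + ny w + nr w" for w
  proof (induct w)
    case (Cons l w) then show ?case by (cases l) auto
  qed simp
  from this[of w] this[of v] have "length v = length w" using assms v by simp
  then show ?thesis
    using word_xword[OF assms] word_xword[OF v(2)] v ksub_trans[OF ksub_midr] ksub_diff_commute[OF ksub_midr]
    by metis
qed

definition ridl :: "ncpoly set" where
  "ridl = kspan ({u * gr * v | u v. u \<in> F \<and> v \<in> F} \<union> kerA)"

lemma midr_ridl: "midr n \<subseteq> ridl"
  unfolding midr_def ridl_def by (rule kspan_mono) (use bas_in in blast)

lemma sub_z_lift_ridl: assumes "f \<in> F" shows "f - z_lift (abl f) \<in> ridl"
proof (rule F_lin_in[OF assms, of "\<lambda>f. f - z_lift (abl f)"])
  show "clin (\<lambda>f. f - z_lift (abl f))"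
    by (intro clin_intros clin_comp[OF clin_z_lift] clin_abl)
  show "ksub ridl" by (simp add: ridl_def ksub_kspan)
  show "wd w - z_lift (abl (wd w)) \<in> ridl" for w
  proof (cases "nr w = 0")
    case True then show ?thesis using word_zmon midr_ridl by (auto simp: abl_wd)
  next
    case False
    then have "Lr \<in> set w" by (metis count_notin)
    then obtain u v where "w = u @ Lr # v" by (meson split_list)
    then have "wd w = wd u * gr * wd v" by (simp add: gen_eq wd_mult)
    then have "wd w \<in> {u * gr * v | u v. u \<in> F \<and> v \<in> F} \<union> kerA" using bas_in by blast
    then have "wd w \<in> ridl" unfolding ridl_def by (rule kspan_base)
    then show ?thesis using False by (simp add: abl_wd clin_zero[OF clin_z_lift])
  qed
qed

text \<open>Sorting shows that an element differs from the lift of its commutative image by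
  multiples of r' and of the relation. If that image vanishes, only these multiples are
  left.\<close>

lemma kerAb_eq: "kerAb = ridl"
proof
  show "kerAb \<subseteq> ridl"
    using sub_z_lift_ridl clin_zero[OF clin_z_lift] by fastforce
  show "ridl \<subseteq> kerAb"
    unfolding ridl_def using kerA_subset_kerAb
    by (intro kspan_minimal ksub_kerAb) (auto simp: abl_mult alg_in)
qed

lemma kerAb_induct:
  assumes "f \<in> kerAb" "clin G" "ksub N" "\<And>u v. u \<in> F \<Longrightarrow> v \<in> F \<Longrightarrow> G (u * gr * v) \<in> N"
    "\<And>f. f \<in> kerA \<Longrightarrow> G f \<in> N"
  shows "G f \<in> N"
  using assms(1) unfolding kerAb_eq ridl_def
  by (rule kspan_lin_in[OF assms(2,3), rotated]) (use assms(4,5) in auto)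

lemma weyl_kerA: assumes "f \<in> kerA" shows "weyl f = 0"
proof -
  have "f \<in> relspan" using sub_expA_relspan[of f] assms by simp
  then have "weyl f \<in> {0}" unfolding relspan_def
    by (rule kspan_lin_in[OF clin_weyl ksub_singleton_0, rotated]) (auto simp: weyl_relA)
  then show ?thesis by simp
qed

lemma weyl_expA: "f \<in> F \<Longrightarrow> weyl (expA f) = weyl f"
  using weyl_kerA[OF sub_expA_kerA] by (simp add: weyl_linear)

lemma kerAb_mult: "a \<in> kerAb \<Longrightarrow> b \<in> F \<Longrightarrow> a * b \<in> kerAb"
  "a \<in> kerAb \<Longrightarrow> b \<in> F \<Longrightarrow> b * a \<in> kerAb"
  by (simp_all add: abl_mult alg_in)

lemma kerA_mult: "a \<in> kerA \<Longrightarrow> b \<in> F \<Longrightarrow> a * b \<in> kerA"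
  "a \<in> kerA \<Longrightarrow> b \<in> F \<Longrightarrow> b * a \<in> kerA"
  by (simp_all add: expA_mult alg_in)

text \<open>Elements of the ideal of r' are divisible by \<epsilon>, and
  \<open>\<epsilon>^2 = 0\<close> leaves only the commutative image of the other factor. As the two
  products agree, \<open>weyl\<close> vanishes on \<open>[Ar'A, A]\<close>.\<close>

lemma weyl_kerAb_mult:
  assumes "a \<in> kerAb" "b \<in> F" shows "weyl (a * b) = weyl a * abl b" "weyl (b * a) = weyl a * abl b"
proof -
  have "weyl (a * b) - weyl a * abl b \<in> {0}"
  proof (rule kerAb_induct[OF assms(1), where G = "\<lambda>a. weyl (a * b) - weyl a * abl b"])
    show "weyl (u * gr * v * b) - weyl (u * gr * v) * abl b \<in> {0}" for u v
      using weyl_mid_r[of u "v * b"] weyl_mid_r[of u v] by (simp add: mult.assoc abl_mult)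
  qed (auto simp: weyl_kerA ksub_singleton_0 weyl_kerA[OF kerA_mult(1)[OF _ assms(2)], simplified]
        intro!: clin_intros lin_weyl clin_weyl)
  then show "weyl (a * b) = weyl a * abl b" by simp
  have "weyl (b * a) - weyl a * abl b \<in> {0}"
  proof (rule kerAb_induct[OF assms(1), where G = "\<lambda>a. weyl (b * a) - weyl a * abl b"])
    show "weyl (b * (u * gr * v)) - weyl (u * gr * v) * abl b \<in> {0}" for u v
      using weyl_mid_r[of "b * u" v] weyl_mid_r[of u v] by (simp add: mult.assoc abl_mult mult.commute mult.left_commute)
  qed (auto simp: weyl_kerA ksub_singleton_0 weyl_kerA[OF kerA_mult(2)[OF _ assms(2)], simplified]
        intro!: clin_intros lin_weyl clin_weyl)
  then show "weyl (b * a) = weyl a * abl b" by simp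
qed

text \<open>The preimage of \<open>[Ar'A, A]\<close> in the free algebra.\<close>

definition relV :: "ncpoly set" where
  "relV = kspan ({a * b - b * a | a b. a \<in> kerAb \<and> b \<in> F} \<union> kerA)"

lemma ksub_relV: "ksub relV" by (simp add: relV_def ksub_kspan)

lemma kerA_relV: "kerA \<subseteq> relV" unfolding relV_def by (auto intro: kspan_base)

lemma comm_relV: "a \<in> kerAb \<Longrightarrow> b \<in> F \<Longrightarrow> a * b - b * a \<in> relV"
  unfolding relV_def by (rule kspan_base) blast

lemma relV_kerAb: "relV \<subseteq> kerAb"
  unfolding relV_def using kerA_subset_kerAb
  by (intro kspan_minimal ksub_kerAb) (auto simp: abl_linear abl_mult alg_in)

lemma relV_F: "relV \<subseteq> F" using relV_kerAb by blast

lemma weyl_relV: assumes "f \<in> relV" shows "weyl f = 0"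
proof -
  have "weyl f \<in> {0}" using assms unfolding relV_def
    by (rule kspan_lin_in[OF clin_weyl ksub_singleton_0, rotated])
      (use weyl_kerAb_mult in \<open>auto simp: weyl_linear weyl_kerA\<close>)
  then show ?thesis by simp
qed

text \<open>Each term u r' v may be rotated to r' v u, since r' v lies in the ideal. With one r' in
  front, questions about the ideal in V become questions about the cofactor.\<close>

lemma kerAb_rep: assumes "f \<in> kerAb" shows "\<exists>h\<in>F. f - gr * h \<in> relV"
proof -
  let ?N = "{f. \<exists>h\<in>F. f - gr * h \<in> relV}"
  have N: "ksub ?N"
  proof (rule ksubI)
    show "0 \<in> ?N" by (auto intro!: bexI[of _ 0] simp: ksub_zero[OF ksub_F] ksub_zero[OF ksub_relV])
  next
    fix x y assume "x \<in> ?N" "y \<in> ?N"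
    then obtain h h' where "h \<in> F" "h' \<in> F" "x - gr * h \<in> relV" "y - gr * h' \<in> relV" by blast
    then have "h + h' \<in> F" "(x + y) - gr * (h + h') \<in> relV"
      using ksub_add[OF ksub_F] ksub_add[OF ksub_relV, of "x - gr * h" "y - gr * h'"] by (auto simp: algebra_simps)
    then show "x + y \<in> ?N" by blast
  next
    fix c x assume "c \<in> k" "x \<in> ?N"
    then obtain h where "h \<in> F" "x - gr * h \<in> relV" by blast
    then have "c *\<^sub>C h \<in> F" "c *\<^sub>C x - gr * (c *\<^sub>C h) \<in> relV"
      using ksub_cscale[OF ksub_F \<open>c \<in> k\<close>] ksub_cscale[OF ksub_relV \<open>c \<in> k\<close>, of "x - gr * h"]
      by (auto simp: cscale_diff_right mult_cscale_right)
    then show "c *\<^sub>C x \<in> ?N" by blast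
  qed
  have "f \<in> ?N"
  proof (rule kerAb_induct[OF assms clin_id N])
    fix u v assume uv: "u \<in> F" "v \<in> F"
    have "gr * v \<in> kerAb" using uv by (simp add: abl_mult alg_in)
    then have "u * (gr * v) - gr * v * u \<in> relV"
      using comm_relV[of "gr * v" u] uv ksub_diff_commute[OF ksub_relV] by blast
    then show "u * gr * v \<in> ?N"
      using uv by (auto simp: mult.assoc alg_in intro!: bexI[of _ "v * u"])
  next
    fix f assume "f \<in> kerA" then show "f \<in> ?N"
      using kerA_relV by (auto intro!: bexI[of _ 0] simp: ksub_zero[OF ksub_F])
  qed
  then show ?thesis by blast
qed

text \<open>Modulo \<open>relV\<close> this is the square of the ideal of r'
  (\<open>V_r2_eq\<close>); the linear term in \<epsilon> separates the first power from the
  second.\<close>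

definition kerAb2 :: "ncpoly set" where
  "kerAb2 = {f \<in> kerAb. weyl f = 0}"

lemma ksub_kerAb2: "ksub kerAb2"
  unfolding kerAb2_def by (rule ksub_Collect_ker[OF ksub_kerAb clin_weyl])

lemma relV_kerAb2: "relV \<subseteq> kerAb2"
  using relV_kerAb weyl_relV by (auto simp: kerAb2_def)

text \<open>The linear term of r' h is the commutative image of h. Where it vanishes, h supplies a
  second factor r'.\<close>

lemma kerAb2_rep: assumes "f \<in> kerAb2" shows "\<exists>h\<in>kerAb. f - gr * h \<in> relV"
proof -
  obtain h where h: "h \<in> F" "f - gr * h \<in> relV" using kerAb_rep assms by (auto simp: kerAb2_def)
  then have "abl h = 0" using weyl_relV[OF h(2)] assms by (simp add: weyl_linear weyl_r kerAb2_def)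
  then show ?thesis using h by blast
qed

section \<open>The module V and the powers of the ideal of r'\<close>

lemma weyl_word_in: "weyl_word w \<in> PK"
  by (auto simp: weyl_word_def ksub_zero[OF ksub_monoid_alg] ksub_cscale[OF ksub_monoid_alg])

lemma weyl_in: "f \<in> F \<Longrightarrow> weyl f \<in> PK"
  by (rule F_lin_in[OF _ clin_weyl ksub_monoid_alg]) (auto simp: weyl_wd weyl_word_in)

lemma zmon_in [simp]: "zmon a b \<in> F"
  by (rule zmon_wd[of a b]) simp

lemma z_lift_in: "p \<in> PK \<Longrightarrow> z_lift p \<in> F"
  by (rule alg_lin_in[OF _ clin_z_lift ksub_F]) (auto simp: z_lift_eq)

lemma gr_in_kerAb: "gr \<in> kerAb" by simp

lemma zero_in_ideal: "ideal I (algA K) \<Longrightarrow> f \<in> kerA \<Longrightarrow> clsA K f \<in> I"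
  using additive_subgroup.zero_closed[OF ideal.axioms(1)] pres_zero_iff[OF pres_algA] by (metis (lifting) mem_Collect_eq)

lemma ideal_r_eq: "ideal_r K = clsA K ` kerAb"
proof
  have "ideal (clsA K ` kerAb) (algA K)"
  proof (rule idealI[OF ring_algA])
    have "submodule (clsA K ` kerAb) K (algA K)"
      by (rule pres_submodule[OF pres_algA ksub_kerAb]) auto
    then show "subgroup (clsA K ` kerAb) (add_monoid (algA K))" by (simp add: submodule_def)
  next
    fix a x assume "a \<in> clsA K ` kerAb" "x \<in> carrier (algA K)"
    then obtain f g where "f \<in> kerAb" "a = clsA K f" "g \<in> F" "x = clsA K g" by (auto elim!: algA_E)
    then show "x \<otimes>\<^bsub>algA K\<^esub> a \<in> clsA K ` kerAb" "a \<otimes>\<^bsub>algA K\<^esub> x \<in> clsA K ` kerAb"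
      using imageI[OF kerAb_mult(1), of f g "clsA K"] imageI[OF kerAb_mult(2), of f g "clsA K"]
      by (auto simp: clsA_mult)
  qed
  moreover have "clsA K gr \<in> clsA K ` kerAb" using gr_in_kerAb by (rule imageI)
  ultimately show "ideal_r K \<subseteq> clsA K ` kerAb"
    unfolding ideal_r_def genideal_def by blast
  show "clsA K ` kerAb \<subseteq> ideal_r K"
    unfolding ideal_r_def genideal_def
  proof safe
    fix f I assume f: "f \<in> F" "abl f = 0" and I: "ideal I (algA K)" "{clsA K gr} \<subseteq> I"
    interpret I: ideal I "algA K" by fact
    \<comment> \<open>An ideal of A is closed under scalars because the scalars are themselves
      elements of A.\<close>
    have "submodule I K (algA K)"
    proof (rule submodule.intro)
      show "subgroup I (add_monoid (algA K))"
        using additive_subgroup.a_subgroup[OF ideal.axioms(1)[OF I(1)]] .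
      show "submodule_axioms I K (algA K)"
      proof
        fix c a assume "c \<in> k" "a \<in> I"
        then obtain g where g: "g \<in> F" "a = clsA K g" using I.Icarr algA_E by metis
        then have "c \<odot>\<^bsub>algA K\<^esub> a = clsA K (Poly_Mapping.single 0 c) \<otimes>\<^bsub>algA K\<^esub> a"
          using \<open>c \<in> k\<close> by (simp add: clsA_mult single_0_in single_0_mult flip: presD(6)[OF pres_algA])
        then show "c \<odot>\<^bsub>algA K\<^esub> a \<in> I"
          using I.I_l_closed[OF \<open>a \<in> I\<close>, of "clsA K (Poly_Mapping.single 0 c)"] \<open>c \<in> k\<close> by (simp add: single_0_in)
      qed
    qed
    then have *: "ksub {x \<in> F. clsA K x \<in> I}" by (rule pres_submodule_vimage(1)[OF pres_algA])
    have "f \<in> kerAb" using f by simp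
    then have "f \<in> {x \<in> F. clsA K x \<in> I}"
    proof (rule kerAb_induct[OF _ clin_id *])
      fix u v assume "u \<in> F" "v \<in> F"
      then show "u * gr * v \<in> {x \<in> F. clsA K x \<in> I}"
        using I.I_l_closed[of "clsA K gr" "clsA K u"] I.I_r_closed[of "clsA K (u * gr)" "clsA K v"] I(2)
        by (simp add: clsA_mult alg_in)
    qed (use zero_in_ideal[OF I(1)] in auto)
    then show "clsA K f \<in> I" by simp
  qed
qed

lemma comm_span_ideal_r: "comm_span K (algA K) (ideal_r K) (carrier (algA K)) = clsA K ` relV"
proof -
  have "{s \<otimes>\<^bsub>algA K\<^esub> t \<ominus>\<^bsub>algA K\<^esub> t \<otimes>\<^bsub>algA K\<^esub> s | s t. s \<in> ideal_r K \<and> t \<in> carrier (algA K)} =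
     clsA K ` {a * b - b * a | a b. a \<in> kerAb \<and> b \<in> F}" (is "?L = ?R")
  proof
    show "?L \<subseteq> ?R"
    proof safe
      fix s t assume "s \<in> ideal_r K" "t \<in> carrier (algA K)"
      then obtain a b where *: "a \<in> kerAb" "s = clsA K a" "b \<in> F" "t = clsA K b"
        by (auto simp: ideal_r_eq elim!: algA_E)
      then have "s \<otimes>\<^bsub>algA K\<^esub> t \<ominus>\<^bsub>algA K\<^esub> t \<otimes>\<^bsub>algA K\<^esub> s = clsA K (a * b - b * a)"
        by (simp add: clsA_mult alg_in pres_diff[OF pres_algA])
      then show "s \<otimes>\<^bsub>algA K\<^esub> t \<ominus>\<^bsub>algA K\<^esub> t \<otimes>\<^bsub>algA K\<^esub> s \<in> ?R" using * by blast
    qed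
    show "?R \<subseteq> ?L"
    proof safe
      fix a b assume *: "a \<in> F" "abl a = 0" "b \<in> F"
      then have "clsA K (a * b - b * a) = clsA K a \<otimes>\<^bsub>algA K\<^esub> clsA K b \<ominus>\<^bsub>algA K\<^esub> clsA K b \<otimes>\<^bsub>algA K\<^esub> clsA K a"
        by (simp add: clsA_mult alg_in pres_diff[OF pres_algA])
      moreover have "clsA K a \<in> ideal_r K" "clsA K b \<in> carrier (algA K)" using * by (auto simp: ideal_r_eq)
      ultimately show "\<exists>s t. clsA K (a * b - b * a) = s \<otimes>\<^bsub>algA K\<^esub> t \<ominus>\<^bsub>algA K\<^esub> t \<otimes>\<^bsub>algA K\<^esub> s \<and> s \<in> ideal_r K \<and> t \<in> carrier (algA K)"
        by blast
    qed
  qed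
  moreover have "{a * b - b * a | a b. a \<in> kerAb \<and> b \<in> F} \<subseteq> F" by (auto simp: alg_in)
  ultimately show ?thesis
    unfolding comm_span_def relV_def by (simp only: pres_span_Un[OF pres_algA])
qed

lemma pres_modV: "pres (modV K) F relV (clsV K)"
  unfolding modV_def clsV_def[abs_def] imgV_def comm_span_ideal_r
  using pres_quot[OF pres_algA ksub_relV kerA_relV relV_F] .

lemma clsV_eq: "f \<in> F \<Longrightarrow> g \<in> F \<Longrightarrow> clsV K f = clsV K g \<longleftrightarrow> f - g \<in> relV"
  by (rule presD(7)[OF pres_modV])

lemma clsV_set: "f \<in> F \<Longrightarrow> clsV K f = clsA K ` {h \<in> F. h - f \<in> relV}"
  unfolding clsV_def imgV_def comm_span_ideal_r
  by (rule pres_coset[OF pres_algA ksub_relV kerA_relV relV_F])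

lemma V_r_eq: "V_r K = clsV K ` kerAb"
  by (simp add: V_r_def ideal_r_eq image_image clsV_def)

lemma ideal_prod_eq:
  "ideal_prod (algA K) (ideal_r K) (ideal_r K) = clsA K ` kspan {a * b | a b. a \<in> kerAb \<and> b \<in> kerAb}"
  (is "?L = clsA K ` kspan ?S")
proof
  have sub: "kspan ?S \<subseteq> F" by (rule kspan_minimal[OF _ ksub_F]) (auto simp: alg_in)
  show "?L \<subseteq> clsA K ` kspan ?S"
  proof
    fix x assume "x \<in> ?L" then show "x \<in> clsA K ` kspan ?S"
    proof (induct rule: ideal_prod.induct)
      case (prod i j)
      then obtain a b where "a \<in> kerAb" "i = clsA K a" "b \<in> kerAb" "j = clsA K b" by (auto simp: ideal_r_eq)
      then have "a * b \<in> kspan ?S" "i \<otimes>\<^bsub>algA K\<^esub> j = clsA K (a * b)" by (auto simp: clsA_mult intro!: kspan_base)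
      then show ?case by blast
    next
      case (sum s1 s2)
      then obtain f g where fg: "f \<in> kspan ?S" "s1 = clsA K f" "g \<in> kspan ?S" "s2 = clsA K g" by blast
      then have "f + g \<in> kspan ?S" using ksub_add[OF ksub_kspan] by blast
      moreover have "s1 \<oplus>\<^bsub>algA K\<^esub> s2 = clsA K (f + g)" using fg sub presD(5)[OF pres_algA, of f g] by auto
      ultimately show ?case by blast
    qed
  qed
  show "clsA K ` kspan ?S \<subseteq> ?L"
  proof safe
    fix f assume "f \<in> kspan ?S" then show "clsA K f \<in> ?L"
    proof induct
      case zero
      \<comment> \<open>\<open>ideal_prod\<close> has rules for products and sums only: zero is
        obtained as a product of zeros, and below a scalar is absorbed into the first
        factor.\<close>
      have "clsA K 0 \<otimes>\<^bsub>algA K\<^esub> clsA K 0 \<in> ?L"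
        by (rule ideal_prod.prod) (auto simp: ideal_r_eq alg_in abl_linear)
      then show ?case by (simp add: clsA_mult alg_in)
    next
      case (step c x v)
      then obtain a b where ab: "a \<in> kerAb" "b \<in> kerAb" "x = a * b" by blast
      have ca: "c *\<^sub>C a \<in> kerAb" using ksub_cscale[OF ksub_kerAb] step ab by blast
      have "clsA K (c *\<^sub>C a) \<otimes>\<^bsub>algA K\<^esub> clsA K b \<in> ?L"
        by (rule ideal_prod.prod) (use ca ab in \<open>auto simp: ideal_r_eq\<close>)
      then have "clsA K (c *\<^sub>C x) \<in> ?L" using ca ab by (simp add: clsA_mult mult_cscale_left)
      then have "clsA K (c *\<^sub>C x) \<oplus>\<^bsub>algA K\<^esub> clsA K v \<in> ?L" using step by (intro ideal_prod.sum)
      moreover have "c *\<^sub>C x \<in> F" "v \<in> F" using step ab sub by (auto simp: alg_in)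
      ultimately show ?case by (simp add: presD(5)[OF pres_algA])
    qed
  qed
qed

lemma V_r2_eq: "V_r2 K = clsV K ` kerAb2"
proof -
  let ?S = "{a * b | a b. a \<in> kerAb \<and> b \<in> kerAb}"
  have sub: "kspan ?S \<subseteq> F" by (rule kspan_minimal[OF _ ksub_F]) (auto simp: alg_in)
  have "?S \<subseteq> kerAb2"
  proof safe
    fix a b assume *: "a \<in> F" "abl a = 0" "b \<in> F" "abl b = 0"
    then have "weyl (a * b) = 0" using weyl_kerAb_mult(1)[of a b] by simp
    then show "a * b \<in> kerAb2" using * by (simp add: kerAb2_def abl_mult alg_in)
  qed
  then have "kspan ?S \<subseteq> kerAb2" by (rule kspan_minimal[OF _ ksub_kerAb2])
  moreover have "clsV K f \<in> clsV K ` kspan ?S" if f: "f \<in> kerAb2" for f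
  proof -
    obtain h where h: "h \<in> kerAb" "f - gr * h \<in> relV" using kerAb2_rep f by blast
    have "gr * h \<in> kspan ?S" using h(1) gr_in_kerAb by (intro kspan_base) blast
    moreover have "clsV K f = clsV K (gr * h)" using h f by (simp add: clsV_eq kerAb2_def alg_in)
    ultimately show ?thesis by blast
  qed
  ultimately have "clsV K ` kspan ?S = clsV K ` kerAb2" by blast
  then show ?thesis by (simp add: V_r2_def ideal_prod_eq image_image clsV_def)
qed

abbreviation zrprod :: "(nat \<times> nat) list \<Rightarrow> ncpoly" where
  "zrprod t \<equiv> prod_list (map (\<lambda>(a, b). zmon a b * gr) t)"

lemma zrprod_in: "zrprod t \<in> F"
  by (rule monoid_alg_prod_list) (auto simp: alg_in)

text \<open>Sorting a word without r' into a \<open>zmon\<close> costs terms u r' v with shorter u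
  and v, and a word with an r' splits there into two shorter words; hence the induction on
  length.\<close>

lemma word_zrprod: "wd w \<in> kspan ({zrprod t * zmon a b | t a b. True} \<union> kerA)" (is "_ \<in> ?Z")
proof (induct "length w" arbitrary: w rule: less_induct)
  case less
  have Z: "f * gr * g \<in> ?Z" if "f \<in> ?Z" "g \<in> ?Z" for f g
  proof -
    have sub: "?Z \<subseteq> F" by (rule kspan_minimal[OF _ ksub_F]) (auto simp: alg_in zrprod_in)
    have "f * gr * (zrprod t * zmon a b) \<in> ?Z" for t a b
      using that(1)
    proof (rule kspan_lin_in[OF clin_multL[OF clin_multL[OF clin_id]] ksub_kspan, rotated])
      fix f assume "f \<in> {zrprod t * zmon a b | t a b. True} \<union> kerA"
      then show "f * gr * (zrprod t * zmon a b) \<in> ?Z"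
      proof
        assume "f \<in> {zrprod t * zmon a b | t a b. True}"
        then obtain t' a' b' where "f = zrprod t' * zmon a' b'" by blast
        then have "f * gr * (zrprod t * zmon a b) = zrprod (t' @ (a', b') # t) * zmon a b" by (simp add: mult.assoc)
        then show ?thesis by (intro kspan_base) blast
      next
        assume "f \<in> kerA"
        then have "f * gr * (zrprod t * zmon a b) \<in> kerA" by (simp add: expA_mult alg_in zrprod_in)
        then show ?thesis by (intro kspan_base) blast
      qed
    qed
    moreover have "f * gr * h \<in> ?Z" if "h \<in> kerA" for h
    proof -
      have "f * gr * h \<in> kerA" using that \<open>f \<in> ?Z\<close> sub by (auto simp: expA_mult alg_in)
      then show ?thesis by (intro kspan_base) blast
    qed
    ultimately show ?thesis
      using that(2) by (intro kspan_lin_in[OF clin_mult_right ksub_kspan _ that(2), of "f * gr"]) blast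
  qed
  show ?case
  proof (cases "nr w = 0")
    case True
    have "midr (length w) \<subseteq> ?Z"
      unfolding midr_def
    proof (rule kspan_minimal[OF _ ksub_kspan])
      have "wd u * gr * wd v \<in> ?Z" if "length u + length v + 2 \<le> length w" for u v
        using that by (intro Z less) auto
      then show "{wd u * gr * wd v |u v. length u + length v + 2 \<le> length w} \<union> kerA \<subseteq> ?Z"
        by (auto intro: kspan_base)
    qed
    then have "wd w - zmon (nx w) (ny w) \<in> ?Z" using word_zmon[OF True] by blast
    moreover have "zrprod [] * zmon (nx w) (ny w) \<in> ?Z" by (rule kspan_base) blast
    ultimately show ?thesis using ksub_add[OF ksub_kspan] by fastforce
  next
    case False
    then have "Lr \<in> set w" by (metis count_notin)
    then obtain u v where w: "w = u @ Lr # v" by (meson split_list)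
    then have "wd w = wd u * gr * wd v" by (simp add: gen_eq wd_mult)
    then show ?thesis using Z[OF less less, of u v] w by simp
  qed
qed

text \<open>Rotating an r' to the end leaves every \<open>zmon\<close> followed by an r', which is
  the shape of the generators of \<open>zr_classes\<close>.\<close>

lemma zr_classes_eq: "zr_classes K = clsV K ` kerAb"
proof -
  let ?S = "{zrprod t | t. t \<noteq> []}"
  have span: "mod_span K (free_alg K) ?S = kspan ?S"
  proof -
    have "?S \<subseteq> F" using zrprod_in by blast
    then show ?thesis using pres_mod_span[OF pres_alg, of ?S] by simp
  qed
  have "zrprod t \<in> kerAb" if "t \<noteq> []" for t
    using that zrprod_in[of t] by (cases t rule: rev_cases) (auto simp: abl_mult)
  then have sub: "kspan ?S \<subseteq> kerAb" by (intro kspan_minimal ksub_kerAb) blast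
  have "\<exists>g\<in>kspan ?S. f - g \<in> relV" if f: "f \<in> kerAb" for f
  proof -
    obtain h where h: "h \<in> F" "f - gr * h \<in> relV" using kerAb_rep f by blast
    have "gr * h - h * gr \<in> relV" using comm_relV[OF gr_in_kerAb h(1)] .
    then have *: "f - h * gr \<in> relV" using h(2) ksub_trans[OF ksub_relV] by blast
    have "h * gr \<in> kspan (?S \<union> kerA)"
    proof (rule F_lin_in[OF h(1) clin_mult_left ksub_kspan])
      fix w
      have "wd w \<in> kspan ({zrprod t * zmon a b | t a b. True} \<union> kerA)" by (rule word_zrprod)
      then show "wd w * gr \<in> kspan (?S \<union> kerA)"
      proof (rule kspan_lin_in[OF clin_mult_left ksub_kspan, rotated])
        fix f assume "f \<in> {zrprod t * zmon a b | t a b. True} \<union> kerA"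
        then show "f * gr \<in> kspan (?S \<union> kerA)"
        proof
          assume "f \<in> {zrprod t * zmon a b | t a b. True}"
          then obtain t a b where "f = zrprod t * zmon a b" by blast
          then have "f * gr = zrprod (t @ [(a, b)])" by (simp add: mult.assoc)
          then show ?thesis by (intro kspan_base) blast
        next
          assume "f \<in> kerA" then have "f * gr \<in> kerA" by (rule kerA_mult(1)) simp
          then show ?thesis by (intro kspan_base) blast
        qed
      qed
    qed
    then obtain g where "g \<in> kspan ?S" "h * gr - g \<in> kerA" using kspan_Un_ksubE[OF _ ksub_kerA] by blast
    then show ?thesis using * kerA_relV ksub_trans[OF ksub_relV] by blast
  qed
  then have "clsV K ` kspan ?S = clsV K ` kerAb"
    using sub by (auto simp: image_iff) (metis (mono_tags, lifting) clsV_eq mem_Collect_eq subsetD)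
  then show ?thesis by (simp add: zr_classes_def span)
qed

section \<open>The action on V\<close>

definition sl2 :: "complex^2^2 \<Rightarrow> bool" where
  "sl2 g \<longleftrightarrow> (\<forall>i j. g $ i $ j \<in> k) \<and> det g = 1"

lemma sl2_inverse: assumes "sl2 g" obtains h where "sl2 h" "g ** h = mat 1" "h ** g = mat 1"
proof -
  let ?h = "vector [vector [g $ 2 $ 2, - g $ 1 $ 2], vector [- g $ 2 $ 1, g $ 1 $ 1]] :: complex^2^2"
  have d: "g $ 1 $ 1 * g $ 2 $ 2 - g $ 1 $ 2 * g $ 2 $ 1 = 1" using assms by (simp add: sl2_def det_2)
  have "g ** ?h = mat 1"
    using d by (simp add: vec_eq_iff forall_2 matrix_matrix_mult_def UNIV_2 mat_def algebra_simps)
  moreover have "sl2 ?h"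
    using assms by (simp add: sl2_def forall_2 det_2 algebra_simps)
  ultimately show ?thesis using that matrix_left_right_inverse by blast
qed

lemma act_F: "sl2 g \<Longrightarrow> f \<in> F \<Longrightarrow> act_free g f \<in> F"
  by (rule act_in) (auto simp: sl2_def)

lemma expA_act: "sl2 g \<Longrightarrow> expA (act_free g f) = act_free g (expA f)"
  by (rule expA_act_commute) (simp add: sl2_def)

lemma act_kerA: "sl2 g \<Longrightarrow> f \<in> kerA \<Longrightarrow> act_free g f \<in> kerA"
  by (simp add: act_F expA_act act_linear)

lemma act_kerAb: "sl2 g \<Longrightarrow> f \<in> kerAb \<Longrightarrow> act_free g f \<in> kerAb"
  by (simp add: act_F abl_act clin_zero[OF clin_act_poly])

lemma act_relV: assumes "sl2 g" "f \<in> relV" shows "act_free g f \<in> relV"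
  using assms(2) unfolding relV_def
proof (rule kspan_lin_in[OF clin_act ksub_kspan, rotated])
  fix f assume "f \<in> {a * b - b * a | a b. a \<in> kerAb \<and> b \<in> F} \<union> kerA"
  then have "act_free g f \<in> {a * b - b * a | a b. a \<in> kerAb \<and> b \<in> F} \<union> kerA"
  proof
    assume "f \<in> {a * b - b * a | a b. a \<in> kerAb \<and> b \<in> F}"
    then obtain a b where "f = a * b - b * a" "a \<in> kerAb" "b \<in> F" by blast
    then have "act_free g f = act_free g a * act_free g b - act_free g b * act_free g a"
      "act_free g a \<in> kerAb" "act_free g b \<in> F"
      using act_kerAb[OF assms(1)] act_F[OF assms(1)] by (auto simp: act_linear act_mult)
    then show ?thesis by blast
  qed (use act_kerA[OF assms(1)] in blast)
  then show "act_free g f \<in> kspan ({a * b - b * a | a b. a \<in> kerAb \<and> b \<in> F} \<union> kerA)" by (rule kspan_base)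
qed

lemma actA_clsA: assumes "sl2 g" "f \<in> F" shows "actA g (clsA K f) = clsA K (act_free g f)"
proof -
  obtain h where "sl2 h" "g ** h = mat 1" using sl2_inverse assms by blast
  then show ?thesis using assms by (intro actA_cls[of g h]) (auto simp: sl2_def)
qed

lemma actV_clsV: assumes "sl2 g" "f \<in> F" shows "actV g (clsV K f) = clsV K (act_free g f)"
proof -
  obtain h where h: "sl2 h" "g ** h = mat 1" "h ** g = mat 1" using sl2_inverse assms by blast
  have gh: "act_free g (act_free h f) = f" "act_free h (act_free g f) = f" for f
    by (simp_all add: act_free_compose h)
  have "act_free g ` {x \<in> F. x - f \<in> relV} = {x \<in> F. x - act_free g f \<in> relV}"
  proof safe
    fix x assume "x \<in> F" "x - f \<in> relV"
    then show "act_free g x \<in> F" "act_free g x - act_free g f \<in> relV"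
      using act_F act_relV assms by (auto simp flip: act_linear)
  next
    fix x assume x: "x \<in> F" "x - act_free g f \<in> relV"
    have "act_free h x - f \<in> relV"
      using act_relV[OF h(1) x(2)] by (simp add: act_linear gh)
    then show "x \<in> act_free g ` {x \<in> F. x - f \<in> relV}"
      using act_F[OF h(1) x(1)] by (intro image_eqI[of _ _ "act_free h x"]) (simp_all add: gh)
  qed
  then have "clsA K ` act_free g ` {x \<in> F. x - f \<in> relV} = clsV K (act_free g f)"
    using assms by (simp add: clsV_set act_F)
  moreover have "actV g (clsV K f) = clsA K ` act_free g ` {x \<in> F. x - f \<in> relV}"
    unfolding actV_def clsV_set[OF assms(2)] image_image
    by (rule image_cong[OF refl]) (simp add: actA_clsA[OF assms(1)])
  ultimately show ?thesis by simp
qed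

text \<open>On all of A the linear term depends on the chosen ordering and is not equivariant. On
  the ideal it is the commutative image of the cofactor of r', and r' is fixed.\<close>

lemma weyl_act: assumes "sl2 g" "f \<in> kerAb" shows "weyl (act_free g f) = act_poly g (weyl f)"
proof -
  obtain h where h: "h \<in> F" "f - gr * h \<in> relV" using kerAb_rep assms by blast
  have "act_free g f - gr * act_free g h \<in> relV"
    using act_relV[OF assms(1) h(2)] by (simp add: act_linear act_mult)
  from weyl_relV[OF this] weyl_relV[OF h(2)] show ?thesis
    by (simp add: weyl_linear weyl_r abl_act)
qed

end

section \<open>Twisted traces on the free algebra\<close>

definition rot_orbit :: "'a list \<Rightarrow> 'a list set" where
  "rot_orbit w = range (\<lambda>n. rotate n w)"

lemma rotate_back: "\<exists>m. rotate m (rotate i w) = w"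
proof -
  have "rotate (length w * i - i) (rotate i w) = w" if "w \<noteq> []"
  proof -
    have "i \<le> length w * i" using that by (cases w) auto
    then show ?thesis by (simp add: rotate_rotate rotate_id)
  qed
  then show ?thesis by (cases "w = []") auto
qed

lemma rot_orbit_rotate [simp]: "rot_orbit (rotate i w) = rot_orbit w"
proof -
  have sub: "rot_orbit (rotate i w) \<subseteq> rot_orbit w" for i and w :: "'a list"
    by (auto simp: rot_orbit_def rotate_rotate)
  obtain m where "rotate m (rotate i w) = w" using rotate_back by blast
  then show ?thesis using sub[of i w] sub[of m "rotate i w"] by simp
qed

lemma rot_orbit_rotate1 [simp]: "rot_orbit (rotate1 w) = rot_orbit w"
  using rot_orbit_rotate[of 1 w] by (simp del: rot_orbit_rotate)

lemma rot_orbit_self: "w \<in> rot_orbit w"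
  using rangeI[of "\<lambda>n. rotate n w" 0] by (simp add: rot_orbit_def)

lemma rot_orbitE: "v \<in> rot_orbit w \<Longrightarrow> (\<And>n. v = rotate n w \<Longrightarrow> P) \<Longrightarrow> P"
  by (auto simp: rot_orbit_def)

lemma rot_orbit_eq_iff: "rot_orbit v = rot_orbit w \<longleftrightarrow> v \<in> rot_orbit w"
proof
  assume "v \<in> rot_orbit w"
  then obtain n where "v = rotate n w" by (rule rot_orbitE)
  then show "rot_orbit v = rot_orbit w" by simp
qed (use rot_orbit_self[of v] in simp)

definition canon :: "'a list \<Rightarrow> 'a list" where
  "canon w = (SOME v. v \<in> rot_orbit w)"

lemma canon_in: "canon w \<in> rot_orbit w"
  unfolding canon_def by (rule someI[of _ w]) (rule rot_orbit_self)

lemma canon_rotate [simp]: "canon (rotate i w) = canon w"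
  and canon_rotate1 [simp]: "canon (rotate1 w) = canon w"
  by (simp_all add: canon_def)

lemma rot_orbit_canon [simp]: "rot_orbit (canon w) = rot_orbit w"
  using canon_in rot_orbit_eq_iff by blast

lemma canon_eq_iff: "canon v = canon w \<longleftrightarrow> rot_orbit v = rot_orbit w"
proof
  assume "canon v = canon w"
  then show "rot_orbit v = rot_orbit w" using rot_orbit_canon by metis
qed (simp add: canon_def)

lemma canon_canon [simp]: "canon (canon w) = canon w"
  by (simp add: canon_eq_iff)

lemma count_rotate1: "count_list (rotate1 w) l = count_list w l"
  by (cases w) auto

lemma count_rotate: "count_list (rotate i w) l = count_list w l"
  by (induct i) (simp_all add: count_rotate1)

lemma count_canon [simp]: "count_list (canon w) l = count_list w l"
  using canon_in[of w] count_rotate by (metis rot_orbitE)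

text \<open>The projection onto cyclic words, with one word chosen in each rotation orbit. It is the
  operator \<open>s\<close> below for the trivial group element
  (\<open>s_eq_cyc_trace\<close>).\<close>

definition cyc_trace :: "ncpoly \<Rightarrow> ncpoly" where
  "cyc_trace = ext (\<lambda>w. wd (canon (letters w)))"

lemma clin_cyc_trace: "clin cyc_trace"
  unfolding cyc_trace_def by (rule clin_ext)

lemma cyc_trace_wd: "cyc_trace (wd w) = wd (canon w)"
  by (simp add: cyc_trace_def)

lemmas trace_linear = clin_simps[OF clin_cyc_trace]
lemmas lin_trace = clin_comp[OF clin_cyc_trace]

context coeff_ring
begin

text \<open>In the skew group algebra the commutator of a and c g is (a c - c g(a)) g.\<close>

definition twist_comm :: "complex^2^2 \<Rightarrow> ncpoly set" where
  "twist_comm g = kspan {a * c - c * act_free g a | a c. a \<in> F \<and> c \<in> F}"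

end

text \<open>
  The columns of \<open>B\<close> are eigenvectors of \<open>g\<close>. The matrix entries of the projections onto them have to
  lie in \<open>K\<close>, whereas \<open>B\<close> itself is only a complex matrix.
\<close>

locale eigenbasis = coeff_ring +
  fixes g B B' :: "complex^2^2" and lam :: "letter \<Rightarrow> complex"
  assumes g_in: "g $ i $ j \<in> k"
    and inv: "B ** B' = mat 1"
    and eigen: "act_free g (act_free B (gen l)) = lam l *\<^sub>C act_free B (gen l)"
    and lam_nz: "lam l \<noteq> 0"
    and proj: "Poly_Mapping.lookup (act_free B' (gen l)) (Word [m]) *\<^sub>C act_free B (gen m) \<in> F"
    and unit: "prod_list (map lam w) \<noteq> 1 \<Longrightarrow> 1 / (1 - prod_list (map lam w)) \<in> k"
begin

section \<open>Rotation of words in eigenletters\<close>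

abbreviation "alph \<equiv> act_free B"
abbreviation "beta \<equiv> act_free B'"

lemma alph_beta [simp]: "alph (beta f) = f" and beta_alph [simp]: "beta (alph f) = f"
proof -
  have "B' ** B = mat 1" using inv matrix_left_right_inverse by blast
  then show "alph (beta f) = f" "beta (alph f) = f" by (simp_all add: act_free_compose inv)
qed

definition lamhd :: "letter list \<Rightarrow> complex" where
  "lamhd w = (case w of [] \<Rightarrow> 1 | l # _ \<Rightarrow> lam l)"

text \<open>Modulo twisted commutators, moving the first eigenletter to the end multiplies by its
  eigenvalue. This collects the factors of j such moves.\<close>

primrec cj :: "nat \<Rightarrow> letter list \<Rightarrow> complex" where
  "cj 0 w = 1"
| "cj (Suc j) w = lamhd w * cj j (rotate1 w)"

lemma lamhd_nz: "lamhd w \<noteq> 0"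
  by (simp add: lamhd_def lam_nz split: list.split)

lemma cj_nz: "cj j w \<noteq> 0"
  by (induct j arbitrary: w) (simp_all add: lamhd_nz)

lemma cj_add: "cj (i + j) w = cj i w * cj j (rotate i w)"
  by (induct i arbitrary: w) (simp_all add: rotate1_rotate_swap)

lemma cj_prod: "\<exists>v. cj j w = prod_list (map lam v)"
proof (induct j arbitrary: w)
  case 0 show ?case by (rule exI[of _ "[]"]) simp
next
  case (Suc j)
  obtain v where "cj j (rotate1 w) = prod_list (map lam v)" using Suc by blast
  then show ?case
    by (cases w) (auto simp: lamhd_def intro: exI[of _ v] exI[of _ "_ # v"])
qed

text \<open>If a rotation returns to the same word with a factor c different from 1, then 1 - c
  times the word is a twisted commutator; 1 - c is invertible, so such a word is set to 0 in
  \<open>tw\<close>. On the other words the factor depends only on the word reached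
  (\<open>cj_indep\<close>), which makes a normal form possible.\<close>

definition adm :: "letter list \<Rightarrow> bool" where
  "adm w \<longleftrightarrow> (\<forall>j. rotate j w = w \<longrightarrow> cj j w = 1)"

lemma cj_indep: assumes "adm w" "rotate i w = rotate j w" shows "cj i w = cj j w"
proof -
  obtain m where m: "rotate m (rotate i w) = w" using rotate_back by blast
  have m': "rotate m (rotate j w) = w" using m assms(2) by simp
  have "rotate (i + m) w = w" using m by (simp add: rotate_rotate add.commute)
  then have "cj i w * cj m (rotate i w) = 1" using assms(1) cj_add[of i m w] by (simp add: adm_def)
  moreover have "rotate (j + m) w = w" using m' by (simp add: rotate_rotate add.commute)
  then have "cj j w * cj m (rotate i w) = 1" using assms cj_add[of j m w] by (simp add: adm_def)
  ultimately have "cj i w * cj m (rotate i w) = cj j w * cj m (rotate i w)" by simp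
  then show ?thesis using cj_nz[of m "rotate i w"] by (metis mult_right_cancel)
qed

lemma rotate1_eq_iff: "rotate1 v = rotate1 w \<longleftrightarrow> v = w"
proof
  assume *: "rotate1 v = rotate1 w"
  then have "length v = length w" by (metis length_rotate1)
  then show "v = w" using * by (cases v; cases w) auto
qed simp

lemma adm_rotate1: "adm (rotate1 w) \<longleftrightarrow> adm w"
proof -
  have "cj j (rotate1 w) = cj j w" if "rotate j w = w" for j
  proof -
    have "lamhd w * cj j (rotate1 w) = cj j w * lamhd w"
      using cj_add[of j 1 w] that by simp
    then show ?thesis using lamhd_nz by simp
  qed
  moreover have "rotate j (rotate1 w) = rotate1 w \<longleftrightarrow> rotate j w = w" for j
    by (simp add: rotate1_rotate_swap[symmetric] rotate1_eq_iff)
  ultimately show ?thesis by (auto simp: adm_def)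
qed

definition rj :: "letter list \<Rightarrow> nat" where
  "rj w = (SOME j. canon w = rotate j w)"

lemma rj: "rotate (rj w) w = canon w"
proof -
  obtain n where "canon w = rotate n w" using canon_in[of w] by (rule rot_orbitE)
  then have "canon w = rotate (rj w) w" unfolding rj_def by (rule someI)
  then show ?thesis by simp
qed

definition tw :: "letter list \<Rightarrow> ncpoly" where
  "tw w = (if adm w then cj (rj w) w *\<^sub>C wd (canon w) else 0)"

lemma tw_rotate1: "tw w = lamhd w *\<^sub>C tw (rotate1 w)"
proof (cases "adm w")
  case True
  have "rotate (Suc (rj (rotate1 w))) w = canon w"
    using rj[of "rotate1 w"] by (simp add: rotate1_rotate_swap)
  then have "cj (rj w) w = cj (Suc (rj (rotate1 w))) w"
    using rj[of w] cj_indep[OF True] by metis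
  then show ?thesis using True by (simp add: tw_def adm_rotate1)
qed (simp add: tw_def adm_rotate1)

definition T :: "ncpoly \<Rightarrow> ncpoly" where
  "T = ext (\<lambda>w. tw (letters w))"

lemma clin_T: "clin T" unfolding T_def by (rule clin_ext)

lemma T_wd: "T (wd w) = tw w" by (simp add: T_def)

definition dg :: "ncpoly \<Rightarrow> ncpoly" where
  "dg = alghom (\<lambda>l. lam l *\<^sub>C gen l)"

text \<open>For one letter this is \<open>tw_rotate1\<close>; in general the letters of the first
  factor are moved to the end one by one.\<close>

lemma T_twisted: "T (f * h) = T (h * dg f)"
proof (rule clin_wd_eqI2[where G = "\<lambda>f h. T (f * h)" and H = "\<lambda>f h. T (h * dg f)"])
  show "T (wd u * wd v) = T (wd v * dg (wd u))" for u v
  proof (induct u arbitrary: v)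
    case Nil then show ?case by (simp add: dg_def)
  next
    case (Cons l u)
    have "T (wd (l # u) * wd v) = lam l *\<^sub>C T (wd u * wd (v @ [l]))"
      using tw_rotate1[of "l # u @ v"] by (simp add: wd_mult T_wd lamhd_def)
    also have "\<dots> = lam l *\<^sub>C T (wd v * gen l * dg (wd u))"
      using Cons[of "v @ [l]"] by (simp add: gen_eq wd_mult)
    also have "\<dots> = T (wd v * dg (wd (l # u)))"
      by (simp add: dg_def wd_Cons alghom_mult mult_cscale_left mult_cscale_right clin_cscale[OF clin_T] mult.assoc)
    finally show ?case .
  qed
qed (unfold dg_def, (intro clin_comp[OF clin_T] lin_alghom clin_intros)+)

lemma act_alph: "act_free g (alph f) = alph (dg f)"
proof -
  have "act_free g (alph f) = alghom (\<lambda>l. lam l *\<^sub>C alph (gen l)) f"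
    unfolding act_free_eq alghom_comp using eigen by (simp add: act_free_eq)
  also have "\<dots> = alph (dg f)"
    by (simp add: act_free_eq alghom_comp dg_def alghom_linear)
  finally show ?thesis .
qed

definition s :: "ncpoly \<Rightarrow> ncpoly" where
  "s f = alph (T (beta f))"

lemma clin_s: "clin s"
  unfolding s_def by (intro lin_act clin_comp[OF clin_T] clin_id)

lemma s_twisted: "s (a * c) = s (c * act_free g a)"
proof -
  have "beta (act_free g a) = dg (beta a)"
    using arg_cong[OF act_alph[of "beta a"], of beta] by simp
  then have "beta (c * act_free g a) = beta c * dg (beta a)" by (simp add: act_mult)
  then show ?thesis using T_twisted[of "beta a" "beta c"] by (simp add: s_def act_mult)
qed

text \<open>Rotation by one letter in the original coordinates. It is defined over K although the
  eigenvectors need not be, it moves elements only by twisted commutators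
  (\<open>sig_twist\<close>), and on eigenwords it is the scaled rotation
  (\<open>sig_alph\<close>).\<close>

definition sig :: "ncpoly \<Rightarrow> ncpoly" where
  "sig = ext (\<lambda>w. case letters w of [] \<Rightarrow> 1 | l # t \<Rightarrow> wd t * act_free g (gen l))"

lemma clin_sig: "clin sig" unfolding sig_def by (rule clin_ext)

lemma sig_wd: "sig (wd w) = (case w of [] \<Rightarrow> 1 | l # t \<Rightarrow> wd t * act_free g (gen l))"
  by (simp add: sig_def)

lemma sig_gen_mult: "sig (gen l * h) = h * act_free g (gen l)"
  by (rule clin_wd_eqI[where F = "\<lambda>h. sig (gen l * h)" and G = "\<lambda>h. h * act_free g (gen l)"])
    (intro clin_comp[OF clin_sig] clin_intros | simp add: sig_wd flip: wd_Cons)+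

lemma act_gF: "f \<in> F \<Longrightarrow> act_free g f \<in> F"
  by (rule act_in) (auto simp: g_in)

lemma ksub_twist: "ksub (twist_comm g)" by (simp add: twist_comm_def ksub_kspan)

lemma sig_F: "f \<in> F \<Longrightarrow> sig f \<in> F"
  by (rule F_lin_in[OF _ clin_sig ksub_F]) (auto simp: sig_wd alg_in act_gF split: list.split)

lemma sig_twist: "f \<in> F \<Longrightarrow> f - sig f \<in> twist_comm g"
proof (rule F_lin_in[where G = "\<lambda>f. f - sig f"])
  show "wd w - sig (wd w) \<in> twist_comm g" for w
  proof (cases w)
    case Nil then show ?thesis by (simp add: sig_wd ksub_zero[OF ksub_twist] flip: wd_Nil)
  next
    case (Cons l t)
    then have "wd w - sig (wd w) = gen l * wd t - wd t * act_free g (gen l)"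
      by (simp add: wd_Cons sig_gen_mult)
    moreover have "gen l \<in> F" "wd t \<in> F" by simp_all
    ultimately show ?thesis
      unfolding twist_comm_def by (intro kspan_base) blast
  qed
qed (intro clin_intros clin_sig ksub_twist | assumption)+

lemma sig_pow: assumes "f \<in> F" shows "(sig ^^ j) f \<in> F \<and> f - (sig ^^ j) f \<in> twist_comm g"
proof (induct j)
  case 0 then show ?case using assms by (simp add: ksub_zero[OF ksub_twist])
next
  case (Suc j)
  then show ?case using sig_F sig_twist ksub_trans[OF ksub_twist] by auto
qed

lemma sig_alph: "sig (alph (wd w)) = lamhd w *\<^sub>C alph (wd (rotate1 w))"
proof (cases w)
  case Nil then show ?thesis using sig_wd[of "[]"] by (simp add: lamhd_def)
next
  case (Cons l t)
  have lin: "sig (act_letter B l * h) = h * act_free g (act_letter B l)" for h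
    by (cases l) (simp_all add: single_0_mult distrib_left distrib_right mult_cscale_left mult_cscale_right
        clin_simps[OF clin_sig] sig_gen_mult act_linear)
  have al: "alph (gen l) = act_letter B l" by (simp add: act_free_eq)
  have "sig (alph (wd w)) = alph (wd t) * act_free g (alph (gen l))"
    by (simp add: Cons wd_Cons act_mult lin al)
  also have "\<dots> = lam l *\<^sub>C alph (wd t * gen l)"
    by (simp add: eigen mult_cscale_right act_mult)
  finally show ?thesis by (simp add: Cons lamhd_def gen_eq wd_mult)
qed

lemma sig_pow_alph: "(sig ^^ j) (c *\<^sub>C alph (wd w)) = (c * cj j w) *\<^sub>C alph (wd (rotate j w))"
proof (induct j arbitrary: c w)
  case (Suc j)
  have "(sig ^^ Suc j) (c *\<^sub>C alph (wd w)) = (sig ^^ j) (sig (c *\<^sub>C alph (wd w)))"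
    by (simp add: funpow_swap1)
  then show ?case by (simp add: clin_cscale[OF clin_sig] sig_alph Suc rotate1_rotate_swap mult.assoc)
qed simp

lemma lookup_gen_mult:
  "Poly_Mapping.lookup (gen m * h) (Word w) = (case w of [] \<Rightarrow> 0 | l # t \<Rightarrow> if l = m then Poly_Mapping.lookup h (Word t) else 0)"
proof (rule clin_wd_eqI[where F = "\<lambda>h. Poly_Mapping.lookup (gen m * h) (Word w)"
      and G = "\<lambda>h. case w of [] \<Rightarrow> 0 | l # t \<Rightarrow> if l = m then Poly_Mapping.lookup h (Word t) else 0"])
  show "clin (\<lambda>h. Poly_Mapping.lookup (gen m * h) (Word w))"
    by (intro clin_comp[OF clin_lookup] clin_intros)
  show "clin (\<lambda>h. case w of [] \<Rightarrow> (0::complex) | l # t \<Rightarrow> if l = m then Poly_Mapping.lookup h (Word t) else 0)"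
    by (auto simp: clin_def split: list.split)
  show "Poly_Mapping.lookup (gen m * wd v) (Word w) =
      (case w of [] \<Rightarrow> 0 | l # t \<Rightarrow> if l = m then Poly_Mapping.lookup (wd v) (Word t) else 0)" for v
    by (auto simp: lookup_single when_def simp flip: wd_Cons split: list.split)
qed

lemma lookup_beta_mult:
  "Poly_Mapping.lookup (act_letter B' l * h) (Word w) = (case w of [] \<Rightarrow> 0 |
    m # t \<Rightarrow> Poly_Mapping.lookup (act_letter B' l) (Word [m]) * Poly_Mapping.lookup h (Word t))"
proof -
  have gen: "Poly_Mapping.lookup (gen n) (Word [m]) = (if m = n then 1 else 0)" for m n
    by (auto simp: gen_eq lookup_single when_def)
  show ?thesis
    by (cases l; cases w) (auto simp: single_0_mult distrib_right mult_cscale_left lookup_gen_mult gen algebra_simps)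
qed

text \<open>The component of a word along an eigenword is a product of one eigenprojection per
  letter, and these are integral by \<open>proj\<close>. Neither the coefficient nor the eigenword
  need be integral alone.\<close>

lemma eigen_component: assumes "f \<in> F" shows "Poly_Mapping.lookup (beta f) (Word w) *\<^sub>C alph (wd w) \<in> F"
proof (rule F_lin_in[OF assms, where G = "\<lambda>f. Poly_Mapping.lookup (beta f) (Word w) *\<^sub>C alph (wd w)"])
  show "clin (\<lambda>f. Poly_Mapping.lookup (beta f) (Word w) *\<^sub>C alph (wd w))"
    by (rule clinI) (simp_all add: act_linear cscale_add_left)
  fix u show "Poly_Mapping.lookup (beta (wd u)) (Word w) *\<^sub>C alph (wd w) \<in> F"
  proof (induct u arbitrary: w)
    case Nil
    show ?case
    proof (cases w)
      case Nil then show ?thesis by (simp add: Word_Nil)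
    next
      case (Cons l t)
      then have "Poly_Mapping.lookup (1 :: ncpoly) (Word w) = 0" by (simp add: lookup_one zero_ncword_def)
      then show ?thesis by (simp add: ksub_zero[OF ksub_F])
    qed
  next
    case IH: (Cons l u)
    have b: "beta (gen l) = act_letter B' l" by (simp add: act_free_eq)
    show ?case
    proof (cases w)
      case Nil then show ?thesis by (simp add: wd_Cons act_mult b lookup_beta_mult ksub_zero[OF ksub_F])
    next
      case (Cons m t)
      have "Poly_Mapping.lookup (beta (wd (l # u))) (Word w) *\<^sub>C alph (wd w) =
        (Poly_Mapping.lookup (beta (gen l)) (Word [m]) *\<^sub>C alph (gen m)) *
        (Poly_Mapping.lookup (beta (wd u)) (Word t) *\<^sub>C alph (wd t))"
        by (simp add: Cons wd_Cons act_mult b lookup_beta_mult mult_cscale_left mult_cscale_right mult.commute)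
      moreover have "Poly_Mapping.lookup (beta (wd u)) (Word t) *\<^sub>C alph (wd t) \<in> F" by (rule IH)
      ultimately show ?thesis using proj[of l m] alg_in(1) by simp
    qed
  qed
qed (rule ksub_F)

text \<open>On an admissible component \<open>s\<close> is an iterate of \<open>sig\<close>, which
  yields integrality and the congruence together. On any other component some iterate of
  \<open>sig\<close> is multiplication by c with 1 - c invertible, so the component is itself a
  twisted commutator.\<close>

lemma s_component:
  assumes "f \<in> F"
  defines "p \<equiv> (\<lambda>w. Poly_Mapping.lookup (beta f) (Word w) *\<^sub>C alph (wd w))"
    and "q \<equiv> (\<lambda>w. Poly_Mapping.lookup (beta f) (Word w) *\<^sub>C alph (tw w))"
  shows "q w \<in> F \<and> p w - q w \<in> twist_comm g"
proof (cases "adm w")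
  case True
  have "(sig ^^ rj w) (p w) = q w"
    by (simp add: p_def q_def tw_def True sig_pow_alph rj act_linear)
  then show ?thesis using sig_pow[of "p w" "rj w"] eigen_component[OF assms(1), of w] by (simp add: p_def)
next
  case False
  then obtain j where j: "rotate j w = w" "cj j w \<noteq> 1" by (auto simp: adm_def)
  obtain v where "cj j w = prod_list (map lam v)" using cj_prod by blast
  then have u: "1 / (1 - cj j w) \<in> k" using unit[of v] j(2) by simp
  have "(sig ^^ j) (p w) = cj j w *\<^sub>C p w"
    by (simp add: p_def sig_pow_alph j mult.commute)
  moreover have "p w - (sig ^^ j) (p w) \<in> twist_comm g"
    using sig_pow[of "p w" j] eigen_component[OF assms(1), of w] by (simp add: p_def)
  moreover have "(1 - cj j w) *\<^sub>C p w = p w - cj j w *\<^sub>C p w"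
    by (simp only: cscale_diff_left cscale_one)
  ultimately have "(1 - cj j w) *\<^sub>C p w \<in> twist_comm g" by simp
  from ksub_cscale[OF ksub_twist u this] j(2) have "p w \<in> twist_comm g" by simp
  then show ?thesis using False by (simp add: q_def tw_def act_linear ksub_zero[OF ksub_F])
qed

lemma s_F: assumes "f \<in> F" shows "s f \<in> F" and s_twist: "f - s f \<in> twist_comm g"
proof -
  let ?A = "Poly_Mapping.keys (beta f)"
  let ?p = "\<lambda>w. Poly_Mapping.lookup (beta f) w *\<^sub>C alph (bas w)"
  let ?q = "\<lambda>w. Poly_Mapping.lookup (beta f) w *\<^sub>C alph (tw (letters w))"
  have pq: "?q w \<in> F \<and> ?p w - ?q w \<in> twist_comm g" for w
    using s_component[OF assms, of "letters w"] by simp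
  have sf: "s f = (\<Sum>w\<in>?A. ?q w)"
    by (simp add: s_def T_def ext_def act_linear)
  then show "s f \<in> F"
    using pq by (simp add: ksub_sum[OF ksub_F])
  have "f = alph (ext bas (beta f))" by (simp add: ext_bas_id)
  then have ff: "f = (\<Sum>w\<in>?A. ?p w)" unfolding ext_def by (simp only: act_linear)
  have "f - s f = (\<Sum>w\<in>?A. ?p w - ?q w)"
    unfolding sum_subtractf by (rule arg_cong2[where f = "(-)", OF ff sf])
  moreover have "(\<Sum>w\<in>?A. ?p w - ?q w) \<in> twist_comm g"
    using pq by (intro ksub_sum[OF ksub_twist]) blast
  ultimately show "f - s f \<in> twist_comm g" by simp
qed

lemma s_eq_cyc_trace: assumes "lam = (\<lambda>_. 1)" "B = mat 1" shows "s = cyc_trace"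
proof
  have B': "B' = mat 1" using inv assms by simp
  have lam1: "lam l = 1" for l by (simp add: assms(1))
  have "cj j w = 1" for j w
    by (induct j arbitrary: w) (simp_all add: lamhd_def lam1 split: list.split)
  then have "tw w = wd (canon w)" for w by (simp add: tw_def adm_def)
  moreover have "alph f = f" "beta f = f" for f by (simp_all add: assms(2) B')
  ultimately show "s f = cyc_trace f" for f by (simp add: s_def T_def cyc_trace_def)
qed

end

context coeff_ring
begin

definition is_twisted_trace :: "complex^2^2 \<Rightarrow> (ncpoly \<Rightarrow> ncpoly) \<Rightarrow> bool" where
  "is_twisted_trace g s \<longleftrightarrow> clin s \<and> (\<forall>a c. s (a * c) = s (c * act_free g a)) \<and>
     (\<forall>f\<in>F. s f \<in> F \<and> f - s f \<in> twist_comm g)"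

lemma eigenbasis_twisted_trace:
  assumes "eigenbasis K g B B' lam" shows "is_twisted_trace g (eigenbasis.s B B' lam)"
proof -
  interpret eigenbasis K g B B' lam by fact
  show ?thesis unfolding is_twisted_trace_def using clin_s s_twisted s_F s_twist by blast
qed

lemma cyc_trace_twisted: "is_twisted_trace (mat 1) cyc_trace"
proof -
  interpret eigenbasis K "mat 1" "mat 1" "mat 1" "\<lambda>_. 1"
  proof
    show "Poly_Mapping.lookup (act_free (mat 1) (gen l)) (Word [m]) *\<^sub>C act_free (mat 1) (gen m) \<in> F" for l m
      by (auto simp: gen_eq lookup_single when_def ksub_zero[OF ksub_F])
    show "1 / (1 - prod_list (map (\<lambda>_. 1) w)) \<in> k" if "prod_list (map (\<lambda>_. 1) w) \<noteq> (1::complex)" for w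
    proof -
      have "prod_list (map (\<lambda>_. 1) w) = (1::complex)" by (induct w) auto
      then show ?thesis using that by simp
    qed
    show "mat 1 $ i $ j \<in> k" for i j :: 2 by (simp add: mat_def)
  qed simp_all
  show ?thesis unfolding is_twisted_trace_def
    using clin_s s_twisted s_F s_twist s_eq_cyc_trace by simp
qed

lemma trace_comm: "cyc_trace (a * c) = cyc_trace (c * a)"
  using cyc_trace_twisted by (metis act_free_1 is_twisted_trace_def)

lemma trace_in: "f \<in> F \<Longrightarrow> cyc_trace f \<in> F"
  using cyc_trace_twisted by (metis is_twisted_trace_def)

lemma sub_trace: "f \<in> F \<Longrightarrow> f - cyc_trace f \<in> kspan {a * c - c * a | a c. a \<in> F \<and> c \<in> F}"
  using cyc_trace_twisted by (simp add: is_twisted_trace_def twist_comm_def)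

text \<open>Products of n-th roots of unity along a word are again n-th roots of unity, so it
  suffices to invert 1 - \<mu> for these. The fixed letter r' has eigenvalue 1.\<close>

lemma eigenbasis_matrix:
  assumes g: "\<And>i j. g $ i $ j \<in> k" and BB: "B ** B' = mat 1"
    and col1: "\<And>i. (g ** B) $ i $ 1 = l1 * B $ i $ 1" and col2: "\<And>i. (g ** B) $ i $ 2 = l2 * B $ i $ 2"
    and P: "\<And>i m l. B $ i $ m * B' $ m $ l \<in> k"
    and root: "l1 ^ n = 1" "l2 ^ n = 1" "n > 0" and unit: "\<And>\<mu>. \<mu> ^ n = 1 \<Longrightarrow> \<mu> \<noteq> 1 \<Longrightarrow> 1 / (1 - \<mu>) \<in> k"
  shows "eigenbasis K g B B' (\<lambda>l. case l of Lx \<Rightarrow> l1 | Ly \<Rightarrow> l2 | Lr \<Rightarrow> 1)"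
proof
  let ?lam = "\<lambda>l. case l of Lx \<Rightarrow> l1 | Ly \<Rightarrow> l2 | Lr \<Rightarrow> 1"
  show "act_free g (act_free B (gen l)) = ?lam l *\<^sub>C act_free B (gen l)" for l
  proof -
    have "act_free g (act_free B (gen l)) = act_letter (g ** B) l" by (simp add: act_free_compose) (simp add: act_free_eq)
    also have "\<dots> = ?lam l *\<^sub>C act_letter B l"
      by (cases l) (simp_all add: single_0_mult col1 col2 cscale_add_right)
    finally show ?thesis by (simp add: act_free_eq)
  qed
  have root': "?lam l ^ n = 1" for l by (cases l) (simp_all add: root)
  then show "?lam l \<noteq> 0" for l using root(3) by (metis power_0_left zero_neq_one gr_implies_not0)
  have "prod_list (map ?lam w) ^ n = 1" for w by (induct w) (simp_all add: power_mult_distrib root')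
  then show "1 / (1 - prod_list (map ?lam w)) \<in> k" if "prod_list (map ?lam w) \<noteq> 1" for w
    using unit that by blast
  show "Poly_Mapping.lookup (act_free B' (gen l)) (Word [m]) *\<^sub>C act_free B (gen m) \<in> F" for l m
  proof -
    have gen: "Poly_Mapping.lookup (gen n) (Word [m]) = (if m = n then 1 else 0)" for m n
      by (auto simp: gen_eq lookup_single when_def)
    have P': "B' $ m $ l * B $ i $ m \<in> k" for i m l using P[of i m l] by (simp add: mult.commute)
    show ?thesis
      by (cases l; cases m) (auto simp: act_free_eq single_0_mult gen cscale_add_right P'
          intro!: ksub_add[OF ksub_F] ksub_cscale[OF ksub_F] ksub_zero[OF ksub_F])
  qed
qed (use g BB in auto)

end

section \<open>Finite subgroups of \<open>SL\<^sub>2\<close>\<close>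

lemma group_SL2: assumes "coeff_ring K" shows "group (SL2 K)"
proof -
  interpret coeff_ring K by fact
  have carr: "g \<in> carrier (SL2 K) \<longleftrightarrow> sl2 g" for g by (simp add: SL2_def sl2_def)
  show ?thesis
  proof (rule groupI)
    fix g h assume gh: "g \<in> carrier (SL2 K)" "h \<in> carrier (SL2 K)"
    then have "(\<forall>i j. (g ** h) $ i $ j \<in> k)"
      unfolding carr sl2_def by (auto simp: matrix_matrix_mult_def intro!: K_sum)
    then show "g \<otimes>\<^bsub>SL2 K\<^esub> h \<in> carrier (SL2 K)"
      using gh unfolding carr by (simp add: sl2_def det_mul) (simp add: SL2_def det_mul)
  next
    have "sl2 (mat 1)" by (simp add: sl2_def mat_def)  (simp add: det_2)
    then show "\<one>\<^bsub>SL2 K\<^esub> \<in> carrier (SL2 K)" unfolding carr by (simp add: SL2_def)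
  next
    fix g assume "g \<in> carrier (SL2 K)"
    then obtain h where "sl2 h" "h ** g = mat 1" using sl2_inverse unfolding carr by blast
    then show "\<exists>h\<in>carrier (SL2 K). h \<otimes>\<^bsub>SL2 K\<^esub> g = \<one>\<^bsub>SL2 K\<^esub>"
      by (intro bexI[of _ h]) (auto simp: carr, simp add: SL2_def)
  qed (simp_all add: SL2_def matrix_mul_assoc)
qed

text \<open>The pair (a, b) with \<open>g^n = a g - b\<close> for a matrix of trace t and
  determinant 1. The recursion is the Cayley-Hamilton identity \<open>g^2 = t g - 1\<close>, and the
  start (0, -1) is \<open>g^0 = 1\<close>.\<close>

primrec cayley :: "complex \<Rightarrow> nat \<Rightarrow> complex \<times> complex" where
  "cayley t 0 = (0, -1)"
| "cayley t (Suc n) = (fst (cayley t n) * t - snd (cayley t n), fst (cayley t n))"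

lemma cayley_root: "z * z = t * z - 1 \<Longrightarrow> z ^ n = fst (cayley t n) * z - snd (cayley t n)"
proof (induct n)
  case (Suc n)
  have "z ^ Suc n = (fst (cayley t n) * z - snd (cayley t n)) * z"
    using Suc(1)[OF Suc(2)] by (simp add: mult.commute)
  also have "\<dots> = fst (cayley t n) * (z * z) - snd (cayley t n) * z" by (simp add: algebra_simps)
  finally show ?case by (simp only: Suc(2)) (simp add: algebra_simps)
qed simp

text \<open>For a double eigenvalue the coefficient of g grows with n and never vanishes for n > 0.
  A non-diagonal matrix of finite order therefore has two distinct eigenvalues.\<close>

lemma cayley_double: "z * z = 1 \<Longrightarrow> cayley (2 * z) n = (of_nat n * z ^ Suc n, (of_nat n - 1) * z ^ n)"
proof (induct n)
  case (Suc n)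
  have e: "z * (z * c) = c" for c using Suc(2) by (simp flip: mult.assoc)
  show ?case using Suc by (simp add: algebra_simps e)
qed simp

text \<open>Multiplying the sum by 1 - \<mu> telescopes it to -n. So 1 - \<mu> is a unit in any ring
  that contains \<mu> and 1/n.\<close>

lemma inverse_one_minus_root_of_unity:
  fixes \<mu> :: complex
  assumes "\<mu> ^ n = 1" "\<mu> \<noteq> 1" "n > 0"
  shows "1 / (1 - \<mu>) = - (\<Sum>i<n. of_nat i * \<mu> ^ i) / of_nat n"
proof -
  have gen: "(1 - \<mu>) * (\<Sum>i<m. of_nat i * \<mu> ^ i) = (\<Sum>i<m. \<mu> ^ i) - 1 - (of_nat m - 1) * \<mu> ^ m" if "m > 0" for m
    using that
  proof (induct m)
    case (Suc m)
    then show ?case by (cases "m = 0") (auto simp: algebra_simps)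
  qed simp
  have "(\<Sum>i<n. \<mu> ^ i) = 0" using geometric_sum[of \<mu> n] assms by simp
  then have "(1 - \<mu>) * (\<Sum>i<n. of_nat i * \<mu> ^ i) = - of_nat n"
    using gen[of n] assms by simp
  moreover have "1 - \<mu> \<noteq> 0" using assms by simp
  ultimately have "(\<Sum>i<n. of_nat i * \<mu> ^ i) = - of_nat n / (1 - \<mu>)"
    by (simp add: field_simps)
  then show ?thesis using assms by simp
qed

lemma SL2_ops [simp]: "g \<otimes>\<^bsub>SL2 K\<^esub> h = g ** h" "\<one>\<^bsub>SL2 K\<^esub> = mat 1"
  by (simp_all add: SL2_def)

text \<open>What the group requires of K. Eigenvalues of elements of \<Gamma> are roots of unity
  whose order divides that of \<Gamma>, hence the form of \<open>root_in\<close>.\<close>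

locale finite_sl2 = coeff_ring K for K :: "(complex, complex) module" +
  fixes \<Gamma> :: "(complex^2^2) set"
  assumes fin: "finite \<Gamma>"
    and sub: "subgroup \<Gamma> (SL2 K)"
    and order_inv: "1 / of_nat (card \<Gamma>) \<in> carrier K"
    and root_in: "\<mu> ^ card \<Gamma> = 1 \<Longrightarrow> \<mu> \<in> carrier K"
begin

abbreviation "G \<equiv> grp K \<Gamma>"
abbreviation "N \<equiv> card \<Gamma>"
abbreviation "gi g \<equiv> inv\<^bsub>G\<^esub> g"

lemma group_G: "group G"
  by (rule subgroup.subgroup_is_group[OF sub group_SL2]) unfold_locales

sublocale G: group G by (rule group_G)

lemma G_mult [simp]: "g \<otimes>\<^bsub>G\<^esub> h = g ** h" and G_one [simp]: "\<one>\<^bsub>G\<^esub> = mat 1"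
  by (simp_all add: SL2_def)

lemma one_\<Gamma> [simp]: "mat 1 \<in> \<Gamma>" and mult_\<Gamma> [simp]: "g \<in> \<Gamma> \<Longrightarrow> h \<in> \<Gamma> \<Longrightarrow> g ** h \<in> \<Gamma>"
  and gi_\<Gamma> [simp]: "g \<in> \<Gamma> \<Longrightarrow> gi g \<in> \<Gamma>"
  and gi_l [simp]: "g \<in> \<Gamma> \<Longrightarrow> gi g ** g = mat 1" and gi_r [simp]: "g \<in> \<Gamma> \<Longrightarrow> g ** gi g = mat 1"
  using G.one_closed G.m_closed[of g h] G.inv_closed[of g] G.l_inv[of g] G.r_inv[of g] by simp_all

lemma gi_l' [simp]: "g \<in> \<Gamma> \<Longrightarrow> gi g ** (g ** h) = h" and gi_r' [simp]: "g \<in> \<Gamma> \<Longrightarrow> g ** (gi g ** h) = h"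
  by (simp_all add: matrix_mul_assoc)

lemma gi_mult: "g \<in> \<Gamma> \<Longrightarrow> h \<in> \<Gamma> \<Longrightarrow> gi (g ** h) = gi h ** gi g"
  using G.inv_mult_group[of g h] by simp

lemma \<Gamma>_sl2: "g \<in> \<Gamma> \<Longrightarrow> sl2 g"
  using subgroup.subset[OF sub] by (auto simp: SL2_def sl2_def)

lemma N_pos: "N > 0"
  using fin one_\<Gamma> by (metis card_gt_0_iff empty_iff)

lemma act_\<Gamma>F [simp]: "g \<in> \<Gamma> \<Longrightarrow> f \<in> F \<Longrightarrow> act_free g f \<in> F"
  using act_F \<Gamma>_sl2 by blast

lemma inv_one_minus_root_in: "\<mu> ^ N = 1 \<Longrightarrow> \<mu> \<noteq> 1 \<Longrightarrow> 1 / (1 - \<mu>) \<in> k"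
proof -
  assume *: "\<mu> ^ N = 1" "\<mu> \<noteq> 1"
  have "- (\<Sum>i<N. of_nat i * \<mu> ^ i) * (1 / of_nat N) \<in> k"
    using root_in[OF *(1)] order_inv by (intro K_mult K_minus K_sum) auto
  then show ?thesis unfolding inverse_one_minus_root_of_unity[OF * N_pos] by simp
qed

lemma pow_entry:
  assumes "g \<in> \<Gamma>"
  shows "(g [^]\<^bsub>G\<^esub> n) $ i $ j =
    fst (cayley (g $ 1 $ 1 + g $ 2 $ 2) n) * g $ i $ j - snd (cayley (g $ 1 $ 1 + g $ 2 $ 2) n) * (if i = j then 1 else 0)"
proof (induct n arbitrary: i j)
  case 0 then show ?case by (simp add: mat_def)
next
  case (Suc n)
  let ?a = "fst (cayley (g $ 1 $ 1 + g $ 2 $ 2) n)" and ?b = "snd (cayley (g $ 1 $ 1 + g $ 2 $ 2) n)"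
  have d: "g $ 1 $ 1 * g $ 2 $ 2 = 1 + g $ 1 $ 2 * g $ 2 $ 1"
    using \<Gamma>_sl2[OF assms] by (simp add: sl2_def det_2 algebra_simps)
  have "(g [^]\<^bsub>G\<^esub> Suc n) $ i $ j = (g [^]\<^bsub>G\<^esub> n) $ i $ 1 * g $ 1 $ j + (g [^]\<^bsub>G\<^esub> n) $ i $ 2 * g $ 2 $ j"
    by (simp add: matrix_matrix_mult_def UNIV_2)
  also have "\<dots> = (?a * (g $ 1 $ 1 + g $ 2 $ 2) - ?b) * g $ i $ j - ?a * (if i = j then 1 else 0)"
  proof -
    have ij: "(i = 1 \<or> i = 2) \<and> (j = 1 \<or> j = 2)" using exhaust_2 by blast
    have e: "?a * (g $ 1 $ 1 * g $ 2 $ 2) = ?a * (1 + g $ 1 $ 2 * g $ 2 $ 1)" by (simp only: d)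
    show ?thesis using ij e unfolding Suc by (elim conjE disjE) (simp_all add: algebra_simps)
  qed
  finally show ?case by simp
qed

lemma twisted_trace_exists: assumes "g \<in> \<Gamma>" shows "\<exists>s. is_twisted_trace g s"
proof -
  let ?p = "g $ 1 $ 1" and ?q = "g $ 1 $ 2" and ?r = "g $ 2 $ 1" and ?s = "g $ 2 $ 2"
  let ?t = "?p + ?s"
  let ?a = "fst (cayley ?t N)" and ?b = "snd (cayley ?t N)"
  have gk: "g $ i $ j \<in> k" for i j using \<Gamma>_sl2[OF assms] by (simp add: sl2_def)
  have d: "?p * ?s = 1 + ?q * ?r"
    using \<Gamma>_sl2[OF assms] by (simp add: sl2_def det_2 algebra_simps)
  have "g [^]\<^bsub>G\<^esub> order G = \<one>\<^bsub>G\<^esub>" using G.pow_order_eq_1 assms by simp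
  then have "g [^]\<^bsub>G\<^esub> N = mat 1" by (simp add: order_def)
  then have pow: "?a * g $ i $ j - ?b * (if i = j then 1 else 0) = (if i = j then 1 else 0)" for i j
    using pow_entry[OF assms, of N i j] by (simp add: mat_def)
  have trI: "\<exists>s. is_twisted_trace g s"
    if "B ** B' = mat 1" "\<And>i. (g ** B) $ i $ 1 = l1 * B $ i $ 1" "\<And>i. (g ** B) $ i $ 2 = l2 * B $ i $ 2"
      "\<And>i m l. B $ i $ m * B' $ m $ l \<in> k" "l1 ^ N = 1" "l2 ^ N = 1" for B B' :: "complex^2^2" and l1 l2
    using eigenbasis_twisted_trace[OF eigenbasis_matrix[OF gk that(1-4) that(5,6) N_pos inv_one_minus_root_in]] by blast
  show ?thesis
  proof (cases "?q = 0 \<and> ?r = 0")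
    case True
    \<comment> \<open>The diagonal case stands apart because the eigenvalues may coincide in it, as
      for 1 and -1; the standard basis serves.\<close>
    have "?p * ?p = ?t * ?p - 1" "?s * ?s = ?t * ?s - 1" using d True by (simp_all add: algebra_simps)
    then have "?p ^ N = 1" "?s ^ N = 1"
      using cayley_root[of ?p ?t N] cayley_root[of ?s ?t N] pow[of 1 1] pow[of 2 2] by simp_all
    then show ?thesis

    proof (intro trI[of "mat 1" "mat 1" ?p ?s])
      show "(g ** mat 1) $ i $ 1 = ?p * mat 1 $ i $ 1" "(g ** mat 1) $ i $ 2 = ?s * mat 1 $ i $ 2" for i
        using True exhaust_2[of i] by (auto simp: matrix_mul_rid) (auto simp: mat_def)
    qed (simp_all, simp add: mat_def)
  next
    case False
    \<comment> \<open>The off-diagonal entries of \<open>g^N = a g - b = 1\<close> force a = 0 and b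
      = -1, after which every root of the characteristic polynomial is an N-th root of
      unity.\<close>
    have a0: "?a = 0" using pow[of 1 2] pow[of 2 1] False by auto
    then have b1: "?b = -1" using pow[of 1 1] by (simp add: eq_neg_iff_add_eq_0 add.commute neg_eq_iff_add_eq_0)
    define l1 where "l1 = (?t + csqrt (?t ^ 2 - 4)) / 2"
    define l2 where "l2 = (?t - csqrt (?t ^ 2 - 4)) / 2"
    have sum: "l1 + l2 = ?t" by (simp add: l1_def l2_def field_simps)
    have "csqrt (?t ^ 2 - 4) * csqrt (?t ^ 2 - 4) = ?t ^ 2 - 4" by (metis power2_csqrt power2_eq_square)
    then have prod: "l1 * l2 = 1" unfolding l1_def l2_def by (simp add: field_simps power2_eq_square)
    have "l1 * l1 = ?t * l1 - 1" "l2 * l2 = ?t * l2 - 1"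
      unfolding sum[symmetric] using prod by (simp_all add: algebra_simps)
    then have root: "l1 ^ N = 1" "l2 ^ N = 1"
      using cayley_root[of l1 ?t N] cayley_root[of l2 ?t N] a0 b1 by simp_all
    have ne: "l1 \<noteq> l2"
    proof
      assume "l1 = l2"
      then have "?t = 2 * l1" "l1 * l1 = 1" using sum prod by auto
      then have "?a = of_nat N * l1 ^ Suc N" using cayley_double[of l1 N] by simp
      then show False using a0 N_pos \<open>l1 * l1 = 1\<close> by auto
    qed
    have l1_nz: "l1 \<noteq> 0" using prod by auto
    have lk: "l1 \<in> k" "l2 \<in> k" using root root_in by auto
    \<comment> \<open>Since l1 l2 = 1, the inverse of l1 - l2 is l2 / (1 - l2 l2), and l2 l2 is an
      N-th root of unity other than 1.\<close>
    have "(l2 * l2) ^ N = 1" using root by (simp add: power_mult_distrib)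
    moreover have "l2 * l2 \<noteq> 1" 
    proof
      assume "l2 * l2 = 1"
      then have "(l1 - l2) * l2 = 0" using prod by (simp add: left_diff_distrib)
      then show False using prod ne by auto
    qed
    ultimately have "l2 * (1 / (1 - l2 * l2)) \<in> k" by (intro K_mult lk inv_one_minus_root_in)
    also have "l2 * (1 / (1 - l2 * l2)) = 1 / (l1 - l2)"
    proof -
      have "l2 \<noteq> 0" using prod by auto
      moreover have "1 - l2 * l2 = l2 * (l1 - l2)" using prod by (simp add: algebra_simps)
      ultimately show ?thesis by simp
    qed
    finally have \<Delta>: "1 / (l1 - l2) \<in> k" .
    have frac: "c \<in> k \<Longrightarrow> c / (l1 - l2) \<in> k" for c using K_mult[OF _ \<Delta>, of c] by simp
    have nz: "l1 - l2 \<noteq> 0" using ne by simp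
    have "(l1 - l2) * (l1 - l2) \<noteq> 0" using nz by simp
    then have sq: "l1 * l1 + l2 * l2 \<noteq> l1 * (l2 * 2)" by (simp add: algebra_simps)
    have ps: "?s = l1 + l2 - ?p" using sum by simp
    have qr: "?q * ?r = ?p * (l1 + l2 - ?p) - l1 * l2" using d prod ps by (simp add: algebra_simps)
    show ?thesis
    proof (cases "?r = 0")
      case r: False
      \<comment> \<open>The columns are the first columns of g - l2 and g - l1. By Cayley-Hamilton
        they are eigenvectors for l1 and l2.\<close>
      let ?B = "vector [vector [?p - l2, ?p - l1], vector [?r, ?r]] :: complex^2^2"
      let ?B' = "vector [vector [1 / (l1 - l2), - (?p - l1) / (?r * (l1 - l2))],
         vector [- 1 / (l1 - l2), (?p - l2) / (?r * (l1 - l2))]] :: complex^2^2"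
      \<comment> \<open>The entry r need not be a unit of K. In the projections it cancels, because
        q r = - (p - l1) (p - l2).\<close>
      have q: "?q = (?p * (l1 + l2 - ?p) - l1 * l2) / ?r" using qr r by (simp add: field_simps)
      have e12: "(?p - l2) * (- (?p - l1) / (?r * (l1 - l2))) = ?q / (l1 - l2)"
        unfolding q using r nz by (simp add: field_simps)
      have e12': "(?p - l1) * ((?p - l2) / (?r * (l1 - l2))) = - ?q / (l1 - l2)"
        unfolding q using r nz by (simp add: field_simps)
      show ?thesis
      proof (rule trI[of ?B ?B' l1 l2])
        show "?B ** ?B' = mat 1"
          using r nz sq by (simp add: vec_eq_iff forall_2 matrix_matrix_mult_def UNIV_2 mat_def) (simp add: field_simps)
        show "(g ** ?B) $ i $ 1 = l1 * ?B $ i $ 1" "(g ** ?B) $ i $ 2 = l2 * ?B $ i $ 2" for i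
          using exhaust_2[of i] qr by (auto simp: matrix_matrix_mult_def UNIV_2 ps algebra_simps)
        show "?B $ i $ m * ?B' $ m $ l \<in> k" for i m l
        proof -
          have "\<forall>i m l. ?B $ i $ m * ?B' $ m $ l \<in> k"
            unfolding forall_2 vector_2 e12 e12'
            using r frac[of "?p - l2"] frac[of ?q] frac[of ?r] frac[of "- (?p - l1)"] frac[of "- (?p - l2)"]
              frac[of "- ?q"] frac[of "- ?r"] frac[of "?p - l1"] K_minus gk lk
            by simp
          then show ?thesis by blast
        qed
      qed (fact root)+
    next
      case r: True
      then have q: "?q \<noteq> 0" using False by simp
      \<comment> \<open>Now the second columns of g - l2 and g - l1 are taken, since the first ones
        may vanish.\<close>
      let ?B = "vector [vector [?q, ?q], vector [l1 - ?p, l2 - ?p]] :: complex^2^2"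
      let ?B' = "vector [vector [- (l2 - ?p) / (?q * (l1 - l2)), 1 / (l1 - l2)],
         vector [(l1 - ?p) / (?q * (l1 - l2)), - 1 / (l1 - l2)]] :: complex^2^2"
      \<comment> \<open>A division by q survives only in products whose numerator is, up to sign,
        (l1 - p) (l2 - p), which is zero here.\<close>
      have z: "(l1 - ?p) * (l2 - ?p) = 0" using qr r by (simp add: algebra_simps)
      show ?thesis
      proof (rule trI[of ?B ?B' l1 l2])
        show "?B ** ?B' = mat 1"
          using q nz z sq by (simp add: vec_eq_iff forall_2 matrix_matrix_mult_def UNIV_2 mat_def) (auto simp: field_simps)
        show "(g ** ?B) $ i $ 1 = l1 * ?B $ i $ 1" "(g ** ?B) $ i $ 2 = l2 * ?B $ i $ 2" for i
          using exhaust_2[of i] qr r by (auto simp: matrix_matrix_mult_def UNIV_2 ps algebra_simps)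
        show "?B $ i $ m * ?B' $ m $ l \<in> k" for i m l
        proof -
          have "- ((l2 - ?p) / (l1 - l2)) \<in> k" "- ((l1 - ?p) / (l1 - l2)) \<in> k" "(l1 - ?p) / (l1 - l2) \<in> k"
            by (intro K_minus frac K_diff lk gk)+
          then have "\<forall>i m l. ?B $ i $ m * ?B' $ m $ l \<in> k"
            unfolding forall_2 vector_2
            using q z frac[of "- (l2 - ?p)"] frac[of ?q] frac[of "l1 - ?p"] frac[of "- ?q"] frac[of "- (l2 - ?p)"] K_minus gk lk
            by (auto simp: mult.commute)
          then show ?thesis by blast
        qed
      qed (fact root)+
    qed
  qed
qed

end

section \<open>The cyclic quotient of the skew group algebra\<close>

lemma sum_fun_apply: "(\<Sum>i\<in>I. f i) x = (\<Sum>i\<in>I. f i x)"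
  by (induct I rule: infinite_finite_induct) simp_all

lemma sum_const_cscale: "(\<Sum>i\<in>I. x) = of_nat (card I) *\<^sub>C x"
  by (induct I rule: infinite_finite_induct) (simp_all add: cscale_add_left)

context coeff_ring
begin

lemma pres_comp:
  assumes P: "pres M U N q" and L: "clin L" and Y: "ksub Y" "\<And>y. y \<in> Y \<Longrightarrow> L y \<in> U"
    and c: "c = (\<lambda>y. q (L y)) ` Y" and N': "N' = {y \<in> Y. L y \<in> N}"
  shows "pres (M\<lparr>carrier := c\<rparr>) Y N' (\<lambda>y. q (L y))"
  unfolding pres_def N' c
  using Y presD[OF P] L by (auto simp: clin_simps ksub_diff intro!: ksub_Collect_vimage)

text \<open>\<open>projective_mod\<close> requires a basis inside the type of the elements of the
  module, so the basis of words is carried there along an injection.\<close>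

definition free_embed :: "(ncword \<Rightarrow> 's) \<Rightarrow> ncpoly \<Rightarrow> 's \<Rightarrow> complex" where
  "free_embed j f = (\<lambda>t. if t \<in> range j then Poly_Mapping.lookup f (inv_into UNIV j t) else 0)"

lemma pres_free_mod:
  assumes "inj j" shows "pres (free_mod K (range j)) F {0} (free_embed j)"
proof -
  have e: "free_embed j f (j w) = Poly_Mapping.lookup f w" for f w
    using assms by (simp add: free_embed_def)
  have z: "t \<notin> range j \<Longrightarrow> free_embed j f t = 0" for f t by (simp add: free_embed_def)
  have supp: "{t. free_embed j f t \<noteq> 0} = j ` Poly_Mapping.keys f" for f
  proof (rule Set.set_eqI)
    show "t \<in> {t. free_embed j f t \<noteq> 0} \<longleftrightarrow> t \<in> j ` Poly_Mapping.keys f" for t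
      using z[of t f] by (cases "t \<in> range j") (auto simp: e in_keys_iff inj_image_mem_iff[OF assms])
  qed
  have "\<exists>f\<in>F. \<phi> = free_embed j f"
    if \<phi>: "\<forall>t. \<phi> t \<in> k" "\<forall>t. t \<notin> range j \<longrightarrow> \<phi> t = 0" "finite {t. \<phi> t \<noteq> 0}" for \<phi>
  proof -
    have "finite {w. \<phi> (j w) \<noteq> 0}"
      using finite_vimageI[OF \<phi>(3) assms] by (simp add: vimage_def)
    then have l: "Poly_Mapping.lookup (Abs_poly_mapping (\<lambda>w. \<phi> (j w))) = (\<lambda>w. \<phi> (j w))"
      by (rule lookup_Abs_poly_mapping)
    have "\<phi> = free_embed j (Abs_poly_mapping (\<lambda>w. \<phi> (j w)))"
    proof
      fix t show "\<phi> t = free_embed j (Abs_poly_mapping (\<lambda>w. \<phi> (j w))) t"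
        using \<phi>(2) by (cases "t \<in> range j") (auto simp: e l z)
    qed
    moreover have "Abs_poly_mapping (\<lambda>w. \<phi> (j w)) \<in> F" using \<phi>(1) by (simp add: monoid_alg_def l)
    ultimately show ?thesis by blast
  qed
  note onto = this
  have "free_embed j f t \<in> k" if "f \<in> F" for f t
    using that by (cases "t \<in> range j") (auto simp: e z monoid_alg_def)
  then have "free_embed j f \<in> carrier (free_mod K (range j))" if "f \<in> F" for f
    using that by (simp add: free_mod_def supp z)
  then have surj: "free_embed j ` F = carrier (free_mod K (range j))"
  proof (intro antisym subsetI)
    fix \<phi> assume "\<phi> \<in> carrier (free_mod K (range j))"
    then show "\<phi> \<in> free_embed j ` F" using onto[of \<phi>] by (auto simp: free_mod_def)
  qed blast
  have inj: "free_embed j f = free_embed j g \<longleftrightarrow> f = g" for f g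
  proof
    assume *: "free_embed j f = free_embed j g"
    show "f = g"
    proof (rule poly_mapping_eqI)
      show "Poly_Mapping.lookup f w = Poly_Mapping.lookup g w" for w
        using fun_cong[OF *, of "j w"] by (simp add: e)
    qed
  qed simp
  show ?thesis
    unfolding pres_def using surj inj
    by (auto simp: ksub_F ksub_singleton_0 ksub_zero[OF ksub_F])
      (auto simp: free_mod_def free_embed_def)
qed

text \<open>The map \<open>r\<close> kills \<open>N\<close> and is the identity modulo
  \<open>N\<close>, so it descends to a section of the quotient map. The quotient is thereby a
  direct summand of the free module of noncommutative polynomials.\<close>

lemma retract_projective:
  fixes M :: "(complex, 'b) module" and j :: "ncword \<Rightarrow> 'b"
  assumes P: "pres M F N q" and r: "clin r" "\<And>f. f \<in> F \<Longrightarrow> r f \<in> F" "\<And>f. f \<in> N \<Longrightarrow> r f = 0"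
    "\<And>f. f \<in> F \<Longrightarrow> f - r f \<in> N" and j: "inj j"
  shows "projective_mod K M" "torsion_free K M"
proof -
  note PF = pres_free_mod[OF j]
  define i where "i m = free_embed j (r (SOME f. f \<in> F \<and> m = q f))" for m
  define p where "p \<phi> = q (SOME f. f \<in> F \<and> \<phi> = free_embed j f)" for \<phi>
  have i: "i (q f) = free_embed j (r f)" if "f \<in> F" for f
  proof -
    define e where "e = (SOME f'. f' \<in> F \<and> q f = q f')"
    have "\<exists>f'. f' \<in> F \<and> q f = q f'" using that by blast
    from someI_ex[OF this] have "e \<in> F" "q e = q f" by (simp_all add: e_def)
    then have "e - f \<in> N" using presD(7)[OF P, of e f] that by simp
    from r(3)[OF this] show ?thesis by (simp add: i_def e_def clin_simps[OF r(1)])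
  qed
  have p: "p (free_embed j f) = q f" if "f \<in> F" for f
  proof -
    define e where "e = (SOME f'. f' \<in> F \<and> free_embed j f = free_embed j f')"
    have "\<exists>f'. f' \<in> F \<and> free_embed j f = free_embed j f'" using that by blast
    from someI_ex[OF this] have "e \<in> F" "free_embed j e = free_embed j f" by (simp_all add: e_def)
    then have "e = f" using presD(7)[OF PF, of e f] that by simp
    then show ?thesis by (simp add: p_def e_def)
  qed
  have "i \<in> mod_hom K M (free_mod K (range j))"
    by (rule pres_hom[OF P PF, of r]) (auto simp: r clin_simps[OF r(1)] i)
  moreover have "p \<in> mod_hom K (free_mod K (range j)) M"
    by (rule pres_hom[OF PF P, of "\<lambda>f. f"]) (auto simp: p ksub_zero[OF presD(2)[OF P]])
  moreover have "p (i m) = m" if "m \<in> carrier M" for m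
  proof -
    obtain f where f: "f \<in> F" "m = q f" using pres_surj[OF P] \<open>m \<in> carrier M\<close> by blast
    then have "q f = q (r f)" using presD(7)[OF P, of f "r f"] r by simp
    then show ?thesis unfolding f(2) i[OF f(1)] p[OF r(2)[OF f(1)]] by (rule sym)
  qed
  ultimately show "projective_mod K M"
    unfolding projective_mod_def using pres_module[OF P] by blast
  show "torsion_free K M"
  proof (rule pres_torsion_free[OF P])
    fix c f assume "c \<in> k" "c \<noteq> 0" "f \<in> F" "c *\<^sub>C f \<in> N"
    then have "r f = 0" using r(3)[of "c *\<^sub>C f"] by (simp add: clin_simps[OF r(1)])
    then show "f \<in> N" using r(4)[OF \<open>f \<in> F\<close>] by simp
  qed
qed

end

type_synonym skewfun = "complex^2^2 \<Rightarrow> ncpoly"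

section \<open>Lifting the skew group algebra to the free algebra\<close>

definition sgl :: "complex^2^2 \<Rightarrow> ncpoly \<Rightarrow> skewfun" where
  "sgl g a = (\<lambda>h. if h = g then a else 0)"

lemma clin_sgl: "clin (sgl g)"
  by (rule clinI) (auto simp: sgl_def fun_eq_iff)

lemmas sgl_linear = clin_simps[OF clin_sgl]

context finite_sl2
begin

text \<open>The lifts vanish off \<Gamma>, whereas the elements of \<open>skew_alg\<close> are
  undefined there; this way they lie in a complex vector space.\<close>

definition skU :: "skewfun set" where
  "skU = {f. (\<forall>g\<in>\<Gamma>. f g \<in> F) \<and> (\<forall>g. g \<notin> \<Gamma> \<longrightarrow> f g = 0)}"

definition skN :: "skewfun set" where
  "skN = {f \<in> skU. \<forall>g\<in>\<Gamma>. expA (f g) = 0}"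

definition skq :: "skewfun \<Rightarrow> complex^2^2 \<Rightarrow> ncpoly set" where
  "skq f = (\<lambda>g\<in>\<Gamma>. clsA K (f g))"

definition skmult :: "skewfun \<Rightarrow> skewfun \<Rightarrow> skewfun" where
  "skmult f h = (\<lambda>\<gamma>. if \<gamma> \<in> \<Gamma> then \<Sum>\<delta>\<in>\<Gamma>. f \<delta> * act_free \<delta> (h (gi \<delta> ** \<gamma>)) else 0)"

lemma ksub_skU: "ksub skU"
  by (auto simp: ksub_def skU_def alg_in)

lemma ksub_skN: "ksub skN"
  using ksub_skU by (auto simp: ksub_def skN_def expA_linear)

lemma sgl_skU [simp]: "g \<in> \<Gamma> \<Longrightarrow> a \<in> F \<Longrightarrow> sgl g a \<in> skU"
  by (auto simp: sgl_def skU_def alg_in)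

lemma skmult_skU: "f \<in> skU \<Longrightarrow> h \<in> skU \<Longrightarrow> skmult f h \<in> skU"
  by (auto simp: skU_def skmult_def alg_in)

lemma skU_F: "f \<in> skU \<Longrightarrow> f g \<in> F"
  by (cases "g \<in> \<Gamma>") (auto simp: skU_def alg_in)

lemma pres_skewA: "pres (skewA K \<Gamma>) skU skN skq"
proof -
  have car: "carrier (skewA K \<Gamma>) = \<Gamma> \<rightarrow>\<^sub>E carrier (algA K)"
    by (simp add: skewA_def skew_alg_def)
  have "\<exists>f\<in>skU. a = skq f" if a: "a \<in> \<Gamma> \<rightarrow>\<^sub>E carrier (algA K)" for a
  proof -
    have "\<forall>g\<in>\<Gamma>. \<exists>f. f \<in> F \<and> a g = clsA K f"
    proof
      fix g assume "g \<in> \<Gamma>"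
      then have "a g \<in> carrier (algA K)" using a by (rule PiE_mem[rotated])
      then show "\<exists>f. f \<in> F \<and> a g = clsA K f" by (rule algA_E) blast
    qed
    from bchoice[OF this] obtain f where f: "\<forall>g\<in>\<Gamma>. f g \<in> F \<and> a g = clsA K (f g)" ..
    let ?f = "\<lambda>g. if g \<in> \<Gamma> then f g else 0"
    have "a = skq ?f"
    proof
      show "a g = skq ?f g" for g
        using f PiE_arb[OF a, of g] by (cases "g \<in> \<Gamma>") (simp_all add: skq_def)
    qed
    moreover have "?f \<in> skU" using f by (auto simp: skU_def)
    ultimately show ?thesis by blast
  qed
  then have "\<Gamma> \<rightarrow>\<^sub>E carrier (algA K) \<subseteq> skq ` skU" by blast
  moreover have "skq f \<in> \<Gamma> \<rightarrow>\<^sub>E carrier (algA K)" if "f \<in> skU" for f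
    using that by (simp add: skq_def skU_def)
  ultimately have surj: "skq ` skU = carrier (skewA K \<Gamma>)"
    unfolding car by blast
  have eq: "skq f = skq h \<longleftrightarrow> f - h \<in> skN" if "f \<in> skU" "h \<in> skU" for f h
  proof -
    have "skq f = skq h \<longleftrightarrow> (\<forall>g\<in>\<Gamma>. clsA K (f g) = clsA K (h g))"
      by (auto simp: skq_def restrict_def fun_eq_iff)
    also have "\<dots> \<longleftrightarrow> (\<forall>g\<in>\<Gamma>. expA (f g - h g) = 0)"
      using that by (simp add: clsA_eq skU_F expA_linear)
    also have "\<dots> \<longleftrightarrow> f - h \<in> skN" using ksub_diff[OF ksub_skU that] by (simp add: skN_def)
    finally show ?thesis .
  qed
  show ?thesis
    unfolding pres_def
  proof (intro conjI ballI ksub_skU ksub_skN surj)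
    show "skN \<subseteq> skU" by (auto simp: skN_def)
    show "skq (f + h) = skq f \<oplus>\<^bsub>skewA K \<Gamma>\<^esub> skq h" if "f \<in> skU" "h \<in> skU" for f h
      using that by (auto simp: skewA_def skew_alg_def skq_def fun_eq_iff presD(5)[OF pres_algA] skU_F)
    show "skq (c *\<^sub>C f) = c \<odot>\<^bsub>skewA K \<Gamma>\<^esub> skq f" if "c \<in> k" "f \<in> skU" for c f
      using that by (auto simp: skewA_def skew_alg_def skq_def fun_eq_iff presD(6)[OF pres_algA] skU_F)
    show "skq 0 = \<zero>\<^bsub>skewA K \<Gamma>\<^esub>"
      by (auto simp: skewA_def skew_alg_def skq_def fun_eq_iff presD(8)[OF pres_algA])
  qed (use eq in auto)
qed

lemma skq_mult: assumes "f \<in> skU" "h \<in> skU" shows "skq f \<otimes>\<^bsub>skewA K \<Gamma>\<^esub> skq h = skq (skmult f h)"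
proof -
  have "skq f \<otimes>\<^bsub>skewA K \<Gamma>\<^esub> skq h =
    (\<lambda>\<gamma>\<in>\<Gamma>. \<Oplus>\<^bsub>algA K\<^esub>\<delta>\<in>\<Gamma>. skq f \<delta> \<otimes>\<^bsub>algA K\<^esub> actA \<delta> (skq h (gi \<delta> ** \<gamma>)))"
    by (simp add: skewA_def skew_alg_def)
  also have "\<dots> = skq (skmult f h)"
    unfolding skq_def[of "skmult f h"]
  proof (rule restrict_ext)
    fix \<gamma> assume \<gamma>: "\<gamma> \<in> \<Gamma>"
    have "(\<Oplus>\<^bsub>algA K\<^esub>\<delta>\<in>\<Gamma>. skq f \<delta> \<otimes>\<^bsub>algA K\<^esub> actA \<delta> (skq h (gi \<delta> ** \<gamma>))) =
       (\<Oplus>\<^bsub>algA K\<^esub>\<delta>\<in>\<Gamma>. clsA K (f \<delta> * act_free \<delta> (h (gi \<delta> ** \<gamma>))))"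
    proof -
      interpret A: ring "algA K" by (rule ring_algA)
      show ?thesis
      proof (rule A.finsum_cong'[OF refl])
        fix \<delta> assume \<delta>: "\<delta> \<in> \<Gamma>"
        then show "skq f \<delta> \<otimes>\<^bsub>algA K\<^esub> actA \<delta> (skq h (gi \<delta> ** \<gamma>)) = clsA K (f \<delta> * act_free \<delta> (h (gi \<delta> ** \<gamma>)))"
          using \<gamma> assms by (simp add: skq_def actA_clsA \<Gamma>_sl2 skU_F clsA_mult)
      qed (use assms in \<open>auto simp: skU_F alg_in\<close>)
    qed
    also have "\<dots> = clsA K (\<Sum>\<delta>\<in>\<Gamma>. f \<delta> * act_free \<delta> (h (gi \<delta> ** \<gamma>)))"
      by (rule pres_finsum[OF pres_algA fin]) (use assms in \<open>auto simp: skU_F alg_in\<close>)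
    finally show "(\<Oplus>\<^bsub>algA K\<^esub>\<delta>\<in>\<Gamma>. skq f \<delta> \<otimes>\<^bsub>algA K\<^esub> actA \<delta> (skq h (gi \<delta> ** \<gamma>))) = clsA K (skmult f h \<gamma>)"
      using \<gamma> by (simp add: skmult_def)
  qed
  finally show ?thesis .
qed

definition skcomm :: "skewfun set" where
  "skcomm = kspan ({skmult f h - skmult h f | f h. f \<in> skU \<and> h \<in> skU} \<union> skN)"

lemma ksub_skcomm: "ksub skcomm" by (simp add: skcomm_def ksub_kspan)

lemma skN_skcomm: "skN \<subseteq> skcomm" unfolding skcomm_def by (auto intro: kspan_base)

lemma skcomm_skU: "skcomm \<subseteq> skU"
  unfolding skcomm_def by (rule kspan_minimal[OF _ ksub_skU]) (auto simp: skmult_skU ksub_diff[OF ksub_skU] skN_def)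

lemma comm_span_skewA: "comm_span K (skewA K \<Gamma>) (carrier (skewA K \<Gamma>)) (carrier (skewA K \<Gamma>)) = skq ` skcomm"
proof -
  have "{s \<otimes>\<^bsub>skewA K \<Gamma>\<^esub> t \<ominus>\<^bsub>skewA K \<Gamma>\<^esub> t \<otimes>\<^bsub>skewA K \<Gamma>\<^esub> s | s t. s \<in> skq ` skU \<and> t \<in> skq ` skU} =
     skq ` {skmult f h - skmult h f | f h. f \<in> skU \<and> h \<in> skU}" (is "?L = ?R")
  proof
    show "?L \<subseteq> ?R"
    proof safe
      fix f h assume "f \<in> skU" "h \<in> skU"
      then show "skq f \<otimes>\<^bsub>skewA K \<Gamma>\<^esub> skq h \<ominus>\<^bsub>skewA K \<Gamma>\<^esub> skq h \<otimes>\<^bsub>skewA K \<Gamma>\<^esub> skq f \<in> ?R"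
        by (auto simp: skq_mult pres_diff[OF pres_skewA] skmult_skU)
    qed
    show "?R \<subseteq> ?L"
    proof safe
      fix f h assume "f \<in> skU" "h \<in> skU"
      then have "skq (skmult f h - skmult h f) = skq f \<otimes>\<^bsub>skewA K \<Gamma>\<^esub> skq h \<ominus>\<^bsub>skewA K \<Gamma>\<^esub> skq h \<otimes>\<^bsub>skewA K \<Gamma>\<^esub> skq f"
        by (simp add: skq_mult pres_diff[OF pres_skewA] skmult_skU)
      then show "\<exists>s t. skq (skmult f h - skmult h f) =
          s \<otimes>\<^bsub>skewA K \<Gamma>\<^esub> t \<ominus>\<^bsub>skewA K \<Gamma>\<^esub> t \<otimes>\<^bsub>skewA K \<Gamma>\<^esub> s \<and> s \<in> skq ` skU \<and> t \<in> skq ` skU"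
        using \<open>f \<in> skU\<close> \<open>h \<in> skU\<close> by blast
    qed
  qed
  moreover have "{skmult f h - skmult h f | f h. f \<in> skU \<and> h \<in> skU} \<subseteq> skU"
    by (auto simp: skmult_skU ksub_diff[OF ksub_skU])
  ultimately show ?thesis
    unfolding comm_span_def skcomm_def presD(4)[OF pres_skewA, symmetric]
    by (simp only: pres_span_Un[OF pres_skewA])
qed

definition skcls :: "skewfun \<Rightarrow> (complex^2^2 \<Rightarrow> ncpoly set) set" where
  "skcls f = cyc_class K (skewA K \<Gamma>) (skq f)"

lemma pres_skew_cyc: "pres (skew_cyc K \<Gamma>) skU skcomm skcls"
  unfolding skew_cyc_def cyc_def skcls_def[abs_def] cyc_class_def comm_span_skewA
  by (rule pres_quot[OF pres_skewA ksub_skcomm skN_skcomm skcomm_skU])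

text \<open>Carries the components on the conjugacy class of \<gamma> to \<gamma> and adds them up;
  a component occurs once for every g that conjugates its group element to \<gamma>.\<close>

definition conj_avg :: "complex^2^2 \<Rightarrow> skewfun \<Rightarrow> ncpoly" where
  "conj_avg \<gamma> f = (\<Sum>g\<in>\<Gamma>. act_free g (f (gi g ** (\<gamma> ** g))))"

lemma clin_conj_avg: "clin (conj_avg \<gamma>)"
  unfolding conj_avg_def
  by (rule clin_sum_fun) (auto simp: clin_def act_linear)

lemma conj_avg_skmult:
  assumes "\<gamma> \<in> \<Gamma>"
  shows "conj_avg \<gamma> (skmult f h) = (\<Sum>g\<in>\<Gamma>. \<Sum>\<delta>\<in>\<Gamma>. act_free g (f \<delta>) * act_free (g ** \<delta>) (h (gi \<delta> ** (gi g ** (\<gamma> ** g)))))"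
  unfolding conj_avg_def using assms
  by (intro sum.cong) (simp_all add: skmult_def act_linear act_mult act_free_compose)

text \<open>At the identity the choice is pinned to \<open>cyc_trace\<close>, with which the summand
  of the trivial class is computed.\<close>

definition twtr :: "complex^2^2 \<Rightarrow> ncpoly \<Rightarrow> ncpoly" where
  "twtr g = (if g = mat 1 then cyc_trace else (SOME s. is_twisted_trace g s))"

lemma twtr: assumes "g \<in> \<Gamma>" shows "is_twisted_trace g (twtr g)"
  using someI_ex[OF twisted_trace_exists[OF assms]] cyc_trace_twisted by (auto simp: twtr_def)

lemma clin_twtr: "g \<in> \<Gamma> \<Longrightarrow> clin (twtr g)"
  and twtr_comm: "g \<in> \<Gamma> \<Longrightarrow> twtr g (a * c) = twtr g (c * act_free g a)"
  and twtr_F: "g \<in> \<Gamma> \<Longrightarrow> f \<in> F \<Longrightarrow> twtr g f \<in> F"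
  and twtr_sub: "g \<in> \<Gamma> \<Longrightarrow> f \<in> F \<Longrightarrow> f - twtr g f \<in> twist_comm g"
  using twtr[of g] by (auto simp: is_twisted_trace_def)

text \<open>The twisted trace exchanges the two factors of every summand, and a substitution in the
  double sum over \<Gamma> restores the original shape with the roles of f and h exchanged.\<close>

lemma conj_avg_comm:
  assumes "\<gamma> \<in> \<Gamma>"
  shows "twtr \<gamma> (expA (conj_avg \<gamma> (skmult f h))) = twtr \<gamma> (expA (conj_avg \<gamma> (skmult h f)))"
proof -
  note lin = clin_simps[OF clin_twtr[OF assms]]
  let ?t = "\<lambda>f. twtr \<gamma> (expA f)"
  have comm: "?t (a * c) = ?t (c * act_free \<gamma> a)" for a c
    using twtr_comm[OF assms, of "expA a" "expA c"] by (simp add: expA_mult expA_act[OF \<Gamma>_sl2[OF assms]])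
  have "?t (conj_avg \<gamma> (skmult f h)) =
    (\<Sum>(g, \<delta>)\<in>\<Gamma> \<times> \<Gamma>. ?t (act_free g (f \<delta>) * act_free (g ** \<delta>) (h (gi \<delta> ** (gi g ** (\<gamma> ** g))))))"
    by (simp add: conj_avg_skmult[OF assms] lin expA_linear sum.cartesian_product case_prod_unfold)
  also have "\<dots> = (\<Sum>(g, \<delta>)\<in>\<Gamma> \<times> \<Gamma>. ?t (act_free (g ** \<delta>) (h (gi \<delta> ** (gi g ** (\<gamma> ** g)))) * act_free (\<gamma> ** g) (f \<delta>)))"
    by (rule sum.cong[OF refl]) (auto simp: act_free_compose intro: comm[THEN trans])
  also have "\<dots> = (\<Sum>(g, \<delta>)\<in>\<Gamma> \<times> \<Gamma>. ?t (act_free g (h \<delta>) * act_free (g ** \<delta>) (f (gi \<delta> ** (gi g ** (\<gamma> ** g))))))"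
  \<comment> \<open>The new pair consists of the element that now acts on the value of h and the
    argument of h; their product is \<gamma> g, the element that acts on the value of f.\<close>
  proof (rule sum.reindex_bij_witness[where i = "\<lambda>(g, \<delta>). (gi \<gamma> ** (g ** \<delta>), gi \<delta> ** (gi g ** (\<gamma> ** g)))"
        and j = "\<lambda>(g, \<delta>). (g ** \<delta>, gi \<delta> ** (gi g ** (\<gamma> ** g)))"], goal_cases)
    case (1 p) then show ?case using assms by (auto simp: gi_mult matrix_mul_assoc[symmetric])
  next
    case (2 p) then show ?case using assms by auto
  next
    case (3 p) then show ?case using assms by (auto simp: gi_mult matrix_mul_assoc[symmetric])
  next
    case (4 p) then show ?case using assms by auto
  next
    case (5 p) then show ?case using assms by (auto simp: gi_mult matrix_mul_assoc[symmetric])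
  qed
  also have "\<dots> = ?t (conj_avg \<gamma> (skmult h f))"
    by (simp add: conj_avg_skmult[OF assms] lin expA_linear sum.cartesian_product case_prod_unfold)
  finally show ?thesis .
qed

lemma conj_avg_skcomm:
  assumes "\<gamma> \<in> \<Gamma>" "f \<in> skcomm" shows "twtr \<gamma> (expA (conj_avg \<gamma> f)) = 0"
proof -
  note lin = clin_simps[OF clin_twtr[OF assms(1)]]
  have c: "clin (\<lambda>f. twtr \<gamma> (expA (conj_avg \<gamma> f)))"
    by (intro clin_comp[OF clin_twtr[OF assms(1)]] lin_expA clin_conj_avg)
  have "twtr \<gamma> (expA (conj_avg \<gamma> f)) \<in> {0}"
    using assms(2) unfolding skcomm_def
  proof (rule kspan_lin_in[OF c ksub_singleton_0, rotated])
    fix f assume "f \<in> {skmult f h - skmult h f | f h. f \<in> skU \<and> h \<in> skU} \<union> skN"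
    then show "twtr \<gamma> (expA (conj_avg \<gamma> f)) \<in> {0}"
    proof
      assume "f \<in> {skmult f h - skmult h f | f h. f \<in> skU \<and> h \<in> skU}"
      then show ?thesis using conj_avg_comm[OF assms(1)]
        by (auto simp: clin_simps[OF clin_conj_avg] expA_linear lin)
    next
      assume "f \<in> skN"
      then have "expA (conj_avg \<gamma> f) = 0"
        using assms(1) by (auto simp: conj_avg_def expA_linear expA_act \<Gamma>_sl2 skN_def act_linear intro!: sum.neutral)
      then show ?thesis by (simp add: lin)
    qed
  qed
  then show ?thesis by simp
qed

lemma skmult_sgl:
  assumes "\<delta> \<in> \<Gamma>" "\<epsilon> \<in> \<Gamma>"
  shows "skmult (sgl \<delta> a) (sgl \<epsilon> b) = sgl (\<delta> ** \<epsilon>) (a * act_free \<delta> b)"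
proof
  fix \<gamma> show "skmult (sgl \<delta> a) (sgl \<epsilon> b) \<gamma> = sgl (\<delta> ** \<epsilon>) (a * act_free \<delta> b) \<gamma>"
  proof (cases "\<gamma> \<in> \<Gamma>")
    case True
    have "(\<Sum>\<eta>\<in>\<Gamma>. sgl \<delta> a \<eta> * act_free \<eta> (sgl \<epsilon> b (gi \<eta> ** \<gamma>))) =
        (\<Sum>\<eta>\<in>\<Gamma>. if \<eta> = \<delta> then a * act_free \<delta> (sgl \<epsilon> b (gi \<delta> ** \<gamma>)) else 0)"
      by (rule sum.cong) (auto simp: sgl_def)
    also have "\<dots> = a * act_free \<delta> (sgl \<epsilon> b (gi \<delta> ** \<gamma>))" using fin assms(1) by simp
    also have "\<dots> = sgl (\<delta> ** \<epsilon>) (a * act_free \<delta> b) \<gamma>"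
      using assms True by (auto simp: sgl_def act_linear)
    finally show ?thesis using True by (simp add: skmult_def)
  next
    case False then show ?thesis using assms by (auto simp: skmult_def sgl_def)
  qed
qed

lemma skcomm_base: "f \<in> skU \<Longrightarrow> h \<in> skU \<Longrightarrow> skmult f h - skmult h f \<in> skcomm"
  unfolding skcomm_def by (rule kspan_base) blast

text \<open>The commutator of g with a \<delta> \<open>g^(-1)\<close>.\<close>

lemma sgl_conj:
  assumes "\<delta> \<in> \<Gamma>" "g \<in> \<Gamma>" "a \<in> F" shows "sgl (g ** (\<delta> ** gi g)) (act_free g a) - sgl \<delta> a \<in> skcomm"
  using skcomm_base[of "sgl g 1" "sgl (\<delta> ** gi g) a"] assms
  by (simp add: skmult_sgl matrix_mul_assoc[symmetric])

lemma sgl_twist: assumes "\<gamma> \<in> \<Gamma>" "f \<in> twist_comm \<gamma>" shows "sgl \<gamma> f \<in> skcomm"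
  using assms(2) unfolding twist_comm_def
proof (rule kspan_lin_in[OF clin_sgl ksub_skcomm, rotated], safe)
  fix a c assume "a \<in> F" "c \<in> F"
  then show "sgl \<gamma> (a * c - c * act_free \<gamma> a) \<in> skcomm"
    using skcomm_base[of "sgl (mat 1) a" "sgl \<gamma> c"] assms(1) by (simp add: skmult_sgl sgl_linear)
qed

section \<open>Normal forms at one group element\<close>

definition centr :: "complex^2^2 \<Rightarrow> (complex^2^2) set" where
  "centr \<gamma> = {g \<in> \<Gamma>. g ** \<gamma> = \<gamma> ** g}"

text \<open>By Lagrange, the inverse is the index of the centralizer times the inverse of the order
  of \<Gamma>.\<close>

lemma centr_card_inv: assumes "\<gamma> \<in> \<Gamma>" shows "1 / of_nat (card (centr \<gamma>)) \<in> k" "card (centr \<gamma>) > 0"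
proof -
  have "subgroup (centr \<gamma>) G"
  proof (rule G.subgroupI)
    show "centr \<gamma> \<subseteq> carrier G" by (auto simp: centr_def)
    have "mat 1 \<in> centr \<gamma>" by (simp add: centr_def)
    then show "centr \<gamma> \<noteq> {}" by blast
  next
    fix g assume g: "g \<in> centr \<gamma>"
    then have "g ** \<gamma> = \<gamma> ** g" "g \<in> \<Gamma>" by (auto simp: centr_def)
    then have "gi g ** (g ** (\<gamma> ** gi g)) = gi g ** (\<gamma> ** (g ** gi g))"
      by (simp add: matrix_mul_assoc) (simp add: matrix_mul_assoc[symmetric])
    then show "gi g \<in> centr \<gamma>" using \<open>g \<in> \<Gamma>\<close> by (simp add: centr_def)
  next
    fix g h assume "g \<in> centr \<gamma>" "h \<in> centr \<gamma>"
    then show "g \<otimes>\<^bsub>G\<^esub> h \<in> centr \<gamma>"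
      by (simp add: centr_def) (metis matrix_mul_assoc)
  qed
  from G.lagrange[OF this] have l: "card (rcosets\<^bsub>G\<^esub> centr \<gamma>) * card (centr \<gamma>) = N" by (simp add: order_def)
  then show pos: "card (centr \<gamma>) > 0" using N_pos by (metis gr0I mult_0_right not_gr_zero)
  have "of_nat (card (rcosets\<^bsub>G\<^esub> centr \<gamma>)) * (1 / of_nat N) \<in> k" using order_inv by (intro K_mult) auto
  moreover have "of_nat N = of_nat (card (rcosets\<^bsub>G\<^esub> centr \<gamma>)) * (of_nat (card (centr \<gamma>)) :: complex)"
    by (simp flip: l)
  moreover have "card (rcosets\<^bsub>G\<^esub> centr \<gamma>) \<noteq> 0" using l N_pos by (metis mult_0 not_gr_zero)
  ultimately show "1 / of_nat (card (centr \<gamma>)) \<in> k" by simp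
qed

definition cavg :: "complex^2^2 \<Rightarrow> ncpoly \<Rightarrow> ncpoly" where
  "cavg \<gamma> b = (1 / of_nat (card (centr \<gamma>))) *\<^sub>C (\<Sum>g\<in>centr \<gamma>. act_free g b)"

lemma clin_cavg: "clin (cavg \<gamma>)"
  unfolding cavg_def by (intro clin_scaled clin_sum_fun clin_act)

lemma cavg_F: "\<gamma> \<in> \<Gamma> \<Longrightarrow> b \<in> F \<Longrightarrow> cavg \<gamma> b \<in> F"
  unfolding cavg_def using centr_card_inv by (intro ksub_cscale[OF ksub_F] ksub_sum[OF ksub_F]) (auto simp: centr_def)

text \<open>Each of the three operations stays within one class modulo commutators, and together
  they annihilate all commutators supported at \<gamma> (\<open>sgl_skcomm_iff\<close>). The result
  is a projection, as \<open>retract_projective\<close> requires.\<close>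

definition nform :: "complex^2^2 \<Rightarrow> ncpoly \<Rightarrow> ncpoly" where
  "nform \<gamma> b = twtr \<gamma> (expA (cavg \<gamma> b))"

lemma clin_nform: "\<gamma> \<in> \<Gamma> \<Longrightarrow> clin (nform \<gamma>)"
  unfolding nform_def by (intro clin_comp[OF clin_twtr] lin_expA clin_cavg)

lemma nform_F: "\<gamma> \<in> \<Gamma> \<Longrightarrow> b \<in> F \<Longrightarrow> nform \<gamma> b \<in> F"
  by (simp add: nform_def twtr_F expA_in cavg_F)

lemma sgl_nform: assumes "\<gamma> \<in> \<Gamma>" "b \<in> F" shows "sgl \<gamma> (b - nform \<gamma> b) \<in> skcomm"
proof -
  have avg: "sgl \<gamma> (b - cavg \<gamma> b) \<in> skcomm"
  proof -
    have "sgl \<gamma> (act_free g b) - sgl \<gamma> b \<in> skcomm" if "g \<in> centr \<gamma>" for g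
    proof -
      have g: "g \<in> \<Gamma>" "g ** \<gamma> = \<gamma> ** g" using that by (auto simp: centr_def)
      then have "g ** (\<gamma> ** gi g) = \<gamma>" by (simp add: matrix_mul_assoc) (simp add: matrix_mul_assoc[symmetric])
      then show ?thesis using sgl_conj[OF assms(1) g(1) assms(2)] by simp
    qed
    then have "(1 / of_nat (card (centr \<gamma>))) *\<^sub>C (\<Sum>g\<in>centr \<gamma>. sgl \<gamma> (act_free g b) - sgl \<gamma> b) \<in> skcomm"
      using centr_card_inv[OF assms(1)] by (intro ksub_cscale[OF ksub_skcomm] ksub_sum[OF ksub_skcomm]) auto
    also have "(\<Sum>g\<in>centr \<gamma>. sgl \<gamma> (act_free g b) - sgl \<gamma> b) =
        sgl \<gamma> ((\<Sum>g\<in>centr \<gamma>. act_free g b) - of_nat (card (centr \<gamma>)) *\<^sub>C b)"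
      by (simp add: sum_subtractf sgl_linear sum_const_cscale del: sum_constant)
    also have "(1 / of_nat (card (centr \<gamma>))) *\<^sub>C \<dots> = sgl \<gamma> (cavg \<gamma> b - b)"
      using centr_card_inv(2)[OF assms(1)] by (simp add: cavg_def cscale_diff_right flip: sgl_linear)
    finally have "sgl \<gamma> (cavg \<gamma> b - b) \<in> skcomm" .
    from ksub_minus[OF ksub_skcomm this] show ?thesis by (simp flip: clin_minus[OF clin_sgl])
  qed
  have c: "cavg \<gamma> b \<in> F" using assms by (rule cavg_F)
  have "sgl \<gamma> (cavg \<gamma> b - expA (cavg \<gamma> b)) \<in> skN"
    using sgl_skU[OF assms(1), of "cavg \<gamma> b - expA (cavg \<gamma> b)"] c
    by (auto simp: skN_def expA_in alg_in) (auto simp: sgl_def expA_linear)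
  then have e: "sgl \<gamma> (cavg \<gamma> b - expA (cavg \<gamma> b)) \<in> skcomm" using skN_skcomm by blast
  have "sgl \<gamma> (expA (cavg \<gamma> b) - nform \<gamma> b) \<in> skcomm"
    unfolding nform_def by (rule sgl_twist[OF assms(1) twtr_sub[OF assms(1) expA_in[OF c]]])
  from ksub_add[OF ksub_skcomm ksub_add[OF ksub_skcomm avg e] this] show ?thesis
    by (simp flip: sgl_linear)
qed

lemma conj_avg_sgl: assumes "\<gamma> \<in> \<Gamma>"
  shows "conj_avg \<gamma> (sgl \<gamma> b) = of_nat (card (centr \<gamma>)) *\<^sub>C cavg \<gamma> b"
proof -
  have "conj_avg \<gamma> (sgl \<gamma> b) = (\<Sum>g\<in>\<Gamma>. if g \<in> centr \<gamma> then act_free g b else 0)"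
    unfolding conj_avg_def
  proof (rule sum.cong[OF refl])
    fix g assume g: "g \<in> \<Gamma>"
    have "gi g ** (\<gamma> ** g) = \<gamma> \<longleftrightarrow> g ** \<gamma> = \<gamma> ** g"
    proof
      assume "gi g ** (\<gamma> ** g) = \<gamma>"
      then have "g ** (gi g ** (\<gamma> ** g)) = g ** \<gamma>" by simp
      then show "g ** \<gamma> = \<gamma> ** g" using g by simp
    next
      assume "g ** \<gamma> = \<gamma> ** g"
      then have "gi g ** (\<gamma> ** g) = gi g ** (g ** \<gamma>)" by simp
      then show "gi g ** (\<gamma> ** g) = \<gamma>" using g by simp
    qed
    then show "act_free g (sgl \<gamma> b (gi g ** (\<gamma> ** g))) = (if g \<in> centr \<gamma> then act_free g b else 0)"
      using g by (auto simp: sgl_def centr_def act_linear)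
  qed
  also have "\<dots> = (\<Sum>g\<in>centr \<gamma>. act_free g b)"
    using fin by (simp add: sum.If_cases centr_def Int_def)
  finally show ?thesis using centr_card_inv(2)[OF assms] by (simp add: cavg_def)
qed

lemma sgl_skcomm_iff: assumes "\<gamma> \<in> \<Gamma>" "b \<in> F" shows "sgl \<gamma> b \<in> skcomm \<longleftrightarrow> nform \<gamma> b = 0"
proof
  assume "sgl \<gamma> b \<in> skcomm"
  from conj_avg_skcomm[OF assms(1) this]
  have "of_nat (card (centr \<gamma>)) *\<^sub>C nform \<gamma> b = 0"
    by (simp add: conj_avg_sgl[OF assms(1)] expA_linear clin_simps[OF clin_twtr[OF assms(1)]] nform_def)
  then show "nform \<gamma> b = 0" using centr_card_inv(2)[OF assms(1)] by simp
next
  assume "nform \<gamma> b = 0" then show "sgl \<gamma> b \<in> skcomm" using sgl_nform[OF assms] by simp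
qed

lemma nform_idem: assumes "\<gamma> \<in> \<Gamma>" "b \<in> F" shows "nform \<gamma> (nform \<gamma> b) = nform \<gamma> b"
proof -
  have "nform \<gamma> (b - nform \<gamma> b) = 0"
    using sgl_skcomm_iff[OF assms(1)] sgl_nform[OF assms] assms nform_F by (auto simp: alg_in)
  then show ?thesis by (simp add: clin_simps[OF clin_nform[OF assms(1)]])
qed

section \<open>Decomposition along conjugacy classes\<close>

definition cclass :: "complex^2^2 \<Rightarrow> (complex^2^2) set" where
  "cclass \<gamma> = {g ** (\<gamma> ** gi g) | g. g \<in> \<Gamma>}"

lemma conj_classes_eq: "conj_classes G = cclass ` \<Gamma>"
proof -
  have "orbit G (\<lambda>g. \<lambda>h\<in>carrier G. g \<otimes>\<^bsub>G\<^esub> h \<otimes>\<^bsub>G\<^esub> inv\<^bsub>G\<^esub> g) \<gamma> = cclass \<gamma>" if "\<gamma> \<in> \<Gamma>" for \<gamma>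
    using that by (auto simp: orbit_def cclass_def matrix_mul_assoc)
  then show ?thesis by (auto simp: conj_classes_def orbits_def)
qed

lemma cclass_self: "\<gamma> \<in> \<Gamma> \<Longrightarrow> \<gamma> \<in> cclass \<gamma>"
  unfolding cclass_def by (intro CollectI exI[of _ "mat 1"]) (simp add: G.inv_one[simplified])

lemma cclass_\<Gamma>: "\<gamma> \<in> \<Gamma> \<Longrightarrow> cclass \<gamma> \<subseteq> \<Gamma>"
  by (auto simp: cclass_def)

lemma cclass_conj: assumes "\<gamma> \<in> \<Gamma>" "h \<in> \<Gamma>" shows "cclass (h ** (\<gamma> ** gi h)) = cclass \<gamma>"
proof -
  have sub: "cclass (h ** (\<gamma> ** gi h)) \<subseteq> cclass \<gamma>" if "\<gamma> \<in> \<Gamma>" "h \<in> \<Gamma>" for \<gamma> h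
  proof
    fix x assume "x \<in> cclass (h ** (\<gamma> ** gi h))"
    then obtain g where "g \<in> \<Gamma>" "x = g ** (h ** (\<gamma> ** gi h) ** gi g)" by (auto simp: cclass_def)
    then have "x = (g ** h) ** (\<gamma> ** gi (g ** h))" "g ** h \<in> \<Gamma>"
      using that by (simp_all add: gi_mult matrix_mul_assoc)
    then show "x \<in> cclass \<gamma>" unfolding cclass_def by blast
  qed
  have "gi h ** (h ** (\<gamma> ** gi h) ** gi (gi h)) = \<gamma>"
    using assms by (simp add: matrix_mul_assoc[symmetric])
  then show ?thesis using sub[OF assms] sub[of "h ** (\<gamma> ** gi h)" "gi h"] assms by simp
qed

lemma cclass_eq: "\<gamma> \<in> \<Gamma> \<Longrightarrow> \<delta> \<in> cclass \<gamma> \<Longrightarrow> cclass \<delta> = cclass \<gamma>"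
  using cclass_conj by (auto simp: cclass_def[of \<gamma>])

lemma cclass_one: "cclass (mat 1) = {mat 1}"
proof -
  have "cclass (mat 1) \<subseteq> {mat 1}" by (auto simp: cclass_def)
  then show ?thesis using cclass_self[OF one_\<Gamma>] by blast
qed

definition restr :: "(complex^2^2) set \<Rightarrow> skewfun \<Rightarrow> skewfun" where
  "restr C f = (\<lambda>g. if g \<in> C then f g else 0)"

lemma clin_restr: "clin (restr C)"
  by (rule clinI) (auto simp: restr_def fun_eq_iff)

definition skUC :: "(complex^2^2) set \<Rightarrow> skewfun set" where
  "skUC C = {f \<in> skU. \<forall>g. g \<notin> C \<longrightarrow> f g = 0}"

lemma ksub_skUC: "ksub (skUC C)"
  using ksub_skU by (auto simp: ksub_def skUC_def)

lemma restr_skUC: "f \<in> skU \<Longrightarrow> restr C f \<in> skUC C"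
  by (auto simp: skUC_def skU_def restr_def alg_in)

text \<open>For each element of the class a conjugating group element is chosen, and the component
  is carried to \<gamma> by \<open>sgl_conj\<close>.\<close>

lemma skUC_rep: assumes "\<gamma> \<in> \<Gamma>" "f \<in> skUC (cclass \<gamma>)" shows "\<exists>b\<in>F. f - sgl \<gamma> b \<in> skcomm"
proof -
  have f: "f \<in> skU" using assms(2) by (simp add: skUC_def)
  have "\<forall>\<delta>\<in>cclass \<gamma>. \<exists>g. g \<in> \<Gamma> \<and> g ** (\<delta> ** gi g) = \<gamma>"
  proof
    fix \<delta> assume \<delta>: "\<delta> \<in> cclass \<gamma>"
    then have "\<gamma> \<in> cclass \<delta>" using cclass_eq[OF assms(1) \<delta>] cclass_self[OF assms(1)] by simp
    then show "\<exists>g. g \<in> \<Gamma> \<and> g ** (\<delta> ** gi g) = \<gamma>" unfolding cclass_def by blast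
  qed
  from bchoice[OF this] obtain c where "\<forall>\<delta>\<in>cclass \<gamma>. c \<delta> \<in> \<Gamma> \<and> c \<delta> ** (\<delta> ** gi (c \<delta>)) = \<gamma>" ..
  then have c: "\<And>\<delta>. \<delta> \<in> cclass \<gamma> \<Longrightarrow> c \<delta> \<in> \<Gamma> \<and> c \<delta> ** (\<delta> ** gi (c \<delta>)) = \<gamma>" by simp
  let ?b = "\<Sum>\<delta>\<in>cclass \<gamma>. act_free (c \<delta>) (f \<delta>)"
  have finC: "finite (cclass \<gamma>)" using cclass_\<Gamma>[OF assms(1)] fin finite_subset by blast
  have "f = (\<Sum>\<delta>\<in>cclass \<gamma>. sgl \<delta> (f \<delta>))"
  proof
    fix g
    have "(\<Sum>\<delta>\<in>cclass \<gamma>. sgl \<delta> (f \<delta>)) g = (\<Sum>\<delta>\<in>cclass \<gamma>. if \<delta> = g then f g else 0)"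
      by (simp add: sum_fun_apply) (auto simp: sgl_def intro: sum.cong)
    then show "f g = (\<Sum>\<delta>\<in>cclass \<gamma>. sgl \<delta> (f \<delta>)) g"
      using finC assms(2) by (simp add: skUC_def)
  qed
  moreover have "(\<Sum>\<delta>\<in>cclass \<gamma>. sgl \<gamma> (act_free (c \<delta>) (f \<delta>)) - sgl \<delta> (f \<delta>)) \<in> skcomm"
  proof (rule ksub_sum[OF ksub_skcomm])
    fix \<delta> assume \<delta>: "\<delta> \<in> cclass \<gamma>"
    then show "sgl \<gamma> (act_free (c \<delta>) (f \<delta>)) - sgl \<delta> (f \<delta>) \<in> skcomm"
      using sgl_conj[of \<delta> "c \<delta>" "f \<delta>"] c[OF \<delta>] cclass_\<Gamma>[OF assms(1)] skU_F[OF f] by auto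
  qed
  ultimately have "sgl \<gamma> ?b - f \<in> skcomm" by (simp add: sum_subtractf sgl_linear)
  then have "f - sgl \<gamma> ?b \<in> skcomm" by (rule ksub_diff_commute[OF ksub_skcomm])
  moreover have "?b \<in> F" using c skU_F[OF f] by (intro ksub_sum[OF ksub_F]) auto
  ultimately show ?thesis by blast
qed

text \<open>The restriction is congruent to a single component b at \<gamma>. The averaged trace at
  \<gamma> sees only its own conjugacy class, so it vanishes on the restriction as on f; hence b has
  normal form 0.\<close>

lemma restr_skcomm: assumes "\<gamma> \<in> \<Gamma>" "f \<in> skcomm" shows "restr (cclass \<gamma>) f \<in> skcomm"
proof -
  let ?f = "restr (cclass \<gamma>) f"
  have f: "f \<in> skU" using assms skcomm_skU by blast
  obtain b where b: "b \<in> F" "?f - sgl \<gamma> b \<in> skcomm" using skUC_rep[OF assms(1) restr_skUC[OF f]] by blast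
  have "conj_avg \<gamma> ?f = conj_avg \<gamma> f"
    unfolding conj_avg_def
  proof (rule sum.cong[OF refl])
    fix g assume g: "g \<in> \<Gamma>"
    then have "gi g ** (\<gamma> ** gi (gi g)) \<in> cclass \<gamma>" unfolding cclass_def using gi_\<Gamma> by blast
    then show "act_free g (?f (gi g ** (\<gamma> ** g))) = act_free g (f (gi g ** (\<gamma> ** g)))"
      using g by (simp add: restr_def)
  qed
  then have "twtr \<gamma> (expA (conj_avg \<gamma> ?f)) = 0" using conj_avg_skcomm[OF assms] by simp
  moreover have "twtr \<gamma> (expA (conj_avg \<gamma> (?f - sgl \<gamma> b))) = 0" by (rule conj_avg_skcomm[OF assms(1) b(2)])
  ultimately have "twtr \<gamma> (expA (conj_avg \<gamma> (sgl \<gamma> b))) = 0"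
    by (simp add: clin_simps[OF clin_conj_avg] expA_linear clin_simps[OF clin_twtr[OF assms(1)]])
  then have "nform \<gamma> b = 0"
    using centr_card_inv(2)[OF assms(1)]
    by (simp add: conj_avg_sgl[OF assms(1)] expA_linear clin_simps[OF clin_twtr[OF assms(1)]] nform_def)
  then have "sgl \<gamma> b \<in> skcomm" using sgl_skcomm_iff assms b by blast
  then show ?thesis using b(2) ksub_cong[OF ksub_skcomm] by blast
qed

lemma cyc_part_eq': assumes "C \<subseteq> \<Gamma>" shows "cyc_part K \<Gamma> C = skcls ` skUC C"
proof -
  have "{a \<in> carrier (skewA K \<Gamma>). \<forall>g\<in>\<Gamma> - C. a g = \<zero>\<^bsub>algA K\<^esub>} = skq ` skUC C"
  proof (intro antisym subsetI)
    fix a assume "a \<in> {a \<in> carrier (skewA K \<Gamma>). \<forall>g\<in>\<Gamma> - C. a g = \<zero>\<^bsub>algA K\<^esub>}"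
    then have a: "a \<in> carrier (skewA K \<Gamma>)" "\<forall>g\<in>\<Gamma> - C. a g = \<zero>\<^bsub>algA K\<^esub>" by auto
    then obtain f where f: "f \<in> skU" "a = skq f" using pres_surj[OF pres_skewA] by blast
    have "skq f = skq (restr C f)"
      using a(2) unfolding f(2)
      by (auto simp: skq_def restr_def fun_eq_iff presD(8)[OF pres_algA])
    then show "a \<in> skq ` skUC C" using f restr_skUC by blast
  next
    fix a assume "a \<in> skq ` skUC C"
    then obtain f where f: "f \<in> skUC C" "a = skq f" by blast
    then have "skq f \<in> carrier (skewA K \<Gamma>)" by (intro presD(9)[OF pres_skewA]) (simp add: skUC_def)
    moreover have "skq f g = \<zero>\<^bsub>algA K\<^esub>" if "g \<in> \<Gamma>" "g \<notin> C" for g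
      using that f(1) by (simp add: skUC_def skq_def presD(8)[OF pres_algA])
    ultimately show "a \<in> {a \<in> carrier (skewA K \<Gamma>). \<forall>g\<in>\<Gamma> - C. a g = \<zero>\<^bsub>algA K\<^esub>}" using f(2) by blast
  qed
  then show ?thesis by (simp add: cyc_part_def skcls_def image_image)
qed

lemma cyc_part_eq: assumes "\<gamma> \<in> \<Gamma>" shows "cyc_part K \<Gamma> (cclass \<gamma>) = (\<lambda>b. skcls (sgl \<gamma> b)) ` F"
  unfolding cyc_part_eq'[OF cclass_\<Gamma>[OF assms]]
proof safe
  fix f assume f: "f \<in> skUC (cclass \<gamma>)"
  then obtain b where b: "b \<in> F" "f - sgl \<gamma> b \<in> skcomm" using skUC_rep assms by blast
  then have "skcls f = skcls (sgl \<gamma> b)" using presD(7)[OF pres_skew_cyc] f assms by (simp add: skUC_def)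
  then show "skcls f \<in> (\<lambda>b. skcls (sgl \<gamma> b)) ` F" using b by blast
next
  fix b assume b: "b \<in> F"
  have "sgl \<gamma> b \<in> skUC (cclass \<gamma>)" using sgl_skU[OF assms b] cclass_self[OF assms] by (auto simp: skUC_def sgl_def)
  then show "skcls (sgl \<gamma> b) \<in> skcls ` skUC (cclass \<gamma>)" by blast
qed

lemma pres_skew_cyc_at: assumes "\<gamma> \<in> \<Gamma>"
  shows "pres (skew_cyc_at K \<Gamma> (cclass \<gamma>)) F {b \<in> F. nform \<gamma> b = 0} (\<lambda>b. skcls (sgl \<gamma> b))"
  unfolding skew_cyc_at_def using assms
  by (intro pres_comp[OF pres_skew_cyc clin_sgl ksub_F]) (auto simp: cyc_part_eq sgl_skcomm_iff)

lemma skew_cyc_at_projective: assumes "\<gamma> \<in> \<Gamma>"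
  shows "projective_mod K (skew_cyc_at K \<Gamma> (cclass \<gamma>))" "torsion_free K (skew_cyc_at K \<Gamma> (cclass \<gamma>))"
proof -
  \<comment> \<open>An arbitrary injection of words into the type of elements of the quotient, to
    carry the basis.\<close>
  have "inj (\<lambda>w. {\<lambda>_ :: complex^2^2. {wd (letters w)}})"
    by (rule injI) (auto simp: fun_eq_iff dest: arg_cong[of _ _ Poly_Mapping.keys])
  from retract_projective[OF pres_skew_cyc_at[OF assms] clin_nform[OF assms] nform_F[OF assms] _ _ this]
  show "projective_mod K (skew_cyc_at K \<Gamma> (cclass \<gamma>))" "torsion_free K (skew_cyc_at K \<Gamma> (cclass \<gamma>))"
    using nform_F[OF assms] nform_idem[OF assms] by (auto simp: alg_in clin_simps[OF clin_nform[OF assms]])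
qed

lemma sum_restr: assumes "f \<in> skU" shows "(\<Sum>C\<in>cclass ` \<Gamma>. restr C f) = f"
proof
  fix g
  have "(\<Sum>C\<in>cclass ` \<Gamma>. restr C f) g = (\<Sum>C\<in>cclass ` \<Gamma>. if g \<in> C then f g else 0)"
    by (simp add: sum_fun_apply restr_def)
  also have "\<dots> = f g"
  proof (cases "g \<in> \<Gamma>")
    case True
    have "g \<in> C \<longleftrightarrow> C = cclass g" if "C \<in> cclass ` \<Gamma>" for C
      using that cclass_eq cclass_self[OF True] by blast
    then have "(\<Sum>C\<in>cclass ` \<Gamma>. if g \<in> C then f g else 0) = (\<Sum>C\<in>cclass ` \<Gamma>. if C = cclass g then f g else 0)"
      by (intro sum.cong) auto
    then show ?thesis using fin True by simp
  next
    case False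
    then have "f g = 0" using assms by (auto simp: skU_def)
    then show ?thesis by (intro trans[OF sum.neutral]) auto
  qed
  finally show "(\<Sum>C\<in>cclass ` \<Gamma>. restr C f) g = f g" .
qed

lemma restr_other: "C \<in> cclass ` \<Gamma> \<Longrightarrow> D \<in> cclass ` \<Gamma> \<Longrightarrow> f \<in> skUC D \<Longrightarrow> restr C f = (if C = D then f else 0)"
proof (cases "C = D")
  case False
  assume *: "C \<in> cclass ` \<Gamma>" "D \<in> cclass ` \<Gamma>" "f \<in> skUC D"
  have "C \<inter> D = {}" using * False cclass_eq by blast
  then show ?thesis using * False by (auto simp: restr_def skUC_def fun_eq_iff)
qed (auto simp: restr_def skUC_def fun_eq_iff)

text \<open>Existence is the splitting of a function by its support. Uniqueness holds because a
  commutator restricts to a commutator on each class.\<close>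

lemma skew_cyc_direct_sum: "internal_direct_sum K (skew_cyc K \<Gamma>) (conj_classes G) (cyc_part K \<Gamma>)"
  unfolding internal_direct_sum_def conj_classes_eq
proof (intro conjI ballI)
  let ?I = "cclass ` \<Gamma>"
  have part: "cyc_part K \<Gamma> C = skcls ` skUC C" if "C \<in> ?I" for C
    using that cyc_part_eq' cclass_\<Gamma> by blast
  have UC: "skUC C \<subseteq> skU" for C by (auto simp: skUC_def)
  show finI: "finite ?I" using fin by simp
  show "submodule (cyc_part K \<Gamma> C) K (skew_cyc K \<Gamma>)" if "C \<in> ?I" for C
    unfolding part[OF that] by (rule pres_submodule[OF pres_skew_cyc ksub_skUC UC])
  interpret M: Module.module K "skew_cyc K \<Gamma>" by (rule pres_module[OF pres_skew_cyc])
  have fs: "(\<Oplus>\<^bsub>skew_cyc K \<Gamma>\<^esub>C\<in>?I. u C) = skcls (\<Sum>C\<in>?I. v C)"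
    if "\<And>C. C \<in> ?I \<Longrightarrow> u C = skcls (v C) \<and> v C \<in> skUC C" for u v
  proof -
    have "(\<Oplus>\<^bsub>skew_cyc K \<Gamma>\<^esub>C\<in>?I. u C) = (\<Oplus>\<^bsub>skew_cyc K \<Gamma>\<^esub>C\<in>?I. skcls (v C))"
      using that UC presD(9)[OF pres_skew_cyc] by (intro M.M.finsum_cong'[OF refl]) blast+
    also have "\<dots> = skcls (\<Sum>C\<in>?I. v C)"
      using that UC by (intro pres_finsum[OF pres_skew_cyc finI]) blast
    finally show ?thesis .
  qed
  fix m assume "m \<in> carrier (skew_cyc K \<Gamma>)"
  then obtain f where f: "f \<in> skU" "m = skcls f" using pres_surj[OF pres_skew_cyc] by blast
  show "\<exists>!u. u \<in> (\<Pi>\<^sub>E C\<in>?I. cyc_part K \<Gamma> C) \<and> m = (\<Oplus>\<^bsub>skew_cyc K \<Gamma>\<^esub>C\<in>?I. u C)"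
  proof (rule ex1I)
    let ?u = "\<lambda>C\<in>?I. skcls (restr C f)"
    have "?u \<in> (\<Pi>\<^sub>E C\<in>?I. cyc_part K \<Gamma> C)" using part restr_skUC[OF f(1)] by auto
    moreover have "m = (\<Oplus>\<^bsub>skew_cyc K \<Gamma>\<^esub>C\<in>?I. ?u C)"
      using fs[of ?u "\<lambda>C. restr C f"] restr_skUC[OF f(1)] sum_restr[OF f(1)] f(2) by simp
    ultimately show "?u \<in> (\<Pi>\<^sub>E C\<in>?I. cyc_part K \<Gamma> C) \<and> m = (\<Oplus>\<^bsub>skew_cyc K \<Gamma>\<^esub>C\<in>?I. ?u C)" by blast
    fix u assume u: "u \<in> (\<Pi>\<^sub>E C\<in>?I. cyc_part K \<Gamma> C) \<and> m = (\<Oplus>\<^bsub>skew_cyc K \<Gamma>\<^esub>C\<in>?I. u C)"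
    have "\<forall>C\<in>?I. \<exists>v. u C = skcls v \<and> v \<in> skUC C"
    proof
      fix C assume C: "C \<in> ?I"
      then have "u C \<in> skcls ` skUC C" using u PiE_mem[of u ?I "cyc_part K \<Gamma>" C] part[OF C] by simp
      then show "\<exists>v. u C = skcls v \<and> v \<in> skUC C" by blast
    qed
    from bchoice[OF this] obtain v where "\<forall>C\<in>?I. u C = skcls (v C) \<and> v C \<in> skUC C" ..
    then have v: "\<And>C. C \<in> ?I \<Longrightarrow> u C = skcls (v C) \<and> v C \<in> skUC C" by blast
    have "skcls f = skcls (\<Sum>C\<in>?I. v C)" using fs[of u v, OF v] u f(2) by simp
    moreover have sU: "(\<Sum>C\<in>?I. v C) \<in> skU" using v UC by (intro ksub_sum[OF ksub_skU]) blast
    ultimately have d: "f - (\<Sum>C\<in>?I. v C) \<in> skcomm" using presD(7)[OF pres_skew_cyc] f(1) by blast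
    have "u C = skcls (restr C f)" if C: "C \<in> ?I" for C
    proof -
      have "restr C (\<Sum>D\<in>?I. v D) = (\<Sum>D\<in>?I. restr C (v D))" by (rule clin_sum[OF clin_restr])
      also have "\<dots> = (\<Sum>D\<in>?I. if D = C then v C else 0)"
        using v C by (intro sum.cong) (auto simp: restr_other)
      also have "\<dots> = v C" using finI C by simp
      finally have rs: "restr C (\<Sum>D\<in>?I. v D) = v C" .
      obtain \<gamma> where \<gamma>: "\<gamma> \<in> \<Gamma>" "C = cclass \<gamma>" using C by blast
      have "restr C f - v C \<in> skcomm"
        using restr_skcomm[OF \<gamma>(1) d] unfolding \<gamma>(2)[symmetric] clin_diff[OF clin_restr] rs .
      moreover have "restr C f \<in> skU" "v C \<in> skU" using restr_skUC[OF f(1)] v[OF C] UC by auto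
      ultimately have "skcls (restr C f) = skcls (v C)" using presD(7)[OF pres_skew_cyc] by blast
      then show ?thesis using v[OF C] by simp
    qed
    then show "u = ?u" using u by (auto simp: fun_eq_iff PiE_def extensional_def)
  qed
qed

end

section \<open>Commutators modulo \<open>[Ar'A, A]\<close>\<close>

definition period :: "'a list \<Rightarrow> nat" where
  "period w = (LEAST p. p > 0 \<and> rotate p w = w)"

lemma period: "period w > 0" "rotate (period w) w = w"
proof -
  have "max 1 (length w) > 0 \<and> rotate (max 1 (length w)) w = w"
  proof (cases "w = []")
    case False
    then have "max 1 (length w) = length w" by (cases w) auto
    then show ?thesis using False by (simp add: rotate_id)
  qed simp
  then have "period w > 0 \<and> rotate (period w) w = w" unfolding period_def by (rule LeastI)
  then show "period w > 0" "rotate (period w) w = w" by auto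
qed

lemma rotate_mult_period: "rotate (m * period w) w = w"
proof (induct m)
  case (Suc m)
  have "rotate (Suc m * period w) w = rotate (m * period w) (rotate (period w) w)"
    by (simp add: rotate_rotate add.commute)
  then show ?case using Suc period(2)[of w] by simp
qed simp

lemma rotate_mod_period: "rotate (n mod period w) w = rotate n w"
proof -
  have "rotate n w = rotate (n mod period w + n div period w * period w) w" by simp
  also have "\<dots> = rotate (n mod period w) (rotate (n div period w * period w) w)"
    by (simp only: rotate_rotate)
  finally show ?thesis by (simp only: rotate_mult_period)
qed

lemma rotate_eq_self_iff: "rotate n w = w \<longleftrightarrow> period w dvd n"
proof
  assume "rotate n w = w"
  then have *: "rotate (n mod period w) w = w" by (simp add: rotate_mod_period)
  show "period w dvd n"
  proof (rule ccontr)
    assume "\<not> period w dvd n"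
    then have "n mod period w > 0" by (simp add: mod_greater_zero_iff_not_dvd)
    then have "period w \<le> n mod period w" unfolding period_def[of w] using * by (intro Least_le) (simp add: period_def)
    then show False using mod_less_divisor[OF period(1)[of w], of n] by simp
  qed
next
  assume "period w dvd n" then show "rotate n w = w" using rotate_mult_period by (metis dvdE mult.commute)
qed

lemma period_dvd_length: "period w dvd length w"
  by (simp flip: rotate_eq_self_iff)

lemma rotate_eq_iff: assumes "i < period w" "j < period w" shows "rotate i w = rotate j w \<longleftrightarrow> i = j"
proof -
  have "i = j" if "i \<le> j" "j < period w" "rotate i w = rotate j w" for i j
  proof -
    have "rotate (period w - j) (rotate j w) = w" using that by (simp add: rotate_rotate period)
    then have "rotate (period w - j) (rotate i w) = w" using that(3) by simp
    then have d: "period w dvd period w - j + i" by (simp add: rotate_rotate flip: rotate_eq_self_iff)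
    show "i = j"
    proof (rule ccontr)
      assume "i \<noteq> j"
      then have "period w - j + i < period w" "0 < period w - j + i" using that by auto
      then show False using d by (metis dvd_imp_le leD)
    qed
  qed
  from this[of i j] this[of j i] show ?thesis using assms by (metis nat_le_linear)
qed

lemma rot_orbit_eq_image: "rot_orbit w = (\<lambda>n. rotate n w) ` {..<period w}"
proof -
  have "rotate n w \<in> (\<lambda>n. rotate n w) ` {..<period w}" for n
    using rotate_mod_period[of n w] period(1)[of w] by (intro image_eqI[of _ _ "n mod period w"]) auto
  then show ?thesis by (auto simp: rot_orbit_def)
qed

lemma card_rot_orbit: "card (rot_orbit w) = period w"
proof -
  have "inj_on (\<lambda>n. rotate n w) {..<period w}" by (rule inj_onI) (simp add: rotate_eq_iff)
  then show ?thesis by (simp add: rot_orbit_eq_image card_image)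
qed

lemma rep_mult_period: "rep w * period w = length w"
proof -
  obtain m where m: "length w = period w * m" using period_dvd_length by (rule dvdE)
  have "{n. n < length w \<and> rotate n w = w} = (\<lambda>i. period w * i) ` {..<m}"
    using period(1)[of w] by (auto simp: rotate_eq_self_iff m elim!: dvdE)
  moreover have "inj_on (\<lambda>i. period w * i) {..<m}" using period(1)[of w] by (auto simp: inj_on_def)
  ultimately have "rep w = m" by (simp add: rep_def card_image)
  then show ?thesis using m by simp
qed

text \<open>The list consists of \<open>rep w\<close> copies of its first \<open>period w\<close>
  entries.\<close>

lemma rep_dvd_sum_list:
  fixes f :: "'a \<Rightarrow> nat" shows "rep w dvd (\<Sum>x\<leftarrow>w. f x)"
proof -
  let ?p = "period w"
  have len: "length w = rep w * ?p" using rep_mult_period[of w] by simp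
  have step: "w ! (i + ?p) = w ! i" if "i + ?p < length w" for i
    using nth_rotate[of i w ?p] that period(2)[of w] by (simp add: add.commute)
  have per: "w ! (i + q * ?p) = w ! i" if "i + q * ?p < length w" for i q
    using that
  proof (induct q)
    case (Suc q) then show ?case using step[of "i + q * ?p"] by (simp add: algebra_simps)
  qed simp
  have "(\<Sum>x\<leftarrow>w. f x) = (\<Sum>i<length w. f (w ! i))"
    by (simp add: sum_list_sum_nth atLeast0LessThan)
  also have "\<dots> = (\<Sum>q<rep w. \<Sum>i\<in>{q * ?p..<q * ?p + ?p}. f (w ! i))"
    by (simp add: len sum.nat_group)
  also have "\<dots> = (\<Sum>q<rep w. \<Sum>i<?p. f (w ! i))"
  proof (rule sum.cong[OF refl])
    fix q assume "q \<in> {..<rep w}"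
    then have q: "i + q * ?p < length w" if "i < ?p" for i
    proof -
      have "i + q * ?p < Suc q * ?p" using that by simp
      also have "\<dots> \<le> rep w * ?p" using \<open>q \<in> {..<rep w}\<close> by (intro mult_le_mono1) auto
      finally show ?thesis by (simp add: len)
    qed
    have "(\<Sum>i\<in>{q * ?p..<q * ?p + ?p}. f (w ! i)) = (\<Sum>i<?p. f (w ! (i + q * ?p)))"
      using sum.shift_bounds_nat_ivl[of "\<lambda>i. f (w ! i)" 0 "q * ?p" ?p] by (simp add: atLeast0LessThan add.commute)
    also have "\<dots> = (\<Sum>i<?p. f (w ! i))" by (rule sum.cong) (simp_all add: per q)
    finally show "(\<Sum>i\<in>{q * ?p..<q * ?p + ?p}. f (w ! i)) = (\<Sum>i<?p. f (w ! i))" .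
  qed
  also have "\<dots> = rep w * (\<Sum>i<?p. f (w ! i))" by simp
  finally show ?thesis by simp
qed

lemma sum_orbits:
  fixes \<Phi> :: "'a list \<Rightarrow> 'b::complex_module"
  assumes "finite S" "\<And>w. w \<in> S \<Longrightarrow> rot_orbit w \<subseteq> S" "\<And>w. w \<in> S \<Longrightarrow> \<Phi> (rotate1 w) = \<Phi> w"
  shows "(\<Sum>w\<in>S. \<Phi> w) = (\<Sum>C\<in>rot_orbit ` S. of_nat (card C) *\<^sub>C \<Phi> (SOME w. w \<in> C))"
proof -
  have inv: "\<Phi> (rotate n w) = \<Phi> w" if "w \<in> S" for n w
  proof (induct n)
    case (Suc n)
    have "rotate n w \<in> S" using assms(2)[OF that] by (auto simp: rot_orbit_def)
    then show ?case using assms(3) Suc by simp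
  qed simp
  have "(\<Sum>w\<in>S. \<Phi> w) = (\<Sum>C\<in>rot_orbit ` S. \<Sum>w\<in>{w \<in> S. rot_orbit w = C}. \<Phi> w)"
    by (rule sum.image_gen[OF assms(1)])
  also have "\<dots> = (\<Sum>C\<in>rot_orbit ` S. of_nat (card C) *\<^sub>C \<Phi> (SOME w. w \<in> C))"
  proof (rule sum.cong[OF refl])
    fix C assume "C \<in> rot_orbit ` S"
    then obtain v where v: "v \<in> S" "C = rot_orbit v" by blast
    have "{w \<in> S. rot_orbit w = C} = C"
      using v assms(2)[OF v(1)] by (auto simp: rot_orbit_eq_iff[symmetric] rot_orbit_self)
    moreover have "\<Phi> w = \<Phi> v" if "w \<in> C" for w
      using that inv[OF v(1)] v(2) by (auto simp: rot_orbit_def)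
    moreover have "(SOME w. w \<in> C) \<in> C" using rot_orbit_self[of v] v(2) by (metis someI)
    ultimately show "(\<Sum>w\<in>{w \<in> S. rot_orbit w = C}. \<Phi> w) = of_nat (card C) *\<^sub>C \<Phi> (SOME w. w \<in> C)"
      by (simp add: sum_const_cscale del: sum_constant)
  qed
  finally show ?thesis .
qed

text \<open>With \<open>brB\<close> it spans the commutators of bidegree (a,b) modulo
  \<open>relV\<close>. For a = 0 the truncated index is harmless, since the bracket then has
  coefficient 0 in \<open>bracket_words\<close>; likewise for \<open>brB\<close> and b = 0.\<close>

definition brA :: "nat \<Rightarrow> nat \<Rightarrow> ncpoly" where
  "brA a b = wd (xword (a - 1) b) * gx - gx * wd (xword (a - 1) b)"

definition brB :: "nat \<Rightarrow> nat \<Rightarrow> ncpoly" where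
  "brB a b = wd (xword a (b - 1)) * gy - gy * wd (xword a (b - 1))"

lemma xword_count [simp]: "nx (xword a b) = a" "ny (xword a b) = b" "nr (xword a b) = 0"
  by (simp_all add: xword_def count_replicate)

context coeff_ring
begin

text \<open>The preimage of \<open>[A, A]\<close> in the free algebra.\<close>

definition CC :: "ncpoly set" where
  "CC = {f \<in> F. cyc_trace (expA f) = 0}"

lemma ksub_CC: "ksub CC"
  unfolding CC_def by (rule ksub_Collect_ker[OF ksub_F lin_trace[OF clin_expA]])

lemma CC_eq: "CC = kspan ({a * c - c * a | a c. a \<in> F \<and> c \<in> F} \<union> kerA)"
proof
  show "CC \<subseteq> kspan ({a * c - c * a | a c. a \<in> F \<and> c \<in> F} \<union> kerA)"
  proof
    fix f assume f: "f \<in> CC"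
    then have fF: "f \<in> F" "cyc_trace (expA f) = 0" by (auto simp: CC_def)
    have "expA f \<in> kspan {a * c - c * a | a c. a \<in> F \<and> c \<in> F}"
      using sub_trace[OF expA_in[OF fF(1)]] fF(2) by simp
    then have "expA f \<in> kspan ({a * c - c * a | a c. a \<in> F \<and> c \<in> F} \<union> kerA)"
      using kspan_mono by blast
    moreover have "f - expA f \<in> kspan ({a * c - c * a | a c. a \<in> F \<and> c \<in> F} \<union> kerA)"
      using sub_expA_kerA[OF fF(1)] by (intro kspan_base) blast
    ultimately show "f \<in> kspan ({a * c - c * a | a c. a \<in> F \<and> c \<in> F} \<union> kerA)"
      using ksub_add[OF ksub_kspan] by fastforce
  qed
  have "a * c - c * a \<in> CC" if "a \<in> F" "c \<in> F" for a c
    using that trace_comm[of "expA a" "expA c"] by (simp add: CC_def alg_in expA_linear expA_mult trace_linear)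
  then show "kspan ({a * c - c * a | a c. a \<in> F \<and> c \<in> F} \<union> kerA) \<subseteq> CC"
    by (intro kspan_minimal ksub_CC) (auto simp: CC_def trace_linear)
qed

lemma CC_induct:
  assumes "f \<in> CC" "clin H" "ksub N" "\<And>u v. H (wd u * wd v - wd v * wd u) \<in> N" "\<And>f. f \<in> kerA \<Longrightarrow> H f \<in> N"
  shows "H f \<in> N"
  using assms(1) unfolding CC_eq
proof (rule kspan_lin_in[OF assms(2,3), rotated])
  fix f assume "f \<in> {a * c - c * a | a c. a \<in> F \<and> c \<in> F} \<union> kerA"
  then show "H f \<in> N"
  proof
    assume "f \<in> {a * c - c * a | a c. a \<in> F \<and> c \<in> F}"
    then obtain a c where ac: "f = a * c - c * a" "a \<in> F" "c \<in> F" by blast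
    have "H (wd u * c - c * wd u) \<in> N" for u
      by (rule F_lin_in[OF ac(3) _ assms(3), where G = "\<lambda>c. H (wd u * c - c * wd u)"])
        (intro clin_comp[OF assms(2)] clin_intros, rule assms(4))
    then have "H (a * c - c * a) \<in> N"
      by (intro F_lin_in[OF ac(2) _ assms(3), where G = "\<lambda>a. H (a * c - c * a)"] clin_comp[OF assms(2)] clin_intros)
    then show ?thesis using ac by simp
  qed (rule assms(5))
qed

lemma relV_CC: "relV \<subseteq> CC"
  unfolding relV_def CC_eq by (rule kspan_mono) auto

lemma CC_kerAb: "CC \<subseteq> kerAb"
  unfolding CC_eq using kerA_subset_kerAb
  by (intro kspan_minimal ksub_kerAb) (auto simp: abl_linear abl_mult alg_in mult.commute)

lemma CC_F: "CC \<subseteq> F" by (auto simp: CC_def)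

text \<open>The difference u - u' lies in the ideal of r', so its commutator with v is a relation of
  V. Words may thus be sorted inside a commutator.\<close>

lemma bracket_left:
  assumes "u \<in> F" "u' \<in> F" "v \<in> F" "abl u = abl u'"
  shows "(u * v - v * u) - (u' * v - v * u') \<in> relV"
proof -
  have "(u - u') * v - v * (u - u') \<in> relV"
    using assms by (intro comm_relV) (auto simp: abl_linear alg_in)
  then show ?thesis by (simp add: algebra_simps)
qed

text \<open>The letters of v cross over one at a time by
  \<open>[u, l v] = [u l, v] + [v u, l]\<close>, and the last term is one of the two standard
  brackets after sorting.\<close>

lemma bracket_words:
  assumes "nr u = 0" "nr v = 0" "a = nx u + nx v" "b = ny u + ny v"
  shows "(wd u * wd v - wd v * wd u) - (of_nat (nx v) *\<^sub>C brA a b + of_nat (ny v) *\<^sub>C brB a b) \<in> relV"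
  using assms
proof (induct v arbitrary: u)
  case Nil then show ?case by (simp add: ksub_zero[OF ksub_relV])
next
  case (Cons l v)
  have IH: "(wd (u @ [l]) * wd v - wd v * wd (u @ [l])) - (of_nat (nx v) *\<^sub>C brA a b + of_nat (ny v) *\<^sub>C brB a b) \<in> relV"
    using Cons(2-) by (intro Cons(1)) (auto split: if_splits)
  have split: "wd u * wd (l # v) - wd (l # v) * wd u =
     (wd (u @ [l]) * wd v - wd v * wd (u @ [l])) + (wd (v @ u) * gen l - gen l * wd (v @ u))"
    by (simp add: wd_mult gen_eq)
  have "(wd (v @ u) * gen l - gen l * wd (v @ u)) - (if l = Lx then brA a b else brB a b) \<in> relV"
  proof (cases l)
    case Lx
    have "abl (wd (v @ u)) = abl (wd (xword (a - 1) b))" using Cons(2-) Lx by (simp add: abl_wd add.commute)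
    then show ?thesis unfolding brA_def using bracket_left Lx by auto
  next
    case Ly
    have "abl (wd (v @ u)) = abl (wd (xword a (b - 1)))" using Cons(2-) Ly by (simp add: abl_wd add.commute)
    then show ?thesis unfolding brB_def using bracket_left Ly by auto
  qed (use Cons(3) in simp)
  from ksub_add[OF ksub_relV IH this] show ?case
    unfolding split by (cases l) (use Cons(3) in \<open>auto simp: cscale_add_left algebra_simps\<close>)
qed

text \<open>Powers of one word commute: take \<open>v = x^(a/g) y^(b/g)\<close> and
  \<open>u = v^(g-1)\<close> in \<open>bracket_words\<close>.\<close>

lemma bracket_torsion:
  assumes g: "g = gcd a b" "g > 0"
  shows "of_nat (a div g) *\<^sub>C brA a b + of_nat (b div g) *\<^sub>C brB a b \<in> relV"
proof -
  let ?v = "xword (a div g) (b div g)"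
  let ?u = "concat (replicate (g - 1) ?v)"
  have c: "count_list ?u l + count_list ?v l = g * count_list ?v l" for l
    using g(2) by (cases g) (simp_all add: count_concat_replicate)
  have "wd ?u * wd ?v = wd ?v * wd ?u"
    unfolding wd_power[symmetric] by (rule power_commutes)
  moreover have "g * (a div g) = a" "g * (b div g) = b" using g by simp_all
  ultimately have "0 - (of_nat (nx ?v) *\<^sub>C brA a b + of_nat (ny ?v) *\<^sub>C brB a b) \<in> relV"
    using bracket_words[of ?u ?v a b] c[of Lx] c[of Ly] by (simp add: count_concat_replicate)
  then show ?thesis using ksub_diff_commute[OF ksub_relV] by fastforce
qed

text \<open>The signs follow \<open>weyl\<close>, which sends \<open>brA a b\<close> and
  \<open>brB a b\<close> to b and -a times the same monomial for positive a and b;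
  \<open>omega\<close> thus has linear coefficient gcd(a,b).\<close>

definition bez :: "nat \<Rightarrow> nat \<Rightarrow> int \<times> int" where
  "bez a b = (SOME pq. fst pq * int b - snd pq * int a = int (gcd a b))"

lemma bez: "fst (bez a b) * int b - snd (bez a b) * int a = int (gcd a b)"
proof -
  obtain p q where "p * int a + q * int b = gcd (int a) (int b)" using bezout_int by blast
  then have "fst (q, - p) * int b - snd (q, - p) * int a = int (gcd a b)" by simp
  then show ?thesis unfolding bez_def by (rule someI)
qed

definition omega :: "nat \<Rightarrow> nat \<Rightarrow> ncpoly" where
  "omega a b = of_int (fst (bez a b)) *\<^sub>C brA a b + of_int (snd (bez a b)) *\<^sub>C brB a b"

lemma cscale_lincomb:
  "(s *\<^sub>C x + t *\<^sub>C y) - m *\<^sub>C (p *\<^sub>C x + q *\<^sub>C y) = (s - m * p) *\<^sub>C x + (t - m * q) *\<^sub>C y"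
  by (simp add: cscale_add_right cscale_diff_left)

text \<open>The coefficient vectors of \<open>omega\<close> and of the relation in
  \<open>bracket_torsion\<close> form an integral basis, having determinant 1. Expanding (s, t) in
  it and dropping the relation leaves a multiple of \<open>omega\<close>.\<close>

lemma bracket_omega:
  fixes s t :: nat
  assumes ab: "a + b > 0"
  shows "(of_nat s *\<^sub>C brA a b + of_nat t *\<^sub>C brB a b) -
    ((of_nat s * of_nat b - of_nat t * of_nat a) / of_nat (gcd a b)) *\<^sub>C omega a b \<in> relV"
proof -
  let ?g = "gcd a b" and ?p = "fst (bez a b)" and ?q = "snd (bez a b)"
  have g: "?g > 0" using ab by (metis add_is_0 gcd_pos_nat less_not_refl)
  have ag: "of_nat a = of_nat ?g * (of_nat (a div ?g) :: complex)" and bg: "of_nat b = of_nat ?g * (of_nat (b div ?g) :: complex)"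
    by (metis dvd_mult_div_cancel gcd_dvd1 of_nat_mult, metis dvd_mult_div_cancel gcd_dvd2 of_nat_mult)
  have gnz: "(of_nat ?g :: complex) \<noteq> 0" using g by simp
  have "of_int (?p * int b - ?q * int a) = (of_int (int ?g) :: complex)" by (simp only: bez)
  then have "of_int ?p * of_nat b - of_int ?q * of_nat a = (of_nat ?g :: complex)" by simp
  then have "of_nat ?g * (of_int ?p * of_nat (b div ?g) - of_int ?q * of_nat (a div ?g)) = (of_nat ?g * 1 :: complex)"
    using ag bg by (simp add: algebra_simps)
  then have bz: "of_int ?p * of_nat (b div ?g) - of_int ?q * of_nat (a div ?g) = (1 :: complex)"
    using gnz by (metis mult_cancel_left)
  let ?A = "of_nat (a div ?g) :: complex" and ?B = "of_nat (b div ?g) :: complex"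
  let ?c = "of_int ?p * of_nat t - of_int ?q * of_nat s :: complex"
  have frac: "(of_nat s * of_nat b - of_nat t * of_nat a) / of_nat ?g = of_nat s * ?B - of_nat t * ?A"
    unfolding ag bg using gnz by (simp add: field_simps)
  have "of_nat s - (of_nat s * ?B - of_nat t * ?A) * of_int ?p = ?c * ?A"
  proof -
    have "of_nat s * (of_int ?p * ?B - of_int ?q * ?A) - (of_nat s * ?B - of_nat t * ?A) * of_int ?p = ?c * ?A"
      by (simp add: algebra_simps)
    then show ?thesis by (simp add: bz)
  qed
  moreover have "of_nat t - (of_nat s * ?B - of_nat t * ?A) * of_int ?q = ?c * ?B"
  proof -
    have "of_nat t * (of_int ?p * ?B - of_int ?q * ?A) - (of_nat s * ?B - of_nat t * ?A) * of_int ?q = ?c * ?B"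
      by (simp add: algebra_simps)
    then show ?thesis by (simp add: bz)
  qed
  ultimately have "(of_nat s *\<^sub>C brA a b + of_nat t *\<^sub>C brB a b) - (of_nat s * ?B - of_nat t * ?A) *\<^sub>C omega a b =
     ?c *\<^sub>C (?A *\<^sub>C brA a b + ?B *\<^sub>C brB a b)"
    unfolding omega_def cscale_lincomb by (simp only: cscale_add_right cscale_cscale)
  moreover have "?c \<in> k" by simp
  ultimately show ?thesis
    unfolding frac using ksub_cscale[OF ksub_relV _ bracket_torsion[OF refl g]] by simp
qed

text \<open>The inverse of \<open>weyl\<close> on commutators modulo \<open>relV\<close>. The
  division by the gcd is made over the complex numbers and cancels on the values that
  \<open>weyl\<close> takes on commutators (\<open>weyl_CC\<close>).\<close>

definition Omega :: "cpoly \<Rightarrow> ncpoly" where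
  "Omega = ext (\<lambda>m. (1 / of_nat (gcd (fst m + 1) (snd m + 1))) *\<^sub>C omega (fst m + 1) (snd m + 1))"

lemma clin_Omega: "clin Omega" unfolding Omega_def by (rule clin_ext)

lemma Omega_xy_monom:
  "a > 0 \<Longrightarrow> b > 0 \<Longrightarrow> Omega (xy_monom (a - 1) (b - 1)) = (1 / of_nat (gcd a b)) *\<^sub>C omega a b"
  by (simp add: Omega_def xy_monom_def)

lemma weyl_bracket:
  assumes "nr u = 0" "nr v = 0"
  shows "weyl (wd u * wd v - wd v * wd u) =
    (of_nat (nx v) * of_nat (ny u) - of_nat (ny v) * of_nat (nx u)) *\<^sub>C xy_monom (nx u + nx v - 1) (ny u + ny v - 1)"
  using assms by (simp add: weyl_linear wd_mult weyl_wd weyl_word_def yx_pairs_append cscale_diff_left algebra_simps)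
   (simp add: algebra_simps flip: cscale_add_left cscale_diff_left)

lemma abl_zero_nr: "nr u \<noteq> 0 \<Longrightarrow> wd u \<in> kerAb"
  by (simp add: abl_wd)

lemma bracket_Omega: "(wd u * wd v - wd v * wd u) - Omega (weyl (wd u * wd v - wd v * wd u)) \<in> relV"
proof (cases "nr u = 0 \<and> nr v = 0")
  case False
  then have "wd u * wd v - wd v * wd u \<in> relV"
  proof (cases "nr u = 0")
    case True
    then have "wd v * wd u - wd u * wd v \<in> relV" using False by (intro comm_relV abl_zero_nr) auto
    then show ?thesis by (rule ksub_diff_commute[OF ksub_relV])
  next
    case False then show ?thesis by (intro comm_relV abl_zero_nr) auto
  qed
  then show ?thesis using weyl_relV by (simp add: clin_zero[OF clin_Omega])
next
  case True
  let ?a = "nx u + nx v" and ?b = "ny u + ny v"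
  let ?c = "of_nat (nx v) * of_nat (ny u) - of_nat (ny v) * of_nat (nx u) :: complex"
  have c: "of_nat (nx v) * of_nat ?b - of_nat (ny v) * of_nat ?a = ?c" by (simp add: algebra_simps)
  have br: "(wd u * wd v - wd v * wd u) - (of_nat (nx v) *\<^sub>C brA ?a ?b + of_nat (ny v) *\<^sub>C brB ?a ?b) \<in> relV"
    using True by (intro bracket_words) auto
  show ?thesis
  proof (cases "?a + ?b > 0")
    case pos: True
    have "(wd u * wd v - wd v * wd u) - (?c / of_nat (gcd ?a ?b)) *\<^sub>C omega ?a ?b \<in> relV"
      using ksub_trans[OF ksub_relV br bracket_omega[OF pos, of "nx v" "ny v", unfolded c]] .
    moreover have "Omega (weyl (wd u * wd v - wd v * wd u)) = (?c / of_nat (gcd ?a ?b)) *\<^sub>C omega ?a ?b"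
    proof (cases "?a > 0 \<and> ?b > 0")
      case True
      then have "Omega (xy_monom (?a - 1) (?b - 1)) = (1 / of_nat (gcd ?a ?b)) *\<^sub>C omega ?a ?b"
        by (intro Omega_xy_monom) auto
      then show ?thesis using \<open>nr u = 0 \<and> nr v = 0\<close>
        by (simp only: weyl_bracket clin_cscale[OF clin_Omega]) simp
    next
      case False
      then have "?c = 0" by auto
      then show ?thesis using \<open>nr u = 0 \<and> nr v = 0\<close> by (simp add: weyl_bracket clin_zero[OF clin_Omega])
    qed
    ultimately show ?thesis by simp
  next
    case False
    have "length w = nx w + ny w + nr w" for w
    proof (induct w)
      case (Cons l w) then show ?case by (cases l) auto
    qed simp
    from this[of u] this[of v] have "u = []" "v = []" using True False by auto
    then show ?thesis by (simp add: ksub_zero[OF ksub_relV] weyl_linear clin_zero[OF clin_Omega])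
  qed
qed

lemma CC_Omega: assumes "f \<in> CC" shows "f - Omega (weyl f) \<in> relV"
proof (rule CC_induct[OF assms, where H = "\<lambda>f. f - Omega (weyl f)"])
  show "f - Omega (weyl f) \<in> relV" if "f \<in> kerA" for f
    using that weyl_kerA[OF that] kerA_relV by (auto simp: clin_zero[OF clin_Omega])
qed (intro clin_intros clin_comp[OF clin_Omega] clin_weyl ksub_relV bracket_Omega)+

text \<open>\<open>Omega\<close> recovers a commutator from its linear term. This is the source of
  the injectivity in (iii) and of the fact that the elements W exhaust the commutators.\<close>

lemma CC_weyl_inj: "f \<in> CC \<Longrightarrow> weyl f = 0 \<Longrightarrow> f \<in> relV"
  using CC_Omega[of f] by (simp add: clin_zero[OF clin_Omega])

definition gcdspan :: "cpoly set" where
  "gcdspan = kspan {of_nat (gcd a b) *\<^sub>C xy_monom (a - 1) (b - 1) | a b. a \<ge> 1 \<and> b \<ge> 1}"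

text \<open>The linear coefficient of a bracket of total bidegree (a,b) is
  \<open>nx v * b - ny v * a\<close>, hence a multiple of gcd(a,b).\<close>

lemma weyl_CC: assumes "f \<in> CC" shows "weyl f \<in> gcdspan"
proof (rule CC_induct[OF assms clin_weyl])
  show "ksub gcdspan" by (simp add: gcdspan_def ksub_kspan)
  show "weyl f \<in> gcdspan" if "f \<in> kerA" for f
    using weyl_kerA[OF that] by (simp add: gcdspan_def)
  show "weyl (wd u * wd v - wd v * wd u) \<in> gcdspan" for u v
  proof (cases "nr u = 0 \<and> nr v = 0")
    case False
    then have "wd u * wd v - wd v * wd u \<in> relV"
      using comm_relV[OF abl_zero_nr, of u "wd v"] comm_relV[OF abl_zero_nr, of v "wd u"]
        ksub_diff_commute[OF ksub_relV] by auto
    then show ?thesis using weyl_relV by (simp add: gcdspan_def)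
  next
    case True
    let ?a = "nx u + nx v" and ?b = "ny u + ny v"
    let ?c = "int (nx v) * int ?b - int (ny v) * int ?a"
    have c: "of_nat (nx v) * of_nat (ny u) - of_nat (ny v) * of_nat (nx u) = (of_int ?c :: complex)"
      by (simp add: algebra_simps)
    show ?thesis
    proof (cases "?a > 0 \<and> ?b > 0")
      case False
      then have "?c = 0" by auto
      then show ?thesis using True c by (simp add: weyl_bracket gcdspan_def)
    next
      case pos: True
      have "int (gcd ?a ?b) dvd ?c"
        by (intro dvd_diff dvd_mult) (auto simp flip: gcd_int_int_eq)
      then obtain m where m: "?c = int (gcd ?a ?b) * m" by (rule dvdE)
      have "weyl (wd u * wd v - wd v * wd u) = of_int ?c *\<^sub>C xy_monom (?a - 1) (?b - 1)"
        using True c by (simp only: weyl_bracket)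
      also have "\<dots> = of_int m *\<^sub>C (of_nat (gcd ?a ?b) *\<^sub>C xy_monom (?a - 1) (?b - 1))"
        unfolding m by (simp add: mult.commute)
      also have "\<dots> \<in> gcdspan"
      proof -
        have "of_nat (gcd ?a ?b) *\<^sub>C xy_monom (?a - 1) (?b - 1) \<in> gcdspan"
          unfolding gcdspan_def using pos by (intro kspan_base CollectI exI[of _ ?a] exI[of _ ?b]) auto
        then show ?thesis unfolding gcdspan_def by (rule ksub_cscale[OF ksub_kspan K_of_int])
      qed
      finally show ?thesis .
    qed
  qed
qed

end

section \<open>Commutators of power series\<close>

lemma of_nat_mult_cscale: "of_nat n * f = of_nat n *\<^sub>C (f :: 'w::monoid_add \<Rightarrow>\<^sub>0 complex)"
  by (induct n) (simp_all add: distrib_right cscale_add_left)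

definition lin_fps :: "ncpoly \<Rightarrow> ncpoly fps" where
  "lin_fps c = 1 - fps_const c * fps_X"

definition geo_fps :: "ncpoly \<Rightarrow> ncpoly fps" where
  "geo_fps c = Abs_fps (\<lambda>n. c ^ n)"

lemma nth_mult_lin: "fps_nth (f * lin_fps c) n = fps_nth f n - (if n = 0 then 0 else fps_nth f (n - 1) * c)"
proof -
  have "f * lin_fps c = f - f * fps_const c * fps_X"
    by (simp add: lin_fps_def right_diff_distrib mult.assoc)
  then show ?thesis by (simp add: fps_X_mult_right_nth)
qed

lemma nth_lin: "fps_nth (lin_fps c) n = (if n = 0 then 1 else if n = 1 then - c else 0)"
  using nth_mult_lin[of 1 c n] by simp

lemma geo_lin: "geo_fps c * lin_fps c = 1"
  by (rule fps_ext) (simp add: nth_mult_lin geo_fps_def power_Suc2[symmetric] del: power_Suc)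

lemma lin_geo: "lin_fps c * geo_fps c = 1"
proof -
  have "lin_fps c * geo_fps c = geo_fps c - fps_X * (fps_const c * geo_fps c)"
    by (simp add: lin_fps_def left_diff_distrib fps_mult_fps_X_commute mult.assoc)
  also have "\<dots> = 1"
  proof (rule fps_ext)
    show "fps_nth (geo_fps c - fps_X * (fps_const c * geo_fps c)) n = fps_nth 1 n" for n
      by (cases n) (simp_all add: geo_fps_def)
  qed
  finally show ?thesis .
qed

text \<open>The degree function is a parameter: here it is the number of letters y, later the
  grading in which r' has degree 2.\<close>

definition homog :: "(letter list \<Rightarrow> nat) \<Rightarrow> nat \<Rightarrow> ncpoly \<Rightarrow> bool" where
  "homog d b f \<longleftrightarrow> (\<forall>w. Poly_Mapping.lookup f w \<noteq> 0 \<longrightarrow> d (letters w) = b)"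

abbreviation ypart :: "nat \<Rightarrow> ncpoly \<Rightarrow> bool" where "ypart \<equiv> homog (\<lambda>w. ny w)"

lemma homog_wd: "d w = b \<Longrightarrow> homog d b (wd w)"
  by (auto simp: homog_def lookup_single when_def)

lemma homog_zero: "homog d b 0"
  by (simp add: homog_def)

lemma homog_add: "homog d b f \<Longrightarrow> homog d b g \<Longrightarrow> homog d b (f + g)"
  unfolding homog_def by (metis add.right_neutral lookup_plus)

lemma homog_cscale: "homog d b f \<Longrightarrow> homog d b (c *\<^sub>C f)"
  by (auto simp: homog_def)

lemma homog_diff: "homog d b f \<Longrightarrow> homog d b g \<Longrightarrow> homog d b (f - g)"
  using homog_add[of d b f "(-1) *\<^sub>C g"] homog_cscale[of d b g "-1"] by simp

lemma homog_sum: "(\<And>i. i \<in> I \<Longrightarrow> homog d b (f i)) \<Longrightarrow> homog d b (sum f I)"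
  by (induct I rule: infinite_finite_induct) (auto simp: homog_zero homog_add)

lemma homog_ext:
  assumes "homog d b f" "\<And>w. d w = b \<Longrightarrow> homog d' b' (h w)"
  shows "homog d' b' (ext (\<lambda>w. h (letters w)) f)"
  unfolding ext_def using assms
  by (auto simp: homog_def[of d b f] in_keys_iff intro!: homog_sum homog_cscale)

lemma homog_mult:
  assumes "homog d b f" "homog d c g" "\<And>u v. d (u @ v) = d u + d v" shows "homog d (b + c) (f * g)"
  unfolding homog_def
proof (intro allI impI)
  fix w assume "Poly_Mapping.lookup (f * g) w \<noteq> 0"
  then have "w \<in> Poly_Mapping.keys (f * g)" by (simp add: in_keys_iff)
  then obtain u v where "w = u + v" "u \<in> Poly_Mapping.keys f" "v \<in> Poly_Mapping.keys g"
    using keys_mult[of f g] by blast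
  then show "d (letters w) = b + c"
    using assms by (auto simp: homog_def in_keys_iff plus_ncword_def)
qed

lemma homog_trace: "homog d b f \<Longrightarrow> (\<And>w. d (canon w) = d w) \<Longrightarrow> homog d b (cyc_trace f)"
  unfolding cyc_trace_def by (erule homog_ext) (simp add: homog_wd)

definition rho :: ncpoly where "rho = gy * gx - gx * gy"

definition tpoly :: "nat \<Rightarrow> ncpoly" where
  "tpoly n = (\<Sum>j<n. (gx * gy) ^ j * gx ^ (n - j))"

text \<open>The coefficient at \<open>X^m\<close> collects the factors \<open>r' z_{m-1,j}\<close>
  with j < m - 1, so the variable records the contribution to a. The contribution to b gets no
  variable; homogeneity in y recovers it in \<open>trace_W_tuples\<close>.\<close>

definition sser :: "ncpoly fps" where
  "sser = Abs_fps (\<lambda>m. rho * tpoly (m - 1))"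

lemma xy_power_x: "(gx * gy) ^ n * gx = gx * (gy * gx) ^ n"
  by (induct n) (simp_all add: mult.assoc)

lemma tpoly_Suc: "tpoly (Suc n) = tpoly n * gx + gx * (gy * gx) ^ n"
proof -
  have "(\<Sum>j<n. (gx * gy) ^ j * gx ^ (Suc n - j)) = tpoly n * gx"
    unfolding tpoly_def sum_distrib_right
    by (rule sum.cong) (auto simp: Suc_diff_le power_Suc2 mult.assoc simp del: power_Suc)
  then show ?thesis by (simp add: tpoly_def xy_power_x)
qed

text \<open>Summed over all \<open>a > b\<close>, the factors of the \<open>W\<^sub>a\<^sub>,\<^sub>b\<close> form a commutator of two invertible series.\<close>

lemma sser_commutator:
  "1 + sser = lin_fps (gy * gx) * lin_fps gx * geo_fps (gy * gx) * geo_fps gx"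
proof -
  let ?u = "gy * gx"
  have s0: "fps_nth (sser * lin_fps gx) n = (if n < 2 then 0 else rho * gx * ?u ^ (n - 2))" for n
  proof (cases "n < 2")
    case True
    then have "n = 0 \<or> n = 1" by auto
    then show ?thesis by (auto simp: nth_mult_lin sser_def tpoly_def)
  next
    case False
    then obtain m where m: "n = Suc (Suc m)" using that[of "n - 2"] by simp
    show ?thesis by (simp add: m nth_mult_lin sser_def tpoly_Suc distrib_left mult.assoc)
  qed
  \<comment> \<open>Multiplying by the two linear series collapses \<open>sser\<close> to the single
    term \<open>\<rho> x X^2\<close>, which is also the additive commutator of these series.\<close>
  have "fps_nth (sser * lin_fps gx * lin_fps ?u) n = (if n = 2 then rho * gx else 0)" for n
  proof (cases "n \<le> 2")
    case True
    then have "n = 0 \<or> n = 1 \<or> n = 2" by auto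
    then show ?thesis unfolding nth_mult_lin[of "sser * lin_fps gx"] s0 by auto
  next
    case False
    then obtain m where m: "n = Suc (Suc (Suc m))" using that[of "n - 3"] by simp
    show ?thesis
      unfolding nth_mult_lin[of "sser * lin_fps gx"] s0 m by (simp add: mult.assoc power_Suc2 del: power_Suc)
  qed
  moreover have "fps_nth (lin_fps ?u * lin_fps gx - lin_fps gx * lin_fps ?u) n = (if n = 2 then rho * gx else 0)" for n
    unfolding fps_sub_nth nth_mult_lin nth_lin by (auto simp: rho_def algebra_simps)
  ultimately have "sser * lin_fps gx * lin_fps ?u = lin_fps ?u * lin_fps gx - lin_fps gx * lin_fps ?u"
    by (intro fps_ext) simp
  then have *: "(1 + sser) * lin_fps gx * lin_fps ?u = lin_fps ?u * lin_fps gx"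
    by (simp add: distrib_right)
  have "1 + sser = (1 + sser) * lin_fps gx * (lin_fps ?u * geo_fps ?u) * geo_fps gx"
    by (simp add: lin_geo mult.assoc)
  also have "\<dots> = (1 + sser) * lin_fps gx * lin_fps ?u * geo_fps ?u * geo_fps gx"
    by (simp only: mult.assoc)
  finally show ?thesis by (simp only: *)
qed

lemma sser_0: "fps_nth sser 0 = 0"
  by (simp add: sser_def tpoly_def)

lemma nth_power_zero_prefix:
  assumes "fps_nth S 0 = 0" "i < k" shows "fps_nth ((S :: 'a::ring_1 fps) ^ k) i = 0"
  using assms(2)
proof (induct k arbitrary: i)
  case (Suc k)
  have "fps_nth S j * fps_nth (S ^ k) (i - j) = 0" if "j \<le> i" for j
    using that Suc assms(1) by (cases "j = 0") auto
  then show ?case by (simp add: fps_mult_nth)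
qed simp

context coeff_ring
begin

section \<open>Traces of logarithms\<close>

definition ftr :: "ncpoly fps \<Rightarrow> nat \<Rightarrow> ncpoly" where
  "ftr f n = cyc_trace (fps_nth f n)"

lemma ftr_linear: "ftr (f + g) n = ftr f n + ftr g n" "ftr (- f) n = - ftr f n" "ftr 0 n = 0"
  by (simp_all add: ftr_def trace_linear)

lemma ftr_comm: "ftr (f * g) n = ftr (g * f) n"
proof -
  have "ftr (f * g) n = (\<Sum>i=0..n. cyc_trace (fps_nth g (n - i) * fps_nth f i))"
    unfolding ftr_def fps_mult_nth trace_linear by (rule sum.cong[OF refl trace_comm])
  also have "\<dots> = (\<Sum>i=0..n. cyc_trace (fps_nth g i * fps_nth f (n - i)))"
    by (rule sum.reindex_bij_witness[of _ "\<lambda>i. n - i" "\<lambda>i. n - i"]) auto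
  finally show ?thesis by (simp add: ftr_def fps_mult_nth trace_linear)
qed

text \<open>Under the trace the logarithmic derivative turns products into sums, so P and Q cancel
  against their inverses.\<close>

lemma ftr_commutator_log_deriv:
  assumes "P * P' = 1" "P' * P = 1" "Q * Q' = 1" "Q' * Q = (1 :: ncpoly fps)"
  shows "ftr (Q * P * Q' * P' * fps_deriv (P * Q * P' * Q')) n = 0"
proof -
  have c: "P * (P' * z) = z" "P' * (P * z) = z" "Q * (Q' * z) = z" "Q' * (Q * z) = z" for z
    using assms by (simp_all flip: mult.assoc)
  have D: "f * fps_deriv g = - (fps_deriv f * g)" if "f * g = (1 :: ncpoly fps)" for f g
    using arg_cong[OF that, of fps_deriv] by (simp add: eq_neg_iff_add_eq_0)
  have 1: "ftr (Q * P * Q' * P' * (P * Q * P' * fps_deriv Q')) n = ftr (Q * fps_deriv Q') n"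
    by (simp add: mult.assoc c)
  have 2: "ftr (Q * P * Q' * P' * (P * Q * fps_deriv P' * Q')) n = ftr (P * fps_deriv P') n"
    using ftr_comm[of Q "P * fps_deriv P' * Q'" n] by (simp add: mult.assoc c assms)
  have 3: "ftr (Q * P * Q' * P' * (P * fps_deriv Q * P' * Q')) n = ftr (Q' * fps_deriv Q) n"
    using ftr_comm[of "Q * P * Q' * fps_deriv Q" "P' * Q'" n] by (simp add: mult.assoc c)
  have 4: "ftr (Q * P * Q' * P' * (fps_deriv P * Q * P' * Q')) n = ftr (P' * fps_deriv P) n"
    using ftr_comm[of "Q * P * Q' * P' * fps_deriv P" "Q * P' * Q'" n] by (simp add: mult.assoc c)
  have "ftr (Q * P * Q' * P' * fps_deriv (P * Q * P' * Q')) n =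
     ftr (Q * fps_deriv Q') n + ftr (P * fps_deriv P') n + ftr (Q' * fps_deriv Q) n + ftr (P' * fps_deriv P) n"
    unfolding fps_deriv_mult distrib_left distrib_right
    using 1 2 3 4 by (simp add: ftr_linear mult.assoc distrib_left distrib_right)
  also have "\<dots> = 0"
    using ftr_comm[of "fps_deriv Q" Q' n] ftr_comm[of "fps_deriv P" P' n]
    by (simp add: D[OF assms(1)] D[OF assms(3)] ftr_linear)
  finally show ?thesis .
qed

text \<open>Cyclicity brings the differentiated factor of every summand into the same position. The
  extra power \<open>S ^ m\<close> is the buffer into which the induction moves factors of
  S.\<close>

lemma ftr_power_deriv: "ftr (fps_deriv (S ^ e) * S ^ m) n = of_nat e *\<^sub>C ftr (S ^ (e - 1 + m) * fps_deriv S) n"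
proof (induct e arbitrary: m)
  case 0 then show ?case by (simp add: ftr_linear)
next
  case (Suc e)
  have "ftr (fps_deriv (S ^ Suc e) * S ^ m) n =
      ftr (S * (fps_deriv (S ^ e) * S ^ m)) n + ftr (fps_deriv S * S ^ (e + m)) n"
    by (simp add: distrib_right ftr_linear mult.assoc power_add)
  also have "ftr (S * (fps_deriv (S ^ e) * S ^ m)) n = ftr (fps_deriv (S ^ e) * S ^ Suc m) n"
    using ftr_comm[of S "fps_deriv (S ^ e) * S ^ m" n] by (simp add: mult.assoc power_commutes)
  also have "\<dots> = of_nat e *\<^sub>C ftr (S ^ (e + m) * fps_deriv S) n"
    unfolding Suc by (cases e) simp_all
  also have "ftr (fps_deriv S * S ^ (e + m)) n = ftr (S ^ (e + m) * fps_deriv S) n"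
    by (rule ftr_comm)
  finally show ?case by (simp add: cscale_add_left)
qed

text \<open>The sum is minus the coefficient of the trace of log(1 + S), obtained by integrating the
  vanishing trace of \<open>(1 + S)^(-1) S'\<close>. It is finite because S has no constant
  term.\<close>

lemma ftr_log:
  assumes S0: "fps_nth S 0 = 0" and inv: "L * (1 + S) = 1" and tr: "\<And>n. ftr (L * fps_deriv S) n = 0"
    and a: "a > 0"
  shows "(\<Sum>e\<in>{1..a}. ((-1) ^ e / of_nat e) *\<^sub>C ftr (S ^ e) a) = 0"
proof -
  have L: "L = (\<Sum>e<m. (- S) ^ e) + L * (- S) ^ m" for m
  proof (induct m)
    case (Suc m)
    have "L + L * S = 1" using inv by (simp add: distrib_left)
    then have "L = 1 - L * S" by (simp only: eq_diff_eq)
    then have "L = 1 + L * (- S)" by simp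
    then have "L * (- S) ^ m = (1 + L * (- S)) * (- S) ^ m" by (rule arg_cong)
    then have "L * (- S) ^ m = (- S) ^ m + L * (- S) ^ Suc m"
      by (simp only: distrib_right mult_1_left mult.assoc power_Suc)
    then have "(\<Sum>e<Suc m. (- S) ^ e) + L * (- S) ^ Suc m = (\<Sum>e<m. (- S) ^ e) + L * (- S) ^ m"
      by (simp only: sum.lessThan_Suc add.assoc)
    then show ?case by (rule trans[OF Suc sym])
  qed simp
  \<comment> \<open>The remainder of the geometric series starts in degree a, beyond the coefficient
    a - 1 that is extracted.\<close>
  have z: "fps_nth (L * (- S) ^ a * fps_deriv S) (a - 1) = 0"
  proof -
    have "fps_nth ((- S) ^ a) i = 0" if "i < a" for i
      using that S0 by (intro nth_power_zero_prefix) auto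
    then have "fps_nth (L * (- S) ^ a) i = 0" if "i < a" for i
      using that by (simp add: fps_mult_nth)
    then show ?thesis using a by (simp add: fps_mult_nth)
  qed
  have "L * fps_deriv S = (\<Sum>e<a. (- S) ^ e * fps_deriv S) + L * (- S) ^ a * fps_deriv S"
    using arg_cong[OF L[of a], of "\<lambda>f. f * fps_deriv S"] by (simp add: distrib_right sum_distrib_right)
  then have "ftr (L * fps_deriv S) (a - 1) = (\<Sum>e<a. ftr ((- S) ^ e * fps_deriv S) (a - 1))"
    by (simp add: ftr_def z[unfolded One_nat_def] trace_linear fps_sum_nth)
  also have "\<dots> = (\<Sum>e<a. (-1) ^ e *\<^sub>C ftr (S ^ e * fps_deriv S) (a - 1))"
  proof (rule sum.cong[OF refl])
    fix e
    have "(- S) ^ e = (if even e then S ^ e else - (S ^ e))" by simp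
    then show "ftr ((- S) ^ e * fps_deriv S) (a - 1) = (-1) ^ e *\<^sub>C ftr (S ^ e * fps_deriv S) (a - 1)"
      by (simp add: ftr_linear)
  qed
  finally have 0: "(\<Sum>e<a. (-1) ^ e *\<^sub>C ftr (S ^ e * fps_deriv S) (a - 1)) = 0" using tr by simp
  have "((-1) ^ Suc e / of_nat (Suc e)) *\<^sub>C ftr (S ^ Suc e) a =
      (- (1 / of_nat a)) *\<^sub>C ((-1) ^ e *\<^sub>C ftr (S ^ e * fps_deriv S) (a - 1))" for e
  proof -
    have "of_nat a *\<^sub>C ftr (S ^ Suc e) a = ftr (fps_deriv (S ^ Suc e) * S ^ 0) (a - 1)"
      using a by (simp add: ftr_def fps_deriv_nth trace_linear of_nat_mult_cscale del: fps_deriv_mult power_Suc)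
    also have "\<dots> = of_nat (Suc e) *\<^sub>C ftr (S ^ e * fps_deriv S) (a - 1)"
      unfolding ftr_power_deriv by simp
    finally have eq: "of_nat a *\<^sub>C ftr (S ^ Suc e) a = of_nat (Suc e) *\<^sub>C ftr (S ^ e * fps_deriv S) (a - 1)" .
    have "ftr (S ^ Suc e) a = (1 / of_nat a) *\<^sub>C (of_nat a *\<^sub>C ftr (S ^ Suc e) a)" using a by simp
    also have "\<dots> = (of_nat (Suc e) / of_nat a) *\<^sub>C ftr (S ^ e * fps_deriv S) (a - 1)"
      unfolding eq by (simp del: of_nat_Suc)
    finally show ?thesis by (simp del: of_nat_Suc power_Suc add: power_Suc[of "-1"])
  qed
  then have "(\<Sum>e<a. ((-1) ^ Suc e / of_nat (Suc e)) *\<^sub>C ftr (S ^ Suc e) a) =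
      (- (1 / of_nat a)) *\<^sub>C (\<Sum>e<a. (-1) ^ e *\<^sub>C ftr (S ^ e * fps_deriv S) (a - 1))"
    unfolding cscale_sum_right by (intro sum.cong) auto
  moreover have "(\<Sum>e\<in>{1..a}. ((-1) ^ e / of_nat e) *\<^sub>C ftr (S ^ e) a) =
      (\<Sum>e<a. ((-1) ^ Suc e / of_nat (Suc e)) *\<^sub>C ftr (S ^ Suc e) a)"
    by (rule sum.reindex_bij_witness[of _ Suc "\<lambda>e. e - 1"]) auto
  ultimately show ?thesis by (simp only: 0 cscale_zero_right)
qed

lemma ftr_sser: "a > 0 \<Longrightarrow> (\<Sum>e\<in>{1..a}. ((-1) ^ e / of_nat e) *\<^sub>C ftr (sser ^ e) a) = 0"
proof (rule ftr_log[OF sser_0, where L = "lin_fps gx * lin_fps (gy * gx) * geo_fps gx * geo_fps (gy * gx)"])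
  let ?P = "lin_fps (gy * gx)" and ?P' = "geo_fps (gy * gx)" and ?Q = "lin_fps gx" and ?Q' = "geo_fps gx"
  have c: "?P * (?P' * z) = z" "?P' * (?P * z) = z" "?Q * (?Q' * z) = z" "?Q' * (?Q * z) = z" for z
    by (simp_all add: lin_geo geo_lin flip: mult.assoc)
  show "?Q * ?P * ?Q' * ?P' * (1 + sser) = 1"
    unfolding sser_commutator by (simp add: mult.assoc c lin_geo)
  have "fps_deriv sser = fps_deriv (1 + sser)" by simp
  then show "ftr (?Q * ?P * ?Q' * ?P' * fps_deriv sser) n = 0" for n
    unfolding sser_commutator using ftr_commutator_log_deriv[OF lin_geo geo_lin lin_geo geo_lin] by simp
qed

section \<open>Expansion over tuples\<close>

definition TT :: "nat \<Rightarrow> nat \<Rightarrow> (nat \<times> nat) list set" where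
  "TT e a = {t. length t = e \<and> (\<forall>p\<in>set t. snd p < fst p) \<and> (\<Sum>p\<leftarrow>t. fst p + 1) = a}"

abbreviation zfac :: "nat \<times> nat \<Rightarrow> ncpoly" where
  "zfac p \<equiv> rho * zmon (fst p) (snd p)"

lemma tuple_bound: "\<lbrakk>\<forall>p\<in>set t. snd p < fst p; (\<Sum>p\<leftarrow>t. fst p + 1) = a; p \<in> set t\<rbrakk> \<Longrightarrow> fst p < a \<and> snd p < (a :: nat)"
  using member_le_sum_list[of "fst p + 1" "map (\<lambda>p. fst p + 1) t"] by force

lemma finite_TT: "finite (TT e a)"
proof (rule finite_subset)
  show "TT e a \<subseteq> {t. set t \<subseteq> {..<a} \<times> {..<a} \<and> length t = e}"
  proof
    fix t assume t: "t \<in> TT e a"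
    have "p \<in> {..<a} \<times> {..<a}" if "p \<in> set t" for p
      using tuple_bound[of t a p] t that by (cases p) (simp add: TT_def)
    then show "t \<in> {t. set t \<subseteq> {..<a} \<times> {..<a} \<and> length t = e}" using t by (auto simp: TT_def)
  qed
  show "finite {t. set t \<subseteq> {..<a} \<times> {..<a} \<and> length t = e}"
    by (rule finite_lists_length_eq) auto
qed

lemma nth_sser: "fps_nth sser m = (\<Sum>p\<in>(\<lambda>j. (m - 1, j)) ` {..<m - 1}. zfac p)"
proof -
  have "fps_nth sser m = (\<Sum>j<m - 1. rho * ((gx * gy) ^ j * gx ^ (m - 1 - j)))"
    by (simp add: sser_def tpoly_def sum_distrib_left)
  also have "\<dots> = (\<Sum>j<m - 1. rho * zmon (m - 1) j)"
    by (rule sum.cong) (auto simp: zmon_def)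
  finally show ?thesis by (simp add: sum.reindex inj_on_def)
qed

lemma nth_sser_power: "fps_nth (sser ^ e) a = (\<Sum>t\<in>TT e a. prod_list (map zfac t))"
proof (induct e arbitrary: a)
  case 0
  have "TT 0 a = (if a = 0 then {[]} else {})" by (auto simp: TT_def)
  then show ?case by simp
next
  case (Suc e)
  let ?I = "\<lambda>m. (\<lambda>j. (m - 1, j)) ` {..<m - 1 :: nat}"
  have "fps_nth (sser ^ Suc e) a = (\<Sum>m=0..a. \<Sum>p\<in>?I m. \<Sum>t\<in>TT e (a - m). zfac p * prod_list (map zfac t))"
    by (simp only: power_Suc fps_mult_nth nth_sser Suc sum_product)
  also have "\<dots> = (\<Sum>(m, p, t)\<in>(SIGMA m:{0..a}. SIGMA p:?I m. TT e (a - m)). zfac p * prod_list (map zfac t))"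
    by (simp add: sum.Sigma finite_TT)
  also have "\<dots> = (\<Sum>t\<in>TT (Suc e) a. prod_list (map zfac t))"
  proof (rule sum.reindex_bij_witness[where i = "\<lambda>t. (fst (hd t) + 1, hd t, tl t)" and j = "\<lambda>(m, p, t). p # t"], goal_cases)
    case (1 x) then show ?case by auto
  next
    case (2 x) then show ?case by (auto simp: TT_def)
  next
    case (3 t) then show ?case by (cases t) (auto simp: TT_def)
  next
    case (4 t) then show ?case
    proof (cases t)
      case (Cons p s) then show ?thesis using 4 by (cases p) (auto simp: TT_def)
    qed (simp add: TT_def)
  next
    case (5 x) then show ?case by auto
  qed
  finally show ?case .
qed

lemma ypart_zfac: assumes "snd p < fst p" shows "ypart (snd p + 1) (zfac p)"
proof -
  have "ypart 1 rho" unfolding rho_def gen_eq by (intro homog_diff) (auto simp: wd_mult intro!: homog_wd)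
  moreover have "ypart (snd p) (zmon (fst p) (snd p))"
    by (rule zmon_wd[of "fst p" "snd p"]) (simp add: homog_wd)
  ultimately show ?thesis using homog_mult[of "\<lambda>w. ny w" 1 rho "snd p"] by simp
qed

lemma ypart_prod: "\<forall>p\<in>set t. snd p < fst p \<Longrightarrow> ypart (\<Sum>p\<leftarrow>t. snd p + 1) (prod_list (map zfac t))"
proof (induct t)
  case Nil then show ?case using homog_wd[of "\<lambda>w. ny w" "[]" 0] by simp
next
  case (Cons p t)
  then show ?case using homog_mult[OF ypart_zfac[of p]] by simp
qed

lemma W_tuples_eq: "W_tuples a b = {t. t \<noteq> [] \<and> (\<forall>p\<in>set t. snd p < fst p) \<and> (\<Sum>p\<leftarrow>t. fst p + 1) = a \<and> (\<Sum>p\<leftarrow>t. snd p + 1) = b}"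
  by (simp add: W_tuples_def case_prod_unfold)

lemma length_le_sum: "length t \<le> (\<Sum>p\<leftarrow>t. fst p + (1::nat))"
  by (induct t) auto

lemma W_tuples_UN: "W_tuples a b = (\<Union>e\<in>{1..a}. {t \<in> TT e a. (\<Sum>p\<leftarrow>t. snd p + 1) = b})"
proof -
  have "length t \<in> {1..a}" if "t \<in> W_tuples a b" for t
    using that length_le_sum[of t] by (cases t) (auto simp: W_tuples_eq)
  then show ?thesis by (auto simp: W_tuples_eq TT_def)
qed

lemma finite_W_tuples: "finite (W_tuples a b)"
  unfolding W_tuples_UN
proof (rule finite_UN_I)
  show "finite {t \<in> TT e a. (\<Sum>p\<leftarrow>t. snd p + 1) = b}" for e
    by (rule finite_subset[OF _ finite_TT[of e a]]) blast
qed simp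

text \<open>The logarithm gives the identity for all b at once. The summand of a tuple is
  homogeneous in y of degree b, so the identity splits into one for each b.\<close>

lemma trace_W_tuples:
  assumes "a > 0"
  shows "(\<Sum>t\<in>W_tuples a b. ((-1) ^ length t / of_nat (length t)) *\<^sub>C cyc_trace (prod_list (map zfac t))) = 0"
proof -
  define h where "h t = ((-1) ^ length t / of_nat (length t)) *\<^sub>C cyc_trace (prod_list (map zfac t))" for t
  define c where "c t = (\<Sum>p\<leftarrow>t. snd p + 1)" for t :: "(nat \<times> nat) list"
  have all: "(\<Sum>e\<in>{1..a}. \<Sum>t\<in>TT e a. h t) = 0"
  proof -
    have "(\<Sum>e\<in>{1..a}. \<Sum>t\<in>TT e a. h t) = (\<Sum>e\<in>{1..a}. ((-1) ^ e / of_nat e) *\<^sub>C ftr (sser ^ e) a)"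
      unfolding ftr_def nth_sser_power trace_linear cscale_sum_right
      by (intro sum.cong refl) (simp add: TT_def h_def)
    then show ?thesis using ftr_sser[OF assms] by simp
  qed
  have yp: "ypart (c t) (h t)" if "t \<in> TT e a" for t e
    unfolding c_def h_def using that by (intro homog_cscale homog_trace ypart_prod) (simp_all add: TT_def)
  have W: "W_tuples a b = (\<Union>e\<in>{1..a}. {t \<in> TT e a. c t = b})"
    unfolding W_tuples_UN c_def ..
  have disj: "(\<Sum>t\<in>W_tuples a b. h t) = (\<Sum>e\<in>{1..a}. \<Sum>t\<in>{t \<in> TT e a. c t = b}. h t)"
    unfolding W
  proof (rule sum.UNION_disjoint)
    show "\<forall>e\<in>{1..a}. finite {t \<in> TT e a. c t = b}"
    proof
      show "finite {t \<in> TT e a. c t = b}" for e by (rule finite_subset[OF _ finite_TT[of e a]]) blast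
    qed
    show "\<forall>i\<in>{1..a}. \<forall>j\<in>{1..a}. i \<noteq> j \<longrightarrow> {t \<in> TT i a. c t = b} \<inter> {t \<in> TT j a. c t = b} = {}"
      by (auto simp: TT_def)
  qed simp
  have "Poly_Mapping.lookup (\<Sum>t\<in>W_tuples a b. h t) w = 0" for w
  proof (cases "ny (letters w) = b")
    case True
    have "(\<Sum>t\<in>{t \<in> TT e a. c t = b}. Poly_Mapping.lookup (h t) w) = (\<Sum>t\<in>TT e a. Poly_Mapping.lookup (h t) w)" for e
    proof (rule sum.mono_neutral_left[OF finite_TT])
      show "\<forall>t\<in>TT e a - {t \<in> TT e a. c t = b}. Poly_Mapping.lookup (h t) w = 0"
      proof
        fix t assume t: "t \<in> TT e a - {t \<in> TT e a. c t = b}"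
        then have "t \<in> TT e a" by blast
        from yp[OF this] show "Poly_Mapping.lookup (h t) w = 0"
          using t True by (auto simp: homog_def)
      qed
    qed auto
    then have "Poly_Mapping.lookup (\<Sum>t\<in>W_tuples a b. h t) w = Poly_Mapping.lookup (\<Sum>e\<in>{1..a}. \<Sum>t\<in>TT e a. h t) w"
      by (simp only: disj lookup_sum)
    then show ?thesis unfolding all by simp
  next
    case False
    have "ypart b (\<Sum>t\<in>W_tuples a b. h t)"
    proof (rule homog_sum)
      fix t assume "t \<in> W_tuples a b"
      then obtain e where "t \<in> TT e a" "c t = b" unfolding W by blast
      then show "ypart b (h t)" using yp by blast
    qed
    then show ?thesis using False by (auto simp: homog_def)
  qed
  then have "(\<Sum>t\<in>W_tuples a b. h t) = 0" by (intro poly_mapping_eqI) simp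
  then show ?thesis by (simp only: h_def)
qed

end

section \<open>The module \<open>W\<close>\<close>

text \<open>Exchanging x and y negates yx - xy, hence the sign at r'. The resulting automorphism of
  A carries \<open>W_{a,b}\<close> to \<open>W_{b,a}\<close> (\<open>Wrep_swp\<close>).\<close>

definition swap_letter :: "letter \<Rightarrow> ncpoly" where
  "swap_letter l = (case l of Lx \<Rightarrow> gy | Ly \<Rightarrow> gx | Lr \<Rightarrow> - gr)"

definition swp :: "ncpoly \<Rightarrow> ncpoly" where
  "swp = alghom swap_letter"

lemma clin_swp: "clin swp" by (simp add: swp_def clin_alghom)

lemma swp_mult: "swp (f * g) = swp f * swp g" by (simp add: swp_def alghom_mult)

lemma swp_gen [simp]: "swp gx = gy" "swp gy = gx" "swp gr = - gr"
  by (simp_all add: swp_def swap_letter_def)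

lemma swp_zmon: "j < i \<Longrightarrow> swp (zmon i j) = zmon j i"
  by (simp add: zmon_def swp_def alghom_mult alghom_power swap_letter_def)

lemma swp_expA: "expA (swp f) = swp (expA f)"
proof -
  have "expA (swap_letter l) = swp (if l = Lr then gy * gx - gx * gy else gen l)" for l
    by (cases l) (simp_all add: swap_letter_def expA_linear clin_simps[OF clin_swp] swp_mult)
  then show ?thesis by (simp add: swp_def expA_def alghom_comp)
qed

context coeff_ring
begin

lemma swp_F: "f \<in> F \<Longrightarrow> swp f \<in> F"
  unfolding swp_def by (rule alghom_in) (auto simp: swap_letter_def alg_in split: letter.split)

lemma swp_CC: assumes "f \<in> CC" shows "swp f \<in> CC"
proof (rule CC_induct[OF assms clin_swp ksub_CC])
  show "swp (wd u * wd v - wd v * wd u) \<in> CC" for u v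
    using swp_F trace_comm[of "expA (swp (wd u))" "expA (swp (wd v))"]
    by (simp add: CC_def clin_simps[OF clin_swp] swp_mult alg_in expA_linear expA_mult trace_linear)
  show "swp f \<in> CC" if "f \<in> kerA" for f
    using that by (simp add: CC_def swp_F swp_expA clin_simps[OF clin_swp] trace_linear)
qed

section \<open>The elements W as commutators\<close>

definition Wrep :: "nat \<Rightarrow> nat \<Rightarrow> (nat \<times> nat \<Rightarrow> ncpoly) \<Rightarrow> ncpoly" where
  "Wrep a b u = (\<Sum>C\<in>rot_orbit ` W_tuples a b. (of_nat (gcd a b) / of_nat (rep (SOME t. t \<in> C))) *\<^sub>C
      prod_list (map u (SOME t. t \<in> C)))"

lemma W_tuples_rotate: "t \<in> W_tuples a b \<Longrightarrow> rotate n t \<in> W_tuples a b"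
proof -
  have s: "sum_list (map f (rotate n t)) = sum_list (map f t)" for f :: "nat \<times> nat \<Rightarrow> nat"

  proof (induct n)
    case (Suc n)
    have "sum_list (map f (rotate1 s)) = sum_list (map f s)" for s by (cases s) simp_all
    then show ?case using Suc by simp
  qed simp
  assume "t \<in> W_tuples a b"
  then show ?thesis by (simp add: W_tuples_eq s)
qed

lemma W_tuples_orbit: "t \<in> W_tuples a b \<Longrightarrow> rot_orbit t \<subseteq> W_tuples a b"
  by (auto simp: W_tuples_rotate elim!: rot_orbitE)

lemma orbit_rep: assumes "C \<in> rot_orbit ` W_tuples a b"
  shows "(SOME t. t \<in> C) \<in> W_tuples a b" "C = rot_orbit (SOME t. t \<in> C)"
proof -
  obtain t where t: "t \<in> W_tuples a b" "C = rot_orbit t" using assms by blast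
  then have "t \<in> C" by (simp add: rot_orbit_self)
  then have s: "(SOME t. t \<in> C) \<in> C" by (rule someI)
  show "(SOME t. t \<in> C) \<in> W_tuples a b" using s t W_tuples_orbit by blast
  show "C = rot_orbit (SOME t. t \<in> C)" using s t rot_orbit_eq_iff by blast
qed

text \<open>The numbers a and b are sums along the tuple, so \<open>rep t\<close> divides both and
  the coefficient is an integer.\<close>

lemma W_coeff_in: assumes "t \<in> W_tuples a b" shows "of_nat (gcd a b) / of_nat (rep t) \<in> k"
proof -
  have "rep t dvd (\<Sum>p\<leftarrow>t. fst p + 1)" "rep t dvd (\<Sum>p\<leftarrow>t. snd p + 1)" by (rule rep_dvd_sum_list)+
  then have "rep t dvd gcd a b" using assms by (simp add: W_tuples_eq)
  then obtain m where m: "gcd a b = rep t * m" by (rule dvdE)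
  have "rep t > 0" using rep_mult_period[of t] assms by (cases t) (auto simp: W_tuples_eq intro: gr0I)
  then have "of_nat (gcd a b) / of_nat (rep t) = (of_nat m :: complex)" by (simp add: m)
  then show ?thesis by simp
qed

lemma W_sum_eq: assumes "\<And>p. u p \<in> F" shows "W_sum K a b u = clsV K (Wrep a b u)" "Wrep a b u \<in> F"
proof -
  let ?t = "\<lambda>C. SOME t. t \<in> C"
  let ?f = "\<lambda>C. (of_nat (gcd a b) / of_nat (rep (?t C))) *\<^sub>C prod_list (map u (?t C))"
  have p: "prod_list (map u t) \<in> F" for t by (rule monoid_alg_prod_list) (auto simp: assms)
  have f: "?f C \<in> F" if "C \<in> rot_orbit ` W_tuples a b" for C
    using W_coeff_in[OF orbit_rep(1)[OF that]] p by (rule ksub_cscale[OF ksub_F])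
  then show "Wrep a b u \<in> F" unfolding Wrep_def by (rule ksub_sum[OF ksub_F])
  interpret M: Module.module K "modV K" by (rule pres_module[OF pres_modV])
  have "W_sum K a b u = (\<Oplus>\<^bsub>modV K\<^esub>C\<in>rot_orbit ` W_tuples a b. clsV K (?f C))"
    unfolding W_sum_def rot_orbit_def[symmetric, abs_def] Let_def
  proof (rule M.M.finsum_cong'[OF refl])
    show "(\<lambda>C. clsV K (?f C)) \<in> rot_orbit ` W_tuples a b \<rightarrow> carrier (modV K)"
      using f presD(9)[OF pres_modV] by blast
    fix C assume C: "C \<in> rot_orbit ` W_tuples a b"
    show "(of_nat (gcd a b) / of_nat (rep (?t C))) \<odot>\<^bsub>modV K\<^esub> clsV K (prod_list (map u (?t C))) = clsV K (?f C)"
      using presD(6)[OF pres_modV W_coeff_in[OF orbit_rep(1)[OF C]] p] by simp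
  qed
  also have "\<dots> = clsV K (Wrep a b u)"
    unfolding Wrep_def using finite_W_tuples f by (intro pres_finsum[OF pres_modV]) auto
  finally show "W_sum K a b u = clsV K (Wrep a b u)" .
qed

lemma neg_prod_zfac: "expA (prod_list (map (\<lambda>(i, j). - gr * zmon i j) t)) =
    (-1) ^ length t *\<^sub>C prod_list (map zfac t)"
proof (induct t)
  case (Cons p t)
  have e: "expA (zmon i j) = zmon i j" for i j
  proof (rule zmon_wd[of i j])
    fix w assume "zmon i j = wd w" "nr w = 0"
    moreover have "expA (wd w) = wd w" if "nr w = 0" for w using that
    proof (induct w)
      case (Cons l w) then show ?case by (cases l) (auto simp: wd_Cons expA_mult split: if_splits)
    qed simp
    ultimately show "expA (zmon i j) = zmon i j" by simp
  qed
  show ?case using Cons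
    by (simp add: case_prod_unfold expA_mult expA_linear e mult_cscale_left mult_cscale_right rho_def mult.assoc)
qed simp

text \<open>An orbit has length / rep elements, so weight gcd / rep on orbits is weight gcd / length
  on tuples. The latter is, up to the factor gcd(a,b), the expansion of the logarithm.\<close>

lemma Wrep_CC: assumes "a > 0" shows "Wrep a b (\<lambda>(i, j). - gr * zmon i j) \<in> CC"
proof -
  let ?u = "\<lambda>(i, j). - gr * zmon i j"
  define \<Phi> where "\<Phi> t = cyc_trace (expA (prod_list (map ?u t)))" for t
  have rot: "\<Phi> (rotate1 t) = \<Phi> t" for t
    using trace_comm[of "expA (?u (hd t))" "expA (prod_list (map ?u (tl t)))"]
    by (cases t) (simp_all add: \<Phi>_def expA_mult)
  define h where "h t = (of_nat (gcd a b) / of_nat (length t)) *\<^sub>C \<Phi> t" for t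
  have "(\<Sum>t\<in>W_tuples a b. h t) = of_nat (gcd a b) *\<^sub>C
     (\<Sum>t\<in>W_tuples a b. ((-1) ^ length t / of_nat (length t)) *\<^sub>C cyc_trace (prod_list (map zfac t)))"
    unfolding cscale_sum_right h_def \<Phi>_def neg_prod_zfac by (rule sum.cong) (simp_all add: trace_linear)
  also have "\<dots> = 0" by (simp add: trace_W_tuples[OF assms])
  finally have h0: "(\<Sum>t\<in>W_tuples a b. h t) = 0" .
  have "(\<Sum>t\<in>W_tuples a b. h t) = (\<Sum>C\<in>rot_orbit ` W_tuples a b. of_nat (card C) *\<^sub>C h (SOME t. t \<in> C))"
    by (rule sum_orbits[OF finite_W_tuples W_tuples_orbit]) (simp_all add: h_def rot)
  also have "\<dots> = (\<Sum>C\<in>rot_orbit ` W_tuples a b. (of_nat (gcd a b) / of_nat (rep (SOME t. t \<in> C))) *\<^sub>C \<Phi> (SOME t. t \<in> C))"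
  proof (rule sum.cong[OF refl])
    fix C assume C: "C \<in> rot_orbit ` W_tuples a b"
    define t where "t = (SOME t. t \<in> C)"
    have t: "t \<in> W_tuples a b" "C = rot_orbit t" using orbit_rep[OF C] by (simp_all add: t_def)
    then have "length t > 0" by (auto simp: W_tuples_eq)
    moreover have l: "length t = rep t * period t" using rep_mult_period[of t] by simp
    ultimately have "rep t > 0" by (auto intro: gr0I)
    then have "of_nat (card C) * (of_nat (gcd a b) / of_nat (length t)) = (of_nat (gcd a b) / of_nat (rep t) :: complex)"
      using period(1)[of t] unfolding t(2) card_rot_orbit l by (simp add: field_simps)
    then show "of_nat (card C) *\<^sub>C h (SOME t. t \<in> C) = (of_nat (gcd a b) / of_nat (rep (SOME t. t \<in> C))) *\<^sub>C \<Phi> (SOME t. t \<in> C)"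
      by (simp add: h_def flip: t_def)
  qed
  also have "\<dots> = cyc_trace (expA (Wrep a b ?u))"
    by (simp add: Wrep_def trace_linear expA_linear \<Phi>_def)
  finally have "cyc_trace (expA (Wrep a b ?u)) = 0" using h0 by simp
  moreover have "Wrep a b ?u \<in> F" by (rule W_sum_eq(2)) (auto simp: alg_in)
  ultimately show ?thesis by (simp add: CC_def)
qed

lemma Wrep_swp: "Wrep a b (\<lambda>(i, j). gr * zmon j i) = swp (Wrep a b (\<lambda>(i, j). - gr * zmon i j))"
proof -
  have "prod_list (map (\<lambda>(i, j). gr * zmon j i) t) = swp (prod_list (map (\<lambda>(i, j). - gr * zmon i j) t))"
    if "\<forall>p\<in>set t. snd p < fst p" for t
    using that
  proof (induct t)
    case Nil then show ?case by (simp add: swp_def)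
  next
    case (Cons p t)
    then show ?case by (simp add: case_prod_unfold swp_mult clin_simps[OF clin_swp] swp_zmon)
  qed
  then have "prod_list (map (\<lambda>(i, j). gr * zmon j i) (SOME t. t \<in> C)) =
      swp (prod_list (map (\<lambda>(i, j). - gr * zmon i j) (SOME t. t \<in> C)))" if "C \<in> rot_orbit ` W_tuples a b" for C
    using orbit_rep(1)[OF that] by (simp add: W_tuples_eq)
  then show ?thesis
    unfolding Wrep_def clin_sum[OF clin_swp] clin_cscale[OF clin_swp] by (intro sum.cong) auto
qed

text \<open>Products of two elements of the ideal of r' have no linear term, so only the tuple of
  length one contributes, which is ((a - 1, b - 1)).\<close>

lemma weyl_Wrep:
  assumes u: "\<And>p. u p \<in> kerAb" and ab: "a > b" "b \<ge> 1"
  shows "weyl (Wrep a b u) = of_nat (gcd a b) *\<^sub>C weyl (u (a - 1, b - 1))"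
proof -
  let ?t0 = "[(a - 1, b - 1)]"
  have t0: "?t0 \<in> W_tuples a b" using ab by (auto simp: W_tuples_eq)
  have orb0: "rot_orbit ?t0 = {?t0}" by (auto simp: rot_orbit_def)
  have w: "weyl (prod_list (map u t)) = (if t = ?t0 then weyl (u (a - 1, b - 1)) else 0)"
    if t: "t \<in> W_tuples a b" for t
  proof (cases t)
    case Nil then show ?thesis using t by (simp add: W_tuples_eq)
  next
    case (Cons p s)
    show ?thesis
    proof (cases s)
      case Nil
      then have "t = ?t0" using t Cons by (cases p) (auto simp: W_tuples_eq)
      then show ?thesis by simp
    next
      case (Cons q r)
      have "prod_list (map u r) \<in> F" using u by (intro monoid_alg_prod_list) auto
      then have "prod_list (map u s) \<in> kerAb" using u[of q] Cons by (simp add: abl_mult alg_in)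
      then have "weyl (u p * prod_list (map u s)) = 0" using weyl_kerAb_mult(1)[OF u[of p], of "prod_list (map u s)"] by simp
      then show ?thesis using \<open>t = p # s\<close> Cons by simp
    qed
  qed
  have "weyl (Wrep a b u) = (\<Sum>C\<in>rot_orbit ` W_tuples a b. if C = rot_orbit ?t0 then of_nat (gcd a b) *\<^sub>C weyl (u (a - 1, b - 1)) else 0)"
    unfolding Wrep_def weyl_linear
  proof (rule sum.cong[OF refl])
    fix C assume C: "C \<in> rot_orbit ` W_tuples a b"
    show "(of_nat (gcd a b) / of_nat (rep (SOME t. t \<in> C))) *\<^sub>C weyl (prod_list (map u (SOME t. t \<in> C))) =
       (if C = rot_orbit ?t0 then of_nat (gcd a b) *\<^sub>C weyl (u (a - 1, b - 1)) else 0)"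
    proof (cases "C = rot_orbit ?t0")
      case True
      then have "(SOME t. t \<in> C) = ?t0" using orb0 by simp
      moreover have "rep ?t0 = 1" using rep_mult_period[of ?t0] by simp
      ultimately show ?thesis using True w[OF t0] by simp
    next
      case False
      then have "(SOME t. t \<in> C) \<noteq> ?t0" using orbit_rep(2)[OF C] by metis
      then show ?thesis using False w[OF orbit_rep(1)[OF C]] by simp
    qed
  qed
  also have "\<dots> = of_nat (gcd a b) *\<^sub>C weyl (u (a - 1, b - 1))"
    using finite_W_tuples t0 by simp
  finally show ?thesis .
qed

definition Wgens :: "ncpoly set" where
  "Wgens = {Wrep a b (\<lambda>(i, j). - gr * zmon i j) | a b. a > b \<and> b \<ge> 1} \<union>
     {Wrep a b (\<lambda>(i, j). gr * zmon j i) | a b. a > b \<and> b \<ge> 1} \<union>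
     {(gx * gy + gr) ^ a - (gx * gy) ^ a | a. a \<ge> 1}"

lemma trace_yx_power: "cyc_trace ((gy * gx) ^ n) = cyc_trace ((gx * gy) ^ n)"
proof (cases n)
  case (Suc m)
  have "(gy * gx) ^ Suc m = gy * ((gx * gy) ^ m * gx)" by (simp add: xy_power_x mult.assoc)
  moreover have "(gx * gy) ^ m * gx * gy = (gx * gy) ^ Suc m" by (simp add: mult.assoc power_Suc2 del: power_Suc)
  ultimately show ?thesis using trace_comm[of gy "(gx * gy) ^ m * gx"] Suc by simp
qed simp

text \<open>In A the element xy + r' is yx, and \<open>(yx)^a\<close> is a rotation of
  \<open>(xy)^a\<close>.\<close>

lemma Waa_CC: "(gx * gy + gr) ^ a - (gx * gy) ^ a \<in> CC"
  using trace_yx_power[of a] by (simp add: CC_def alg_in expA_linear expA_power expA_mult trace_linear)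

lemma weyl_Waa: assumes "a \<ge> 1" shows "weyl ((gx * gy + gr) ^ a - (gx * gy) ^ a) = of_nat a *\<^sub>C xy_monom (a - 1) (a - 1)"
proof -
  have e: "weyl ((gx * gy + gr) ^ a) = weyl ((gy * gx) ^ a)"
  proof -
    have "weyl (expA ((gx * gy + gr) ^ a)) = weyl ((gx * gy + gr) ^ a)" by (rule weyl_expA) (simp add: alg_in)
    then show ?thesis by (simp add: expA_power expA_linear expA_mult)
  qed
  \<comment> \<open>The inversions number n(n+1)/2 and n(n-1)/2; only the difference is
    needed.\<close>
  have p: "yx_pairs (concat (replicate n [Ly, Lx])) = yx_pairs (concat (replicate n [Lx, Ly])) + n" for n
  proof (induct n)
    case (Suc n)
    then show ?case using yx_pairs_append[of "[Ly, Lx]" "concat (replicate n [Ly, Lx])"]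
        yx_pairs_append[of "[Lx, Ly]" "concat (replicate n [Lx, Ly])"]
      by (simp add: count_concat_replicate)
  qed simp
  have "weyl ((gy * gx) ^ a) - weyl ((gx * gy) ^ a) = of_nat a *\<^sub>C xy_monom (a - 1) (a - 1)"
    by (simp add: gen_eq wd_mult wd_power weyl_wd weyl_word_def count_concat_replicate p cscale_add_left)
  then show ?thesis by (simp add: weyl_linear e)
qed

lemma Wgens_CC: "Wgens \<subseteq> CC"
proof -
  have "Wrep a b (\<lambda>(i, j). gr * zmon j i) \<in> CC" if "a > b" for a b
    unfolding Wrep_swp using that by (intro swp_CC Wrep_CC) simp
  then show ?thesis using Wrep_CC Waa_CC unfolding Wgens_def by auto
qed

lemma gcdspan_Wgens: assumes "p \<in> gcdspan" shows "\<exists>h\<in>kspan Wgens. weyl h = p"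
proof -
  have "\<exists>h\<in>kspan Wgens. weyl h = of_nat (gcd a b) *\<^sub>C xy_monom (a - 1) (b - 1)" if "a \<ge> 1" "b \<ge> 1" for a b
  proof -
    consider "a > b" | "a < b" | "a = b" by linarith
    then show ?thesis
    proof cases
      case 1
      let ?w = "Wrep a b (\<lambda>(i, j). - gr * zmon i j)"
      have "weyl ?w = of_nat (gcd a b) *\<^sub>C weyl (- gr * zmon (a - 1) (b - 1))"
        using weyl_Wrep[of "\<lambda>(i, j). - gr * zmon i j", OF _ 1 that(2)] by (simp add: case_prod_unfold abl_linear abl_mult alg_in)
      also have "\<dots> = - (of_nat (gcd a b) *\<^sub>C xy_monom (a - 1) (b - 1))" by (simp add: weyl_linear weyl_r)
      finally have "weyl ((-1) *\<^sub>C ?w) = of_nat (gcd a b) *\<^sub>C xy_monom (a - 1) (b - 1)" by (simp add: weyl_linear)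
      moreover have "?w \<in> kspan Wgens" using 1 that by (intro kspan_base) (auto simp: Wgens_def)
      then have "(-1) *\<^sub>C ?w \<in> kspan Wgens" by (intro ksub_cscale[OF ksub_kspan]) auto
      ultimately show ?thesis by blast
    next
      case 2
      let ?w = "Wrep b a (\<lambda>(i, j). gr * zmon j i)"
      have "weyl ?w = of_nat (gcd b a) *\<^sub>C weyl (gr * zmon (a - 1) (b - 1))"
        using weyl_Wrep[of "\<lambda>(i, j). gr * zmon j i", OF _ 2 that(1)] by (simp add: case_prod_unfold abl_linear abl_mult alg_in)
      also have "\<dots> = of_nat (gcd a b) *\<^sub>C xy_monom (a - 1) (b - 1)" by (simp add: weyl_r gcd.commute)
      finally have "weyl ?w = of_nat (gcd a b) *\<^sub>C xy_monom (a - 1) (b - 1)" .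
      moreover have "?w \<in> kspan Wgens" using 2 that by (intro kspan_base) (auto simp: Wgens_def)
      ultimately show ?thesis by blast
    next
      case 3
      have "(gx * gy + gr) ^ a - (gx * gy) ^ a \<in> kspan Wgens" using that by (intro kspan_base) (auto simp: Wgens_def)
      then show ?thesis using weyl_Waa[OF that(1)] 3 by (intro bexI) auto
    qed
  qed
  then have "{of_nat (gcd a b) *\<^sub>C xy_monom (a - 1) (b - 1) | a b. a \<ge> 1 \<and> b \<ge> 1} \<subseteq> weyl ` kspan Wgens" by force
  then have "gcdspan \<subseteq> weyl ` kspan Wgens"
    unfolding gcdspan_def by (intro kspan_minimal ksub_image[OF clin_weyl ksub_kspan])
  then show ?thesis using assms by auto
qed

text \<open>A combination of the W with the same linear term exists by \<open>gcdspan_Wgens\<close>,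
  and a commutator with vanishing linear term is a relation of V.\<close>

lemma CC_mod_Wgens: assumes "f \<in> CC" shows "\<exists>h\<in>kspan Wgens. f - h \<in> relV"
proof -
  obtain h where h: "h \<in> kspan Wgens" "weyl h = weyl f" using gcdspan_Wgens[OF weyl_CC[OF assms]] by blast
  have "h \<in> CC" using h kspan_minimal[OF Wgens_CC ksub_CC] by blast
  then have "f - h \<in> relV" using assms h by (intro CC_weyl_inj ksub_diff[OF ksub_CC]) (auto simp: weyl_linear)
  then show ?thesis using h by blast
qed

text \<open>W turns out to be the image of \<open>[A, A]\<close> in V. In this form it is stable
  under \<Gamma>, which its generators do not show.\<close>

lemma modW_eq: "modW K = clsV K ` CC"
proof -
  have "modW K = mod_span K (modV K) (clsV K ` Wgens)"
  proof -
    have 1: "W_sum K a b (\<lambda>(i, j). - gr * zmon i j) = clsV K (Wrep a b (\<lambda>(i, j). - gr * zmon i j))" for a b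
      by (rule W_sum_eq(1)) (auto simp: alg_in)
    have 2: "W_sum K a b (\<lambda>(i, j). gr * zmon j i) = clsV K (Wrep a b (\<lambda>(i, j). gr * zmon j i))" for a b
      by (rule W_sum_eq(1)) (auto simp: alg_in)
    have 3: "clsV K ((gx * gy + gr) ^ a) \<ominus>\<^bsub>modV K\<^esub> clsV K ((gx * gy) ^ a) = clsV K ((gx * gy + gr) ^ a - (gx * gy) ^ a)" for a
      by (rule pres_diff[OF pres_modV]) (auto simp: alg_in)
    show ?thesis
      unfolding modW_def 1 2 3 Wgens_def image_Un by (intro arg_cong[where f = "mod_span K (modV K)"] arg_cong2[where f = "(\<union>)"]) blast+
  qed
  also have "\<dots> = clsV K ` kspan Wgens"
    using Wgens_CC CC_F by (intro pres_mod_span[OF pres_modV]) blast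
  also have "\<dots> = clsV K ` CC"
  proof
    show "clsV K ` kspan Wgens \<subseteq> clsV K ` CC" using kspan_minimal[OF Wgens_CC ksub_CC] by blast
    show "clsV K ` CC \<subseteq> clsV K ` kspan Wgens"
    proof
      fix v assume "v \<in> clsV K ` CC"
      then obtain f where f: "f \<in> CC" "v = clsV K f" by blast
      obtain h where h: "h \<in> kspan Wgens" "f - h \<in> relV" using CC_mod_Wgens[OF f(1)] by blast
      have "h \<in> F" using h(1) kspan_minimal[OF Wgens_CC ksub_CC] CC_F by blast
      then have "clsV K f = clsV K h" using clsV_eq[of f h] f(1) CC_F h(2) by blast
      then show "v \<in> clsV K ` kspan Wgens" using f h by blast
    qed
  qed
  finally show ?thesis .
qed

end

section \<open>Powers of \<open>yx - xy\<close> up to cyclic permutation\<close>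

lemma sum_power_words:
  fixes Y :: "'l \<Rightarrow> 'r::ring_1"
  assumes "finite L"
  shows "(\<Sum>l\<in>L. Y l) ^ n = (\<Sum>w\<in>{w. set w \<subseteq> L \<and> length w = n}. prod_list (map Y w))"
proof (induct n)
  case 0
  have "{w. set w \<subseteq> L \<and> length w = 0} = {[]}" by auto
  then show ?case by simp
next
  case (Suc n)
  let ?S = "{w. set w \<subseteq> L \<and> length w = n}"
  have "(\<Sum>l\<in>L. Y l) ^ Suc n = (\<Sum>(l, w)\<in>L \<times> ?S. Y l * prod_list (map Y w))"
    by (simp add: Suc sum_product sum.cartesian_product)
  also have "\<dots> = (\<Sum>w\<in>{w. set w \<subseteq> L \<and> length w = Suc n}. prod_list (map Y w))"
    by (rule sum.reindex_bij_witness[where i = "\<lambda>w. (hd w, tl w)" and j = "\<lambda>(l, w). l # w"])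
      (auto simp: length_Suc_conv)
  finally show ?case .
qed

lemma rotate1_eq_imp_replicate: "rotate1 w = w \<Longrightarrow> w = replicate (length w) (hd w)"
proof (induct w)
  case (Cons l w)
  then have *: "w @ [l] = l # w" by simp
  have "\<forall>x\<in>set w. x = l"
    using *
  proof (induct w)
    case (Cons x w) then show ?case by auto
  qed simp
  then show ?case by (simp add: replicate_length_same[symmetric])
qed simp

lemma rot_orbit_replicate: "rot_orbit (replicate n l) = {replicate n l}"
proof -
  have "rotate i (replicate n l) = replicate n l" for i
  proof (induct i)
    case (Suc i)
    have "rotate1 (replicate n l) = replicate n l" by (cases n) (simp_all add: replicate_append_same)
    then show ?case using Suc by simp
  qed simp
  then show ?thesis by (auto simp: rot_orbit_def)
qed

lemma canon_replicate [simp]: "canon (replicate n l) = replicate n l"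
  using canon_in[of "replicate n l"] by (simp add: rot_orbit_replicate)

lemma gen_power: "gen l ^ n = wd (replicate n l)"
  by (simp add: gen_eq wd_power)

lemma trace_idem [simp]: "cyc_trace (cyc_trace f) = cyc_trace f"
  by (rule clin_wd_eqI[OF lin_trace[OF clin_cyc_trace] clin_cyc_trace]) (simp add: cyc_trace_wd)

lemma trace_gr_power [simp]: "cyc_trace (gr ^ n) = gr ^ n"
  by (simp add: gen_power cyc_trace_wd)

text \<open>The normal form of the class of \<open>r'^n\<close> as a combination of cyclic words in
  x and y (\<open>chi_gr_power\<close>).\<close>

definition rr :: "nat \<Rightarrow> ncpoly" where "rr n = cyc_trace (rho ^ n)"

lemma rr_1: "rr 1 = 0" if "coeff_ring K"
proof -
  interpret coeff_ring K by fact
  show ?thesis using trace_comm[of gx gy] by (simp add: rr_def rho_def trace_linear)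
qed

text \<open>The words in the expansion of \<open>(yx - xy)^n\<close> are strings of n syllables yx
  (\<open>True\<close>) or xy (\<open>False\<close>).\<close>

definition pairw :: "bool list \<Rightarrow> letter list" where
  "pairw w = concat (map (\<lambda>b. if b then [Ly, Lx] else [Lx, Ly]) w)"

lemma pairw_simps [simp]: "pairw [] = []" "pairw (b # w) = (if b then [Ly, Lx] else [Lx, Ly]) @ pairw w"
  "pairw (v @ w) = pairw v @ pairw w"
  by (simp_all add: pairw_def)

lemma length_pairw [simp]: "length (pairw w) = 2 * length w"
  by (induct w) auto

lemma pairw_inj: "pairw v = pairw w \<Longrightarrow> v = w"
proof (induct v arbitrary: w)
  case Nil then show ?case by (cases w) (auto split: if_splits)
next
  case (Cons b v) then show ?case by (cases w) (auto split: if_splits)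
qed

lemma pairw_rotate1: "pairw (rotate1 w) = rotate 2 (pairw w)"
  by (cases w) (auto simp: numeral_2_eq_2)

lemma pairw_rotate: "pairw (rotate j w) = rotate (2 * j) (pairw w)"
  by (induct j) (simp_all add: pairw_rotate1 rotate_rotate numeral_2_eq_2)

text \<open>Rotation by one letter cuts every syllable in two. The pieces form syllables again only
  if x and y alternate throughout, that is, if all syllables are equal.\<close>

lemma pairw_odd_rotation:
  "(if b then Lx else Ly) # pairw t @ [if b then Ly else Lx] = pairw w \<Longrightarrow> set t \<subseteq> {b}"
proof (induct t arbitrary: w)
  case (Cons c t)
  obtain b1 w1 where w: "w = b1 # w1" using Cons(2) by (cases w) auto
  have c: "c = b" using Cons(2) w by (cases b; cases c; cases b1) auto
  have "(if b then Lx else Ly) # pairw t @ [if b then Ly else Lx] = pairw w1"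
    using Cons(2) w c by (cases b; cases b1) auto
  from Cons(1)[OF this] c show ?case by simp
qed simp

text \<open>Even rotations are rotations of syllables, and odd ones are excluded unless the
  syllables are all equal.\<close>

lemma rot_orbit_pairw:
  assumes "rot_orbit (pairw w) = rot_orbit (pairw v)" "v \<noteq> []" "\<not> (\<exists>b. set v \<subseteq> {b})"
  shows "w \<in> rot_orbit v"
proof -
  obtain m where m: "pairw w = rotate m (pairw v)"
    using assms(1) rot_orbit_self[of "pairw w"] by (auto elim: rot_orbitE)
  show ?thesis
  proof (cases "even m")
    case True
    then obtain j where "m = 2 * j" by (rule evenE)
    then have "w = rotate j v" using m by (intro pairw_inj) (simp add: pairw_rotate)
    then show ?thesis by (simp add: rot_orbit_def)
  next
    case False
    then obtain j where j: "m = Suc (2 * j)" by (metis oddE Suc_eq_plus1)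
    let ?v = "rotate j v"
    have e: "pairw w = rotate1 (pairw ?v)" using m j by (simp add: pairw_rotate)
    have "?v \<noteq> []" using assms(2) by simp
    then obtain b t where v: "?v = b # t" by (cases ?v) auto
    have "(if b then Lx else Ly) # pairw t @ [if b then Ly else Lx] = pairw w"
      unfolding e v by auto
    then have "set t \<subseteq> {b}" by (rule pairw_odd_rotation)
    then have "set ?v \<subseteq> {b}" using v by simp
    then show ?thesis using assms(3) by auto
  qed
qed

definition sgnw :: "bool list \<Rightarrow> int" where
  "sgnw w = (-1) ^ count_list w False"

lemma rho_power: "rho ^ n = (\<Sum>w\<in>{w. length w = n}. of_int (sgnw w) *\<^sub>C wd (pairw w))"
proof -
  let ?Y = "\<lambda>b. if b then gy * gx else - (gx * gy)"
  have p: "prod_list (map ?Y w) = of_int (sgnw w) *\<^sub>C wd (pairw w)" for w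
  proof (induct w)
    case Nil then show ?case by (simp add: sgnw_def)
  next
    case (Cons b w)
    then show ?case by (auto simp: sgnw_def wd_Cons mult_cscale_right mult.assoc)
  qed
  have "rho = (\<Sum>b\<in>UNIV. ?Y b)" by (simp add: rho_def UNIV_bool)
  from arg_cong[OF this, of "\<lambda>z. z ^ n"]
  have "rho ^ n = (\<Sum>w\<in>{w. set w \<subseteq> UNIV \<and> length w = n}. prod_list (map ?Y w))"
    by (simp only: sum_power_words[OF finite])
  then show ?thesis by (simp add: p)
qed

text \<open>A string of n syllables whose smallest period is the given divisor d of n.\<close>

definition pattern :: "nat \<Rightarrow> nat \<Rightarrow> bool list" where
  "pattern d n = map (\<lambda>i. d dvd i) [0..<n]"

lemma period_pattern: assumes "d dvd n" "n > 0" shows "period (pattern d n) = d"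
proof (rule dvd_antisym)
  have len: "length (pattern d n) = n" by (simp add: pattern_def)
  have nth: "rotate m (pattern d n) ! i \<longleftrightarrow> d dvd m + i" if "i < n" for m i
  proof -
    have "rotate m (pattern d n) ! i \<longleftrightarrow> d dvd (m + i) mod n"
      using that assms(2) by (simp add: nth_rotate len) (simp add: pattern_def)
    then show ?thesis using assms(1) by (simp add: dvd_mod_iff)
  qed
  have "rotate d (pattern d n) = pattern d n"
  proof (rule nth_equalityI)
    fix i assume "i < length (rotate d (pattern d n))"
    then have "i < n" by (simp add: len)
    then show "rotate d (pattern d n) ! i = pattern d n ! i"
      using nth[of i d] by (simp add: pattern_def)
  qed simp
  then show "period (pattern d n) dvd d" by (simp add: rotate_eq_self_iff)
  have "rotate (period (pattern d n)) (pattern d n) ! 0 = pattern d n ! 0" by (simp add: period)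
  then show "d dvd period (pattern d n)"
    using nth[OF assms(2), of "period (pattern d n)"] assms(2) by (simp add: pattern_def)
qed

text \<open>The terms of the expansion that yield the cyclic word of \<open>pattern d n\<close> are
  exactly its d rotations, all with the same sign. The bound on d keeps the pattern from being
  constant.\<close>

lemma rr_coeff:
  assumes "d dvd n" "d \<ge> 2" "n > 0"
  shows "\<exists>w. Poly_Mapping.lookup (rr n) w = of_nat d \<or> Poly_Mapping.lookup (rr n) w = - of_nat d"
proof -
  let ?b = "pattern d n"
  have len: "length ?b = n" by (simp add: pattern_def)
  have "n \<ge> 2" using assms by (meson dvd_imp_le order_trans)
  then have "?b ! 0" "\<not> ?b ! 1" using assms(2) by (auto simp: pattern_def)
  moreover have "?b ! 0 \<in> set ?b" "?b ! 1 \<in> set ?b" using \<open>n \<ge> 2\<close> len by (auto intro!: nth_mem)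
  ultimately have nc: "\<not> (\<exists>c. set ?b \<subseteq> {c})" by (metis singletonD subsetD)
  have ne: "?b \<noteq> []" using len assms(3) by auto
  let ?w = "Word (canon (pairw ?b))"
  have fin: "finite {w :: bool list. length w = n}"
    using finite_lists_length_eq[of "UNIV :: bool set" n] by simp
  have sub: "rot_orbit ?b \<subseteq> {w. length w = n}" using len by (auto simp: rot_orbit_def)
  have sg: "sgnw w = sgnw ?b" if "w \<in> rot_orbit ?b" for w
  proof -
    have "count_list (rotate j v) c = count_list v c" for j and v :: "bool list" and c
    proof (induct j)
      case (Suc j)
      have "count_list (rotate1 u) c = count_list u c" for u :: "bool list" by (cases u) auto
      then show ?case using Suc by simp
    qed simp
    then show ?thesis using that by (auto simp: sgnw_def elim!: rot_orbitE)
  qed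
  have iff: "canon (pairw w) = canon (pairw ?b) \<longleftrightarrow> w \<in> rot_orbit ?b" for w
  proof
    assume "canon (pairw w) = canon (pairw ?b)"
    then show "w \<in> rot_orbit ?b" by (intro rot_orbit_pairw[OF _ ne nc]) (simp add: canon_eq_iff)
  next
    assume "w \<in> rot_orbit ?b"
    then show "canon (pairw w) = canon (pairw ?b)" by (auto simp: pairw_rotate elim!: rot_orbitE)
  qed
  have "Poly_Mapping.lookup (rr n) ?w =
      (\<Sum>w\<in>{w. length w = n}. of_int (sgnw w) * (if canon (pairw w) = canon (pairw ?b) then 1 else 0))"
    unfolding rr_def rho_power trace_linear lookup_sum
    by (intro sum.cong refl) (auto simp: cyc_trace_wd lookup_single when_def)
  also have "\<dots> = (\<Sum>w\<in>{w. length w = n}. if w \<in> rot_orbit ?b then of_int (sgnw ?b) else 0)"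
    by (intro sum.cong refl) (auto simp: iff sg)
  also have "\<dots> = (\<Sum>w\<in>rot_orbit ?b. of_int (sgnw ?b))"
    using fin sub by (simp add: sum.If_cases Int_absorb1 Collect_mem_eq Int_def[symmetric])
  also have "\<dots> = of_nat d * of_int (sgnw ?b)"
    by (simp add: card_rot_orbit period_pattern[OF assms(1,3)])
  finally have "Poly_Mapping.lookup (rr n) ?w = of_nat d * of_int (sgnw ?b)" .
  moreover have "sgnw ?b = 1 \<or> sgnw ?b = -1" by (auto simp: sgnw_def neg_one_even_power neg_one_odd_power) (metis neg_one_even_power neg_one_odd_power)
  ultimately show ?thesis by (intro exI[of _ ?w]) auto
qed

section \<open>The grading, and the content of the powers\<close>

definition rdegree :: "letter list \<Rightarrow> nat" where "rdegree w = word_degree (Word w)"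

lemma rdegree_simps [simp]: "rdegree [] = 0" "rdegree (l # w) = (if l = Lr then 2 else 1) + rdegree w"
  "rdegree (u @ v) = rdegree u + rdegree v"
  by (simp_all add: rdegree_def word_degree_def)

lemma rdegree_count: "rdegree w = nx w + ny w + 2 * nr w"
proof (induct w)
  case (Cons l w) then show ?case by (cases l) auto
qed simp

lemma rdegree_canon [simp]: "rdegree (canon w) = rdegree w"
  by (simp add: rdegree_count)

lemma homog_alghom:
  assumes "homog rdegree d f" "\<And>l. homog rdegree (rdegree [l]) (\<phi> l)"
  shows "homog rdegree d (alghom \<phi> f)"
  unfolding alghom_def
proof (rule homog_ext[OF assms(1)])
  have "homog rdegree (rdegree w) (prod_list (map \<phi> w))" for w
  proof (induct w)
    case Nil then show ?case using homog_wd[of rdegree "[]" 0] by simp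
  next
    case (Cons l w)
    then show ?case using homog_mult[OF assms(2)[of l] Cons] by simp
  qed
  then show "rdegree w = d \<Longrightarrow> homog rdegree d (prod_list (map \<phi> w))" for w by auto
qed

lemma homog_gen: "homog rdegree (rdegree [l]) (gen l)"
  unfolding gen_eq by (rule homog_wd) simp

lemma homog_expA: "homog rdegree d f \<Longrightarrow> homog rdegree d (expA f)"
  unfolding expA_def
proof (erule homog_alghom)
  fix l
  show "homog rdegree (rdegree [l]) (if l = Lr then gy * gx - gx * gy else gen l)"
    using homog_gen[of l] by (cases "l = Lr") (auto simp: gen_eq wd_mult intro!: homog_diff homog_wd)
qed

lemma homog_act: "homog rdegree d f \<Longrightarrow> homog rdegree d (act_free g f)"
  unfolding act_free_eq
proof (erule homog_alghom)
  fix l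
  show "homog rdegree (rdegree [l]) (act_letter g l)"
    by (cases l) (auto simp: single_0_mult gen_eq intro!: homog_add homog_cscale homog_wd)
qed

lemma rho_expA: "expA (gr ^ n) = rho ^ n"
  by (simp add: expA_power rho_def)

lemma homog_rr: "homog rdegree (2 * n) (rr n)"
proof -
  have "homog rdegree (2 * n) (gr ^ n)"
    unfolding gen_power by (rule homog_wd) (simp add: rdegree_count count_replicate)
  then show ?thesis unfolding rr_def rho_expA[symmetric] by (intro homog_trace homog_expA) auto
qed

text \<open>The greatest common divisor of the coefficients of \<open>rr n\<close> for \<open>n \<ge> 2\<close>, see \<open>rprim_unimodular\<close> and \<open>rprim_in\<close>.\<close>

definition content :: "nat \<Rightarrow> nat" where
  "content n = (if \<exists>p l. Factorial_Ring.prime p \<and> l \<ge> 1 \<and> n = p ^ l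
     then THE p. Factorial_Ring.prime p \<and> p dvd n else 1)"

lemma content_prime_power: assumes "Factorial_Ring.prime p" "l \<ge> 1" shows "content (p ^ l) = p"
proof -
  have "(THE q. Factorial_Ring.prime q \<and> q dvd p ^ l) = p"
    using assms by (intro the_equality) (auto dest: prime_dvd_power primes_dvd_imp_eq)
  then show ?thesis using assms unfolding content_def by auto
qed

lemma content_other: "\<not> (\<exists>p l. Factorial_Ring.prime p \<and> l \<ge> 1 \<and> n = p ^ l) \<Longrightarrow> content n = 1"
  unfolding content_def by (rule if_not_P)

lemma content_pos: "content n > 0"
proof (cases "\<exists>p l. Factorial_Ring.prime p \<and> l \<ge> 1 \<and> n = p ^ l")
  case True
  then obtain p l where "Factorial_Ring.prime p" "l \<ge> 1" "n = p ^ l" by blast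
  then show ?thesis by (simp add: content_prime_power prime_gt_0_nat)
qed (simp add: content_other)

text \<open>The primitive vector on the line of \<open>rr n\<close>. It vanishes for n = 1, where
  [r'] itself is a commutator in A.\<close>

definition rprim :: "nat \<Rightarrow> ncpoly" where
  "rprim n = (1 / of_nat (content n)) *\<^sub>C rr n"

lemma rr_rprim: "rr n = of_nat (content n) *\<^sub>C rprim n"
  using content_pos[of n] by (simp add: rprim_def)

lemma homog_rprim: "homog rdegree (2 * n) (rprim n)"
  unfolding rprim_def by (intro homog_cscale homog_rr)

lemma two_primes:
  assumes "n \<ge> 2" "\<not> (\<exists>p l. Factorial_Ring.prime p \<and> l \<ge> 1 \<and> n = p ^ l)"
  obtains p q :: nat where "Factorial_Ring.prime p" "Factorial_Ring.prime q" "p \<noteq> q" "p dvd n" "q dvd n"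
proof -
  obtain p where p: "Factorial_Ring.prime p" "p dvd n" using prime_factor_nat[of n] assms(1) by auto
  have "n \<noteq> 0" "\<not> is_unit p" using assms(1) p by auto
  then obtain m where m: "n = p ^ multiplicity p n * m" "\<not> p dvd m" using multiplicity_decompose'[of n p] by blast
  have "multiplicity p n \<ge> 1" using p \<open>n \<noteq> 0\<close> by (simp add: Suc_le_eq prime_multiplicity_gt_zero_iff)
  then have "m \<noteq> 1" using assms(2) m(1) p(1) by (metis mult.right_neutral)
  then obtain q where q: "Factorial_Ring.prime q" "q dvd m" using prime_factor_nat by blast
  then have "q \<noteq> p" "q dvd n" using m by (auto, metis dvd_mult)
  then show ?thesis using that p q by metis
qed

text \<open>For a power of p the period p gives a coefficient p or -p, which the content cancels.
  Otherwise n has two distinct prime divisors, whose coefficients are coprime.\<close>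

lemma rprim_unimodular: assumes "n \<ge> 2"
  shows "\<exists>w1 w2 (m1::int) (m2::int). of_int m1 * Poly_Mapping.lookup (rprim n) w1 + of_int m2 * Poly_Mapping.lookup (rprim n) w2 = 1"
proof (cases "\<exists>p l. Factorial_Ring.prime p \<and> l \<ge> 1 \<and> n = p ^ l")
  case True
  then obtain p l where p: "Factorial_Ring.prime p" "l \<ge> 1" "n = p ^ l" by blast
  have "p dvd n" using p by (simp add: dvd_power)
  then obtain w where w: "Poly_Mapping.lookup (rr n) w = of_nat p \<or> Poly_Mapping.lookup (rr n) w = - of_nat p"
    using rr_coeff[of p n] prime_ge_2_nat[OF p(1)] assms by auto
  have "(of_nat p :: complex) \<noteq> 0" using p(1) by (simp add: prime_gt_0_nat)
  then have "Poly_Mapping.lookup (rprim n) w = 1 \<or> Poly_Mapping.lookup (rprim n) w = - 1"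
    using w p by (auto simp: rprim_def content_prime_power)
  then show ?thesis
  proof
    assume "Poly_Mapping.lookup (rprim n) w = 1"
    then show ?thesis by (intro exI[of _ w] exI[of _ 1] exI[of _ 0]) auto
  next
    assume "Poly_Mapping.lookup (rprim n) w = - 1"
    then show ?thesis by (intro exI[of _ w] exI[of _ "-1"] exI[of _ 0]) auto
  qed
next
  case False
  obtain p q where pq: "Factorial_Ring.prime p" "Factorial_Ring.prime q" "p \<noteq> q" "p dvd n" "q dvd n"
    using two_primes[OF assms False] by metis
  have r: "rprim n = rr n" using False by (simp add: rprim_def content_other)
  have "\<exists>w (s::int). of_int s * Poly_Mapping.lookup (rprim n) w = of_nat d" if d: "d dvd n" "d \<ge> 2" for d
  proof -
    obtain w where "Poly_Mapping.lookup (rr n) w = of_nat d \<or> Poly_Mapping.lookup (rr n) w = - of_nat d"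
      using rr_coeff[OF d] assms by auto
    then show ?thesis
    proof
      assume "Poly_Mapping.lookup (rr n) w = of_nat d"
      then show ?thesis by (intro exI[of _ w] exI[of _ 1]) (simp add: r)
    next
      assume "Poly_Mapping.lookup (rr n) w = - of_nat d"
      then show ?thesis by (intro exI[of _ w] exI[of _ "-1"]) (simp add: r)
    qed
  qed
  then obtain w1 s1 w2 s2 where w: "of_int s1 * Poly_Mapping.lookup (rprim n) w1 = of_nat p"
      "of_int s2 * Poly_Mapping.lookup (rprim n) w2 = of_nat q"
    using pq prime_ge_2_nat by metis
  have "coprime p q" using pq primes_coprime by blast
  then obtain u v where "u * int p + v * int q = 1" using bezout_int[of "int p" "int q"] by auto
  then have "of_int u * of_nat p + of_int v * of_nat q = (1 :: complex)"
    by (metis of_int_1 of_int_add of_int_mult of_int_of_nat_eq)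
  then have "of_int (u * s1) * Poly_Mapping.lookup (rprim n) w1 + of_int (v * s2) * Poly_Mapping.lookup (rprim n) w2 = 1"
    using w by (simp add: mult.assoc)
  then show ?thesis by blast
qed

context coeff_ring
begin

lemma rho_in: "rho \<in> F" by (simp add: rho_def alg_in)

lemma rr_in: "rr n \<in> F" by (simp add: rr_def trace_in rho_in alg_in)

lemma expA_trace: "f \<in> F \<Longrightarrow> cyc_trace (expA (cyc_trace f)) = cyc_trace (expA f)"
proof -
  assume f: "f \<in> F"
  have "f - cyc_trace f \<in> CC"
    using sub_trace[OF f] kspan_mono[of "{a * c - c * a | a c. a \<in> F \<and> c \<in> F}"] unfolding CC_eq by blast
  then show ?thesis by (simp add: CC_def expA_linear trace_linear)
qed

text \<open>The cyclic group of order \<open>p\<^sup>l\<close> acts on words of length \<open>p\<^sup>l\<close>; its non-trivial orbits have length divisible by \<open>p\<close>.\<close>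

lemma trace_prime_power:
  fixes Y :: "'l \<Rightarrow> ncpoly"
  assumes L: "finite L" "\<And>l. Y l \<in> F" and p: "Factorial_Ring.prime p" and n: "n = p ^ e" "e \<ge> 1"
  shows "\<exists>d\<in>F. cyc_trace d = d \<and> cyc_trace ((\<Sum>l\<in>L. Y l) ^ n) = of_nat p *\<^sub>C d + (\<Sum>l\<in>L. cyc_trace (Y l ^ n))"
proof -
  define \<Phi> where "\<Phi> w = cyc_trace (prod_list (map Y w))" for w
  have rot: "\<Phi> (rotate1 w) = \<Phi> w" for w
    using trace_comm[of "Y (hd w)" "prod_list (map Y (tl w))"] by (cases w) (simp_all add: \<Phi>_def)
  let ?S = "{w. set w \<subseteq> L \<and> length w = n}"
  let ?C = "(\<lambda>l. replicate n l) ` L"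
  have npos: "n > 0" using p n by (simp add: prime_gt_0_nat)
  have fin: "finite ?S" by (rule finite_lists_length_eq[OF L(1)])
  have C: "?C \<subseteq> ?S" by auto
  have closed: "rot_orbit w \<subseteq> ?S - ?C" if "w \<in> ?S - ?C" for w
  proof
    fix v assume v: "v \<in> rot_orbit w"
    then have "v \<in> ?S" using that by (auto elim!: rot_orbitE)
    moreover have "v \<notin> ?C"
    proof
      assume "v \<in> ?C"
      then obtain l where "l \<in> L" "v = replicate n l" by blast
      then have "w \<in> {replicate n l}" using v rot_orbit_eq_iff[of v w] rot_orbit_self[of w] by (simp add: rot_orbit_replicate)
      then show False using that \<open>l \<in> L\<close> by blast
    qed
    ultimately show "v \<in> ?S - ?C" by blast
  qed
  have div: "p dvd card ob" if ob: "ob \<in> rot_orbit ` (?S - ?C)" for ob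
  proof -
    obtain w where w: "w \<in> ?S - ?C" "ob = rot_orbit w" using ob by blast
    have "period w dvd p ^ e" using period_dvd_length[of w] w n by simp
    then obtain i where i: "period w = p ^ i" using p divides_primepow_nat by blast
    have "i \<noteq> 0"
    proof
      assume "i = 0"
      then have "rotate1 w = w" using i rotate_eq_self_iff[of 1 w] by simp
      then have r: "w = replicate (length w) (hd w)" by (rule rotate1_eq_imp_replicate)
      have "w \<noteq> []" using w npos by auto
      then have "hd w \<in> L" using w by (auto dest: hd_in_set)
      then show False using r w by auto
    qed
    then show ?thesis by (simp add: w(2) card_rot_orbit i dvd_power)
  qed
  define d where "d = (\<Sum>ob\<in>rot_orbit ` (?S - ?C). of_nat (card ob div p) *\<^sub>C \<Phi> (SOME w. w \<in> ob))"
  have \<Phi>F: "\<Phi> w \<in> F" for w unfolding \<Phi>_def using L(2) by (intro trace_in monoid_alg_prod_list) auto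
  have dF: "d \<in> F" unfolding d_def by (intro ksub_sum[OF ksub_F] ksub_cscale[OF ksub_F] \<Phi>F) simp
  have dt: "cyc_trace d = d" by (simp add: d_def trace_linear \<Phi>_def)
  have "(\<Sum>w\<in>?S - ?C. \<Phi> w) = (\<Sum>ob\<in>rot_orbit ` (?S - ?C). of_nat (card ob) *\<^sub>C \<Phi> (SOME w. w \<in> ob))"
    using fin closed rot by (intro sum_orbits) auto
  also have "\<dots> = of_nat p *\<^sub>C d"
    unfolding d_def cscale_sum_right
  proof (rule sum.cong[OF refl])
    fix ob assume "ob \<in> rot_orbit ` (?S - ?C)"
    then have "of_nat (card ob) = of_nat p * (of_nat (card ob div p) :: complex)"
      using div by (metis dvd_mult_div_cancel of_nat_mult)
    then show "of_nat (card ob) *\<^sub>C \<Phi> (SOME w. w \<in> ob) = of_nat p *\<^sub>C of_nat (card ob div p) *\<^sub>C \<Phi> (SOME w. w \<in> ob)"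
      by simp
  qed
  finally have 1: "(\<Sum>w\<in>?S - ?C. \<Phi> w) = of_nat p *\<^sub>C d" .
  have "inj_on (\<lambda>l. replicate n l) L" using npos by (intro inj_onI) simp
  then have 2: "(\<Sum>w\<in>?C. \<Phi> w) = (\<Sum>l\<in>L. cyc_trace (Y l ^ n))"
    by (simp add: sum.reindex \<Phi>_def map_replicate_const prod_list_replicate)
  have "cyc_trace ((\<Sum>l\<in>L. Y l) ^ n) = (\<Sum>w\<in>?S. \<Phi> w)"
    by (simp add: sum_power_words[OF L(1)] trace_linear \<Phi>_def)
  also have "\<dots> = (\<Sum>w\<in>?S - ?C. \<Phi> w) + (\<Sum>w\<in>?C. \<Phi> w)"
    by (rule sum.subset_diff[OF C fin])
  finally show ?thesis using 1 2 dF dt by auto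
qed

text \<open>Modulo p the cyclic class of the power is the sum of the classes of the powers of xy,
  -yx and r'. The first two are rotations of each other up to sign.\<close>

lemma trace_relA_power:
  assumes p: "Factorial_Ring.prime p" and n: "n = p ^ e" "e \<ge> 1"
  shows "\<exists>d\<in>F. cyc_trace d = d \<and> cyc_trace (relA ^ n) = of_nat p *\<^sub>C d + gr ^ n"
proof -
  define Y where "Y l = (case l of Lx \<Rightarrow> gx * gy | Ly \<Rightarrow> - (gy * gx) | Lr \<Rightarrow> gr)" for l
  have U: "(UNIV :: letter set) = {Lx, Ly, Lr}" using letter.exhaust by auto
  have finU: "finite (UNIV :: letter set)" by (simp add: U)
  have YF: "Y l \<in> F" for l by (cases l) (auto simp: Y_def alg_in)
  have s: "relA = (\<Sum>l\<in>UNIV. Y l)" by (simp add: U Y_def relA_def)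
  obtain d where d: "d \<in> F" "cyc_trace d = d"
      "cyc_trace (relA ^ n) = of_nat p *\<^sub>C d + (\<Sum>l\<in>UNIV. cyc_trace (Y l ^ n))"
    using trace_prime_power[where Y = Y, OF finU YF p n, folded s] by (elim bexE conjE)
  have neg: "cyc_trace ((- (gy * gx)) ^ n) = (-1) ^ n *\<^sub>C cyc_trace ((gx * gy) ^ n)"
    using trace_yx_power[of n] by (cases "even n") (simp_all add: trace_linear)
  \<comment> \<open>For odd p the exponent n is odd and the sum is 0; for p = 2 it is 2.\<close>
  obtain m :: int where m: "1 + (-1) ^ n = int p * m"
  proof (cases "p = 2")
    case True
    then have "even n" using n by simp
    then show ?thesis using that[of 1] True by simp
  next
    case False
    then have "odd p" using p prime_odd_nat prime_ge_2_nat[OF p] by fastforce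
    then have "odd n" using n by simp
    then show ?thesis using that[of 0] by simp
  qed
  let ?z = "cyc_trace ((gx * gy) ^ n)"
  have "(\<Sum>l\<in>UNIV. cyc_trace (Y l ^ n)) = (1 + (-1) ^ n) *\<^sub>C ?z + gr ^ n"
    by (simp add: U Y_def neg cscale_add_left)
  also have "(1 + (-1) ^ n :: complex) = of_int (int p * m)"
    by (simp flip: m)
  finally have "cyc_trace (relA ^ n) = of_nat p *\<^sub>C (d + of_int m *\<^sub>C ?z) + gr ^ n"
    using d(3) by (simp add: cscale_add_right)
  moreover have "d + of_int m *\<^sub>C ?z \<in> F"
    using d(1) by (intro ksub_add[OF ksub_F] ksub_cscale[OF ksub_F] trace_in) (auto simp: alg_in)
  moreover have "cyc_trace (d + of_int m *\<^sub>C ?z) = d + of_int m *\<^sub>C ?z"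
    using d(2) by (simp add: trace_linear)
  ultimately show ?thesis by blast
qed

lemma expA_relA_power: "n > 0 \<Longrightarrow> expA (relA ^ n) = 0"
  by (cases n) (simp_all add: expA_mult expA_relA)

text \<open>For a prime power n, the n-th power of the relation is zero in A. Hence
  \<open>trace_relA_power\<close> exhibits the normal form of \<open>r'^n\<close> as p times an
  element of F.\<close>

lemma rprim_in: assumes "n \<ge> 1" shows "rprim n \<in> F"
proof (cases "\<exists>p l. Factorial_Ring.prime p \<and> l \<ge> 1 \<and> n = p ^ l")
  case True
  then obtain p e where p: "Factorial_Ring.prime p" "e \<ge> 1" "n = p ^ e" by blast
  obtain d where d: "d \<in> F" "cyc_trace (relA ^ n) = of_nat p *\<^sub>C d + gr ^ n"
    using trace_relA_power[OF p(1,3,2)] by blast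
  have "0 = cyc_trace (expA (cyc_trace (relA ^ n)))"
    using assms by (simp add: expA_trace alg_in expA_relA_power trace_linear)
  also have "\<dots> = of_nat p *\<^sub>C cyc_trace (expA d) + rr n"
    unfolding d(2) by (simp add: expA_linear trace_linear rho_expA rr_def)
  finally have "rr n = of_nat p *\<^sub>C (- cyc_trace (expA d))" by (simp add: eq_neg_iff_add_eq_0 add.commute)
  moreover have "(of_nat p :: complex) \<noteq> 0" using p(1) by (simp add: prime_gt_0_nat)
  ultimately have "rprim n = - cyc_trace (expA d)" using p by (simp add: rprim_def content_prime_power)
  then show ?thesis using d(1) by (simp add: trace_in expA_in ksub_minus[OF ksub_F])
qed (simp add: rprim_def content_other rr_in)

end

section \<open>The summand of the trivial conjugacy class\<close>

context coeff_ring
begin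

lemma kspan_image: assumes "clin L" shows "kspan (L ` S) = L ` kspan S"
proof
  show "kspan (L ` S) \<subseteq> L ` kspan S"
    using kspan_base by (intro kspan_minimal[OF _ ksub_image[OF assms ksub_kspan]] image_mono subsetI)
  show "L ` kspan S \<subseteq> kspan (L ` S)"
  proof (intro subsetI, elim imageE, hypsubst)
    fix x assume "x \<in> kspan S"
    then show "L x \<in> kspan (L ` S)"
      by (rule kspan_lin_in[OF assms ksub_kspan, rotated]) (intro kspan_base imageI)
  qed
qed

lemma act_CC: assumes "sl2 g" "f \<in> CC" shows "act_free g f \<in> CC"
proof (rule CC_induct[OF assms(2) clin_act ksub_CC])
  fix u v
  have "act_free g (wd u) \<in> F" "act_free g (wd v) \<in> F" using assms(1) by (simp_all add: act_F)
  then show "act_free g (wd u * wd v - wd v * wd u) \<in> CC"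
    unfolding CC_eq act_linear act_mult by (intro kspan_base UnI1) blast
next
  fix f assume "f \<in> kerA"
  then have "act_free g f \<in> kerA" by (rule act_kerA[OF assms(1)])
  then show "act_free g f \<in> CC" unfolding CC_eq by (intro kspan_base UnI2)
qed

end

context finite_sl2
begin

lemma centr_one: "centr (mat 1) = \<Gamma>" by (auto simp: centr_def)

abbreviation "av \<equiv> cavg (mat 1)"
abbreviation "chi \<equiv> nform (mat 1)"

lemma av_eq: "av b = (1 / of_nat N) *\<^sub>C (\<Sum>g\<in>\<Gamma>. act_free g b)"
  by (simp add: cavg_def centr_one)

lemma chi_eq: "chi b = cyc_trace (expA (av b))"
  by (simp add: nform_def twtr_def)

lemmas chi_linear = clin_simps[OF clin_nform[OF one_\<Gamma>]]

lemma av_F: "b \<in> F \<Longrightarrow> av b \<in> F"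
  by (simp add: cavg_F)

lemma chi_F: "b \<in> F \<Longrightarrow> chi b \<in> F"
  by (simp add: nform_F)

lemma sum_translate: "h \<in> \<Gamma> \<Longrightarrow> (\<Sum>g\<in>\<Gamma>. f (h ** g)) = (\<Sum>g\<in>\<Gamma>. f g)"
  by (rule sum.reindex_bij_witness[where i = "\<lambda>g. gi h ** g" and j = "\<lambda>g. h ** g"]) auto

lemma act_av: "h \<in> \<Gamma> \<Longrightarrow> act_free h (av b) = av b"
  by (simp add: av_eq act_linear act_free_compose sum_translate[where f = "\<lambda>g. act_free g b"])

lemma av_invariant: assumes "\<And>g. g \<in> \<Gamma> \<Longrightarrow> act_free g b = b" shows "av b = b"
proof -
  have "(\<Sum>g\<in>\<Gamma>. act_free g b) = of_nat N *\<^sub>C b" using assms by (simp add: sum_const_cscale del: sum_constant)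
  then show ?thesis using N_pos by (simp add: av_eq)
qed

lemma av_av: "av (av b) = av b"
  by (intro av_invariant act_av)

lemma av_in: assumes "ksub Y" "\<And>g. g \<in> \<Gamma> \<Longrightarrow> act_free g b \<in> Y" shows "av b \<in> Y"
  unfolding av_eq using assms order_inv by (intro ksub_cscale[OF assms(1)] ksub_sum[OF assms(1)]) auto

lemma av_mod: assumes "ksub Y" "\<And>g. g \<in> \<Gamma> \<Longrightarrow> act_free g b - b \<in> Y" shows "av b - b \<in> Y"
proof -
  have "av b - b = (1 / of_nat N) *\<^sub>C (\<Sum>g\<in>\<Gamma>. act_free g b - b)"
    using N_pos by (simp add: av_eq sum_subtractf sum_const_cscale cscale_diff_right del: sum_constant)
  then show ?thesis
    using assms order_inv by (simp add: ksub_cscale[OF assms(1)] ksub_sum[OF assms(1)])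
qed

definition avp :: "cpoly \<Rightarrow> cpoly" where
  "avp p = (1 / of_nat N) *\<^sub>C (\<Sum>g\<in>\<Gamma>. act_poly g p)"

lemma avp_invariant: assumes "\<And>g. g \<in> \<Gamma> \<Longrightarrow> act_poly g p = p" shows "avp p = p"
proof -
  have "(\<Sum>g\<in>\<Gamma>. act_poly g p) = of_nat N *\<^sub>C p" using assms by (simp add: sum_const_cscale del: sum_constant)
  then show ?thesis using N_pos by (simp add: avp_def)
qed

lemma abl_av: "abl (av b) = avp (abl b)"
  by (simp add: av_eq avp_def abl_linear abl_act)

lemma weyl_av: "b \<in> kerAb \<Longrightarrow> weyl (av b) = avp (weyl b)"
  by (simp add: av_eq avp_def weyl_linear weyl_act \<Gamma>_sl2)

lemma chi_av: "chi (av b) = chi b"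
  by (simp add: chi_eq av_av)

lemma chi_idem: "b \<in> F \<Longrightarrow> chi (chi b) = chi b"
  by (simp add: nform_idem)

lemma chi_CC: assumes "f \<in> CC" shows "chi f = 0"
proof -
  have "av f \<in> CC" using assms by (intro av_in[OF ksub_CC] act_CC \<Gamma>_sl2)
  then show ?thesis by (simp add: chi_eq CC_def)
qed

lemma chi_zeroD: "f \<in> F \<Longrightarrow> chi f = 0 \<Longrightarrow> av f \<in> CC"
  by (simp add: chi_eq CC_def av_F)

definition icls :: "ncpoly \<Rightarrow> (complex^2^2 \<Rightarrow> ncpoly set) set" where
  "icls b = skcls (sgl (mat 1) b)"

lemma A_to_cyc_cls: "f \<in> F \<Longrightarrow> A_to_cyc K \<Gamma> (clsA K f) = icls f"
proof -
  have "skew_single G (algA K) (mat 1) (clsA K f) = skq (sgl (mat 1) f)"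
    by (auto simp: skew_single_def skq_def sgl_def presD(8)[OF pres_algA] intro!: restrict_ext)
  then show ?thesis by (simp add: A_to_cyc_def icls_def skcls_def)
qed

lemma free_to_cyc_eq: "f \<in> F \<Longrightarrow> free_to_cyc K \<Gamma> f = icls f"
  by (simp add: free_to_cyc_def A_to_cyc_cls)

definition Nchi :: "ncpoly set" where
  "Nchi = {b \<in> F. chi b = 0}"

lemma pres_M1: "pres (skew_cyc_at K \<Gamma> {mat 1}) F Nchi icls"
  using pres_skew_cyc_at[OF one_\<Gamma>] unfolding cclass_one icls_def Nchi_def .

lemma skew_cyc_at_ops: "add (skew_cyc_at K \<Gamma> C) = add (skew_cyc K \<Gamma>)"
  by (simp add: skew_cyc_at_def)

section \<open>Invariant classes and the isomorphism in (ii)\<close>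

definition Inv0 :: "cpoly set" where
  "Inv0 = {p \<in> PK. \<forall>g\<in>\<Gamma>. act_poly g p = p}"

text \<open>A representative of an invariant class is invariant only modulo \<open>relV\<close>; its
  average is strictly invariant and represents the same class (\<open>av_mod\<close>).\<close>

definition UV :: "ncpoly set" where
  "UV = {f \<in> kerAb. \<forall>g\<in>\<Gamma>. act_free g f - f \<in> relV}"

definition UW :: "ncpoly set" where
  "UW = {f \<in> CC. \<forall>g\<in>\<Gamma>. act_free g f - f \<in> relV}"

definition UV2 :: "ncpoly set" where
  "UV2 = {f \<in> kerAb2. \<forall>g\<in>\<Gamma>. act_free g f - f \<in> relV}"

lemma ksub_Inv0: "ksub Inv0"
  unfolding Inv0_def
proof (rule ksubI)
qed (auto simp: clin_simps[OF clin_act_poly] ksub_zero[OF ksub_monoid_alg] ksub_add[OF ksub_monoid_alg]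
    ksub_cscale[OF ksub_monoid_alg])

lemma ksub_inv_mod: assumes "ksub Y" shows "ksub {f \<in> Y. \<forall>g\<in>\<Gamma>. act_free g f - f \<in> relV}"
proof -
  have c: "clin (\<lambda>f. act_free g f - f)" for g by (intro clin_minus_fun clin_act clin_id)
  note l = clin_simps[OF c]
  show ?thesis
    unfolding ksub_def
    by (auto simp: l ksub_zero[OF ksub_relV] ksub_zero[OF assms] ksub_add[OF assms] ksub_cscale[OF assms]
      clin_zero[OF clin_act] intro: ksub_add[OF ksub_relV] ksub_cscale[OF ksub_relV])
qed

lemma ksub_UV: "ksub UV" and ksub_UW: "ksub UW" and ksub_UV2: "ksub UV2"
  unfolding UV_def UW_def UV2_def by (intro ksub_inv_mod ksub_kerAb ksub_CC ksub_kerAb2)+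

lemma UV_F: "UV \<subseteq> F" and UV_kerAb: "UV \<subseteq> kerAb" and UW_UV: "UW \<subseteq> UV" and UV2_UV: "UV2 \<subseteq> UV" and UW_CC: "UW \<subseteq> CC"
  using CC_kerAb by (auto simp: UV_def UW_def UV2_def kerAb2_def)

lemma relV_act_diff: "f \<in> relV \<Longrightarrow> g \<in> \<Gamma> \<Longrightarrow> act_free g f - f \<in> relV"
  by (intro ksub_diff[OF ksub_relV] act_relV \<Gamma>_sl2)

lemma relV_UV: "relV \<subseteq> UV" and relV_UW: "relV \<subseteq> UW" and relV_UV2: "relV \<subseteq> UV2"
  using relV_kerAb relV_CC relV_kerAb2 relV_act_diff by (auto simp: UV_def UW_def UV2_def)

lemma UW_Nchi: "UW \<subseteq> Nchi"
  using CC_F chi_CC by (auto simp: UW_def Nchi_def)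

lemma relV_Nchi: "relV \<subseteq> Nchi"
  using relV_UW UW_Nchi by blast

lemma invariant_kerAb_UV: "f \<in> kerAb \<Longrightarrow> av f \<in> UV"
proof -
  assume f: "f \<in> kerAb"
  then have "av f \<in> kerAb" by (intro av_in[OF ksub_kerAb] act_kerAb \<Gamma>_sl2)
  then show ?thesis by (simp add: UV_def act_av ksub_zero[OF ksub_relV])
qed

lemma invariants_clsV:
  assumes "Y \<subseteq> F"
  shows "invariants \<Gamma> actV (clsV K ` Y) = clsV K ` {f \<in> Y. \<forall>g\<in>\<Gamma>. act_free g f - f \<in> relV}"
proof -
  have "actV g (clsV K f) = clsV K f \<longleftrightarrow> act_free g f - f \<in> relV" if "g \<in> \<Gamma>" "f \<in> Y" for g f
  proof -
    have "f \<in> F" using assms that by blast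
    then show ?thesis using that by (simp add: actV_clsV \<Gamma>_sl2 clsV_eq)
  qed
  then show ?thesis unfolding invariants_def by blast
qed

lemma kerAb_F: "kerAb \<subseteq> F" and kerAb2_F: "kerAb2 \<subseteq> F" by (auto simp: kerAb2_def)

lemma V_invariants:
  "invariants \<Gamma> actV (zr_classes K) = clsV K ` UV" "invariants \<Gamma> actV (V_r K) = clsV K ` UV"
  "invariants \<Gamma> actV (V_r2 K) = clsV K ` UV2" "W1 K \<Gamma> = clsV K ` UW"
proof -
  show "invariants \<Gamma> actV (zr_classes K) = clsV K ` UV" "invariants \<Gamma> actV (V_r K) = clsV K ` UV"
    "invariants \<Gamma> actV (V_r2 K) = clsV K ` UV2"
    unfolding zr_classes_eq V_r_eq V_r2_eq UV_def UV2_def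
    by (intro invariants_clsV kerAb_F kerAb2_F)+
  have "invariants \<Gamma> actV (modW K) = clsV K ` UW"
    unfolding modW_eq UW_def by (intro invariants_clsV CC_F)
  moreover have "UW \<subseteq> F" using UW_UV UV_F by blast
  ultimately show "W1 K \<Gamma> = clsV K ` UW"
    using pres_mod_span[OF pres_modV, of UW] by (simp add: W1_def kspan_eq ksub_UW)
qed

lemma pres_Inv0: "pres ((poly_alg K)\<lparr>carrier := invariants \<Gamma> act_poly PK\<rparr>) Inv0 {0} (\<lambda>p. p)"
proof -
  have "pres ((poly_alg K)\<lparr>carrier := (\<lambda>p. p) ` Inv0\<rparr>) Inv0 {0} (\<lambda>p. p)"
    by (rule pres_restrict'[OF pres_alg ksub_Inv0]) (use ksub_zero[OF ksub_Inv0] in \<open>auto simp: Inv0_def\<close>)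
  moreover have "invariants \<Gamma> act_poly PK = Inv0" by (simp add: invariants_def Inv0_def)
  ultimately show ?thesis by simp
qed

lemma pres_UV: "pres ((modV K)\<lparr>carrier := clsV K ` UV\<rparr>) UV relV (clsV K)"
  by (rule pres_restrict'[OF pres_modV ksub_UV relV_UV UV_F])

lemma pres_UW: "pres ((modV K)\<lparr>carrier := clsV K ` UW\<rparr>) UW relV (clsV K)"
  by (rule pres_restrict'[OF pres_modV ksub_UW relV_UW]) (use UW_UV UV_F in blast)

abbreviation "V1cls \<equiv> map_prod (\<lambda>p. p) (clsV K)"

lemma pres_V1: "pres (modV1 K \<Gamma>) (Inv0 \<times> UV) ({0} \<times> relV) V1cls"
  unfolding modV1_def V_invariants by (rule pres_dirsum[OF pres_Inv0 pres_UV])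

lemma W1_in_V1_eq: "W1_in_V1 K \<Gamma> = V1cls ` ({0} \<times> UW)"
  by (auto simp: W1_in_V1_def V_invariants)

lemma ksub_prod: "ksub Y \<Longrightarrow> ksub Y' \<Longrightarrow> ksub (Y \<times> Y')"
  by (auto simp: ksub_def zero_prod_def)

lemma V1_sub: "ksub Y \<Longrightarrow> Y \<subseteq> UV \<Longrightarrow> ksub ({0} \<times> Y)" "Y \<subseteq> UV \<Longrightarrow> {0} \<times> Y \<subseteq> Inv0 \<times> UV"
  using ksub_prod[OF ksub_singleton_0] ksub_zero[OF ksub_Inv0] by auto

definition V1lift :: "cpoly \<times> ncpoly \<Rightarrow> ncpoly" where
  "V1lift x = z_lift (fst x) + snd x"

lemma clin_V1lift: "clin V1lift"
  unfolding V1lift_def by (intro clin_plus clin_comp[OF clin_z_lift]) (simp_all add: clin_def)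

lemma V1lift_F: "x \<in> Inv0 \<times> UV \<Longrightarrow> V1lift x \<in> F"
  using UV_F by (auto simp: V1lift_def Inv0_def intro!: ksub_add[OF ksub_F] z_lift_in)

lemma V1_to_cyc_eq: assumes "x \<in> Inv0 \<times> UV" shows "V1_to_cyc K \<Gamma> (V1cls x) = icls (V1lift x)"
proof -
  obtain p f where x: "x = (p, f)" "p \<in> Inv0" "f \<in> UV" using assms by auto
  have F: "z_lift p \<in> F" "f \<in> F" using x UV_F by (auto simp: Inv0_def z_lift_in)
  have "A_to_cyc K \<Gamma> ` clsV K f = {icls f}"
  proof -
    have e: "A_to_cyc K \<Gamma> (clsA K h) = icls f" if "h \<in> F" "h - f \<in> relV" for h
      using that F relV_Nchi presD(7)[OF pres_M1, of h f] by (auto simp: A_to_cyc_cls)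
    have "f \<in> {h \<in> F. h - f \<in> relV}" using F by (simp add: ksub_zero[OF ksub_relV])
    then show ?thesis unfolding clsV_set[OF F(2)] using e by blast
  qed
  then have "induced (A_to_cyc K \<Gamma>) (clsV K f) = icls f" by (simp add: induced_def)
  then show ?thesis
    using F presD(5)[OF pres_M1, of "z_lift p" f]
    by (simp add: x V1_to_cyc_def V1lift_def free_to_cyc_eq skew_cyc_at_ops)
qed

text \<open>If the average of z_lift p + f is a commutator, its commutative image vanishes. This
  image is p, as p is invariant and f lies in the ideal of r'. Then f itself is a
  commutator.\<close>

lemma V1lift_kernel:
  assumes "x \<in> Inv0 \<times> UV" "chi (V1lift x) = 0" shows "x \<in> {0} \<times> UW"
proof -
  obtain p f where x: "x = (p, f)" "p \<in> Inv0" "f \<in> UV" using assms by auto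
  have ab: "abl f = 0" using x UV_kerAb by blast
  have C: "av (V1lift x) \<in> CC" by (rule chi_zeroD[OF V1lift_F[OF assms(1)] assms(2)])
  then have "abl (av (V1lift x)) = 0" using CC_kerAb by blast
  then have "avp p = 0" by (simp add: abl_av V1lift_def x(1) abl_linear ab)
  moreover have "avp p = p" using x(2) by (intro avp_invariant) (simp add: Inv0_def)
  ultimately have p: "p = 0" by simp
  then have "av f \<in> CC" using C by (simp add: V1lift_def x(1) clin_zero[OF clin_z_lift])
  moreover have "av f - f \<in> CC"
    using x(3) relV_CC av_mod[OF ksub_relV, of f] by (auto simp: UV_def)
  ultimately have "f \<in> CC" using ksub_cong[OF ksub_CC] by blast
  then show ?thesis using x p by (simp add: UW_def UV_def)
qed

text \<open>After averaging b its commutative image is lifted by \<open>z_lift\<close>. That lift is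
  not equivariant, so the difference has to be averaged again; \<open>chi\<close> does not
  notice.\<close>

lemma V1lift_onto: assumes "b \<in> F" shows "\<exists>x\<in>Inv0 \<times> UV. chi (V1lift x - b) = 0"
proof -
  let ?a = "av b"
  let ?p = "abl ?a"
  let ?f = "av (?a - z_lift ?p)"
  have aF: "?a \<in> F" using assms by (rule av_F)
  have p: "?p \<in> Inv0" using aF by (simp add: Inv0_def abl_in abl_act[symmetric] act_av)
  have zF: "z_lift ?p \<in> F" using aF by (intro z_lift_in abl_in)
  have "?a - z_lift ?p \<in> kerAb" using aF zF by (simp add: ksub_diff[OF ksub_F] abl_linear)
  then have "?f \<in> UV" by (rule invariant_kerAb_UV)
  moreover have "chi (V1lift (?p, ?f) - b) = 0"
    by (simp add: V1lift_def chi_linear chi_av)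
  ultimately show ?thesis using p by blast
qed

text \<open>The parameter \<open>H\<close> serves both maps out of \<open>V_1\<close>: it is the
  identity in (ii) and the projection to \<open>modQ\<close> in (iv).\<close>

lemma V1_induced:
  assumes Y: "ksub Y" "relV \<subseteq> Y" "Y \<subseteq> UV" "x \<in> Inv0 \<times> UV"
    and c: "\<And>f h. f \<in> F \<Longrightarrow> h \<in> F \<Longrightarrow> f - h \<in> Y \<Longrightarrow> H (icls f) = H (icls h)"
  shows "induced (\<lambda>v. H (V1_to_cyc K \<Gamma> v)) (V1cls ` ({0} \<times> Y) +>\<^bsub>modV1 K \<Gamma>\<^esub> V1cls x) = H (icls (V1lift x))"
proof -
  have "induced (\<lambda>v. H (V1_to_cyc K \<Gamma> v)) (V1cls ` ({0} \<times> Y) +>\<^bsub>modV1 K \<Gamma>\<^esub> V1cls x) = H (V1_to_cyc K \<Gamma> (V1cls x))"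
  proof (rule pres_induced[OF pres_V1 V1_sub(1)[OF Y(1,3)] _ V1_sub(2)[OF Y(3)] Y(4)])
    show "{0} \<times> relV \<subseteq> {0} \<times> Y" using Y(2) by blast
    fix y assume y: "y \<in> Inv0 \<times> UV" "y - x \<in> {0} \<times> Y"
    then have "V1lift y - V1lift x \<in> Y"
      by (cases x; cases y) (auto simp: V1lift_def)
    then show "H (V1_to_cyc K \<Gamma> (V1cls y)) = H (V1_to_cyc K \<Gamma> (V1cls x))"
      using y(1) Y(4) c[OF V1lift_F V1lift_F] by (simp only: V1_to_cyc_eq)
  qed
  then show ?thesis using Y(4) by (simp only: V1_to_cyc_eq)
qed

lemma pres_V1_quot:
  assumes "ksub Y" "relV \<subseteq> Y" "Y \<subseteq> UV"
  shows "pres (quot_mod (modV1 K \<Gamma>) (V1cls ` ({0} \<times> Y))) (Inv0 \<times> UV) ({0} \<times> Y)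
    (\<lambda>x. V1cls ` ({0} \<times> Y) +>\<^bsub>modV1 K \<Gamma>\<^esub> V1cls x)"
  using assms by (intro pres_quot[OF pres_V1] V1_sub) auto

lemma V1_W1_iso:
  "Module.module K (modV1 K \<Gamma>)" "submodule (W1_in_V1 K \<Gamma>) K (modV1 K \<Gamma>)"
  "induced (V1_to_cyc K \<Gamma>) \<in> mod_iso K (quot_mod (modV1 K \<Gamma>) (W1_in_V1 K \<Gamma>)) (skew_cyc_at K \<Gamma> {mat 1})"
proof -
  show "Module.module K (modV1 K \<Gamma>)" by (rule pres_module[OF pres_V1])
  show "submodule (W1_in_V1 K \<Gamma>) K (modV1 K \<Gamma>)"
    unfolding W1_in_V1_eq by (intro pres_submodule[OF pres_V1] V1_sub ksub_UW UW_UV)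
  show "induced (V1_to_cyc K \<Gamma>) \<in> mod_iso K (quot_mod (modV1 K \<Gamma>) (W1_in_V1 K \<Gamma>)) (skew_cyc_at K \<Gamma> {mat 1})"
    unfolding W1_in_V1_eq
  proof (rule pres_iso[OF pres_V1_quot[OF ksub_UW relV_UW UW_UV] pres_M1, where L = V1lift])
    fix x assume x: "x \<in> Inv0 \<times> UV"
    show "V1lift x \<in> F" by (rule V1lift_F[OF x])
    show "x \<in> {0} \<times> UW" if "V1lift x \<in> Nchi" using V1lift_kernel[OF x] that by (simp add: Nchi_def)
    show "induced (V1_to_cyc K \<Gamma>) (V1cls ` ({0} \<times> UW) +>\<^bsub>modV1 K \<Gamma>\<^esub> V1cls x) = icls (V1lift x)"
    proof (rule V1_induced[where H = "\<lambda>z. z", OF ksub_UW relV_UW UW_UV x])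
      show "icls f = icls h" if "f \<in> F" "h \<in> F" "f - h \<in> UW" for f h
        using that presD(7)[OF pres_M1, of f h] UW_Nchi by auto
    qed
  next
    fix y assume y: "y \<in> F"
    obtain x where x: "x \<in> Inv0 \<times> UV" "chi (V1lift x - y) = 0" using V1lift_onto[OF y] by blast
    then have "V1lift x - y \<in> Nchi" using y V1lift_F by (simp add: Nchi_def ksub_diff[OF ksub_F])
    then show "\<exists>x\<in>Inv0 \<times> UV. V1lift x - y \<in> Nchi" using x(1) by blast
  qed (simp_all add: clin_simps[OF clin_V1lift])
qed

section \<open>The linear term as a map on the graded piece of (r')\<close>

definition theta :: "ncpoly set set set \<Rightarrow> cpoly" where
  "theta Z = weyl (SOME f. f \<in> kerAb \<and> Z = V_r2 K +>\<^bsub>modV K\<^esub> clsV K f)"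

lemma coset_carrier_update: "H +>\<^bsub>M\<lparr>carrier := c\<rparr>\<^esub> x = H +>\<^bsub>M\<^esub> x"
  by (simp add: a_r_coset_def r_coset_def)

lemma kerAb2_kerAb: "kerAb2 \<subseteq> kerAb" by (auto simp: kerAb2_def)

lemma pres_Vr_quot:
  "pres (quot_mod ((modV K)\<lparr>carrier := V_r K\<rparr>) (V_r2 K)) kerAb kerAb2 (\<lambda>f. V_r2 K +>\<^bsub>modV K\<^esub> clsV K f)"
proof -
  have "pres ((modV K)\<lparr>carrier := clsV K ` kerAb\<rparr>) kerAb relV (clsV K)"
    by (rule pres_restrict'[OF pres_modV ksub_kerAb relV_kerAb kerAb_F])
  from pres_quot[OF this ksub_kerAb2 relV_kerAb2 kerAb2_kerAb]
  show ?thesis unfolding V_r_eq V_r2_eq coset_carrier_update .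
qed

text \<open>Two representatives differ by an element of \<open>kerAb2\<close>, on which the linear
  term vanishes.\<close>

lemma theta: assumes "f \<in> kerAb" shows "theta (V_r2 K +>\<^bsub>modV K\<^esub> clsV K f) = weyl f"
proof -
  let ?P = "\<lambda>h. h \<in> kerAb \<and> V_r2 K +>\<^bsub>modV K\<^esub> clsV K f = V_r2 K +>\<^bsub>modV K\<^esub> clsV K h"
  have "?P (SOME h. ?P h)" using assms by (intro someI[of ?P f]) simp
  then have "f - (SOME h. ?P h) \<in> kerAb2" using presD(7)[OF pres_Vr_quot] assms by blast
  then have "weyl f - weyl (SOME h. ?P h) = 0" by (simp add: kerAb2_def weyl_linear)
  then show ?thesis by (simp add: theta_def)
qed

lemma gr_z_lift: "p \<in> PK \<Longrightarrow> gr * z_lift p \<in> kerAb" "weyl (gr * z_lift p) = p"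
  by (simp_all add: alg_in z_lift_in abl_mult weyl_r)

lemma theta_iso: "theta \<in> mod_iso K (quot_mod ((modV K)\<lparr>carrier := V_r K\<rparr>) (V_r2 K)) (poly_alg K)"
proof (rule pres_iso[OF pres_Vr_quot pres_alg, where L = weyl])
  fix y :: cpoly assume "y \<in> PK"
  then show "\<exists>x\<in>kerAb. weyl x - y \<in> {0}" using gr_z_lift by fastforce
next
  show "theta (V_r2 K +>\<^bsub>modV K\<^esub> clsV K f) = weyl f" if "f \<in> kerAb" for f by (rule theta[OF that])
qed (auto simp: weyl_in weyl_linear kerAb2_def)

lemma theta_zmon: "theta (V_r2 K +>\<^bsub>modV K\<^esub> clsV K (gr * zmon a b)) = xy_monom a b"
  by (subst theta) (simp_all add: alg_in abl_mult weyl_r)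

abbreviation "Vrr \<equiv> quot_mod ((modV K)\<lparr>carrier := clsV K ` UV\<rparr>) (clsV K ` UV2)"
abbreviation "Vrrcls v \<equiv> clsV K ` UV2 +>\<^bsub>modV K\<^esub> v"
abbreviation "theta_inv \<equiv> induced (\<lambda>v. theta (V_r2 K +>\<^bsub>modV K\<^esub> v))"

lemma pres_Vrr: "pres Vrr UV UV2 (\<lambda>f. Vrrcls (clsV K f))"
  using pres_quot[OF pres_UV ksub_UV2 relV_UV2 UV2_UV] unfolding coset_carrier_update .

lemma theta_inv: assumes "f \<in> UV" shows "theta_inv (Vrrcls (clsV K f)) = weyl f"
proof -
  have kf: "f \<in> kerAb" using assms UV_kerAb by blast
  have "theta_inv (clsV K ` UV2 +>\<^bsub>(modV K)\<lparr>carrier := clsV K ` UV\<rparr>\<^esub> clsV K f) = theta (V_r2 K +>\<^bsub>modV K\<^esub> clsV K f)"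
  proof (rule pres_induced[OF pres_UV ksub_UV2 relV_UV2 UV2_UV assms])
    fix y assume y: "y \<in> UV" "y - f \<in> UV2"
    then have "weyl y - weyl f = 0" "y \<in> kerAb" using UV_kerAb by (auto simp: UV2_def kerAb2_def simp flip: weyl_linear)
    then show "theta (V_r2 K +>\<^bsub>modV K\<^esub> clsV K y) = theta (V_r2 K +>\<^bsub>modV K\<^esub> clsV K f)"
      using theta[OF kf] theta[of y] by simp
  qed
  then show ?thesis using theta[OF kf] by (simp add: coset_carrier_update)
qed

lemma weyl_UV: assumes "f \<in> UV" shows "weyl f \<in> Inv0"
proof -
  have f: "f \<in> kerAb" using assms UV_kerAb by blast
  have "act_poly g (weyl f) = weyl f" if "g \<in> \<Gamma>" for g
  proof -
    have "weyl (act_free g f - f) = 0" using assms that by (intro weyl_relV) (simp add: UV_def)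
    then show ?thesis using f that by (simp add: weyl_linear weyl_act \<Gamma>_sl2)
  qed
  then show ?thesis using f by (simp add: Inv0_def weyl_in)
qed

lemma Inv0_avp: "p \<in> Inv0 \<Longrightarrow> avp p = p"
  by (intro avp_invariant) (simp add: Inv0_def)

lemma theta_inv_iso: "theta_inv \<in> mod_iso K Vrr ((poly_alg K)\<lparr>carrier := invariants \<Gamma> act_poly PK\<rparr>)"
proof (rule pres_iso[OF pres_Vrr pres_Inv0, where L = weyl])
  fix p assume p: "p \<in> Inv0"
  let ?f = "gr * z_lift p"
  have f: "?f \<in> kerAb" using p by (intro gr_z_lift) (simp add: Inv0_def)
  then have "weyl (av ?f) = p" using Inv0_avp[OF p] by (simp only: weyl_av gr_z_lift)
  then show "\<exists>x\<in>UV. weyl x - p \<in> {0}" using invariant_kerAb_UV[OF f] by force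
next
  fix f assume f: "f \<in> UV"
  show "weyl f \<in> Inv0" by (rule weyl_UV[OF f])
  show "f \<in> UV2" if "weyl f \<in> {0}" using f that by (simp add: UV_def UV2_def kerAb2_def)
  show "theta_inv (Vrrcls (clsV K f)) = weyl f" by (rule theta_inv[OF f])
qed (simp_all add: weyl_linear)

abbreviation "W1mod \<equiv> (modV K)\<lparr>carrier := clsV K ` UW\<rparr>"

lemma Vrrcls_hom: "Vrrcls \<in> mod_hom K W1mod Vrr"
  by (rule pres_hom[OF pres_UW pres_Vrr, where L = "\<lambda>f. f"]) (use UW_UV ksub_zero[OF ksub_UV2] in auto)

lemma Vrrcls_inj: "inj_on Vrrcls (clsV K ` UW)"
proof -
  have "inj_on Vrrcls (carrier W1mod)"
  proof (rule pres_hom_inj[OF pres_UW pres_Vrr, where L = "\<lambda>f. f"])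
    show "f \<in> relV" if "f \<in> UW" "f \<in> UV2" for f
      using that UW_CC by (intro CC_weyl_inj) (auto simp: UV2_def kerAb2_def)
  qed (use UW_UV in auto)
  then show ?thesis by simp
qed

lemma gcd_module_eq: "gcd_module K \<Gamma> = {p \<in> gcdspan. \<forall>g\<in>\<Gamma>. act_poly g p = p}"
proof -
  let ?S = "{of_nat (gcd a b) *\<^sub>C xy_monom (a - 1) (b - 1) | a b. a \<ge> 1 \<and> b \<ge> 1}"
  have "?S \<subseteq> PK" by (auto intro!: ksub_cscale[OF ksub_monoid_alg])
  from pres_mod_span[OF pres_alg this] have "mod_span K (poly_alg K) ?S = kspan ?S" by simp
  then show ?thesis by (simp add: gcd_module_def invariants_def gcdspan_def of_nat_mult_cscale)
qed

text \<open>An invariant element of the gcd lattice is the linear term of some commutator; averaging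
  makes the commutator invariant and keeps the linear term.\<close>

lemma theta_inv_image: "theta_inv ` Vrrcls ` (clsV K ` UW) = gcd_module K \<Gamma>"
proof -
  have "theta_inv ` Vrrcls ` (clsV K ` UW) = weyl ` UW"
    unfolding image_image using theta_inv UW_UV by (intro image_cong refl) blast
  also have "\<dots> = gcd_module K \<Gamma>"
    unfolding gcd_module_eq
  proof (intro antisym subsetI)
    fix p assume "p \<in> weyl ` UW"
    then obtain f where f: "f \<in> UW" "p = weyl f" by blast
    then have "p \<in> gcdspan" "p \<in> Inv0" using weyl_CC weyl_UV UW_UV UW_CC by blast+
    then show "p \<in> {p \<in> gcdspan. \<forall>g\<in>\<Gamma>. act_poly g p = p}" by (simp add: Inv0_def)
  next
    fix p assume p: "p \<in> {p \<in> gcdspan. \<forall>g\<in>\<Gamma>. act_poly g p = p}"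
    then obtain h where h: "h \<in> kspan Wgens" "weyl h = p" using gcdspan_Wgens by blast
    have hC: "h \<in> CC" using h kspan_minimal[OF Wgens_CC ksub_CC] by blast
    have "av h \<in> CC" using hC by (intro av_in[OF ksub_CC] act_CC \<Gamma>_sl2)
    then have "av h \<in> UW" by (simp add: UW_def act_av ksub_zero[OF ksub_relV])
    moreover have "weyl (av h) = p"
      using p h(2) hC CC_kerAb avp_invariant[of p] weyl_av[of h] by auto
    ultimately show "p \<in> weyl ` UW" by blast
  qed
  finally show ?thesis .
qed

end

section \<open>The quotient by the powers of \<open>r'\<close>\<close>

definition dproj :: "nat \<Rightarrow> ncpoly \<Rightarrow> ncpoly" where
  "dproj d = ext (\<lambda>w. if word_degree w = d then bas w else 0)"

lemma clin_dproj: "clin (dproj d)"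
  unfolding dproj_def by (rule clin_ext)

lemmas dproj_linear = clin_simps[OF clin_dproj]

lemma lookup_dproj: "Poly_Mapping.lookup (dproj d f) w = (if word_degree w = d then Poly_Mapping.lookup f w else 0)"
proof (rule clin_eqI[where F = "\<lambda>f. Poly_Mapping.lookup (dproj d f) w"
      and G = "\<lambda>f. if word_degree w = d then Poly_Mapping.lookup f w else 0"])
  show "clin (\<lambda>f. Poly_Mapping.lookup (dproj d f) w)"
    by (rule clin_comp[OF clin_lookup clin_dproj])
  show "clin (\<lambda>f. if word_degree w = d then Poly_Mapping.lookup f w else 0 :: complex)"
    by (auto simp: clin_def)
  show "Poly_Mapping.lookup (dproj d (bas v)) w = (if word_degree w = d then Poly_Mapping.lookup (bas v) w else 0)" for v
    by (auto simp: dproj_def lookup_single when_def)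
qed

lemma sum_dproj: "(\<Sum>d\<in>word_degree ` Poly_Mapping.keys f. dproj d f) = f"
proof (rule poly_mapping_eqI)
  fix w
  show "Poly_Mapping.lookup (\<Sum>d\<in>word_degree ` Poly_Mapping.keys f. dproj d f) w = Poly_Mapping.lookup f w"
    by (cases "w \<in> Poly_Mapping.keys f") (auto simp: lookup_sum lookup_dproj sum.delta' in_keys_iff)
qed

lemma homog_rdegree_iff: "homog rdegree d f \<longleftrightarrow> (\<forall>w\<in>Poly_Mapping.keys f. word_degree w = d)"
  by (auto simp: homog_def rdegree_def in_keys_iff)

lemma dproj_homog: "homog rdegree e f \<Longrightarrow> dproj d f = (if d = e then f else 0)"
  by (rule poly_mapping_eqI) (auto simp: lookup_dproj homog_rdegree_iff in_keys_iff)

context coeff_ring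
begin

lemma kspan_singletonD: "x \<in> kspan {z} \<Longrightarrow> \<exists>t\<in>k. x = t *\<^sub>C z"
proof (induct rule: kspan.induct)
  case zero show ?case by (intro bexI[of _ 0]) simp_all
next
  case (step c x v)
  then obtain t where "t \<in> k" "v = t *\<^sub>C z" by blast
  then show ?case using step by (intro bexI[of _ "c + t"]) (simp_all add: cscale_add_left)
qed

lemma kspan_singletonI: "t \<in> k \<Longrightarrow> t *\<^sub>C z \<in> kspan {z}"
  by (intro ksub_cscale[OF ksub_kspan] kspan_base) simp_all

text \<open>The generators lie in distinct even degrees, so at most one of them meets a given
  degree.\<close>

lemma dproj_kspan:
  assumes h: "\<And>m. homog rdegree (2 * m) (h m)" and x: "x \<in> kspan {h m | m. m \<ge> 1}"
  shows "n \<ge> 1 \<Longrightarrow> \<exists>t\<in>k. dproj (2 * n) x = t *\<^sub>C h n"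
    and "(\<And>m. m \<ge> 1 \<Longrightarrow> d \<noteq> 2 * m) \<Longrightarrow> dproj d x = 0"
proof -
  have "dproj (2 * n) x \<in> kspan {h n}"
  proof (rule kspan_lin_in[OF clin_dproj ksub_kspan _ x])
    fix y assume "y \<in> {h m | m. m \<ge> 1}"
    then obtain m where y: "y = h m" by blast
    show "dproj (2 * n) y \<in> kspan {h n}"
      unfolding y by (cases "n = m") (simp_all add: dproj_homog[OF h] kspan_base)
  qed
  then show "\<exists>t\<in>k. dproj (2 * n) x = t *\<^sub>C h n" by (rule kspan_singletonD)
  show "dproj d x = 0" if d: "\<And>m. m \<ge> 1 \<Longrightarrow> d \<noteq> 2 * m"
  proof -
    have "dproj d x \<in> {0}"
    proof (rule kspan_lin_in[OF clin_dproj ksub_singleton_0 _ x])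
      fix y assume "y \<in> {h m | m. m \<ge> 1}"
      then obtain m where "y = h m" "m \<ge> 1" by blast
      then show "dproj d y \<in> {0}" using d[of m] by (simp add: dproj_homog[OF h])
    qed
    then show ?thesis by simp
  qed
qed

lemma lookup_in: "f \<in> carrier (monoid_alg K) \<Longrightarrow> Poly_Mapping.lookup f w \<in> k"
  by (simp add: monoid_alg_def)

lemma dproj_in: "f \<in> F \<Longrightarrow> dproj d f \<in> F"
  by (simp add: monoid_alg_def lookup_dproj)

text \<open>By unimodularity s is an integral combination of two coefficients of
  \<open>s rprim n\<close>.\<close>

lemma cscale_rprim_in: assumes "s *\<^sub>C rprim n \<in> F" "n \<ge> 2" shows "s \<in> k"
proof -
  obtain w1 w2 m1 m2 where *: "of_int m1 * Poly_Mapping.lookup (rprim n) w1 + of_int m2 * Poly_Mapping.lookup (rprim n) w2 = 1"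
    using rprim_unimodular[OF assms(2)] by blast
  have "s = s * (of_int m1 * Poly_Mapping.lookup (rprim n) w1 + of_int m2 * Poly_Mapping.lookup (rprim n) w2)"
    unfolding * by simp
  also have "\<dots> = of_int m1 * Poly_Mapping.lookup (s *\<^sub>C rprim n) w1 + of_int m2 * Poly_Mapping.lookup (s *\<^sub>C rprim n) w2"
    by (simp add: algebra_simps)
  also have "\<dots> \<in> k" using lookup_in[OF assms(1)] by (intro K_add K_mult K_of_int)
  finally show ?thesis .
qed

lemma rprim_nonzero: assumes "n \<ge> 2" shows "rprim n \<noteq> 0"
  using rprim_unimodular[OF assms] by auto

lemma rprim_1: "rprim 1 = 0"
  using rr_1[of K] coeff_ring_axioms by (simp add: rprim_def)

text \<open>The powers of r' span \<open>RG\<close> in the free algebra, and their normal forms span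
  \<open>RS\<close>. \<open>RP\<close> is the saturation of \<open>RS\<close> in F, by
  \<open>RP_multiple\<close> and \<open>RP_saturated\<close>; the torsion is the quotient of
  \<open>RP\<close> by \<open>RS\<close>.\<close>

definition RG :: "ncpoly set" where "RG = kspan {gr ^ l | l. l \<ge> 1}"
definition RS :: "ncpoly set" where "RS = kspan {rr l | l. l \<ge> 1}"
definition RP :: "ncpoly set" where "RP = kspan {rprim l | l. l \<ge> 1}"

lemma ksub_RG: "ksub RG" and ksub_RS: "ksub RS" and ksub_RP: "ksub RP"
  by (simp_all add: RG_def RS_def RP_def ksub_kspan)

lemma gr_power_RG: "l \<ge> 1 \<Longrightarrow> gr ^ l \<in> RG" and rr_RS: "l \<ge> 1 \<Longrightarrow> rr l \<in> RS" and rprim_RP: "l \<ge> 1 \<Longrightarrow> rprim l \<in> RP"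
  unfolding RG_def RS_def RP_def by (intro kspan_base, blast)+

lemma RG_F: "RG \<subseteq> F"
  unfolding RG_def by (intro kspan_minimal ksub_F) (auto simp: monoid_alg_power)

lemma RS_RP: "RS \<subseteq> RP"
  unfolding RS_def
  by (intro kspan_minimal ksub_RP) (auto simp: rr_rprim intro!: ksub_cscale[OF ksub_RP] rprim_RP)

lemma RP_multiple: assumes "x \<in> RP" shows "\<exists>c>0. of_nat c *\<^sub>C x \<in> RS"
  using assms unfolding RP_def
proof (induct rule: kspan.induct)
  case zero show ?case using ksub_zero[OF ksub_RS] by (intro exI[of _ 1]) simp
next
  case (step a x v)
  then obtain l d where l: "l \<ge> 1" "x = rprim l" and d: "d > 0" "of_nat d *\<^sub>C v \<in> RS" by blast
  have "of_nat (content l * d) *\<^sub>C (a *\<^sub>C x + v) = (of_nat d * a) *\<^sub>C rr l + of_nat (content l) *\<^sub>C of_nat d *\<^sub>C v"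
    by (simp add: cscale_add_right rr_rprim l(2) mult.commute mult.left_commute)
  moreover have "\<dots> \<in> RS"
    using step(1)
    by (intro ksub_add[OF ksub_RS ksub_cscale[OF ksub_RS _ rr_RS[OF l(1)]] ksub_cscale[OF ksub_RS _ d(2)]] K_mult K_of_nat)
  ultimately show ?case using content_pos[of l] d(1) by (intro exI[of _ "content l * d"]) simp
qed

text \<open>In degree 2n everything lies on the line of \<open>rr n\<close>, and the integral
  multiples of the primitive vector are its K-multiples.\<close>

lemma RP_saturated: assumes y: "y \<in> F" and c: "c \<noteq> 0" "c *\<^sub>C y \<in> RS" shows "y \<in> RP"
proof -
  have "dproj d y \<in> RP" for d
  proof (cases "\<exists>m\<ge>1. d = 2 * m")
    case True
    then obtain n where n: "n \<ge> 1" "d = 2 * n" by blast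
    obtain t where t: "dproj d (c *\<^sub>C y) = t *\<^sub>C rr n"
      using dproj_kspan(1)[OF homog_rr c(2)[unfolded RS_def] n(1)] n(2) by blast
    define s where "s = t * of_nat (content n) / c"
    have "c *\<^sub>C dproj d y = c *\<^sub>C s *\<^sub>C rprim n" using t c(1) by (simp add: s_def dproj_linear rr_rprim)
    then have s: "dproj d y = s *\<^sub>C rprim n" by (rule cscale_cancel[OF c(1), THEN iffD1])
    \<comment> \<open>Unimodularity starts at n = 2; for n = 1 the generator is 0 and so is the
      component.\<close>
    show ?thesis
    proof (cases "n = 1")
      case True
      then have "dproj d y = 0" using s rprim_1 by simp
      then show ?thesis by (simp add: ksub_zero[OF ksub_RP])
    next
      case False
      then have "s \<in> k" using cscale_rprim_in[of s n] dproj_in[OF y, of d] s n(1) by simp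
      then show ?thesis unfolding s using n(1) by (intro ksub_cscale[OF ksub_RP] rprim_RP)
    qed
  next
    case False
    then have "dproj d (c *\<^sub>C y) = 0" by (intro dproj_kspan(2)[OF homog_rr c(2)[unfolded RS_def]]) auto
    then have "dproj d y = 0" using c(1) by (simp add: dproj_linear)
    then show ?thesis by (simp add: ksub_zero[OF ksub_RP])
  qed
  then show ?thesis using ksub_sum[OF ksub_RP, of _ "\<lambda>d. dproj d y"] sum_dproj[of y] by metis
qed

lemma RG_support: assumes "x \<in> RG" "Poly_Mapping.lookup x w \<noteq> 0" shows "\<exists>m\<ge>1. bas w = gr ^ m"
proof -
  let ?Y = "{x. \<forall>w. Poly_Mapping.lookup x w \<noteq> 0 \<longrightarrow> (\<exists>m\<ge>1. bas w = gr ^ m)}"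
  have "ksub ?Y"
  proof (rule ksubI)
    show "x + y \<in> ?Y" if "x \<in> ?Y" "y \<in> ?Y" for x y
      using that by (auto simp del: One_nat_def) (metis add.right_neutral)
  qed (auto simp del: One_nat_def)
  moreover have "{gr ^ l | l. l \<ge> 1} \<subseteq> ?Y"
    by (auto simp: gen_power lookup_single when_def simp del: One_nat_def split: if_splits)
  ultimately have "RG \<subseteq> ?Y" unfolding RG_def by (intro kspan_minimal)
  then show ?thesis using assms by blast
qed

text \<open>The generators are basis words of the free algebra, so membership is a condition on the
  support.\<close>

lemma RG_saturated: assumes x: "x \<in> F" and c: "c \<noteq> 0" "c *\<^sub>C x \<in> RG" shows "x \<in> RG"
proof -
  have "bas w \<in> RG" if "w \<in> Poly_Mapping.keys x" for w
  proof -
    have "Poly_Mapping.lookup (c *\<^sub>C x) w \<noteq> 0" using that c(1) by (simp add: in_keys_iff)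
    then obtain m where "m \<ge> 1" "bas w = gr ^ m" using RG_support[OF c(2)] by blast
    then show ?thesis using gr_power_RG by metis
  qed
  then have "ext bas x \<in> RG"
    unfolding ext_def using lookup_in[OF x] by (intro ksub_sum[OF ksub_RG] ksub_cscale[OF ksub_RG])
  then show ?thesis by (simp add: ext_bas_id)
qed

lemma trace_RG: assumes "g \<in> RG" shows "cyc_trace g = g"
proof -
  have "cyc_trace g - g \<in> {0}"
    using assms unfolding RG_def
    by (rule kspan_lin_in[OF clin_minus_fun[OF clin_cyc_trace clin_id] ksub_singleton_0, rotated]) auto
  then show ?thesis by simp
qed

definition FC :: "ncpoly set" where "FC = {f \<in> F. cyc_trace f = 0}"

lemma ksub_FC: "ksub FC"
  unfolding FC_def by (intro ksub_Collect_ker ksub_F clin_cyc_trace)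

lemma FC_F: "FC \<subseteq> F" by (auto simp: FC_def)

lemma FC_eq: "FC = kspan {a * c - c * a | a c. a \<in> F \<and> c \<in> F}"
proof
  show "FC \<subseteq> kspan {a * c - c * a | a c. a \<in> F \<and> c \<in> F}"
  proof
    fix f assume "f \<in> FC"
    then show "f \<in> kspan {a * c - c * a | a c. a \<in> F \<and> c \<in> F}"
      using sub_trace[of f] by (simp add: FC_def)
  qed
  have "a * c - c * a \<in> FC" if "a \<in> F" "c \<in> F" for a c
    using that trace_comm[of a c] by (simp add: FC_def trace_linear alg_in)
  then show "kspan {a * c - c * a | a c. a \<in> F \<and> c \<in> F} \<subseteq> FC"
    by (intro kspan_minimal ksub_FC) blast
qed

lemma FC_CC: "FC \<subseteq> CC"
proof
  fix f assume "f \<in> FC"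
  then show "f \<in> CC" using expA_trace[of f] by (simp add: FC_def CC_def expA_linear trace_linear)
qed

abbreviation "fcls \<equiv> cyc_class K (free_alg K)"

lemma comm_span_free: "comm_span K (free_alg K) F F = (\<lambda>f. f) ` FC"
proof -
  let ?S = "{a * c - c * a | a c. a \<in> F \<and> c \<in> F}"
  have e: "s * t \<ominus>\<^bsub>free_alg K\<^esub> t * s = s * t - t * s" if "s \<in> F" "t \<in> F" for s t
    using pres_diff[OF pres_alg, of "s * t" "t * s"] that by (simp add: monoid_alg_mult)
  have "{s \<otimes>\<^bsub>free_alg K\<^esub> t \<ominus>\<^bsub>free_alg K\<^esub> t \<otimes>\<^bsub>free_alg K\<^esub> s | s t. s \<in> F \<and> t \<in> F} = ?S"
    by (intro Collect_cong ex_cong1) (auto simp: e)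
  moreover have "?S \<subseteq> F" by (auto intro!: alg_in)
  ultimately show ?thesis
    using pres_mod_span[OF pres_alg, of ?S] by (simp add: comm_span_def FC_eq)
qed

lemma pres_cyc_free: "pres (cyc K (free_alg K)) F FC fcls"
  using pres_quot[OF pres_alg ksub_FC _ FC_F] ksub_zero[OF ksub_FC]
  unfolding cyc_def cyc_class_def comm_span_free by simp

lemma is_r_divided_iff: assumes "f \<in> F"
  shows "is_r_divided K p l (fcls f) \<longleftrightarrow> (\<exists>g\<in>RG. of_nat p *\<^sub>C f - relA ^ (p ^ l) - g \<in> FC)"
proof -
  note P = pres_cyc_free
  have pf: "of_nat p *\<^sub>C f \<in> F" "relA ^ (p ^ l) \<in> F"
    using assms by (simp_all add: ksub_cscale[OF ksub_F] monoid_alg_power)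
  have 1: "(of_nat p \<odot>\<^bsub>cyc K (free_alg K)\<^esub> fcls f) \<ominus>\<^bsub>cyc K (free_alg K)\<^esub> fcls (relA ^ (p ^ l))
      = fcls (of_nat p *\<^sub>C f - relA ^ (p ^ l))"
    using pf assms by (simp add: presD(6)[OF P, symmetric] pres_diff[OF P])
  have "{fcls (gr ^ m) | m. m \<ge> 1} = fcls ` {gr ^ m | m. m \<ge> 1}" by blast
  moreover have "{gr ^ m | m. m \<ge> 1} \<subseteq> F" by (auto simp: monoid_alg_power)
  ultimately have 2: "mod_span K (cyc K (free_alg K)) {fcls (gr ^ m) | m. m \<ge> 1} = fcls ` RG"
    using pres_mod_span[OF P] by (simp add: RG_def)
  have "fcls (of_nat p *\<^sub>C f - relA ^ (p ^ l)) \<in> fcls ` RG \<longleftrightarrow> (\<exists>g\<in>RG. of_nat p *\<^sub>C f - relA ^ (p ^ l) - g \<in> FC)"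
    using presD(7)[OF P] pf RG_F ksub_diff[OF ksub_F] by (auto simp: image_iff subset_iff)
  then show ?thesis
    using presD(9)[OF P assms] unfolding is_r_divided_def relA_def[symmetric] 1 2 by simp
qed

text \<open>In contrast to \<open>pres_iso\<close> no map of quotients is given; it is defined from
  \<open>L\<close> by choosing representatives.\<close>

lemma pres_iso_ex:
  assumes P: "pres M U N q" and P': "pres M' U' N' q'"
    and L: "\<And>x. x \<in> U \<Longrightarrow> L x \<in> U'"
      "\<And>x y. x \<in> U \<Longrightarrow> y \<in> U \<Longrightarrow> L (x + y) = L x + L y"
      "\<And>c x. c \<in> k \<Longrightarrow> x \<in> U \<Longrightarrow> L (c *\<^sub>C x) = c *\<^sub>C L x"
      "\<And>x. x \<in> U \<Longrightarrow> L x \<in> N' \<longleftrightarrow> x \<in> N"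
      "\<And>y. y \<in> U' \<Longrightarrow> \<exists>x\<in>U. L x - y \<in> N'"
  shows "\<exists>h\<in>mod_iso K M M'. \<forall>x\<in>U. h (q x) = q' (L x)"
proof -
  define h where "h m = q' (L (SOME x. x \<in> U \<and> q x = m))" for m
  have h: "h (q x) = q' (L x)" if x: "x \<in> U" for x
  proof -
    let ?z = "SOME z. z \<in> U \<and> q z = q x"
    have z: "?z \<in> U" "q ?z = q x" using someI[of "\<lambda>z. z \<in> U \<and> q z = q x" x] x by auto
    then have d: "?z - x \<in> N" using presD(7)[OF P] x by blast
    then have dU: "?z - x \<in> U" using presD(3)[OF P] by blast
    have "L ?z - L x = L (?z - x)" using L(2)[OF dU x] by (simp add: algebra_simps)
    also have "\<dots> \<in> N'" using L(4)[OF dU] d by simp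
    finally show ?thesis unfolding h_def using presD(7)[OF P'] L(1) z(1) x by blast
  qed
  have "h \<in> mod_iso K M M'" by (rule pres_iso[OF P P', where L = L]) (use L h in auto)
  then show ?thesis using h by blast
qed

lemma mod_iso_torsion:
  assumes h: "h \<in> mod_iso K M M'" and M: "Module.module K M" "Module.module K M'"
  shows "h ` torsion K M = torsion K M'"
proof -
  interpret M: Module.module K M by fact
  interpret M': Module.module K M' by fact
  have hom: "m \<in> carrier M \<Longrightarrow> h m \<in> carrier M'" "c \<in> k \<Longrightarrow> m \<in> carrier M \<Longrightarrow> h (c \<odot>\<^bsub>M\<^esub> m) = c \<odot>\<^bsub>M'\<^esub> h m" for c m
    using h by (auto simp: mod_iso_def mod_hom_def)
  have bij: "inj_on h (carrier M)" "h ` carrier M = carrier M'"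
    using h by (auto simp: mod_iso_def bij_betw_def)
  have z: "h \<zero>\<^bsub>M\<^esub> = \<zero>\<^bsub>M'\<^esub>"
    using hom(2)[of 0 "\<zero>\<^bsub>M\<^esub>"] hom(1)[OF M.M.zero_closed] M.smult_l_null[of "\<zero>\<^bsub>M\<^esub>"] M'.smult_l_null[of "h \<zero>\<^bsub>M\<^esub>"]
    by simp
  have "(c \<odot>\<^bsub>M'\<^esub> h m = \<zero>\<^bsub>M'\<^esub>) = (c \<odot>\<^bsub>M\<^esub> m = \<zero>\<^bsub>M\<^esub>)" if "c \<in> k" "m \<in> carrier M" for c m
    using hom(2)[OF that] z inj_onD[OF bij(1), of "c \<odot>\<^bsub>M\<^esub> m" "\<zero>\<^bsub>M\<^esub>"] M.smult_closed[OF that] by auto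
  then show ?thesis unfolding torsion_def bij(2)[symmetric] by auto
qed

lemma pres_K: "pres K k {0} (\<lambda>c. c)"
proof -
  have "ksub k" by (rule ksubI) auto
  then show ?thesis by (auto simp: pres_def ksub_singleton_0)
qed

end

context finite_sl2
begin

section \<open>The torsion of the quotient, degree by degree\<close>

lemma chi_gr_power: "chi (gr ^ n) = rr n"
proof -
  have "av (gr ^ n) = gr ^ n" by (rule av_invariant) (simp add: act_power)
  then show ?thesis by (simp add: chi_eq rho_expA rr_def)
qed

lemma RS_eq: "RS = chi ` RG"
proof -
  have "{rr l | l. l \<ge> 1} = chi ` {gr ^ l | l. l \<ge> 1}" by (auto simp: chi_gr_power[symmetric])
  then show ?thesis by (simp add: RS_def RG_def kspan_image[OF clin_nform[OF one_\<Gamma>]])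
qed

lemma chi_rr: "chi (rr n) = rr n"
  unfolding chi_gr_power[symmetric] by (simp add: chi_idem monoid_alg_power)

lemma chi_rprim: "chi (rprim n) = rprim n"
  by (simp add: rprim_def chi_linear chi_rr)

text \<open>The preimages of \<open>0\<close> and of the torsion submodule of \<open>modQ\<close>.\<close>

definition NQ :: "ncpoly set" where "NQ = {f \<in> F. chi f \<in> RS}"
definition NT :: "ncpoly set" where "NT = {f \<in> F. chi f \<in> RP}"

lemma ksub_NQ: "ksub NQ" and ksub_NT: "ksub NT"
  unfolding NQ_def NT_def by (intro ksub_Collect_vimage ksub_F clin_nform one_\<Gamma> ksub_RS ksub_RP)+

lemma Nchi_NQ: "Nchi \<subseteq> NQ" and NQ_NT: "NQ \<subseteq> NT" and NQ_F: "NQ \<subseteq> F" and NT_F: "NT \<subseteq> F"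
  using RS_RP by (auto simp: Nchi_def NQ_def NT_def ksub_zero[OF ksub_RS])

lemma NQ_rep: assumes "f \<in> NQ" shows "\<exists>g\<in>RG. f - g \<in> Nchi"
proof -
  obtain g where "g \<in> RG" "chi f = chi g" using assms by (auto simp: NQ_def RS_eq)
  then show ?thesis using assms RG_F by (intro bexI[of _ g]) (auto simp: Nchi_def NQ_def chi_linear ksub_diff[OF ksub_F])
qed

lemma RG_NQ: "RG \<subseteq> NQ"
  using RG_F by (auto simp: NQ_def RS_eq)

lemma icls_RG: "icls ` RG = icls ` NQ"
proof
  show "icls ` NQ \<subseteq> icls ` RG"
  proof
    fix m assume "m \<in> icls ` NQ"
    then obtain f where f: "f \<in> NQ" "m = icls f" by blast
    obtain g where g: "g \<in> RG" "f - g \<in> Nchi" using NQ_rep[OF f(1)] by blast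
    then have "icls f = icls g" using presD(7)[OF pres_M1] f(1) NQ_F RG_F by blast
    then show "m \<in> icls ` RG" using g f by blast
  qed
qed (use RG_NQ in blast)

lemma r_powers_eq: "r_powers K \<Gamma> = icls ` NQ"
proof -
  let ?S = "{gr ^ l | l. l \<ge> 1}"
  have S: "?S \<subseteq> F" by (auto simp: monoid_alg_power)
  have "{free_to_cyc K \<Gamma> (gr ^ l) | l. l \<ge> 1} = skcls ` sgl (mat 1) ` ?S"
    unfolding image_image icls_def[symmetric] by (auto simp: free_to_cyc_eq monoid_alg_power)
  moreover have "sgl (mat 1) ` ?S \<subseteq> skU" using S by auto
  ultimately have "r_powers K \<Gamma> = skcls ` kspan (sgl (mat 1) ` ?S)"
    unfolding r_powers_def using pres_mod_span[OF pres_skew_cyc] by simp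
  also have "\<dots> = icls ` RG"
    by (simp add: kspan_image[OF clin_sgl] RG_def image_image icls_def)
  finally show ?thesis using icls_RG by simp
qed

definition clsQ :: "ncpoly \<Rightarrow> (complex^2^2 \<Rightarrow> ncpoly set) set set" where
  "clsQ f = cls_modQ K \<Gamma> (icls f)"

lemma pres_modQ: "pres (modQ K \<Gamma>) F NQ clsQ"
proof -
  have "clsQ = (\<lambda>f. icls ` NQ +>\<^bsub>skew_cyc_at K \<Gamma> {mat 1}\<^esub> icls f)"
    by (simp add: fun_eq_iff clsQ_def cls_modQ_def r_powers_eq skew_cyc_at_def coset_carrier_update)
  then show ?thesis
    using pres_quot[OF pres_M1 ksub_NQ Nchi_NQ NQ_F] by (simp add: modQ_def r_powers_eq)
qed

lemma torsion_modQ: "torsion K (modQ K \<Gamma>) = clsQ ` NT"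
proof -
  have "{x \<in> F. \<exists>c\<in>k. c \<noteq> 0 \<and> c *\<^sub>C x \<in> NQ} = NT"
  proof (intro antisym subsetI)
    fix f assume "f \<in> {x \<in> F. \<exists>c\<in>k. c \<noteq> 0 \<and> c *\<^sub>C x \<in> NQ}"
    then obtain c where c: "f \<in> F" "c \<noteq> 0" "c *\<^sub>C f \<in> NQ" by blast
    then have "c *\<^sub>C chi f \<in> RS" by (simp add: NQ_def chi_linear)
    then have "chi f \<in> RP" using c by (intro RP_saturated[of "chi f" c] chi_F)
    then show "f \<in> NT" using c by (simp add: NT_def)
  next
    fix f assume f: "f \<in> NT"
    then obtain c :: nat where c: "c > 0" "of_nat c *\<^sub>C chi f \<in> RS" using RP_multiple by (auto simp: NT_def)
    then have "of_nat c *\<^sub>C f \<in> NQ" using f by (simp add: NQ_def NT_def chi_linear ksub_cscale[OF ksub_F])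
    then show "f \<in> {x \<in> F. \<exists>c\<in>k. c \<noteq> 0 \<and> c *\<^sub>C x \<in> NQ}"
      using c(1) f NT_F by (auto intro!: bexI[of _ "of_nat c"])
  qed
  then show ?thesis by (simp add: pres_torsion[OF pres_modQ])
qed

lemma modQ_degree_eq: "modQ_degree K \<Gamma> d = {clsQ f | f. f \<in> F \<and> homog rdegree d f}"
  unfolding modQ_degree_def homog_rdegree_iff clsQ_def
  by (intro Collect_cong ex_cong1) (auto simp: free_to_cyc_eq)

lemma homog_chi: assumes "homog rdegree d f" shows "homog rdegree d (chi f)"
  unfolding chi_eq av_eq using assms
  by (intro homog_trace homog_expA homog_cscale homog_sum homog_act) auto

lemma clsQ_rprim: "c \<in> k \<Longrightarrow> n \<ge> 1 \<Longrightarrow> f \<in> F \<Longrightarrow> chi f - c *\<^sub>C rprim n \<in> RS \<Longrightarrow> clsQ f = clsQ (c *\<^sub>C rprim n)"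
  using presD(7)[OF pres_modQ, of f "c *\<^sub>C rprim n"]
  by (simp add: NQ_def rprim_in chi_linear chi_rprim ksub_diff[OF ksub_F] ksub_cscale[OF ksub_F])

text \<open>Passing to normal forms preserves degrees, and in degree 2n the saturation
  \<open>RP\<close> consists of the multiples of \<open>rprim n\<close>.\<close>

lemma torsion_degree:
  assumes "n \<ge> 1"
  shows "torsion K (modQ K \<Gamma>) \<inter> modQ_degree K \<Gamma> (2 * n) = (\<lambda>c. clsQ (c *\<^sub>C rprim n)) ` k"
proof (intro antisym subsetI)
  fix m assume "m \<in> torsion K (modQ K \<Gamma>) \<inter> modQ_degree K \<Gamma> (2 * n)"
  then obtain f where f: "m = clsQ f" "f \<in> F" "homog rdegree (2 * n) f" "clsQ f \<in> clsQ ` NT"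
    unfolding modQ_degree_eq torsion_modQ by blast
  then have "f \<in> NT" using pres_image_eq[OF pres_modQ ksub_NT NT_F NQ_NT] by blast
  then have "chi f \<in> RP" by (simp add: NT_def)
  then obtain t where t: "t \<in> k" "dproj (2 * n) (chi f) = t *\<^sub>C rprim n"
    using dproj_kspan(1)[OF homog_rprim _ assms] unfolding RP_def by blast
  then have "chi f = t *\<^sub>C rprim n" using dproj_homog[OF homog_chi[OF f(3)], of "2 * n"] by simp
  then have "clsQ f = clsQ (t *\<^sub>C rprim n)"
    using t(1) assms f(2) by (intro clsQ_rprim) (simp_all add: ksub_zero[OF ksub_RS])
  then show "m \<in> (\<lambda>c. clsQ (c *\<^sub>C rprim n)) ` k" using f(1) t(1) by blast
next
  fix m assume "m \<in> (\<lambda>c. clsQ (c *\<^sub>C rprim n)) ` k"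
  then obtain c where c: "c \<in> k" "m = clsQ (c *\<^sub>C rprim n)" by blast
  have "c *\<^sub>C rprim n \<in> F" using c(1) assms by (intro ksub_cscale[OF ksub_F] rprim_in)
  moreover have "c *\<^sub>C rprim n \<in> NT"
    using calculation c(1) assms by (simp add: NT_def chi_linear chi_rprim ksub_cscale[OF ksub_RP] rprim_RP)
  ultimately show "m \<in> torsion K (modQ K \<Gamma>) \<inter> modQ_degree K \<Gamma> (2 * n)"
    unfolding modQ_degree_eq torsion_modQ using c(2) homog_cscale[OF homog_rprim] by blast
qed

lemma prime_power_ge_2: "Factorial_Ring.prime p \<Longrightarrow> l \<ge> 1 \<Longrightarrow> p ^ l \<ge> (2::nat)"
  using prime_ge_2_nat[of p] self_le_power[of p l] by simp

text \<open>The torsion in this degree is generated by the class of \<open>rprim\<close>. Since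
  \<open>rr = p * rprim\<close>, a multiple c of it vanishes exactly for c in (p).\<close>

lemma torsion_degree_iso:
  assumes p: "Factorial_Ring.prime p" "l \<ge> 1"
  shows "mod_iso K ((modQ K \<Gamma>)\<lparr>carrier := torsion K (modQ K \<Gamma>) \<inter> modQ_degree K \<Gamma> (2 * p ^ l)\<rparr>)
    (quot_mod K (PIdl\<^bsub>K\<^esub> (of_nat p))) \<noteq> {}"
proof -
  let ?n = "p ^ l"
  let ?I = "{c * of_nat p | c. c \<in> k}"
  have n: "?n \<ge> 2" by (rule prime_power_ge_2[OF p])
  have rF: "rprim ?n \<in> F" using n by (intro rprim_in) simp
  have K: "ksub k" by (rule presD(1)[OF pres_K])
  have ker: "c *\<^sub>C rprim ?n \<in> NQ \<longleftrightarrow> c \<in> ?I" if c: "c \<in> k" for c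
  proof
    assume "c *\<^sub>C rprim ?n \<in> NQ"
    then have "c *\<^sub>C rprim ?n \<in> RS" by (simp add: NQ_def chi_linear chi_rprim)
    then obtain t where t: "t \<in> k" "dproj (2 * ?n) (c *\<^sub>C rprim ?n) = t *\<^sub>C rr ?n"
      using dproj_kspan(1)[OF homog_rr, of _ ?n] n unfolding RS_def by auto
    then have "(c - t * of_nat p) *\<^sub>C rprim ?n = 0"
      using dproj_homog[OF homog_cscale[OF homog_rprim], of "2 * ?n" c ?n]
      by (simp add: rr_rprim content_prime_power[OF p] cscale_diff_left)
    then have "c = t * of_nat p" using rprim_nonzero[OF n] by simp
    then show "c \<in> ?I" using t(1) by blast
  next
    assume "c \<in> ?I"
    then obtain t where t: "t \<in> k" "c = t * of_nat p" by blast
    then have "c *\<^sub>C rprim ?n = t *\<^sub>C rr ?n" by (simp add: rr_rprim content_prime_power[OF p])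
    moreover have "t *\<^sub>C rr ?n \<in> RS" using t(1) n by (intro ksub_cscale[OF ksub_RS] rr_RS) simp_all
    ultimately show "c *\<^sub>C rprim ?n \<in> NQ"
      using ksub_cscale[OF ksub_F c rF] by (simp add: NQ_def chi_linear chi_rr)
  qed
  have P: "pres ((modQ K \<Gamma>)\<lparr>carrier := torsion K (modQ K \<Gamma>) \<inter> modQ_degree K \<Gamma> (2 * ?n)\<rparr>) k
      {c \<in> k. c *\<^sub>C rprim ?n \<in> NQ} (\<lambda>c. clsQ (c *\<^sub>C rprim ?n))"
  proof (rule pres_comp[OF pres_modQ _ K])
    show "clin (\<lambda>c. c *\<^sub>C rprim ?n)" by (simp add: clin_def cscale_add_left)
    show "torsion K (modQ K \<Gamma>) \<inter> modQ_degree K \<Gamma> (2 * ?n) = (\<lambda>c. clsQ (c *\<^sub>C rprim ?n)) ` k"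
      using n by (intro torsion_degree) simp
  qed (use rF in \<open>auto intro: ksub_cscale[OF ksub_F]\<close>)
  have I: "PIdl\<^bsub>K\<^esub> (of_nat p) = (\<lambda>c. c) ` ?I"
    by (simp add: cgenideal_def)
  have "ksub ?I"
  proof (rule ksubI)
    show "0 \<in> ?I" by (auto intro!: exI[of _ 0])
    show "x + y \<in> ?I" if xy: "x \<in> ?I" "y \<in> ?I" for x y
    proof -
      obtain a b where "x = a * of_nat p" "y = b * of_nat p" "a \<in> k" "b \<in> k" using xy by blast
      then show ?thesis by (intro CollectI exI[of _ "a + b"]) (simp add: algebra_simps)
    qed
    show "c *\<^sub>C x \<in> ?I" if "c \<in> k" "x \<in> ?I" for c x
    proof -
      obtain a where "x = a * of_nat p" "a \<in> k" using \<open>x \<in> ?I\<close> by blast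
      then show ?thesis using that(1) by (intro CollectI exI[of _ "c * a"]) simp
    qed
  qed
  then have Q: "pres (quot_mod K (PIdl\<^bsub>K\<^esub> (of_nat p))) k ?I (\<lambda>c. PIdl\<^bsub>K\<^esub> (of_nat p) +>\<^bsub>K\<^esub> c)"
    unfolding I by (rule pres_quot[OF pres_K]) (auto intro!: exI[of _ 0])
  have z: "0 \<in> ?I" by (intro CollectI exI[of _ 0]) simp
  have "\<exists>x\<in>k. x - y \<in> ?I" if "y \<in> k" for y
    using that z by (intro bexI[of _ y]) simp_all
  moreover have "c \<in> ?I \<longleftrightarrow> c \<in> {c \<in> k. c *\<^sub>C rprim ?n \<in> NQ}" if "c \<in> k" for c
    using ker[OF that] that by blast
  ultimately have "\<exists>h\<in>mod_iso K ((modQ K \<Gamma>)\<lparr>carrier := torsion K (modQ K \<Gamma>) \<inter> modQ_degree K \<Gamma> (2 * ?n)\<rparr>)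
      (quot_mod K (PIdl\<^bsub>K\<^esub> (of_nat p))). \<forall>c\<in>k. h (clsQ (c *\<^sub>C rprim ?n)) = PIdl\<^bsub>K\<^esub> (of_nat p) +>\<^bsub>K\<^esub> c"
    by (intro pres_iso_ex[OF P Q]) blast+
  then show ?thesis by blast
qed

text \<open>The power of the relation maps to 0 in A and equals p d plus \<open>r'^n\<close> up to
  rotation, so d has normal form minus \<open>rprim\<close>. A divided class differs from d by
  powers of r' only.\<close>

lemma r_divided_chi:
  assumes p: "Factorial_Ring.prime p" "l \<ge> 1" and f: "f \<in> F" "is_r_divided K p l (fcls f)"
  shows "chi f + rprim (p ^ l) \<in> RS"
proof -
  let ?n = "p ^ l"
  obtain d where d: "d \<in> F" "cyc_trace d = d" "cyc_trace (relA ^ ?n) = of_nat p *\<^sub>C d + gr ^ ?n"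
    using trace_relA_power[OF p(1) refl p(2)] by blast
  obtain g where g: "g \<in> RG" "of_nat p *\<^sub>C f - relA ^ ?n - g \<in> FC"
    using f is_r_divided_iff by blast
  have p0: "(of_nat p :: complex) \<noteq> 0" using p(1) by (simp add: prime_gt_0_nat)
  have n: "?n \<ge> 1" using prime_power_ge_2[OF p] by simp
  let ?t = "cyc_trace f"
  have "of_nat p *\<^sub>C (?t - d) = gr ^ ?n + g"
    using g d(3) by (simp add: FC_def trace_linear trace_RG cscale_diff_right algebra_simps)
  then have "of_nat p *\<^sub>C (?t - d) \<in> RG" using g(1) n by (simp add: ksub_add[OF ksub_RG] gr_power_RG)
  \<comment> \<open>Division by p stays within the span of the powers of r' because these are basis
    words.\<close>
  from RG_saturated[OF _ p0 this] have "?t - d \<in> RG" using f(1) d(1) by (simp add: ksub_diff[OF ksub_F] trace_in)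
  then have 1: "chi ?t - chi d \<in> RS" unfolding RS_eq by (simp flip: chi_linear)
  have tr: "chi (cyc_trace h) = chi h" if "h \<in> F" for h
  proof -
    have "h - cyc_trace h \<in> FC" using that by (simp add: FC_def trace_linear trace_in ksub_diff[OF ksub_F])
    then have "chi (h - cyc_trace h) = 0" using FC_CC by (intro chi_CC) blast
    then show ?thesis by (simp add: chi_linear)
  qed
  have "expA (relA ^ ?n) = 0" by (rule expA_relA_power) (use n in linarith)
  then have "relA ^ ?n \<in> CC" by (simp add: CC_def trace_linear monoid_alg_power)
  then have "chi (cyc_trace (relA ^ ?n)) = 0" by (simp add: tr monoid_alg_power chi_CC)
  then have "of_nat p *\<^sub>C chi d + rr ?n = 0" using d(3) by (simp add: chi_linear chi_gr_power)
  then have "of_nat p *\<^sub>C (chi d + rprim ?n) = of_nat p *\<^sub>C 0"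
    by (simp add: cscale_add_right rr_rprim content_prime_power[OF p])
  then have "chi d + rprim ?n = 0" by (rule cscale_cancel[OF p0, THEN iffD1])
  then have "chi d = - rprim ?n" by (simp add: eq_neg_iff_add_eq_0)
  then show ?thesis using 1 tr[OF f(1)] by simp
qed

lemma r_divided_exists:
  assumes p: "Factorial_Ring.prime p" "l \<ge> 1"
  shows "\<exists>f\<in>F. is_r_divided K p l (fcls f)"
proof -
  let ?n = "p ^ l"
  obtain d where d: "d \<in> F" "cyc_trace d = d" "cyc_trace (relA ^ ?n) = of_nat p *\<^sub>C d + gr ^ ?n"
    using trace_relA_power[OF p(1) refl p(2)] by blast
  have "?n \<ge> 1" using prime_power_ge_2[OF p] by simp
  then have g: "- (gr ^ ?n) \<in> RG" by (intro ksub_minus[OF ksub_RG] gr_power_RG)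
  moreover have "of_nat p *\<^sub>C d - relA ^ ?n - - (gr ^ ?n) \<in> FC"
    unfolding FC_def using d(1) g RG_F
    by (auto simp: trace_linear d(2,3) intro!: ksub_add[OF ksub_F] ksub_diff[OF ksub_F] ksub_cscale[OF ksub_F] monoid_alg_power)
  ultimately show ?thesis using d(1) is_r_divided_iff by blast
qed

lemma r_divided_cls: "is_r_divided K p l u \<Longrightarrow> \<exists>f\<in>F. u = fcls f"
  unfolding is_r_divided_def using pres_surj[OF pres_cyc_free] by blast

lemma cyc_to_modQ_eq: assumes "f \<in> F" shows "cyc_to_modQ K \<Gamma> (fcls f) = clsQ f"
proof -
  have "induced (\<lambda>f. cls_modQ K \<Gamma> (free_to_cyc K \<Gamma> f)) ((\<lambda>f. f) ` FC +>\<^bsub>free_alg K\<^esub> f) = cls_modQ K \<Gamma> (free_to_cyc K \<Gamma> f)"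
  proof (rule pres_induced[OF pres_alg ksub_FC _ FC_F assms])
    fix y assume y: "y \<in> F" "y - f \<in> FC"
    then have "y - f \<in> Nchi" using FC_CC FC_F chi_CC by (auto simp: Nchi_def)
    then have "icls y = icls f" using presD(7)[OF pres_M1] y(1) assms by blast
    then show "cls_modQ K \<Gamma> (free_to_cyc K \<Gamma> y) = cls_modQ K \<Gamma> (free_to_cyc K \<Gamma> f)"
      using y(1) assms by (simp add: free_to_cyc_eq)
  qed (simp add: ksub_zero[OF ksub_FC])
  then show ?thesis
    using assms by (simp add: cyc_to_modQ_def cyc_class_def comm_span_free clsQ_def free_to_cyc_eq)
qed

lemma torsion_degree_span:
  assumes p: "Factorial_Ring.prime p" "l \<ge> 1" and u: "is_r_divided K p l u"
  shows "torsion K (modQ K \<Gamma>) \<inter> modQ_degree K \<Gamma> (2 * p ^ l) = mod_span K (modQ K \<Gamma>) {cyc_to_modQ K \<Gamma> u}"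
proof -
  let ?n = "p ^ l"
  obtain f where f: "f \<in> F" "u = fcls f" using r_divided_cls[OF u] by blast
  have c: "chi f + rprim ?n \<in> RS" using r_divided_chi[OF p f(1)] u f(2) by simp
  have n: "?n \<ge> 1" using prime_power_ge_2[OF p] by simp
  have eq: "clsQ (t *\<^sub>C f) = clsQ ((- t) *\<^sub>C rprim ?n)" if t: "t \<in> k" for t
  proof (rule clsQ_rprim)
    have "chi (t *\<^sub>C f) - (- t) *\<^sub>C rprim ?n = t *\<^sub>C (chi f + rprim ?n)" by (simp add: chi_linear cscale_add_right)
    then show "chi (t *\<^sub>C f) - (- t) *\<^sub>C rprim ?n \<in> RS" using c t by (simp only: ksub_cscale[OF ksub_RS])
  qed (use t n f(1) in \<open>auto intro: ksub_cscale[OF ksub_F]\<close>)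
  have "mod_span K (modQ K \<Gamma>) {cyc_to_modQ K \<Gamma> u} = clsQ ` kspan {f}"
    using pres_mod_span[OF pres_modQ, of "{f}"] f by (simp add: cyc_to_modQ_eq)
  also have "\<dots> = (\<lambda>c. clsQ (c *\<^sub>C rprim ?n)) ` k"
  proof (intro antisym subsetI)
    fix m assume "m \<in> clsQ ` kspan {f}"
    then obtain t where t: "t \<in> k" "m = clsQ (t *\<^sub>C f)" using kspan_singletonD by blast
    then show "m \<in> (\<lambda>c. clsQ (c *\<^sub>C rprim ?n)) ` k" unfolding t(2) eq[OF t(1)] by (intro imageI) simp
  next
    fix m assume "m \<in> (\<lambda>c. clsQ (c *\<^sub>C rprim ?n)) ` k"
    then obtain t where t: "t \<in> k" "m = clsQ (t *\<^sub>C rprim ?n)" by blast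
    have mt: "- t \<in> k" using t(1) by simp
    have "m = clsQ ((- t) *\<^sub>C f)" using eq[OF mt] t(2) by simp
    then show "m \<in> clsQ ` kspan {f}" using kspan_singletonI[OF mt] by blast
  qed
  finally show ?thesis using torsion_degree[OF n] by simp
qed

text \<open>The saturation is generated by the \<open>rprim n\<close>. Those with n a power of a
  prime not dividing the order come from divided classes, and the others already lie in
  \<open>RS\<close>.\<close>

lemma torsion_modQ_span:
  "torsion K (modQ K \<Gamma>) = mod_span K (modQ K \<Gamma>)
     {cyc_to_modQ K \<Gamma> u | p l u. Factorial_Ring.prime p \<and> \<not> p dvd N \<and> l \<ge> 1 \<and> is_r_divided K p l u}"
proof -
  define S where "S = {f \<in> F. \<exists>p l. Factorial_Ring.prime p \<and> \<not> p dvd N \<and> l \<ge> 1 \<and> is_r_divided K p l (fcls f)}"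
  have SF: "S \<subseteq> F" by (auto simp: S_def)
  have "{cyc_to_modQ K \<Gamma> u | p l u. Factorial_Ring.prime p \<and> \<not> p dvd N \<and> l \<ge> 1 \<and> is_r_divided K p l u} = clsQ ` S"
    (is "?T = _")
  proof (intro antisym subsetI)
    fix m assume "m \<in> ?T"
    then obtain p l u where u: "m = cyc_to_modQ K \<Gamma> u" "Factorial_Ring.prime p" "\<not> p dvd N" "l \<ge> 1" "is_r_divided K p l u"
      by blast
    then obtain f where "f \<in> F" "u = fcls f" using r_divided_cls by blast
    then have "m = clsQ f" "f \<in> S" using u cyc_to_modQ_eq unfolding S_def by blast+
    then show "m \<in> clsQ ` S" by blast
  next
    fix m assume "m \<in> clsQ ` S"
    then obtain f where f: "f \<in> S" "m = clsQ f" by blast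
    then have "m = cyc_to_modQ K \<Gamma> (fcls f)" using SF cyc_to_modQ_eq by (metis subsetD)
    then show "m \<in> ?T" using f unfolding S_def by blast
  qed
  then have "mod_span K (modQ K \<Gamma>) ?T = clsQ ` kspan (S \<union> NQ)"
    using pres_span_Un[OF pres_modQ SF] by simp
  moreover have "kspan (S \<union> NQ) = NT"
  proof
    have "f \<in> NT" if fS: "f \<in> S" for f
    proof -
      obtain p l where p: "Factorial_Ring.prime p" "l \<ge> 1" "is_r_divided K p l (fcls f)" "f \<in> F"
        using fS unfolding S_def by blast
      have "chi f + rprim (p ^ l) \<in> RP" using r_divided_chi[OF p(1,2,4,3)] RS_RP by blast
      moreover have "rprim (p ^ l) \<in> RP" using prime_power_ge_2[OF p(1,2)] by (intro rprim_RP) simp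
      ultimately show ?thesis using ksub_diff[OF ksub_RP] p(4) unfolding NT_def by fastforce
    qed
    then show "kspan (S \<union> NQ) \<subseteq> NT" using NQ_NT by (intro kspan_minimal ksub_NT) blast
    let ?Y = "{x. \<exists>g\<in>kspan (S \<union> NQ). chi g - x \<in> RS}"
    have "ksub ?Y"
    proof (rule ksubI)
      show "0 \<in> ?Y" by (intro CollectI bexI[of _ 0]) (simp_all add: chi_linear ksub_zero[OF ksub_RS])
      show "x + y \<in> ?Y" if xy: "x \<in> ?Y" "y \<in> ?Y" for x y
      proof -
        obtain g h where gh: "g \<in> kspan (S \<union> NQ)" "h \<in> kspan (S \<union> NQ)" "chi g - x \<in> RS" "chi h - y \<in> RS"
          using xy by blast
        have e: "chi (g + h) - (x + y) = (chi g - x) + (chi h - y)" by (simp add: chi_linear)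
        have "chi (g + h) - (x + y) \<in> RS" unfolding e by (rule ksub_add[OF ksub_RS gh(3,4)])
        then show ?thesis using gh ksub_add[OF ksub_kspan] by blast
      qed
      show "c *\<^sub>C x \<in> ?Y" if "c \<in> k" "x \<in> ?Y" for c x
      proof -
        obtain g where g: "g \<in> kspan (S \<union> NQ)" "chi g - x \<in> RS" using \<open>x \<in> ?Y\<close> by blast
        have e: "chi (c *\<^sub>C g) - c *\<^sub>C x = c *\<^sub>C (chi g - x)" by (simp add: chi_linear cscale_diff_right)
        have "chi (c *\<^sub>C g) - c *\<^sub>C x \<in> RS" unfolding e by (rule ksub_cscale[OF ksub_RS that(1) g(2)])
        then show ?thesis using g(1) that(1) ksub_cscale[OF ksub_kspan] by blast
      qed
    qed
    moreover have "rprim n \<in> ?Y" if n: "n \<ge> 1" for n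
    proof (cases "\<exists>p l. Factorial_Ring.prime p \<and> \<not> p dvd N \<and> l \<ge> 1 \<and> n = p ^ l")
      case True
      then obtain p l where p: "Factorial_Ring.prime p" "\<not> p dvd N" "l \<ge> 1" "n = p ^ l" by blast
      obtain f where f: "f \<in> F" "is_r_divided K p l (fcls f)" using r_divided_exists[OF p(1,3)] by blast
      have "f \<in> S" using p f unfolding S_def by blast
      then have "- f \<in> kspan (S \<union> NQ)" by (intro ksub_minus[OF ksub_kspan] kspan_base) simp
      moreover have "chi (- f) - rprim n \<in> RS"
        using ksub_minus[OF ksub_RS r_divided_chi[OF p(1,3) f]] p(4) by (simp add: chi_linear)
      ultimately show ?thesis by blast
    next
      case False
      \<comment> \<open>The content is 1 or a prime dividing the order of \<Gamma>, invertible in K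
        in either case.\<close>
      have "1 / of_nat (content n) \<in> k"
      proof (cases "\<exists>p l. Factorial_Ring.prime p \<and> l \<ge> 1 \<and> n = p ^ l")
        case True
        then obtain p l where p: "Factorial_Ring.prime p" "l \<ge> 1" "n = p ^ l" by blast
        then have "p dvd N" using False by blast
        then obtain j where j: "N = p * j" by blast
        then have "j > 0" using N_pos by simp
        then have "1 / of_nat p = of_nat j * (1 / of_nat N :: complex)" by (simp add: j)
        also have "\<dots> \<in> k" by (intro K_mult K_of_nat order_inv)
        finally show ?thesis using p by (simp add: content_prime_power)
      qed (simp add: content_other)
      then have "rprim n \<in> RS" unfolding rprim_def using n by (intro ksub_cscale[OF ksub_RS] rr_RS)
      then show ?thesis
        by (intro CollectI bexI[of _ 0]) (simp_all add: chi_linear ksub_minus[OF ksub_RS])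
    qed
    ultimately have RP: "RP \<subseteq> ?Y" unfolding RP_def by (intro kspan_minimal) blast+
    show "NT \<subseteq> kspan (S \<union> NQ)"
    proof
      fix h assume h: "h \<in> NT"
      then have "chi h \<in> ?Y" using RP by (auto simp: NT_def)
      then obtain g where g: "g \<in> kspan (S \<union> NQ)" "chi g - chi h \<in> RS" by blast
      have "S \<union> NQ \<subseteq> F" using SF NQ_F by blast
      then have "g \<in> F" using g(1) kspan_minimal[OF _ ksub_F] by blast
      then have "g - h \<in> NQ" using g(2) h NT_F by (auto simp: NQ_def chi_linear ksub_diff[OF ksub_F])
      then have "g - h \<in> kspan (S \<union> NQ)" by (intro kspan_base) simp
      then show "h \<in> kspan (S \<union> NQ)" using g(1) ksub_cong[OF ksub_kspan] by blast
    qed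
  qed
  ultimately show ?thesis by (simp add: torsion_modQ)
qed

section \<open>The torsion in terms of V_1\<close>

definition UWR :: "ncpoly set" where "UWR = {a + b | a b. a \<in> UW \<and> b \<in> RG}"

lemma RG_UV: "RG \<subseteq> UV"
  unfolding RG_def
proof (intro kspan_minimal ksub_UV subsetI, elim CollectE exE conjE)
  fix x l assume "x = gr ^ l" "(l::nat) \<ge> 1"
  then show "x \<in> UV"
    by (cases l) (simp_all add: UV_def act_power abl_mult ksub_zero[OF ksub_relV] alg_in monoid_alg_power act_mult)
qed

lemma UWR_props: "ksub UWR" "relV \<subseteq> UWR" "UWR \<subseteq> UV" "UWR \<subseteq> NQ"
proof -
  show "ksub UWR" unfolding UWR_def by (rule ksub_set_plus[OF ksub_UW ksub_RG])
  show "relV \<subseteq> UWR"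
  proof
    fix f assume "f \<in> relV"
    then have "f \<in> UW" "0 \<in> RG" using relV_UW ksub_zero[OF ksub_RG] by blast+
    then show "f \<in> UWR" unfolding UWR_def by (intro CollectI exI[of _ f] exI[of _ 0]) simp
  qed
  show "UWR \<subseteq> UV" unfolding UWR_def using UW_UV RG_UV by (auto intro!: ksub_add[OF ksub_UV])
  show "UWR \<subseteq> NQ" unfolding UWR_def using UW_Nchi Nchi_NQ RG_NQ by (auto intro!: ksub_add[OF ksub_NQ])
qed

lemma V1_denominator: "W1_in_V1 K \<Gamma> <+>\<^bsub>modV1 K \<Gamma>\<^esub> r_powers_in_V1 K \<Gamma> = V1cls ` ({0} \<times> UWR)"
proof -
  let ?S = "{gr ^ l | l. l \<ge> 1}"
  let ?j = "\<lambda>f::ncpoly. (0::cpoly, f)"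
  have j: "clin ?j" by (simp add: clin_def)
  have "{(0, clsV K (gr ^ l)) | l. l \<ge> 1} = V1cls ` ?j ` ?S" by (simp add: image_image) blast
  moreover have "?j ` ?S \<subseteq> Inv0 \<times> UV" using gr_power_RG RG_UV ksub_zero[OF ksub_Inv0] by blast
  ultimately have "r_powers_in_V1 K \<Gamma> = V1cls ` kspan (?j ` ?S)"
    unfolding r_powers_in_V1_def using pres_mod_span[OF pres_V1] by simp
  also have "kspan (?j ` ?S) = {0} \<times> RG"
    unfolding kspan_image[OF j] RG_def by auto
  finally have "W1_in_V1 K \<Gamma> <+>\<^bsub>modV1 K \<Gamma>\<^esub> r_powers_in_V1 K \<Gamma>
      = V1cls ` {a + b | a b. a \<in> {0} \<times> UW \<and> b \<in> {0} \<times> RG}"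
    using pres_set_add[OF pres_V1 V1_sub(2)[OF UW_UV] V1_sub(2)[OF RG_UV]] by (simp add: W1_in_V1_eq)
  also have "{a + b | a b. a \<in> {0} \<times> UW \<and> b \<in> {0} \<times> RG} = {0::cpoly} \<times> UWR"
    unfolding UWR_def by auto
  finally show ?thesis .
qed

abbreviation "V1quot \<equiv> quot_mod (modV1 K \<Gamma>) (W1_in_V1 K \<Gamma> <+>\<^bsub>modV1 K \<Gamma>\<^esub> r_powers_in_V1 K \<Gamma>)"
abbreviation "psi \<equiv> induced (\<lambda>v. cls_modQ K \<Gamma> (V1_to_cyc K \<Gamma> v))"

lemma psi_iso: "psi \<in> mod_iso K V1quot (modQ K \<Gamma>)" "psi ` torsion K V1quot = torsion K (modQ K \<Gamma>)"
proof -
  note P = pres_V1_quot[OF UWR_props(1-3)]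
  show iso: "psi \<in> mod_iso K V1quot (modQ K \<Gamma>)"
    unfolding V1_denominator
  proof (rule pres_iso[OF P pres_modQ, where L = V1lift])
    fix x assume x: "x \<in> Inv0 \<times> UV"
    show "V1lift x \<in> F" by (rule V1lift_F[OF x])
    show "x \<in> {0} \<times> UWR" if NQ: "V1lift x \<in> NQ"
    proof -
      \<comment> \<open>Subtracting a combination of powers of r' reduces the claim to the kernel
        computed for (ii).\<close>
      obtain g where g: "g \<in> RG" "V1lift x - g \<in> Nchi" using NQ_rep[OF NQ] by blast
      let ?x = "x - (0, g)"
      have "?x \<in> Inv0 \<times> UV" using x g(1) RG_UV ksub_diff[OF ksub_UV] by (cases x) auto
      moreover have "chi (V1lift ?x) = 0" using g(2) by (cases x) (simp add: V1lift_def Nchi_def chi_linear algebra_simps)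
      ultimately have *: "?x \<in> {0} \<times> UW" by (rule V1lift_kernel)
      obtain p f where pf: "x = (p, f)" by (cases x)
      have "p = 0" "f - g \<in> UW" using * pf by auto
      moreover have "f = (f - g) + g" by simp
      ultimately show ?thesis using g(1) unfolding pf UWR_def by blast
    qed
    show "psi (V1cls ` ({0} \<times> UWR) +>\<^bsub>modV1 K \<Gamma>\<^esub> V1cls x) = clsQ (V1lift x)"
      unfolding clsQ_def
    proof (rule V1_induced[where H = "cls_modQ K \<Gamma>", OF UWR_props(1-3) x])
      show "cls_modQ K \<Gamma> (icls f) = cls_modQ K \<Gamma> (icls h)" if "f \<in> F" "h \<in> F" "f - h \<in> UWR" for f h
        using that presD(7)[OF pres_modQ, of f h] UWR_props(4) unfolding clsQ_def by blast
    qed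
  next
    fix y assume y: "y \<in> F"
    obtain x where x: "x \<in> Inv0 \<times> UV" "chi (V1lift x - y) = 0" using V1lift_onto[OF y] by blast
    then have "V1lift x - y \<in> Nchi" using y V1lift_F by (simp add: Nchi_def ksub_diff[OF ksub_F])
    then show "\<exists>x\<in>Inv0 \<times> UV. V1lift x - y \<in> NQ" using x(1) Nchi_NQ by blast
  qed (simp_all add: clin_simps[OF clin_V1lift])
  have "Module.module K V1quot" unfolding V1_denominator by (rule pres_module[OF P])
  then show "psi ` torsion K V1quot = torsion K (modQ K \<Gamma>)"
    by (rule mod_iso_torsion[OF iso _ pres_module[OF pres_modQ]])
qed

end

section \<open>Tensoring with the complex numbers\<close>

context coeff_ring
begin

text \<open>\<open>clin\<close> does not apply to \<open>extf\<close>, which is additive only on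
  finitely supported functions.\<close>

definition klin :: "'a::complex_module set \<Rightarrow> ('a \<Rightarrow> 'b::complex_module) \<Rightarrow> bool" where
  "klin U h \<longleftrightarrow> (\<forall>x\<in>U. \<forall>y\<in>U. h (x + y) = h x + h y) \<and> (\<forall>c\<in>k. \<forall>x\<in>U. h (c *\<^sub>C x) = c *\<^sub>C h x)"

lemma klinD: "klin U h \<Longrightarrow> x \<in> U \<Longrightarrow> y \<in> U \<Longrightarrow> h (x + y) = h x + h y"
  "klin U h \<Longrightarrow> c \<in> k \<Longrightarrow> x \<in> U \<Longrightarrow> h (c *\<^sub>C x) = c *\<^sub>C h x"
  by (simp_all add: klin_def)

lemma klin_zero: "klin U h \<Longrightarrow> ksub U \<Longrightarrow> h 0 = 0"
  using klinD(2)[of U h 0 0] by (simp add: ksub_zero)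

lemma klin_diff: assumes "klin U h" "ksub U" "x \<in> U" "y \<in> U" shows "h (x - y) = h x - h y"
  using klinD(1)[OF assms(1,3), of "(-1) *\<^sub>C y"] klinD(2)[OF assms(1) _ assms(4), of "-1"] ksub_minus[OF assms(2,4)]
  by simp

lemma klin_kspan_in:
  assumes h: "klin U h" and U: "ksub U" "T \<subseteq> U" and Y: "ksub Y" "\<And>x. x \<in> T \<Longrightarrow> h x \<in> Y" and x: "x \<in> kspan T"
  shows "h x \<in> Y"
proof -
  have "ksub {x \<in> U. h x \<in> Y}"
    using U(1) Y(1) h by (intro ksubI) (auto simp: ksub_zero ksub_add ksub_cscale klinD klin_zero)
  then have "kspan T \<subseteq> {x \<in> U. h x \<in> Y}" using U(2) Y(2) by (intro kspan_minimal) auto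
  then show ?thesis using x by blast
qed

section \<open>Free modules and tensor relations\<close>

definition FS :: "'s set \<Rightarrow> ('s \<Rightarrow> complex) set" where
  "FS S = {f. (\<forall>s. f s \<in> k) \<and> (\<forall>s. s \<notin> S \<longrightarrow> f s = 0) \<and> finite {s. f s \<noteq> 0}}"

abbreviation delta :: "'s \<Rightarrow> 's \<Rightarrow> complex" where "delta \<equiv> free_basis K"

lemma delta_eq: "delta s t = (if t = s then 1 else 0)"
  by (simp add: free_basis_def)

lemma ksub_FS: "ksub (FS S)"
proof (rule ksubI)
  fix f g :: "'a \<Rightarrow> complex" assume "f \<in> FS S" "g \<in> FS S"
  moreover have "{s. f s + g s \<noteq> 0} \<subseteq> {s. f s \<noteq> 0} \<union> {s. g s \<noteq> 0}" by auto
  ultimately show "f + g \<in> FS S" by (auto simp: FS_def intro: finite_subset)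
next
  fix c and f :: "'a \<Rightarrow> complex" assume "c \<in> k" "f \<in> FS S"
  moreover have "{s. c * f s \<noteq> 0} \<subseteq> {s. f s \<noteq> 0}" by auto
  ultimately show "c *\<^sub>C f \<in> FS S" by (auto simp: FS_def intro: finite_subset)
qed (simp add: FS_def)

lemma delta_FS: "s \<in> S \<Longrightarrow> delta s \<in> FS S"
  by (auto simp: FS_def delta_eq)

lemma pres_free: "pres (free_mod K S) (FS S) {0} (\<lambda>f. f)"
  unfolding pres_def using ksub_FS[of S]
  by (auto simp: ksub_singleton_0 free_mod_def FS_def fun_eq_iff)

definition extf :: "('s \<Rightarrow> 'b::complex_module) \<Rightarrow> ('s \<Rightarrow> complex) \<Rightarrow> 'b" where
  "extf H f = (\<Sum>s | f s \<noteq> 0. f s *\<^sub>C H s)"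

lemma extf_superset: "finite A \<Longrightarrow> {s. f s \<noteq> 0} \<subseteq> A \<Longrightarrow> extf H f = (\<Sum>s\<in>A. f s *\<^sub>C H s)"
  unfolding extf_def by (rule sum.mono_neutral_left) auto

lemma klin_extf: "klin (FS S) (extf H)"
  unfolding klin_def
proof (intro conjI ballI)
  fix f g assume "f \<in> FS S" "g \<in> FS S"
  then have fin: "finite ({s. f s \<noteq> 0} \<union> {s. g s \<noteq> 0})" by (simp add: FS_def)
  show "extf H (f + g) = extf H f + extf H g"
    by (subst (1 2 3) extf_superset[OF fin]) (auto simp: cscale_add_left sum.distrib)
next
  fix c f assume "f \<in> FS S"
  then have fin: "finite {s. f s \<noteq> 0}" by (simp add: FS_def)
  show "extf H (c *\<^sub>C f) = c *\<^sub>C extf H f"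
    by (subst (1 2) extf_superset[OF fin]) (auto simp: cscale_sum_right)
qed

lemma extf_delta [simp]: "extf H (delta s) = H s"
  by (subst extf_superset[of "{s}"]) (auto simp: delta_eq)

lemma FS_kspan: "FS S = kspan (delta ` S)"
proof
  show "kspan (delta ` S) \<subseteq> FS S" by (intro kspan_minimal ksub_FS) (auto simp: delta_FS)
  show "FS S \<subseteq> kspan (delta ` S)"
  proof
    fix f assume f: "f \<in> FS S"
    then have fin: "finite {s. f s \<noteq> 0}" by (simp add: FS_def)
    have "f = (\<Sum>s | f s \<noteq> 0. f s *\<^sub>C delta s)"
    proof
      fix t
      have "(\<Sum>s | f s \<noteq> 0. f s * delta s t) = (\<Sum>s | f s \<noteq> 0. if t = s then f s else 0)"
        by (intro sum.cong refl) (simp add: delta_eq)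
      then show "f t = (\<Sum>s | f s \<noteq> 0. f s *\<^sub>C delta s) t"
        using fin by (simp add: sum_fun_apply sum.delta)
    qed
    moreover have "(\<Sum>s | f s \<noteq> 0. f s *\<^sub>C delta s) \<in> kspan (delta ` S)"
      using f by (intro ksub_sum[OF ksub_kspan] ksub_cscale[OF ksub_kspan] kspan_base imageI) (auto simp: FS_def)
    ultimately show "f \<in> kspan (delta ` S)" by simp
  qed
qed

lemma FS_lin_in:
  assumes "klin (FS S) h" "ksub Y" "\<And>s. s \<in> S \<Longrightarrow> h (delta s) \<in> Y" "f \<in> FS S"
  shows "h f \<in> Y"
proof (rule klin_kspan_in[OF assms(1) ksub_FS _ assms(2)])
  show "delta ` S \<subseteq> FS S" by (auto simp: delta_FS)
  show "f \<in> kspan (delta ` S)" using assms(4) unfolding FS_kspan .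
qed (use assms(3) in auto)

text \<open>Bilinearity modulo \<open>Y\<close>: maps out of a tensor product are given on free
  generators, where they are bilinear only up to the relations of the target.\<close>

definition balanced :: "(complex, 'a) module \<Rightarrow> (complex, 'b) module \<Rightarrow> ('a \<times> 'b \<Rightarrow> 'c::complex_module) \<Rightarrow> 'c set \<Rightarrow> bool" where
  "balanced M N H Y \<longleftrightarrow>
    (\<forall>x\<in>carrier M. \<forall>x'\<in>carrier M. \<forall>y\<in>carrier N. H (x \<oplus>\<^bsub>M\<^esub> x', y) - (H (x, y) + H (x', y)) \<in> Y) \<and>
    (\<forall>x\<in>carrier M. \<forall>y\<in>carrier N. \<forall>y'\<in>carrier N. H (x, y \<oplus>\<^bsub>N\<^esub> y') - (H (x, y) + H (x, y')) \<in> Y) \<and>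
    (\<forall>c\<in>k. \<forall>x\<in>carrier M. \<forall>y\<in>carrier N. H (c \<odot>\<^bsub>M\<^esub> x, y) - c *\<^sub>C H (x, y) \<in> Y) \<and>
    (\<forall>c\<in>k. \<forall>x\<in>carrier M. \<forall>y\<in>carrier N. H (x, c \<odot>\<^bsub>N\<^esub> y) - c *\<^sub>C H (x, y) \<in> Y)"

definition TR :: "(complex, 'a) module \<Rightarrow> (complex, 'b) module \<Rightarrow> ('a \<times> 'b \<Rightarrow> complex) set" where
  "TR M N =
    {delta (x \<oplus>\<^bsub>M\<^esub> x', y) - (delta (x, y) + delta (x', y)) | x x' y.
       x \<in> carrier M \<and> x' \<in> carrier M \<and> y \<in> carrier N} \<union>
    {delta (x, y \<oplus>\<^bsub>N\<^esub> y') - (delta (x, y) + delta (x, y')) | x y y'.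
       x \<in> carrier M \<and> y \<in> carrier N \<and> y' \<in> carrier N} \<union>
    {delta (c \<odot>\<^bsub>M\<^esub> x, y) - c *\<^sub>C delta (x, y) | c x y. c \<in> k \<and> x \<in> carrier M \<and> y \<in> carrier N} \<union>
    {delta (x, c \<odot>\<^bsub>N\<^esub> y) - c *\<^sub>C delta (x, y) | c x y. c \<in> k \<and> x \<in> carrier M \<and> y \<in> carrier N}"

lemma balanced_delta: "balanced M N delta (kspan (TR M N))"
  unfolding balanced_def by (intro conjI ballI kspan_base; unfold TR_def; blast)

context
  fixes M :: "(complex, 'a) module" and N :: "(complex, 'b) module"
  assumes M: "Module.module K M" and N: "Module.module K N"
begin

interpretation M: Module.module K M by (rule M)
interpretation N: Module.module K N by (rule N)

abbreviation "FMN \<equiv> FS (carrier M \<times> carrier N)"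

lemma dFS: "x \<in> carrier M \<Longrightarrow> y \<in> carrier N \<Longrightarrow> delta (x, y) \<in> FMN"
  by (simp add: delta_FS)

lemma TR_FS: "TR M N \<subseteq> FMN"
  unfolding TR_def by (auto intro!: ksub_diff[OF ksub_FS] ksub_add[OF ksub_FS] ksub_cscale[OF ksub_FS] dFS)

lemma extf_TR:
  assumes H: "balanced M N H Y" and Y: "ksub Y" and x: "x \<in> kspan (TR M N)" shows "extf H x \<in> Y"
proof (rule klin_kspan_in[OF klin_extf ksub_FS TR_FS Y _ x])
  note d = klin_diff[OF klin_extf[where S = "carrier M \<times> carrier N"] ksub_FS] klinD[OF klin_extf[where S = "carrier M \<times> carrier N"]]
  fix t assume "t \<in> TR M N"
  then show "extf H t \<in> Y"
    using H unfolding TR_def balanced_def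
    by (elim UnE CollectE exE conjE)
      (simp_all add: d dFS ksub_add[OF ksub_FS] ksub_cscale[OF ksub_FS])
qed

lemma tensor_relations_eq: "tensor_relations K M N = (\<lambda>f. f) ` kspan (TR M N)"
proof -
  let ?F = "free_mod K (carrier M \<times> carrier N)"
  note P = pres_free[of "carrier M \<times> carrier N"]
  have a: "f \<oplus>\<^bsub>?F\<^esub> g = f + g" for f g by (simp add: free_mod_def fun_eq_iff)
  have s: "c \<odot>\<^bsub>?F\<^esub> f = c *\<^sub>C f" for c f by (simp add: free_mod_def fun_eq_iff)
  have d: "f \<ominus>\<^bsub>?F\<^esub> g = f - g" if "f \<in> FMN" "g \<in> FMN" for f g using pres_diff[OF P that] .
  have e1: "delta (x \<oplus>\<^bsub>M\<^esub> x', y) \<ominus>\<^bsub>?F\<^esub> (delta (x, y) + delta (x', y)) = delta (x \<oplus>\<^bsub>M\<^esub> x', y) - (delta (x, y) + delta (x', y))"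
    if "x \<in> carrier M" "x' \<in> carrier M" "y \<in> carrier N" for x x' y
    using that by (intro d ksub_add[OF ksub_FS] dFS) auto
  have e2: "delta (x, y \<oplus>\<^bsub>N\<^esub> y') \<ominus>\<^bsub>?F\<^esub> (delta (x, y) + delta (x, y')) = delta (x, y \<oplus>\<^bsub>N\<^esub> y') - (delta (x, y) + delta (x, y'))"
    if "x \<in> carrier M" "y \<in> carrier N" "y' \<in> carrier N" for x y y'
    using that by (intro d ksub_add[OF ksub_FS] dFS) auto
  have e3: "delta (c \<odot>\<^bsub>M\<^esub> x, y) \<ominus>\<^bsub>?F\<^esub> c *\<^sub>C delta (x, y) = delta (c \<odot>\<^bsub>M\<^esub> x, y) - c *\<^sub>C delta (x, y)"
    and e4: "delta (x, c \<odot>\<^bsub>N\<^esub> y) \<ominus>\<^bsub>?F\<^esub> c *\<^sub>C delta (x, y) = delta (x, c \<odot>\<^bsub>N\<^esub> y) - c *\<^sub>C delta (x, y)"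
    if "c \<in> k" "x \<in> carrier M" "y \<in> carrier N" for c x y
    using that by (intro d ksub_cscale[OF ksub_FS] dFS; simp)+
  have "tensor_relations K M N = mod_span K ?F (TR M N)"
    unfolding tensor_relations_def Let_def a s TR_def
    by (intro arg_cong[where f = "mod_span K ?F"] arg_cong2[where f = "(\<union>)"] Collect_cong ex_cong1)
      (auto simp: e1 e2 e3 e4)
  then show ?thesis using pres_mod_span[OF P TR_FS] by simp
qed

lemma pres_tensor:
  "pres (tensor_mod K M N) FMN (kspan (TR M N)) (\<lambda>f. (\<lambda>f. f) ` kspan (TR M N) +>\<^bsub>free_mod K (carrier M \<times> carrier N)\<^esub> f)"
proof -
  have "kspan (TR M N) \<subseteq> FMN" by (rule kspan_minimal[OF TR_FS ksub_FS])
  then show ?thesis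
    unfolding tensor_mod_def tensor_relations_eq using ksub_zero[OF ksub_kspan]
    by (intro pres_quot[OF pres_free ksub_kspan]) auto
qed

end

lemma extf_FS: assumes "\<And>s. s \<in> S \<Longrightarrow> H s \<in> Y" "ksub Y" "f \<in> FS S" shows "extf H f \<in> Y"
  by (rule FS_lin_in[OF klin_extf assms(2) _ assms(3)]) (simp add: assms(1))

lemma klin_sub_id: "klin (FS S) h \<Longrightarrow> klin (FS S) (\<lambda>x. h x - x)"
  by (simp add: klin_def cscale_diff_right algebra_simps)

lemma klin_extf_comp:
  assumes "\<And>s. s \<in> S \<Longrightarrow> H s \<in> FS S'" shows "klin (FS S) (\<lambda>x. extf H' (extf H x))"
proof -
  have "extf H x \<in> FS S'" if "x \<in> FS S" for x by (rule extf_FS[OF assms ksub_FS that])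
  then show ?thesis
    using klinD[OF klin_extf[of S H]] klinD[OF klin_extf[of S' H']] by (simp add: klin_def)
qed

lemma module_complex_ring: "Module.module K complex_ring"
proof -
  have "pres complex_ring UNIV {0} (\<lambda>c. c)"
    by (auto simp: pres_def complex_ring_def ksub_UNIV ksub_singleton_0)
  then show ?thesis by (rule pres_module)
qed

lemma complex_ring_ops: "carrier complex_ring = UNIV" "l \<oplus>\<^bsub>complex_ring\<^esub> l' = l + l'" "c \<odot>\<^bsub>complex_ring\<^esub> l = c * l"
  by (simp_all add: complex_ring_def)

text \<open>
  The inverse of \<open>\<complex> \<otimes> f\<close> sends \<open>l \<otimes> n\<close> to \<open>l/d \<otimes> m\<close>, where \<open>d n = f m\<close> and \<open>d > 0\<close>.
\<close>

lemma tensor_iso_torsion_cokernel: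
  fixes M :: "(complex, 'a) module" and N :: "(complex, 'b) module"
  assumes M: "Module.module K M" and N: "Module.module K N"
    and f: "f \<in> mod_hom K M N" "inj_on f (carrier M)"
    and tors: "\<And>n. n \<in> carrier N \<Longrightarrow> \<exists>d>0. \<exists>m\<in>carrier M. of_nat d \<odot>\<^bsub>N\<^esub> n = f m"
  shows "tensor_iso K complex_ring M N f"
proof -
  interpret M: Module.module K M by (rule M)
  interpret N: Module.module K N by (rule N)
  note C = module_complex_ring
  have fc: "f m \<in> carrier N" if "m \<in> carrier M" for m using f(1) that by (auto simp: mod_hom_def)
  have fa: "f (m \<oplus>\<^bsub>M\<^esub> m') = f m \<oplus>\<^bsub>N\<^esub> f m'" if "m \<in> carrier M" "m' \<in> carrier M" for m m'
    using f(1) that by (auto simp: mod_hom_def)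
  have fs: "f (c \<odot>\<^bsub>M\<^esub> m) = c \<odot>\<^bsub>N\<^esub> f m" if "c \<in> k" "m \<in> carrier M" for c m
    using f(1) that by (auto simp: mod_hom_def)
  have Na: "c \<odot>\<^bsub>N\<^esub> (c' \<odot>\<^bsub>N\<^esub> n) = (c * c') \<odot>\<^bsub>N\<^esub> n" if "c \<in> k" "c' \<in> k" "n \<in> carrier N" for c c' n
    using N.smult_assoc1[OF that] by simp
  have "\<forall>n\<in>carrier N. \<exists>dm. fst dm > (0::nat) \<and> snd dm \<in> carrier M \<and> of_nat (fst dm) \<odot>\<^bsub>N\<^esub> n = f (snd dm)"
    using tors by fastforce
  from bchoice[OF this] obtain dm where dm: "\<forall>n\<in>carrier N. fst (dm n) > (0::nat) \<and> snd (dm n) \<in> carrier M \<and>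
      of_nat (fst (dm n)) \<odot>\<^bsub>N\<^esub> n = f (snd (dm n))" ..
  \<comment> \<open>A denominator and a numerator for each n. The choice is not additive in n, hence
    the congruences modulo \<open>?RM\<close> below.\<close>
  define D where "D n = fst (dm n)" for n
  define E where "E n = snd (dm n)" for n
  have D: "D n > 0" and E: "E n \<in> carrier M" and DE: "of_nat (D n) \<odot>\<^bsub>N\<^esub> n = f (E n)" if "n \<in> carrier N" for n
    using dm that by (auto simp: D_def E_def)
  let ?RM = "kspan (TR complex_ring M)" and ?RN = "kspan (TR complex_ring N)"
  note bM = balanced_delta[of complex_ring M, unfolded balanced_def complex_ring_ops]
  note bN = balanced_delta[of complex_ring N, unfolded balanced_def complex_ring_ops]
  have addM: "delta (l, m \<oplus>\<^bsub>M\<^esub> m') - (delta (l, m) + delta (l, m')) \<in> ?RM" if "m \<in> carrier M" "m' \<in> carrier M" for l m m'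
    using bM that by simp
  have scM: "delta (l, c \<odot>\<^bsub>M\<^esub> m) - c *\<^sub>C delta (l, m) \<in> ?RM" "delta (c * l, m) - c *\<^sub>C delta (l, m) \<in> ?RM"
    if "c \<in> k" "m \<in> carrier M" for l c m
    using bM that by simp_all
  have scN: "delta (l, c \<odot>\<^bsub>N\<^esub> n) - c *\<^sub>C delta (l, n) \<in> ?RN" "delta (c * l, n) - c *\<^sub>C delta (l, n) \<in> ?RN"
    if "c \<in> k" "n \<in> carrier N" for l c n
    using bN that by simp_all
  have moveM: "delta (l / of_nat d, of_nat d \<odot>\<^bsub>M\<^esub> m) - delta (l, m) \<in> ?RM" if "d > 0" "m \<in> carrier M" for l d m
  proof -
    have "delta (of_nat d * (l / of_nat d), m) - of_nat d *\<^sub>C delta (l / of_nat d, m) \<in> ?RM"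
      using scM(2)[OF K_of_nat that(2)] .
    then have "of_nat d *\<^sub>C delta (l / of_nat d, m) - delta (l, m) \<in> ?RM"
      using that(1) ksub_diff_commute[OF ksub_kspan] by simp
    then show ?thesis using ksub_trans[OF ksub_kspan scM(1)[OF K_of_nat that(2)]] by blast
  qed
  have moveN: "delta (l / of_nat d, of_nat d \<odot>\<^bsub>N\<^esub> n) - delta (l, n) \<in> ?RN" if "d > 0" "n \<in> carrier N" for l d n
  proof -
    have "delta (of_nat d * (l / of_nat d), n) - of_nat d *\<^sub>C delta (l / of_nat d, n) \<in> ?RN"
      using scN(2)[OF K_of_nat that(2)] .
    then have "of_nat d *\<^sub>C delta (l / of_nat d, n) - delta (l, n) \<in> ?RN"
      using that(1) ksub_diff_commute[OF ksub_kspan] by simp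
    then show ?thesis using ksub_trans[OF ksub_kspan scN(1)[OF K_of_nat that(2)]] by blast
  qed
  \<comment> \<open>Two fractions for the same n agree: both are expanded to the denominator d e,
    and the numerators coincide because f is injective.\<close>
  have indep: "delta (l / of_nat d, m) - delta (l / of_nat e, m') \<in> ?RM"
    if n: "n \<in> carrier N" and d: "d > 0" "m \<in> carrier M" "of_nat d \<odot>\<^bsub>N\<^esub> n = f m"
      and e: "e > 0" "m' \<in> carrier M" "of_nat e \<odot>\<^bsub>N\<^esub> n = f m'" for l n d e m m'
  proof -
    have "f (of_nat e \<odot>\<^bsub>M\<^esub> m) = of_nat e \<odot>\<^bsub>N\<^esub> (of_nat d \<odot>\<^bsub>N\<^esub> n)" using fs[OF K_of_nat d(2)] d(3) by simp
    also have "\<dots> = of_nat d \<odot>\<^bsub>N\<^esub> (of_nat e \<odot>\<^bsub>N\<^esub> n)" using n by (simp add: Na mult.commute)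
    also have "\<dots> = f (of_nat d \<odot>\<^bsub>M\<^esub> m')" using fs[OF K_of_nat e(2)] e(3) by simp
    finally have eq: "of_nat e \<odot>\<^bsub>M\<^esub> m = of_nat d \<odot>\<^bsub>M\<^esub> m'"
      using inj_onD[OF f(2)] M.smult_closed[OF K_of_nat] d(2) e(2) by blast
    have "delta (l / of_nat d / of_nat e, of_nat e \<odot>\<^bsub>M\<^esub> m) - delta (l / of_nat d, m) \<in> ?RM"
      by (rule moveM[OF e(1) d(2)])
    moreover have "delta (l / of_nat e / of_nat d, of_nat d \<odot>\<^bsub>M\<^esub> m') - delta (l / of_nat e, m') \<in> ?RM"
      by (rule moveM[OF d(1) e(2)])
    moreover have "l / of_nat d / of_nat e = l / of_nat e / of_nat d" by simp
    ultimately show ?thesis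
      using eq ksub_trans[OF ksub_kspan ksub_diff_commute[OF ksub_kspan]] by metis
  qed
  define G1 where "G1 = (\<lambda>(l, m). delta (l, f m) :: complex \<times> 'b \<Rightarrow> complex)"
  define G2 where "G2 = (\<lambda>(l, n). delta (l / of_nat (D n), E n) :: complex \<times> 'a \<Rightarrow> complex)"
  have b1: "balanced complex_ring M G1 ?RN"
    using bN fc by (auto simp: balanced_def complex_ring_ops G1_def fa fs)
  have b2: "balanced complex_ring N G2 ?RM"
    unfolding balanced_def complex_ring_ops
  proof (intro conjI ballI)
    fix l l' :: complex and n assume "n \<in> carrier N"
    then show "G2 (l + l', n) - (G2 (l, n) + G2 (l', n)) \<in> ?RM"
      using bM E[of n] by (simp add: G2_def add_divide_distrib)
  next
    fix l :: complex and n n' assume n: "n \<in> carrier N" "n' \<in> carrier N"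
    let ?d = "D n" and ?d' = "D n'"
    \<comment> \<open>The fractions of n and n' are brought to the denominator
      \<open>D n * D n'\<close>, where their numerators can be added.\<close>
    let ?m = "of_nat ?d' \<odot>\<^bsub>M\<^esub> E n" and ?m' = "of_nat ?d \<odot>\<^bsub>M\<^esub> E n'"
    have mc: "?m \<in> carrier M" "?m' \<in> carrier M" using M.smult_closed[OF K_of_nat] E n by blast+
    have nn: "n \<oplus>\<^bsub>N\<^esub> n' \<in> carrier N" using n by simp
    have "of_nat (?d * ?d') \<odot>\<^bsub>N\<^esub> (n \<oplus>\<^bsub>N\<^esub> n') = of_nat (?d * ?d') \<odot>\<^bsub>N\<^esub> n \<oplus>\<^bsub>N\<^esub> of_nat (?d * ?d') \<odot>\<^bsub>N\<^esub> n'"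
      by (rule N.smult_r_distr[OF K_of_nat n])
    also have "of_nat (?d * ?d') \<odot>\<^bsub>N\<^esub> n = f ?m"
      using Na[OF K_of_nat K_of_nat n(1), of ?d' ?d] fs[OF K_of_nat E[OF n(1)], of ?d'] DE[OF n(1)] by (simp add: mult.commute)
    also have "of_nat (?d * ?d') \<odot>\<^bsub>N\<^esub> n' = f ?m'"
      using Na[OF K_of_nat K_of_nat n(2), of ?d ?d'] fs[OF K_of_nat E[OF n(2)], of ?d] DE[OF n(2)] by simp
    also have "f ?m \<oplus>\<^bsub>N\<^esub> f ?m' = f (?m \<oplus>\<^bsub>M\<^esub> ?m')" using fa[OF mc] by simp
    finally have eq: "of_nat (?d * ?d') \<odot>\<^bsub>N\<^esub> (n \<oplus>\<^bsub>N\<^esub> n') = f (?m \<oplus>\<^bsub>M\<^esub> ?m')" .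
    let ?l = "l / of_nat (?d * ?d')"
    have dd: "?d * ?d' > 0" using D n by simp
    have mm: "?m \<oplus>\<^bsub>M\<^esub> ?m' \<in> carrier M" using mc by simp
    have 1: "G2 (l, n \<oplus>\<^bsub>N\<^esub> n') - delta (?l, ?m \<oplus>\<^bsub>M\<^esub> ?m') \<in> ?RM"
      using indep[OF nn D[OF nn] E[OF nn] DE[OF nn] dd mm eq] by (simp only: G2_def prod.case)
    have 2: "delta (?l, ?m \<oplus>\<^bsub>M\<^esub> ?m') - (delta (?l, ?m) + delta (?l, ?m')) \<in> ?RM" by (rule addM[OF mc])
    have 3: "delta (?l, ?m) - G2 (l, n) \<in> ?RM"
      using moveM[OF D[OF n(2)] E[OF n(1)], of "l / of_nat ?d"] by (simp add: G2_def)
    have 4: "delta (?l, ?m') - G2 (l, n') \<in> ?RM"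
      using moveM[OF D[OF n(1)] E[OF n(2)], of "l / of_nat ?d'"] by (simp add: G2_def mult.commute)
    have "(delta (?l, ?m) + delta (?l, ?m')) - (G2 (l, n) + G2 (l, n')) \<in> ?RM"
      using ksub_add[OF ksub_kspan 3 4] by (simp add: algebra_simps)
    then show "G2 (l, n \<oplus>\<^bsub>N\<^esub> n') - (G2 (l, n) + G2 (l, n')) \<in> ?RM"
      using ksub_trans[OF ksub_kspan ksub_trans[OF ksub_kspan 1 2]] by blast
  next
    fix c l :: complex and n assume "c \<in> k" "n \<in> carrier N"
    then show "G2 (c * l, n) - c *\<^sub>C G2 (l, n) \<in> ?RM"
      using scM(2)[of c "E n" "l / of_nat (D n)"] E[of n] by (simp add: G2_def)
  next
    fix c l :: complex and n assume c: "c \<in> k" and n: "n \<in> carrier N"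
    have cn: "c \<odot>\<^bsub>N\<^esub> n \<in> carrier N" and cm: "c \<odot>\<^bsub>M\<^esub> E n \<in> carrier M" using c n E[OF n] by simp_all
    have "of_nat (D n) \<odot>\<^bsub>N\<^esub> (c \<odot>\<^bsub>N\<^esub> n) = f (c \<odot>\<^bsub>M\<^esub> E n)"
      using Na[OF K_of_nat c n, of "D n"] Na[OF c K_of_nat n, of "D n"] fs[OF c E[OF n]] DE[OF n] by (simp add: mult.commute)
    from indep[OF cn D[OF cn] E[OF cn] DE[OF cn] D[OF n] cm this]
    have "G2 (l, c \<odot>\<^bsub>N\<^esub> n) - delta (l / of_nat (D n), c \<odot>\<^bsub>M\<^esub> E n) \<in> ?RM" by (simp add: G2_def)
    then show "G2 (l, c \<odot>\<^bsub>N\<^esub> n) - c *\<^sub>C G2 (l, n) \<in> ?RM"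
      using ksub_trans[OF ksub_kspan _ scM(1)[OF c E[OF n]]] by (simp add: G2_def)
  qed
  let ?SM = "carrier complex_ring \<times> carrier M" and ?SN = "carrier complex_ring \<times> carrier N"
  have G1: "G1 s \<in> FS ?SN" if "s \<in> ?SM" for s
    using that fc by (auto simp: G1_def complex_ring_ops intro!: delta_FS)
  have G2: "G2 s \<in> FS ?SM" if "s \<in> ?SN" for s
    using that E by (auto simp: G2_def complex_ring_ops intro!: delta_FS)
  have inv1: "extf G2 (extf G1 x) - x \<in> ?RM" if x: "x \<in> FS ?SM" for x
  proof (rule FS_lin_in[OF klin_sub_id[OF klin_extf_comp[OF G1]] ksub_kspan _ x])
    fix s assume "s \<in> ?SM"
    then obtain l m where s: "s = (l, m)" "m \<in> carrier M" by auto
    have n: "f m \<in> carrier N" using s(2) by (rule fc)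
    have "of_nat 1 \<odot>\<^bsub>N\<^esub> f m = f m" using N.smult_one[OF n] by simp
    from indep[OF n D[OF n] E[OF n] DE[OF n] zero_less_one s(2) this, of l]
    show "extf G2 (extf G1 (delta s)) - delta s \<in> ?RM" by (simp add: s(1) G1_def G2_def)
  qed
  have inv2: "extf G1 (extf G2 y) - y \<in> ?RN" if y: "y \<in> FS ?SN" for y
  proof (rule FS_lin_in[OF klin_sub_id[OF klin_extf_comp[OF G2]] ksub_kspan _ y])
    fix s assume "s \<in> ?SN"
    then obtain l n where s: "s = (l, n)" "n \<in> carrier N" by auto
    show "extf G1 (extf G2 (delta s)) - delta s \<in> ?RN"
      using moveN[OF D[OF s(2)] s(2), of l] DE[OF s(2)] by (simp add: s(1) G1_def G2_def)
  qed
  have "\<exists>h\<in>mod_iso K (tensor_mod K complex_ring M) (tensor_mod K complex_ring N). \<forall>x\<in>FS ?SM.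
      h ((\<lambda>f. f) ` ?RM +>\<^bsub>free_mod K ?SM\<^esub> x) = (\<lambda>f. f) ` ?RN +>\<^bsub>free_mod K ?SN\<^esub> extf G1 x"
  proof (rule pres_iso_ex[OF pres_tensor[OF C M] pres_tensor[OF C N]])
    fix x assume x: "x \<in> FS ?SM"
    show "extf G1 x \<in> FS ?SN" by (rule extf_FS[OF _ ksub_FS x]) (rule G1)
    show "extf G1 x \<in> ?RN \<longleftrightarrow> x \<in> ?RM"
    proof
      assume "extf G1 x \<in> ?RN"
      then have "extf G2 (extf G1 x) \<in> ?RM" by (rule extf_TR[OF C N b2 ksub_kspan])
      then show "x \<in> ?RM" using ksub_cong[OF ksub_kspan inv1[OF x]] by blast
    qed (rule extf_TR[OF C M b1 ksub_kspan])
  next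
    fix y assume y: "y \<in> FS ?SN"
    show "\<exists>x\<in>FS ?SM. extf G1 x - y \<in> ?RN"
    proof (rule bexI)
      show "extf G1 (extf G2 y) - y \<in> ?RN" by (rule inv2[OF y])
      show "extf G2 y \<in> FS ?SM" by (rule extf_FS[OF _ ksub_FS y]) (rule G2)
    qed
  qed (use klinD[OF klin_extf[of ?SM G1]] in auto)
  then obtain h where h: "h \<in> mod_iso K (tensor_mod K complex_ring M) (tensor_mod K complex_ring N)"
    "\<And>x. x \<in> FS ?SM \<Longrightarrow> h ((\<lambda>f. f) ` ?RM +>\<^bsub>free_mod K ?SM\<^esub> x) = (\<lambda>f. f) ` ?RN +>\<^bsub>free_mod K ?SN\<^esub> extf G1 x"
    by blast
  have "h (pure_tensor K complex_ring M l m) = pure_tensor K complex_ring N l (f m)" if "m \<in> carrier M" for l m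
    using h(2)[OF delta_FS, of "(l, m)"] that
    by (simp add: pure_tensor_def tensor_relations_eq[OF C M] tensor_relations_eq[OF C N] G1_def complex_ring_ops)
  then show ?thesis unfolding tensor_iso_def using h(1) by blast
qed

lemma gcdspan_multiple: assumes "p \<in> PK" shows "\<exists>d>0. of_nat d *\<^sub>C p \<in> gcdspan"
proof -
  have g: "ksub gcdspan" by (simp add: gcdspan_def ksub_kspan)
  let ?Y = "{p. \<exists>d>0. of_nat d *\<^sub>C p \<in> gcdspan}"
  have "ksub ?Y"
  proof (rule ksubI)
    show "0 \<in> ?Y" using ksub_zero[OF g] by (auto intro!: exI[of _ 1])
    show "p + q \<in> ?Y" if pq: "p \<in> ?Y" "q \<in> ?Y" for p q
    proof -
      obtain d e where de: "d > 0" "e > 0" "of_nat d *\<^sub>C p \<in> gcdspan" "of_nat e *\<^sub>C q \<in> gcdspan"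
        using pq by blast
      have "of_nat (d * e) *\<^sub>C (p + q) = of_nat e *\<^sub>C of_nat d *\<^sub>C p + of_nat d *\<^sub>C of_nat e *\<^sub>C q"
        by (simp add: cscale_add_right mult.commute)
      also have "\<dots> \<in> gcdspan" using ksub_add[OF g ksub_cscale[OF g K_of_nat de(3)] ksub_cscale[OF g K_of_nat de(4)]] .
      finally show ?thesis using de by (intro CollectI exI[of _ "d * e"]) simp
    qed
    show "c *\<^sub>C p \<in> ?Y" if c: "c \<in> k" and p: "p \<in> ?Y" for c p
    proof -
      obtain d where d: "d > 0" "of_nat d *\<^sub>C p \<in> gcdspan" using p by blast
      have "of_nat d *\<^sub>C c *\<^sub>C p = c *\<^sub>C of_nat d *\<^sub>C p" by (simp add: mult.commute)
      also have "\<dots> \<in> gcdspan" by (rule ksub_cscale[OF g c d(2)])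
      finally show ?thesis using d(1) by blast
    qed
  qed
  moreover have "bas w \<in> ?Y" for w :: "nat \<times> nat"
  proof -
    obtain a b where w: "w = (a, b)" by (cases w)
    have "of_nat (gcd (Suc a) (Suc b)) *\<^sub>C xy_monom (Suc a - 1) (Suc b - 1) \<in> gcdspan"
      unfolding gcdspan_def by (intro kspan_base CollectI exI[of _ "Suc a"] exI[of _ "Suc b"]) simp
    then show ?thesis by (intro CollectI exI[of _ "gcd (Suc a) (Suc b)"]) (simp add: w xy_monom_def)
  qed
  ultimately show ?thesis using alg_lin_in[OF assms clin_id, of ?Y] by blast
qed

end

context finite_sl2
begin

text \<open>A multiple of any invariant linear term lies in the gcd lattice, since each monomial
  does after multiplication by its gcd. The cokernel of the projection is therefore torsion.\<close>

lemma Vrr_tensor_iso: "tensor_iso K complex_ring W1mod Vrr Vrrcls"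
proof (rule tensor_iso_torsion_cokernel[OF pres_module[OF pres_UW] pres_module[OF pres_Vrr] Vrrcls_hom])
  show "inj_on Vrrcls (carrier W1mod)" using Vrrcls_inj by simp
  fix n assume "n \<in> carrier Vrr"
  then obtain f where f: "f \<in> UV" "n = Vrrcls (clsV K f)" using pres_surj[OF pres_Vrr] by blast
  have wf: "weyl f \<in> Inv0" by (rule weyl_UV[OF f(1)])
  then obtain d where d: "d > 0" "of_nat d *\<^sub>C weyl f \<in> gcdspan" using gcdspan_multiple by (auto simp: Inv0_def)
  have "of_nat d *\<^sub>C weyl f \<in> Inv0" using wf by (intro ksub_cscale[OF ksub_Inv0]) simp
  then have "of_nat d *\<^sub>C weyl f \<in> gcd_module K \<Gamma>" using d(2) by (simp add: gcd_module_eq Inv0_def)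
  then obtain w where w: "w \<in> UW" "of_nat d *\<^sub>C weyl f = weyl w"
    unfolding theta_inv_image[symmetric] using theta_inv UW_UV by auto
  have df: "of_nat d *\<^sub>C f \<in> UV" "w \<in> UV" using f(1) w(1) UW_UV ksub_cscale[OF ksub_UV K_of_nat] by blast+
  have "of_nat d *\<^sub>C f - w \<in> UV" by (rule ksub_diff[OF ksub_UV df])
  moreover have "weyl (of_nat d *\<^sub>C f - w) = 0" using w(2) by (simp add: weyl_linear)
  ultimately have "of_nat d *\<^sub>C f - w \<in> UV2" by (simp add: UV_def UV2_def kerAb2_def)
  then have "Vrrcls (clsV K (of_nat d *\<^sub>C f)) = Vrrcls (clsV K w)" using presD(7)[OF pres_Vrr df] by simp
  then have "of_nat d \<odot>\<^bsub>Vrr\<^esub> n = Vrrcls (clsV K w)" using presD(6)[OF pres_Vrr K_of_nat f(1)] f(2) by simp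
  then show "\<exists>d>0. \<exists>m\<in>carrier W1mod. of_nat d \<odot>\<^bsub>Vrr\<^esub> n = Vrrcls m" using d(1) w(1) by auto
qed

end

section \<open>The main theorem\<close>

lemma complex_ring_minus: "\<ominus>\<^bsub>complex_ring\<^esub> c = - c"
proof -
  interpret C: coeff_ring complex_ring by unfold_locales (simp_all add: complex_ring_def)
  show ?thesis using C.pres_inv[OF C.pres_K, of c] by (simp add: complex_ring_def)
qed

lemma base_ring_finite_sl2:
  assumes K: "K = base_ring (card \<Gamma>)" and fin: "finite \<Gamma>" and sub: "subgroup \<Gamma> (SL2 K)"
  shows "finite_sl2 K \<Gamma>"
proof -
  let ?n = "card \<Gamma>"
  let ?S = "{1 / of_nat ?n, exp (2 * of_real pi * \<i> / of_nat ?n)}"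
  have carr: "carrier K = generate_ring complex_ring ?S" by (simp add: K base_ring_def)
  note gen = generate_ring.one[of complex_ring ?S] generate_ring.eng_add[of _ complex_ring ?S]
    generate_ring.eng_mult[of _ complex_ring ?S] generate_ring.a_inv[of _ complex_ring ?S]
  interpret coeff_ring K
    by unfold_locales
      (use gen in \<open>simp_all add: carr complex_ring_minus\<close>, simp_all add: K base_ring_def complex_ring_def)
  have "mat 1 \<in> \<Gamma>" using subgroup.one_closed[OF sub] by (simp add: SL2_def)
  then have n: "?n > 0" using fin by (auto simp: card_gt_0_iff)
  show ?thesis
  proof (intro finite_sl2.intro finite_sl2_axioms.intro)
    show "coeff_ring K" by unfold_locales
    show "1 / of_nat ?n \<in> carrier K" unfolding carr by (intro generate_ring.incl) simp
    fix \<mu> :: complex assume "\<mu> ^ ?n = 1"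
    then have "\<mu> \<in> (\<lambda>j. cis (2 * pi * real j / real ?n)) ` {..<?n}"
      using bij_betw_imp_surj_on[OF bij_betw_roots_unity[OF n]] by blast
    then obtain j where j: "\<mu> = cis (2 * pi * real j / real ?n)" by blast
    have "exp (2 * of_real pi * \<i> / of_nat ?n) ^ j = exp (of_nat j * (2 * of_real pi * \<i> / of_nat ?n))"
      by (rule exp_of_nat_mult[symmetric])
    also have "\<dots> = \<mu>" by (simp add: j cis_conv_exp algebra_simps)
    finally have "\<mu> = exp (2 * of_real pi * \<i> / of_nat ?n) ^ j" by simp
    moreover have "exp (2 * of_real pi * \<i> / of_nat ?n) \<in> carrier K"
      unfolding carr by (intro generate_ring.incl) simp
    ultimately show "\<mu> \<in> carrier K" by simp
  qed (fact fin sub)+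
qed

theorem theorem4p2p13:
  fixes \<Gamma> :: "(complex^2^2) set" and K :: "(complex, complex) module"
  assumes K: "K = base_ring (card \<Gamma>)"
    and fin: "finite \<Gamma>"
    and subgrp: "subgroup \<Gamma> (SL2 K)"
  shows
    "Module.module K (skew_cyc K \<Gamma>) \<and>
     internal_direct_sum K (skew_cyc K \<Gamma>) (conj_classes (grp K \<Gamma>)) (cyc_part K \<Gamma>) \<and>

     \<comment> \<open>(i)\<close>
     (\<forall>C\<in>conj_classes (grp K \<Gamma>). C \<noteq> {mat 1} \<longrightarrow>
        torsion_free K (skew_cyc_at K \<Gamma> C) \<and> projective_mod K (skew_cyc_at K \<Gamma> C)) \<and>

     \<comment> \<open>(ii)\<close>
     Module.module K (modV1 K \<Gamma>) \<and>
     submodule (W1_in_V1 K \<Gamma>) K (modV1 K \<Gamma>) \<and>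
     induced (V1_to_cyc K \<Gamma>)
       \<in> mod_iso K (quot_mod (modV1 K \<Gamma>) (W1_in_V1 K \<Gamma>)) (skew_cyc_at K \<Gamma> {mat 1}) \<and>

     \<comment> \<open>(iii)\<close>
     (\<exists>\<theta>.
        \<theta> \<in> mod_iso K (quot_mod ((modV K)\<lparr>carrier := V_r K\<rparr>) (V_r2 K)) (poly_alg K) \<and>
        (\<forall>a b. \<theta> (V_r2 K +>\<^bsub>modV K\<^esub> clsV K (gr * zmon a b)) = xy_monom a b) \<and>
        (let W1_mod = (modV K)\<lparr>carrier := W1 K \<Gamma>\<rparr>;
             V_r_inv = invariants \<Gamma> actV (V_r K);
             V_r2_inv = invariants \<Gamma> actV (V_r2 K);
             Vrr = quot_mod ((modV K)\<lparr>carrier := V_r_inv\<rparr>) V_r2_inv;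
             \<theta>_inv = induced (\<lambda>v. \<theta> (V_r2 K +>\<^bsub>modV K\<^esub> v));
             \<pi> = (\<lambda>w. V_r2_inv +>\<^bsub>modV K\<^esub> w)
         in \<theta>_inv \<in> mod_iso K Vrr ((poly_alg K)\<lparr>carrier := invariants \<Gamma> act_poly (carrier (poly_alg K))\<rparr>) \<and>
            \<pi> \<in> mod_hom K W1_mod Vrr \<and>
            inj_on \<pi> (W1 K \<Gamma>) \<and>
            tensor_iso K complex_ring W1_mod Vrr \<pi> \<and>
            \<theta>_inv ` \<pi> ` W1 K \<Gamma> = gcd_module K \<Gamma>)) \<and>

     \<comment> \<open>(iv)\<close>
     torsion_free K (skew_cyc_at K \<Gamma> {mat 1}) \<and>
     projective_mod K (skew_cyc_at K \<Gamma> {mat 1}) \<and>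
     (\<forall>p l. Factorial_Ring.prime p \<and> \<not> p dvd card \<Gamma> \<and> l \<ge> 1 \<longrightarrow>
        (let T = torsion K (modQ K \<Gamma>) \<inter> modQ_degree K \<Gamma> (2 * p ^ l)
         in mod_iso K ((modQ K \<Gamma>)\<lparr>carrier := T\<rparr>) (quot_mod K (PIdl\<^bsub>K\<^esub> (of_nat p))) \<noteq> {} \<and>
            (\<exists>u. is_r_divided K p l u) \<and>
            (\<forall>u. is_r_divided K p l u \<longrightarrow> T = mod_span K (modQ K \<Gamma>) {cyc_to_modQ K \<Gamma> u}))) \<and>
     torsion K (modQ K \<Gamma>) =
       mod_span K (modQ K \<Gamma>)
         {cyc_to_modQ K \<Gamma> u | p l u. Factorial_Ring.prime p \<and> \<not> p dvd card \<Gamma> \<and> l \<ge> 1 \<and> is_r_divided K p l u} \<and>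
     (let V1_quot = quot_mod (modV1 K \<Gamma>) (W1_in_V1 K \<Gamma> <+>\<^bsub>modV1 K \<Gamma>\<^esub> r_powers_in_V1 K \<Gamma>);
          \<psi> = induced (\<lambda>v. cls_modQ K \<Gamma> (V1_to_cyc K \<Gamma> v))
      in \<psi> \<in> mod_iso K V1_quot (modQ K \<Gamma>) \<and> \<psi> ` torsion K V1_quot = torsion K (modQ K \<Gamma>))"
proof -
  interpret finite_sl2 K \<Gamma> by (rule base_ring_finite_sl2[OF K fin subgrp])
  show ?thesis
    \<comment> \<open>This replaces the invariant submodules of the statement by the images of
      \<open>UV\<close>, \<open>UV2\<close> and \<open>UW\<close>, for which the parts have been
      proved.\<close>
    unfolding Let_def V_invariants
  proof (intro conjI, goal_cases)
    case 1 show ?case by (rule pres_module[OF pres_skew_cyc])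
  next
    case 2 show ?case by (rule skew_cyc_direct_sum)
  next
    case 3 show ?case unfolding conj_classes_eq using skew_cyc_at_projective by blast
  next
    case 4 show ?case by (rule V1_W1_iso)
  next
    case 5 show ?case by (rule V1_W1_iso)
  next
    case 6 show ?case by (rule V1_W1_iso)
  next
    case 7 show ?case
      by (intro exI[of _ theta] conjI allI theta_iso theta_zmon theta_inv_iso Vrrcls_hom Vrrcls_inj
          Vrr_tensor_iso theta_inv_image)
  next
    case 8 show ?case using skew_cyc_at_projective(2)[OF one_\<Gamma>] by (simp only: cclass_one)
  next
    case 9 show ?case using skew_cyc_at_projective(1)[OF one_\<Gamma>] by (simp only: cclass_one)
  next
    case 10 show ?case
    proof (intro allI impI, elim conjE, intro conjI allI impI)
      fix p l :: nat assume p: "Factorial_Ring.prime p" "l \<ge> 1"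
      show "\<exists>u. is_r_divided K p l u" using r_divided_exists[OF p] by blast
    qed (rule torsion_degree_iso torsion_degree_span; assumption)+
  next
    case 11 show ?case by (rule torsion_modQ_span)
  next
    case 12 show ?case by (rule psi_iso)
  next
    case 13 show ?case by (rule psi_iso)
  qed
qed

end
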